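(* In the setting described in the context, let $U'\Subset U$. (i) If $t\in(0,1)$ then $$\|p(t)\|_{L^\infty(U')}\le Ct^{-\frac{\kappa_1}{\alpha-a}}\Big(1+\|\bar p_0\|_{L^\alpha(U)}+[\mathrm{Env}A(\alpha,t)]^{\frac1{\alpha-a}}+\|\Psi\|_{L^\alpha(U\times(0,t))}\Big)^{\kappa_2}.$$ If $t\ge1$ then $$\|p(t)\|_{L^\infty(U')}\le C\Big(1+\|\bar p_0\|_{L^\alpha(U)}+[\mathrm{Env}A(\alpha,t)]^{\frac1{\alpha-a}}+\|\Psi\|_{L^\alpha(U\times(t-1,t))}\Big)^{\kappa_2}.$$ (ii) If $A(\alpha)<\infty$ then $$\limsup_{t\to\infty}\|p(t)\|_{L^\infty(U')}\le C\Big(1+A(\alpha)^{\frac1{\alpha-a}}+\limsup_{t\to\infty}\|\Psi\|_{L^\alpha(U\times(t-1,t))}\Big)^{\kappa_2}.$$ (iii) If $\beta(\alpha)<\infty$ then there is $T>0$ such that for all $t\ge T$, $$\|p(t)\|_{L^\infty(U')}\le C\Big(1+\beta(\alpha)^{\frac1{\alpha-2a}}+\|A(\alpha,\cdot)\|_{L^{\frac\alpha{\alpha-a}}(t-1,t)}^{\frac1{\alpha-a}}+\|\Psi\|_{L^\alpha(U\times(t-1,t))}\Big)^{\kappa_2}.$$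
   Context: Let $n\ge 2$ and let $U\subset\mathbb{R}^n$ be a bounded, open, connected set with $C^2$ boundary $\Gamma$. Let $g(s)=a_0s^{\alpha_0}+\cdots+a_Ns^{\alpha_N}$ ($s\ge0$), $N\ge1$, $0=\alpha_0<\cdots<\alpha_N$, $a_i\ge0$, $a_0>0$, $a_N>0$. Define $K(\xi)=1/g(s(\xi))$, where $s(\xi)\ge0$ satisfies $s(\xi)g(s(\xi))=\xi$. Let $a=\alpha_N/(1+\alpha_N)\in(0,1)$, $\alpha_*=an/(2-a)$. Let $p(x,t)$ solve $\partial_tp=\nabla\cdot(K(|\nabla p|)\nabla p)$ in $U\times(0,\infty)$, $p(x,0)=p_0(x)$ in $U$, $p=\psi$ on $\Gamma\times(0,\infty)$, and let $\Psi$ on $\bar U\times[0,\infty)$ be an extension of $\psi$; $p,\Psi$ regular enough for all computations. $\bar p_0=p_0-\Psi(\cdot,0)$; $p(t)=p(\cdot,t)$. For $\alpha\ge1$, $t\ge0$: $A(\alpha,t)=\big[\int_U|\nabla\Psi(x,t)|^{\frac{\alpha(2-a)}2}dx\big]^{\frac{2(\alpha-a)}{\alpha(2-a)}}+\big[\int_U|\Psi_t(x,t)|^\alpha dx\big]^{\frac{\alpha-a}{\alpha(1-a)}}$, $A(\alpha)=\limsup_{t\to\infty}A(\alpha,t)$, $\beta(\alpha)=\limsup_{t\to\infty}[\partial_tA(\alpha,t)]^-$ (negative part; $t\mapsto A(\alpha,t)$ assumed $C^1$ on $(0,\infty)$ when $\beta(\alpha)$ is used). $\mathrm{Env}A(\alpha,\cdot)$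 is a continuous increasing function $F$ on $[0,\infty)$ with $F\ge A(\alpha,\cdot)$. Fix $\alpha$ with $\alpha\ge2$ and $\alpha>\alpha_*$; let $\kappa_0=\alpha(1+\frac{2-a}n)-a$, $\kappa_1=1/(1-\alpha/\kappa_0)$, $\kappa_2=1/[(1-a/\alpha)(1-\alpha_*/\alpha)]$. $C$ is a positive constant independent of initial and boundary data and of $t$. *)

theory Defs
  imports "HOL-Analysis.Analysis" "HOL-Probability.Essential_Supremum"
begin

definition C2_boundary :: "(real^'n) set \<Rightarrow> bool" where
  "C2_boundary U \<longleftrightarrow>
     (\<exists>(\<rho>::real^'n \<Rightarrow> real) (D\<rho>::real^'n \<Rightarrow> real^'n) (D2\<rho>::real^'n \<Rightarrow> real^'n^'n).
        (\<forall>x. (\<rho> has_derivative (\<lambda>h. D\<rho> x \<bullet> h)) (at x)) \<and>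
        (\<forall>x. (D\<rho> has_derivative (\<lambda>h. D2\<rho> x *v h)) (at x)) \<and>
        continuous_on UNIV D2\<rho> \<and>
        U = {x. \<rho> x < 0} \<and>
        (\<forall>x\<in>frontier U. D\<rho> x \<noteq> 0))"

text \<open>g(s) = c_0 s^{e_0} + ... + c_N s^{e_N} with e_0 = 0; the zeroth term is written
  as the constant c_0 (because 0 powr 0 = 0 in Isabelle).\<close>

definition admissible_g :: "(nat \<Rightarrow> real) \<Rightarrow> (nat \<Rightarrow> real) \<Rightarrow> nat \<Rightarrow> bool" where
  "admissible_g c e N \<longleftrightarrow> N \<ge> 1 \<and> e 0 = 0 \<and> strict_mono_on {0..N} e \<and>
     (\<forall>i\<le>N. c i \<ge> 0) \<and> c 0 > 0 \<and> c N > 0"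

definition gfun :: "(nat \<Rightarrow> real) \<Rightarrow> (nat \<Rightarrow> real) \<Rightarrow> nat \<Rightarrow> real \<Rightarrow> real" where
  "gfun c e N s = c 0 + (\<Sum>i=1..N. c i * s powr e i)"

definition sfun :: "(nat \<Rightarrow> real) \<Rightarrow> (nat \<Rightarrow> real) \<Rightarrow> nat \<Rightarrow> real \<Rightarrow> real" where
  "sfun c e N \<xi> = (THE s. s \<ge> 0 \<and> s * gfun c e N s = \<xi>)"

definition Kfun :: "(nat \<Rightarrow> real) \<Rightarrow> (nat \<Rightarrow> real) \<Rightarrow> nat \<Rightarrow> real \<Rightarrow> real" where
  "Kfun c e N \<xi> = 1 / gfun c e N (sfun c e N \<xi>)"

definition expo_a :: "(nat \<Rightarrow> real) \<Rightarrow> nat \<Rightarrow> real" where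
  "expo_a e N = e N / (1 + e N)"

definition alpha_star :: "nat \<Rightarrow> real \<Rightarrow> real" where
  "alpha_star n a = a * real n / (2 - a)"

definition kappa0 :: "nat \<Rightarrow> real \<Rightarrow> real \<Rightarrow> real" where
  "kappa0 n a \<alpha> = \<alpha> * (1 + (2 - a) / real n) - a"

definition kappa1 :: "nat \<Rightarrow> real \<Rightarrow> real \<Rightarrow> real" where
  "kappa1 n a \<alpha> = 1 / (1 - \<alpha> / kappa0 n a \<alpha>)"

definition kappa2 :: "nat \<Rightarrow> real \<Rightarrow> real \<Rightarrow> real" where
  "kappa2 n a \<alpha> = 1 / ((1 - a / \<alpha>) * (1 - alpha_star n a / \<alpha>))"

definition Lnorm :: "'a measure \<Rightarrow> real \<Rightarrow> ('a \<Rightarrow> real) \<Rightarrow> real" where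
  "Lnorm M q f = (integral\<^sup>L M (\<lambda>x. \<bar>f x\<bar> powr q)) powr (1 / q)"

definition Linf_norm :: "'a::euclidean_space set \<Rightarrow> ('a \<Rightarrow> real) \<Rightarrow> ereal" where
  "Linf_norm S f = esssup (lebesgue_on S) (\<lambda>x. ereal \<bar>f x\<bar>)"

definition Afun :: "(real^'n) set \<Rightarrow> real \<Rightarrow> real \<Rightarrow> (real^'n \<Rightarrow> real \<Rightarrow> real^'n)
    \<Rightarrow> (real^'n \<Rightarrow> real \<Rightarrow> real) \<Rightarrow> real \<Rightarrow> real" where
  "Afun U a \<alpha> gradPsi Psit t =
     (integral\<^sup>L (lebesgue_on U) (\<lambda>x. norm (gradPsi x t) powr (\<alpha> * (2 - a) / 2)))
        powr (2 * (\<alpha> - a) / (\<alpha> * (2 - a)))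
   + (integral\<^sup>L (lebesgue_on U) (\<lambda>x. \<bar>Psit x t\<bar> powr \<alpha>))
        powr ((\<alpha> - a) / (\<alpha> * (1 - a)))"

text \<open>p solves p_t = div(K(|grad p|) grad p) in U x (0,oo), p = Psi on the boundary for t>0;
  gradPsi, Psit are the spatial gradient and time derivative of Psi.
  The initial datum is p0 = p(.,0).\<close>

definition classical_solution ::
  "(real^'n) set \<Rightarrow> (real \<Rightarrow> real) \<Rightarrow> (real^'n \<Rightarrow> real \<Rightarrow> real) \<Rightarrow> (real^'n \<Rightarrow> real \<Rightarrow> real)
    \<Rightarrow> (real^'n \<Rightarrow> real \<Rightarrow> real^'n) \<Rightarrow> (real^'n \<Rightarrow> real \<Rightarrow> real) \<Rightarrow> bool" where
  "classical_solution U K p Psi gradPsi Psit \<longleftrightarrow>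
     (\<exists>(gradp::real^'n \<Rightarrow> real \<Rightarrow> real^'n) (pt::real^'n \<Rightarrow> real \<Rightarrow> real)
        (DF::real^'n \<Rightarrow> real \<Rightarrow> real^'n \<Rightarrow> real^'n).
        continuous_on (closure U \<times> {0..}) (\<lambda>z. p (fst z) (snd z)) \<and>
        (\<forall>x\<in>U. \<forall>t>0. ((\<lambda>y. p y t) has_derivative (\<lambda>h. gradp x t \<bullet> h)) (at x)) \<and>
        continuous_on (closure U \<times> {0<..}) (\<lambda>z. gradp (fst z) (snd z)) \<and>
        (\<forall>x\<in>U. \<forall>t>0. ((\<lambda>s. p x s) has_real_derivative pt x t) (at t)) \<and>
        continuous_on (closure U \<times> {0<..}) (\<lambda>z. pt (fst z) (snd z)) \<and>
        (\<forall>x\<in>U. \<forall>t>0.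
           ((\<lambda>y. K (norm (gradp y t)) *\<^sub>R gradp y t) has_derivative DF x t) (at x)) \<and>
        (\<forall>x\<in>U. \<forall>t>0. pt x t = (\<Sum>i\<in>UNIV. DF x t (axis i 1) $ i)) \<and>
        (\<forall>x\<in>frontier U. \<forall>t>0. p x t = Psi x t) \<and>
        continuous_on (closure U \<times> {0..}) (\<lambda>z. Psi (fst z) (snd z)) \<and>
        (\<forall>x\<in>U. \<forall>t\<ge>0. ((\<lambda>y. Psi y t) has_derivative (\<lambda>h. gradPsi x t \<bullet> h)) (at x)) \<and>
        continuous_on (closure U \<times> {0..}) (\<lambda>z. gradPsi (fst z) (snd z)) \<and>
        (\<forall>x\<in>U. \<forall>t\<ge>0. ((\<lambda>s. Psi x s) has_real_derivative Psit x t) (at t within {0..})) \<and>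
        continuous_on (closure U \<times> {0..}) (\<lambda>z. Psit (fst z) (snd z)))"

end

theory Submission
  imports Defs
begin

text \<open>Write $q = 2 - a$. The structure of $g$ gives $K(\xi)\xi^2 \ge k_1 \xi^q - k_2$ and
  $K(\xi)\xi \le k_3\xi^{q-1}$, so the flow behaves like a degenerate $q$-Laplacian flow.

  The local part is a De Giorgi iteration: testing the equation with a cut-off truncated power of
  $p - k_j$ for increasing levels $k_j$ gives energy estimates, and a parabolic
  Gagliardo--Nirenberg inequality turns them into a superlinear recursion for the level-set
  integrals. It bounds $\sup_{U'}|p(t)|$ by a power of the space-time integral of $|p|^\alpha$
  over the time interval $(t-\sigma,t)$.

  The global part tests with truncated powers of $\pm(p - \Psi) - 1$, which have compact support
  in $U$ for $t > 0$, so that the integrations by parts have no boundary terms.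
  This gives $Z' \le -c Z^{(\alpha-a)/\alpha} + C(1 + A(\alpha,t))$ for a quantity $Z$ comparable
  to $1 + \|p-\Psi\|_{L^\alpha(U)}^\alpha$, and comparison arguments for this differential inequality
  yield the three estimates of $Z$ that are fed into the local bound.\<close>

section \<open>The divergence theorem for compactly supported fields\<close>

text \<open>The regularity in \<open>classical_solution\<close> makes the flux differentiable at
  every point of U, with divergence equal to the continuous p_t, but its separate partial
  derivatives need be neither continuous nor integrable. As \<alpha> = 2 is allowed, s_+ powr
  \<alpha> need not be C^2; s_+ powr (\<alpha> + 1) / (d + s_+) replaces it, with d half of a level
  gap in the local part and d = 1 in the global part. With n the dimension and \<gamma> = q/n,
  Gagliardo--Nirenberg raises the integrability from \<alpha> to \<kappa>0 = \<alpha> - a + \<alpha>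
  \<gamma>. The gain \<kappa>0 - \<alpha> is \<gamma> times \<alpha> - \<open>alpha_star\<close>,
  which is where \<alpha> > \<open>alpha_star\<close> enters. Constants must not depend on the
  solution, so every estimate fixes them before p and \<Psi> appear. The exponents in
  \<open>Afun\<close> are those that Young's inequality produces when the data terms are absorbed
  into a power of Z. The iteration itself yields the exponents (1 + \<gamma>)/(\<kappa>0 - \<alpha>)
  and \<alpha> \<gamma>/(\<kappa>0 - \<alpha>), which are at most \<kappa>1/(\<alpha> - a) and
  \<kappa>2.\<close>

lemma integral_cbox_superset:
  fixes f :: "'a::euclidean_space \<Rightarrow> real"
  assumes "continuous_on UNIV f" "\<And>x. x \<notin> cbox a b \<Longrightarrow> f x = 0" "cbox a b \<subseteq> cbox c d"
  shows "integral (cbox c d) f = integral (cbox a b) f"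
proof (rule integral_unique, rule has_integral_on_superset)
  show "(f has_integral integral (cbox a b) f) (cbox a b)"
    by (intro integrable_integral integrable_continuous continuous_on_subset[OF assms(1)]) auto
qed (use assms in auto)

text \<open>The integrals of f and of its translate by v agree. Writing f(x + v) - f(x) as an
  integral along the segment and swapping the two integrals, every parameter s contributes the same
  value, the one to be shown zero.\<close>

lemma integral_gradient_zero:
  fixes f :: "'a::euclidean_space \<Rightarrow> real"
  assumes f: "\<And>x. (f has_derivative (\<lambda>h. Df x \<bullet> h)) (at x)" and Df: "continuous_on UNIV Df"
    and z: "\<And>x. x \<notin> cbox a b \<Longrightarrow> f x = 0" "\<And>x. x \<notin> cbox a b \<Longrightarrow> Df x = 0"
  shows "integral (cbox a b) (\<lambda>x. Df x \<bullet> v) = 0"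
proof -
  have cf: "continuous_on UNIV f"
    by (meson has_derivative_continuous continuous_at_imp_continuous_on f)
  note [continuous_intros] = continuous_on_compose2[OF Df] continuous_on_compose2[OF cf]
  \<comment> \<open>The enlarged box still covers the support after every shift by s v with s in
    [0,1], so a single box serves before and after the swap.\<close>
  define a' b' where "a' = a - norm v *\<^sub>R One" "b' = b + norm v *\<^sub>R One"
  have sub: "cbox a b \<subseteq> cbox (a' + s *\<^sub>R v) (b' + s *\<^sub>R v)" if "0 \<le> s" "s \<le> 1" for s
  proof -
    have "\<bar>s * (v \<bullet> i)\<bar> \<le> norm v" if "i \<in> Basis" for i
      using that \<open>0 \<le> s\<close> \<open>s \<le> 1\<close> Basis_le_norm[OF that, of v] mult_mono[of s 1 "\<bar>v \<bullet> i\<bar>" "norm v"]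
      by (simp add: abs_mult)
    then show ?thesis
      by (auto simp: a'_b'_def mem_box algebra_simps abs_le_iff subset_iff) (smt (verit))+
  qed
  have tr: "integral (cbox a' b') (\<lambda>x. g (x + s *\<^sub>R v)) = integral (cbox a b) g"
    if "continuous_on UNIV g" "\<And>x. x \<notin> cbox a b \<Longrightarrow> g x = 0" "0 \<le> s" "s \<le> 1" for g :: "'a \<Rightarrow> real" and s
    using integral_shift_cbox_plus[of a' b' g "s *\<^sub>R v"]
      integral_cbox_superset[OF that(1,2) sub[OF that(3,4)]] by (simp add: o_def add.commute)
  have ftc: "f (x + v) - f x = integral (cbox 0 1) (\<lambda>s. Df (x + s *\<^sub>R v) \<bullet> v)" for x
  proof -
    have "((\<lambda>s. Df (x + s *\<^sub>R v) \<bullet> v) has_integral f (x + 1 *\<^sub>R v) - f (x + 0 *\<^sub>R v)) {0..1}"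
    proof (rule fundamental_theorem_of_calculus)
      fix s :: real
      have "((\<lambda>s. f (x + s *\<^sub>R v)) has_derivative (\<lambda>h. Df (x + s *\<^sub>R v) \<bullet> (h *\<^sub>R v))) (at s within {0..1})"
        by (rule has_derivative_compose[OF _ f]) (auto intro!: derivative_eq_intros)
      then show "((\<lambda>s. f (x + s *\<^sub>R v)) has_vector_derivative Df (x + s *\<^sub>R v) \<bullet> v) (at s within {0..1})"
        by (simp add: has_vector_derivative_def)
    qed simp
    then show ?thesis by (simp add: integral_unique)
  qed
  have "0 = integral (cbox a' b') (\<lambda>x. f (x + v) - f x)"
    using tr[OF cf z(1), of 1] tr[OF cf z(1), of 0]
    by (subst integral_diff) (auto intro!: integrable_continuous continuous_intros)
  also have "\<dots> = integral (cbox a' b') (\<lambda>x. integral (cbox 0 1) (\<lambda>s. Df (x + s *\<^sub>R v) \<bullet> v))"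
    by (simp only: ftc)
  also have "\<dots> = integral (cbox 0 1) (\<lambda>s. integral (cbox a' b') (\<lambda>x. Df (x + s *\<^sub>R v) \<bullet> v))"
    by (rule integral_swap_continuous) (auto simp: split_beta intro!: continuous_intros)
  also have "\<dots> = integral (cbox 0 1) (\<lambda>s::real. integral (cbox a b) (\<lambda>x. Df x \<bullet> v))"
    by (rule integral_cong, rule tr) (auto intro!: continuous_intros simp: z)
  finally show ?thesis by simp
qed

section \<open>Quadratic B-splines: C^1 bumps with an exact two-scale relation\<close>

definition pos_part :: "real \<Rightarrow> real" where
  "pos_part s = max 0 s"

text \<open>The quadratic cardinal B-spline on [0,3], written as half the third difference of the
  squared positive part. It is C^1, compactly supported and refinable, the three properties that the
  Goursat argument uses.\<close>

definition bspline :: "real \<Rightarrow> real" where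
  "bspline s = ((pos_part s)\<^sup>2 - 3 * (pos_part (s - 1))\<^sup>2 + 3 * (pos_part (s - 2))\<^sup>2 - (pos_part (s - 3))\<^sup>2) / 2"

definition bspline' :: "real \<Rightarrow> real" where
  "bspline' s = pos_part s - 3 * pos_part (s - 1) + 3 * pos_part (s - 2) - pos_part (s - 3)"

lemma continuous_bspline [continuous_intros]:
  "continuous_on A f \<Longrightarrow> continuous_on A (\<lambda>x. bspline (f x))"
  "continuous_on A f \<Longrightarrow> continuous_on A (\<lambda>x. bspline' (f x))"
  unfolding bspline_def bspline'_def pos_part_def by (intro continuous_intros; simp)+

lemma bspline_zero: 
  assumes "s \<notin> {0..3}" shows "bspline s = 0" "bspline' s = 0"
proof -
  consider "s < 0" | "s > 3" using assms by fastforce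
  then have "bspline s = 0 \<and> bspline' s = 0"
  proof cases
    case 1
    then have "pos_part s = 0" "pos_part (s - 1) = 0" "pos_part (s - 2) = 0" "pos_part (s - 3) = 0"
      by (auto simp: pos_part_def)
    then show ?thesis by (simp add: bspline_def bspline'_def)
  next
    case 2
    then have "pos_part s = s" "pos_part (s - 1) = s - 1" "pos_part (s - 2) = s - 2" "pos_part (s - 3) = s - 3"
      by (auto simp: pos_part_def)
    then show ?thesis by (simp only: bspline_def bspline'_def) (simp add: power2_eq_square algebra_simps)
  qed
  then show "bspline s = 0" "bspline' s = 0" by auto
qed

lemma bspline_bounded: "\<exists>M\<ge>1. \<forall>s. \<bar>bspline s\<bar> \<le> M \<and> \<bar>bspline' s\<bar> \<le> M"
proof -
  have "compact (bspline ` {0..3})" "compact (bspline' ` {0..3})"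
    by (intro compact_continuous_image continuous_intros; simp)+
  then obtain a b where ab: "\<forall>x\<in>bspline ` {0..3}. norm x \<le> a" "\<forall>x\<in>bspline' ` {0..3}. norm x \<le> b"
    by (meson bounded_iff compact_imp_bounded)
  have "\<bar>bspline s\<bar> \<le> max 1 (max a b) \<and> \<bar>bspline' s\<bar> \<le> max 1 (max a b)" for s
    using ab bspline_zero[of s] by (cases "s \<in> {0..3}") (auto simp: le_max_iff_disj)
  then show ?thesis by (intro exI[of _ "max 1 (max a b)"]) auto
qed

text \<open>\<open>pos_part\<close> is homogeneous, so each dilated copy on the right is a
  combination of squares shifted by half-integers, and the coefficients of these squares match. The
  masks 1/4, 3/4, 3/4, 1/4 add up to 2.\<close>

lemma bspline_refine: "bspline s = (\<Sum>k\<le>3::nat. real (3 choose k) / 4 * bspline (2 * s - k))"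
proof -
  have m: "pos_part (2 * s - c) = 2 * pos_part (s - c / 2)" for c by (auto simp: max_def pos_part_def)
  have *: "bspline (2 * s - c) = 2 * ((pos_part (s - c/2))\<^sup>2 - 3 * (pos_part (s - (c + 1)/2))\<^sup>2
      + 3 * (pos_part (s - (c + 2)/2))\<^sup>2 - (pos_part (s - (c + 3)/2))\<^sup>2)" for c
    unfolding bspline_def using m[of c] m[of "c+1"] m[of "c+2"] m[of "c+3"]
    by (simp add: diff_diff_eq power_mult_distrib)
  have e: "{..3::nat} = {0,1,2,3}" by auto
  have c: "3 choose 2 = (3::nat)" by (simp add: numeral_eq_Suc)
  show ?thesis
    unfolding e using *[of 0] *[of 1] *[of 2] *[of 3]
    by (simp add: c) (simp add: bspline_def add_divide_distrib diff_divide_distrib)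
qed

text \<open>Only the point 0 needs work: there the bound by a power \<beta> > 1 of s sends the
  difference quotient to 0. The truncated powers below are all differentiated in this way.\<close>

lemma DERIV_extend_by_zero:
  fixes f f' :: "real \<Rightarrow> real"
  assumes d: "\<And>s. s > 0 \<Longrightarrow> (f has_real_derivative f' s) (at s)"
    and z: "\<And>s. s \<le> 0 \<Longrightarrow> f s = 0" "\<And>s. s \<le> 0 \<Longrightarrow> f' s = 0"
    and b: "\<And>s. s > 0 \<Longrightarrow> \<bar>f s\<bar> \<le> K * s powr \<beta>" "\<beta> > 1"
  shows "(f has_real_derivative f' s) (at s)"
proof -
  consider "s > 0" | "s = 0" | "s < 0" by linarith
  then show ?thesis
  proof cases
    case 2
    have "((\<lambda>h. (f (0 + h) - f 0) / h) \<longlongrightarrow> 0) (at 0)"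
    proof (rule Lim_null_comparison)
      show "\<forall>\<^sub>F h in at 0. norm ((f (0 + h) - f 0) / h) \<le> \<bar>K\<bar> * \<bar>h\<bar> powr (\<beta> - 1)"
      proof (intro always_eventually allI)
        fix h :: real
        show "norm ((f (0 + h) - f 0) / h) \<le> \<bar>K\<bar> * \<bar>h\<bar> powr (\<beta> - 1)"
        proof (cases "h > 0")
          case True
          have "\<bar>f h\<bar> \<le> \<bar>K\<bar> * h powr \<beta>"
            using b(1)[OF True] by (smt (verit) mult_right_mono powr_ge_zero)
          also have "h powr \<beta> = h powr (\<beta> - 1) * h" using True by (simp add: powr_diff)
          finally show ?thesis using True z by (simp add: field_simps)
        qed (use z in simp)
      qed
      show "((\<lambda>h. \<bar>K\<bar> * \<bar>h\<bar> powr (\<beta> - 1)) \<longlongrightarrow> 0) (at 0)"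
        using b(2) by (auto intro!: tendsto_eq_intros tendsto_mult_right_zero)
    qed
    then show ?thesis using 2 z by (simp add: DERIV_def)
  next
    case 3
    have "((\<lambda>x. 0) has_real_derivative 0) (at s)" by simp
    then have "(f has_real_derivative 0) (at s)"
      by (rule has_field_derivative_transform_within_open[of _ _ _ "{..<0}"]) (use 3 z in auto)
    then show ?thesis using z 3 by simp
  qed (use d in auto)
qed

section \<open>C^1 step functions and a one-exponent Young inequality\<close>

lemma DERIV_square_pos_part: "((\<lambda>s::real. (max 0 s)\<^sup>2) has_real_derivative 2 * max 0 s) (at s)"
proof (rule DERIV_extend_by_zero[where K=1 and \<beta>=2])
  fix s :: real assume s: "s > 0"
  have "((\<lambda>s::real. s\<^sup>2) has_real_derivative 2 * max 0 s) (at s)"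
    using s by (auto intro!: derivative_eq_intros)
  then show "((\<lambda>s::real. (max 0 s)\<^sup>2) has_real_derivative 2 * max 0 s) (at s)"
    by (rule has_field_derivative_transform_within_open[of _ _ _ "{0<..}"]) (use s in auto)
qed auto

text \<open>Equals 2 s^2 on [0,1/2] and 1 - 2 (1 - s)^2 on [1/2,1]. The slope peaks at 2 in the
  midpoint, and this 2 reappears in the constants of the iteration.\<close>

definition smoothstep :: "real \<Rightarrow> real" where
  "smoothstep s = 2 * (max 0 s)\<^sup>2 - 4 * (max 0 (s - 1/2))\<^sup>2 + 2 * (max 0 (s - 1))\<^sup>2"

definition smoothstep' :: "real \<Rightarrow> real" where
  "smoothstep' s = 4 * max 0 s - 8 * max 0 (s - 1/2) + 4 * max 0 (s - 1)"

lemma DERIV_smoothstep: "(smoothstep has_real_derivative smoothstep' s) (at s)"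
proof -
  have *: "((\<lambda>s::real. (max 0 (s - k))\<^sup>2) has_real_derivative 2 * max 0 (s - k)) (at s)" for k
  proof -
    have "((\<lambda>s. s - k) has_real_derivative 1) (at s)" by (auto intro!: derivative_eq_intros)
    from DERIV_chain2[OF DERIV_square_pos_part this] show ?thesis by simp
  qed
  show ?thesis unfolding smoothstep_def[abs_def] smoothstep'_def
    by (rule derivative_eq_intros DERIV_square_pos_part * refl)+ simp
qed

lemma smoothstep_simps:
  "s \<le> 0 \<Longrightarrow> smoothstep s = 0" "s \<ge> 1 \<Longrightarrow> smoothstep s = 1"
  by (auto simp: smoothstep_def max_def power2_eq_square algebra_simps)

lemma smoothstep'_simps:
  "s \<le> 0 \<Longrightarrow> smoothstep' s = 0" "s \<ge> 1 \<Longrightarrow> smoothstep' s = 0"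
  by (auto simp: smoothstep'_def max_def)

lemma smoothstep'_range: "0 \<le> smoothstep' s" "smoothstep' s \<le> 2"
  by (auto simp: smoothstep'_def max_def)

lemma continuous_smoothstep' [continuous_intros]:
  "continuous_on A f \<Longrightarrow> continuous_on A (\<lambda>x. smoothstep' (f x))"
  unfolding smoothstep'_def by (intro continuous_intros)

lemma continuous_smoothstep [continuous_intros]:
  "continuous_on A f \<Longrightarrow> continuous_on A (\<lambda>x. smoothstep (f x))"
  unfolding smoothstep_def by (intro continuous_intros)

lemma smoothstep_mono: "mono smoothstep"
  by (intro monoI DERIV_nonneg_imp_nondecreasing[where f=smoothstep]) (use DERIV_smoothstep smoothstep'_range in auto)

lemma smoothstep_range: "0 \<le> smoothstep s" "smoothstep s \<le> 1"
proof -
  show "0 \<le> smoothstep s" using monoD[OF smoothstep_mono, of "min s 0" s] by (simp add: smoothstep_simps)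
  show "smoothstep s \<le> 1" using monoD[OF smoothstep_mono, of s "max s 1"] by (simp add: smoothstep_simps)
qed

text \<open>Case distinction on y \<le> \<epsilon> x: in either case one of the two terms on the
  right alone dominates. Both carry the same power q, which is the form in which the dissipation
  absorbs them.\<close>

lemma young_powr:
  assumes "(x::real) \<ge> 0" "y \<ge> 0" "q > 1" "\<epsilon> > 0"
  shows "x powr (q - 1) * y \<le> \<epsilon> * x powr q + \<epsilon> powr (1 - q) * y powr q"
proof (cases "y \<le> \<epsilon> * x")
  case True
  have "x powr (q - 1) * y \<le> x powr (q - 1) * (\<epsilon> * x)" using True by (intro mult_left_mono) auto
  also have "\<dots> = \<epsilon> * x powr q" using assms by (cases "x = 0") (auto simp: powr_diff)
  also have "\<dots> \<le> \<epsilon> * x powr q + \<epsilon> powr (1 - q) * y powr q" by simp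
  finally show ?thesis .
next
  case False
  then have y: "y > 0" "x \<le> y / \<epsilon>" using assms by (auto simp: field_simps intro: order_le_less_trans[of 0 "\<epsilon> * x" y])
  have "x powr (q - 1) * y \<le> (y / \<epsilon>) powr (q - 1) * y" using y assms by (intro mult_right_mono powr_mono2) auto
  also have "\<dots> = \<epsilon> powr (1 - q) * y powr q"
    using assms y by (simp add: powr_divide powr_diff field_simps)
  also have "\<dots> \<le> \<epsilon> * x powr q + \<epsilon> powr (1 - q) * y powr q" using assms by simp
  finally show ?thesis .
qed

text \<open>At positive arguments this is the chain rule. At 0 it is the bound
  \<open>smoothstep s\<close> \<le> 2 s^2, which makes the q-th power of order s powr (2 q) with 2 q
  > 1.\<close>

lemma DERIV_smoothstep_powr:
  assumes "q > 1"
  shows "((\<lambda>s. smoothstep s powr q) has_real_derivative q * smoothstep s powr (q - 1) * smoothstep' s) (at s)"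
proof (rule DERIV_extend_by_zero[where K="2 powr q" and \<beta>="2 * q"])
  fix s :: real assume s: "s > 0"
  have "smoothstep s > 0"
  proof -
    have "smoothstep (min s (1/2)) = 2 * (min s (1/2))\<^sup>2" using s by (auto simp: smoothstep_def)
    also have "\<dots> > 0" using s by simp
    finally show ?thesis using monoD[OF smoothstep_mono, of "min s (1/2)" s] by simp
  qed
  then show "((\<lambda>s. smoothstep s powr q) has_real_derivative q * smoothstep s powr (q - 1) * smoothstep' s) (at s)"
    using DERIV_smoothstep[of s] by (auto intro!: derivative_eq_intros simp: powr_diff)
  have "smoothstep s \<le> 2 * s\<^sup>2"
    using s by (auto simp: smoothstep_def max_def power2_eq_square algebra_simps)
       (sos | (simp add: field_simps; sos))+
  then have "smoothstep s powr q \<le> (2 * s\<^sup>2) powr q"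
    using assms smoothstep_range by (intro powr_mono2) auto
  also have "\<dots> = 2 powr q * s powr (2 * q)"
    using s by (simp add: powr_mult powr_powr flip: powr_numeral)
  finally show "\<bar>smoothstep s powr q\<bar> \<le> 2 powr q * s powr (2 * q)" by simp
qed (use assms in \<open>auto simp: smoothstep_simps smoothstep'_simps\<close>)

section \<open>Tensor-product splines and their dyadic refinement\<close>

definition spl :: "real \<Rightarrow> real^'n \<Rightarrow> real^'n \<Rightarrow> real" where
  "spl h x y = (\<Prod>i\<in>UNIV. bspline ((y$i - x$i) / h))"

definition dspl :: "real \<Rightarrow> real^'n \<Rightarrow> real^'n \<Rightarrow> real^'n" where
  "dspl h x y = (\<chi> i. bspline' ((y$i - x$i) / h) / h * (\<Prod>j\<in>UNIV-{i}. bspline ((y$j - x$j) / h)))"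

lemma DERIV_bspline: "(bspline has_real_derivative bspline' s) (at s)"
proof -
  have *: "((\<lambda>s. (pos_part (s - k))\<^sup>2) has_real_derivative 2 * pos_part (s - k)) (at s)" for k
  proof -
    have "((\<lambda>s. s - k) has_real_derivative 1) (at s)" by (auto intro!: derivative_eq_intros)
    from DERIV_chain2[OF DERIV_square_pos_part this] show ?thesis by (simp add: pos_part_def)
  qed
  have "((\<lambda>s. ((pos_part s)\<^sup>2 - 3 * (pos_part (s - 1))\<^sup>2 + 3 * (pos_part (s - 2))\<^sup>2 - (pos_part (s - 3))\<^sup>2) / 2)
    has_real_derivative (2 * pos_part s - 3 * (2 * pos_part (s - 1)) + 3 * (2 * pos_part (s - 2)) - 2 * pos_part (s - 3)) / 2) (at s)"
    by (intro DERIV_cdivide DERIV_add DERIV_diff DERIV_cmult * *[of 0, simplified])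
  then show ?thesis unfolding bspline_def[abs_def] bspline'_def by (rule DERIV_cong) simp
qed

lemma spl_deriv:
  fixes x y :: "real^'n"
  assumes "h > 0"
  shows "(spl h x has_derivative (\<lambda>k. dspl h x y \<bullet> k)) (at y)"
proof -
  have "((\<lambda>y. bspline ((y$i - x$i) / h)) has_derivative (\<lambda>k. bspline' ((y$i - x$i) / h) / h * k$i)) (at y)" for i
  proof -
    have l: "((\<lambda>y. (y$i - x$i) / h) has_derivative (\<lambda>k. k$i / h)) (at y)"
      using assms by (auto intro!: derivative_eq_intros bounded_linear.has_derivative[OF bounded_linear_vec_nth])
    have "(bspline has_derivative (\<lambda>k. bspline' ((y$i - x$i) / h) * k)) (at ((y$i - x$i) / h))"
      using DERIV_bspline by (simp add: has_field_derivative_def)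
    from has_derivative_compose[OF l this] show ?thesis by simp
  qed
  from has_derivative_prod[where I=UNIV, OF this] show ?thesis
    by (simp add: spl_def[abs_def] dspl_def inner_vec_def mult_ac)
qed

lemma continuous_spl:
  fixes x :: "real^'n"
  shows "continuous_on A (spl h x)" "continuous_on A (dspl h x)"
  unfolding spl_def[abs_def] dspl_def[abs_def] divide_inverse
  by (intro continuous_intros)+

lemma spl_outside:
  fixes x y :: "real^'n"
  assumes "h > 0" "y \<notin> cbox x (x + (3 * h) *\<^sub>R 1)"
  shows "spl h x y = 0" "dspl h x y = 0"
proof -
  obtain i where "\<not> (x$i \<le> y$i \<and> y$i \<le> x$i + 3 * h)"
    using assms by (auto simp: mem_box_cart)
  then have i: "(y$i - x$i) / h \<notin> {0..3}" using assms by (auto simp: field_simps)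
  show "spl h x y = 0" unfolding spl_def
    by (rule prod_zero) (use bspline_zero[OF i] in auto)
  have "dspl h x y $ j = 0" for j
  proof (cases "j = i")
    case False
    then have "(\<Prod>k\<in>UNIV-{j}. bspline ((y$k - x$k) / h)) = 0"
      by (intro prod_zero) (use bspline_zero[OF i] in auto)
    then show ?thesis by (simp add: dspl_def)
  qed (use bspline_zero[OF i] in \<open>simp add: dspl_def\<close>)
  then show "dspl h x y = 0" by (simp add: vec_eq_iff)
qed

text \<open>The refinement mask in n dimensions. Its total mass is 2 ^ n, exactly the factor by
  which the volume scale h ^ n shrinks when h is halved.\<close>

definition spl_weight :: "('n::finite \<Rightarrow> nat) \<Rightarrow> real" where
  "spl_weight k = (\<Prod>i\<in>UNIV. real (3 choose k i) / 4)"

lemma spl_weight_nonneg: "spl_weight k \<ge> 0"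
  unfolding spl_weight_def by (intro prod_nonneg) auto

abbreviation (input) spl_index :: "('n::finite \<Rightarrow> nat) set" where
  "spl_index \<equiv> Pi\<^sub>E UNIV (\<lambda>_. {..3})"

lemma sum_spl_weight: "(\<Sum>k\<in>spl_index. spl_weight (k :: 'n::finite \<Rightarrow> nat)) = 2 ^ CARD('n)"
proof -
  have "(\<Sum>k\<in>spl_index. spl_weight (k :: 'n::finite \<Rightarrow> nat)) = (\<Prod>i\<in>(UNIV::'n set). \<Sum>k\<le>3. real (3 choose k) / 4)"
    unfolding spl_weight_def by (subst prod_sum_PiE) auto
  also have "(\<Sum>k\<le>3. real (3 choose k) / 4) = 2"
    by (simp add: numeral_3_eq_3 numeral_eq_Suc)
  finally show ?thesis by simp
qed

abbreviation (input) spl_shift :: "real \<Rightarrow> real^'n \<Rightarrow> ('n \<Rightarrow> nat) \<Rightarrow> real^'n" where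
  "spl_shift h x k \<equiv> x + (h / 2) *\<^sub>R (\<chi> i. real (k i))"

lemma spl_refine:
  fixes x y :: "real^'n"
  assumes "h > 0"
  shows "spl h x y = (\<Sum>k\<in>spl_index. spl_weight k * spl (h / 2) (spl_shift h x k) y)"
proof -
  have "spl h x y = (\<Prod>i\<in>UNIV. \<Sum>k\<le>3. real (3 choose k) / 4 * bspline (2 * ((y$i - x$i) / h) - k))"
    unfolding spl_def by (subst bspline_refine) simp
  also have "\<dots> = (\<Sum>k\<in>spl_index. \<Prod>i\<in>UNIV. real (3 choose k i) / 4 * bspline (2 * ((y$i - x$i) / h) - k i))"
    by (subst prod_sum_PiE) auto
  also have "\<dots> = (\<Sum>k\<in>spl_index. spl_weight k * spl (h / 2) (spl_shift h x k) y)"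
    unfolding spl_weight_def spl_def prod.distrib
    using assms by (intro sum.cong refl arg_cong2[where f="(*)"] prod.cong arg_cong[where f=bspline]) (auto simp: field_simps)
  finally show ?thesis .
qed

text \<open>Differentiates \<open>spl_refine\<close> and appeals to uniqueness of the derivative,
  which avoids a second computation with products.\<close>

lemma dspl_refine:
  fixes x y :: "real^'n"
  assumes "h > 0"
  shows "dspl h x y = (\<Sum>k\<in>spl_index. spl_weight k *\<^sub>R dspl (h / 2) (spl_shift h x k) y)"
proof -
  have "((\<lambda>y. \<Sum>k\<in>spl_index. spl_weight k * spl (h / 2) (spl_shift h x k) y) has_derivative
      (\<lambda>v. \<Sum>k\<in>spl_index. spl_weight k * (dspl (h / 2) (spl_shift h x k) y \<bullet> v))) (at y)"
    using assms by (intro has_derivative_sum has_derivative_mult_right spl_deriv) auto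
  then have "(spl h x has_derivative (\<lambda>v. \<Sum>k\<in>spl_index. spl_weight k * (dspl (h / 2) (spl_shift h x k) y \<bullet> v))) (at y)"
    using spl_refine[OF assms, of x] by presburger
  from has_derivative_unique[OF this spl_deriv[OF assms]]
  have "dspl h x y \<bullet> v = (\<Sum>k\<in>spl_index. spl_weight k *\<^sub>R dspl (h / 2) (spl_shift h x k) y) \<bullet> v" for v
    by (simp add: inner_sum_left fun_eq_iff)
  then show ?thesis using vector_eq_rdot by blast
qed

lemma spl_bounds:
  assumes "\<And>s. \<bar>bspline s\<bar> \<le> M \<and> \<bar>bspline' s\<bar> \<le> M" "M \<ge> 1" "h > 0"
  shows "\<bar>spl h x y\<bar> \<le> M ^ CARD('n)" "norm (dspl h x (y::real^'n)) \<le> CARD('n) * (M ^ CARD('n) / h)"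
proof -
  have p: "\<bar>\<Prod>j\<in>A. bspline (f j)\<bar> \<le> M ^ card A" for f and A :: "'n set"
  proof -
    have "(\<Prod>j\<in>A. \<bar>bspline (f j)\<bar>) \<le> (\<Prod>j\<in>A. M)"
      using assms(1) by (intro prod_mono) auto
    then show ?thesis by (simp add: abs_prod)
  qed
  show "\<bar>spl h x y\<bar> \<le> M ^ CARD('n)" unfolding spl_def by (rule p)
  have "\<bar>dspl h x y $ i\<bar> \<le> M ^ CARD('n) / h" for i
  proof -
    have "\<bar>dspl h x y $ i\<bar> \<le> M / h * M ^ card (UNIV - {i})"
      using assms p[of "\<lambda>j. (y$j - x$j) / h" "UNIV - {i}"]
      by (auto simp: dspl_def abs_mult intro!: mult_mono divide_right_mono)
    also have "M / h * M ^ card (UNIV - {i}) = M ^ CARD('n) / h"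
      by (simp add: card_Diff_singleton flip: power_Suc)
    finally show ?thesis .
  qed
  then have "(\<Sum>i\<in>UNIV. \<bar>dspl h x y $ i\<bar>) \<le> (\<Sum>i\<in>(UNIV::'n set). M ^ CARD('n) / h)"
    by (rule sum_mono)
  with norm_le_l1_cart[of "dspl h x y"] show "norm (dspl h x y) \<le> CARD('n) * (M ^ CARD('n) / h)" by simp
qed

text \<open>The integrand is the divergence of the spline times an affine field. That field has C^1
  components, so \<open>integral_gradient_zero\<close> applies to each coordinate separately. This
  is the reference term subtracted in the Goursat argument.\<close>

lemma affine_flux_zero:
  fixes x z g :: "real^'n" and M :: "real^'n^'n"
  assumes h: "h > 0"
  shows "integral (cbox x (x + (3 * h) *\<^sub>R 1))
    (\<lambda>y. (\<Sum>i\<in>UNIV. M$i$i) * spl h x y + (g + M *v (y - z)) \<bullet> dspl h x y) = 0"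
proof -
  let ?Q = "cbox x (x + (3 * h) *\<^sub>R 1)"
  let ?P = "\<lambda>y. g + M *v (y - z)"
  have cP: "continuous_on A (\<lambda>y. ?P y $ i)" for A i
    unfolding vector_add_component matrix_vector_mul_component by (intro continuous_intros)
  have cM: "continuous_on B (\<lambda>y. M *v (y - z))" for B
    by (intro bounded_linear.continuous_on[OF matrix_vector_mul_bounded_linear] continuous_intros)
  note c [continuous_intros] = continuous_spl cP cM
  have "integral ?Q (\<lambda>y. (?P y $ i *\<^sub>R dspl h x y + spl h x y *\<^sub>R M$i) \<bullet> axis i 1) = 0" for i
  proof (rule integral_gradient_zero[where f="\<lambda>y. ?P y $ i * spl h x y"])
    fix y
    have "((\<lambda>y. ?P y $ i) has_derivative (\<lambda>k. M$i \<bullet> k)) (at y)"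
      unfolding vector_add_component matrix_vector_mul_component
      by (auto intro!: derivative_eq_intros)
    from has_derivative_mult[OF this spl_deriv[OF h, of x y]]
    show "((\<lambda>y. ?P y $ i * spl h x y) has_derivative (\<lambda>k. (?P y $ i *\<^sub>R dspl h x y + spl h x y *\<^sub>R M$i) \<bullet> k)) (at y)"
      by (simp add: inner_add_left mult_ac)
  qed (auto simp: spl_outside[OF h] intro!: continuous_intros)
  then have "0 = (\<Sum>i\<in>UNIV. integral ?Q (\<lambda>y. (?P y $ i *\<^sub>R dspl h x y + spl h x y *\<^sub>R M$i) \<bullet> axis i 1))"
    by simp
  also have "\<dots> = integral ?Q (\<lambda>y. \<Sum>i\<in>UNIV. (?P y $ i *\<^sub>R dspl h x y + spl h x y *\<^sub>R M$i) \<bullet> axis i 1)"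
    by (rule integral_sum[symmetric]) (auto intro!: integrable_continuous continuous_intros)
  also have "(\<lambda>y. \<Sum>i\<in>UNIV. (?P y $ i *\<^sub>R dspl h x y + spl h x y *\<^sub>R M$i) \<bullet> axis i 1)
     = (\<lambda>y. (\<Sum>i\<in>UNIV. M$i$i) * spl h x y + ?P y \<bullet> dspl h x y)"
    by (auto simp: fun_eq_iff inner_axis inner_vec_def[of "_ + _"] sum.distrib sum_distrib_left sum_distrib_right mult_ac add_ac)
  finally show ?thesis by simp
qed

text \<open>A Goursat argument: a defect of size $c\,h^n$ on one spline would be inherited by one of the
  splines of the next dyadic generation, contradicting differentiability at the limit point.\<close>

lemma spline_flux_zero:
  fixes G :: "real^'n \<Rightarrow> real^'n"
  assumes G: "\<And>y. (G has_derivative DG y) (at y)"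
    and d: "\<And>y. d y = (\<Sum>i\<in>UNIV. DG y (axis i 1) $ i)" and cd: "continuous_on UNIV d"
    and h0: "h0 > 0"
  shows "integral (cbox x0 (x0 + (3 * h0) *\<^sub>R 1)) (\<lambda>y. d y * spl h0 x0 y + G y \<bullet> dspl h0 x0 y) = 0"
proof (rule ccontr)
  let ?n = "CARD('n)"
  define Q where "Q h x = cbox x (x + (3 * h) *\<^sub>R (1::real^'n))" for h x
  define L where "L h x = integral (Q h0 x0) (\<lambda>y. d y * spl h x y + G y \<bullet> dspl h x y)" for h x
  assume "integral (cbox x0 (x0 + (3 * h0) *\<^sub>R 1)) (\<lambda>y. d y * spl h0 x0 y + G y \<bullet> dspl h0 x0 y) \<noteq> 0"
  then have L0: "\<bar>L h0 x0\<bar> > 0" by (simp add: L_def Q_def)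
  \<comment> \<open>The defect relative to h0 ^ n; this ratio is what survives all
    subdivisions.\<close>
  define c where "c = \<bar>L h0 x0\<bar> / h0 ^ ?n"
  have c: "c > 0" using L0 h0 by (simp add: c_def)
  have cG: "continuous_on UNIV G"
    by (meson has_derivative_continuous continuous_at_imp_continuous_on G)
  have cM: "continuous_on B (\<lambda>y. A *v (y - z))" for B z and A :: "real^'n^'n"
    by (intro bounded_linear.continuous_on[OF matrix_vector_mul_bounded_linear] continuous_intros)
  note ci [continuous_intros] = continuous_spl continuous_on_subset[OF cG] continuous_on_subset[OF cd]
  have L_refine: "L h x = (\<Sum>k\<in>spl_index. spl_weight k * L (h / 2) (spl_shift h x k))" if "h > 0" for h x
  proof -
    have "L h x = integral (Q h0 x0) (\<lambda>y. \<Sum>k\<in>spl_index. spl_weight k * (d y * spl (h / 2) (spl_shift h x k) y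
        + G y \<bullet> dspl (h / 2) (spl_shift h x k) y))"
      unfolding L_def spl_refine[OF that, of x] dspl_refine[OF that, of x]
      by (simp add: inner_sum_right sum_distrib_left sum.distrib distrib_left mult_ac)
    also have "\<dots> = (\<Sum>k\<in>spl_index. integral (Q h0 x0) (\<lambda>y. spl_weight k * (d y * spl (h / 2) (spl_shift h x k) y
        + G y \<bullet> dspl (h / 2) (spl_shift h x k) y)))"
      unfolding Q_def
      by (intro integral_sum integrable_continuous continuous_intros) (auto simp: finite_PiE)
    finally show ?thesis unfolding L_def by simp
  qed
  \<comment> \<open>If all children stayed below c (h/2) ^ n, their total weight 2 ^ n would force
    the parent below c h ^ n. Strictness uses one child of positive weight, and every child is
    supported inside the cube of its parent.\<close>
  have step: "\<exists>x'. Q (h / 2) x' \<subseteq> Q h x \<and> \<bar>L (h / 2) x'\<bar> \<ge> c * (h / 2) ^ ?n"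
    if h: "h > 0" and l: "\<bar>L h x\<bar> \<ge> c * h ^ ?n" for h x
  proof (rule ccontr)
    assume no: "\<not> ?thesis"
    have lt: "\<bar>L (h / 2) (spl_shift h x k)\<bar> < c * (h / 2) ^ ?n" if "k \<in> spl_index" for k
    proof -
      have "k i \<le> 3" for i using that by (auto simp: PiE_iff)
      then have "h * real (k i) \<le> h * 3" "0 \<le> h * real (k i)" for i
        using h by simp_all
      then have b: "h / 2 * real (k i) \<le> 3 * h / 2" "0 \<le> h / 2 * real (k i)" for i
        by (simp_all add: mult.commute)
      have "Q (h / 2) (spl_shift h x k) \<subseteq> Q h x"
      proof
        fix y assume "y \<in> Q (h / 2) (spl_shift h x k)"
        then have "x $ i + h / 2 * real (k i) \<le> y $ i" "y $ i \<le> x $ i + h / 2 * real (k i) + 3 * (h / 2)" for i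
          by (auto simp: Q_def mem_box_cart)
        then have "x $ i \<le> y $ i" "y $ i \<le> x $ i + 3 * h" for i
          using b[of i] by (smt (verit) field_sum_of_halves)+
        then show "y \<in> Q h x" by (auto simp: Q_def mem_box_cart)
      qed
      then show ?thesis using no by force
    qed
    have w: "\<exists>k\<in>(spl_index :: ('n \<Rightarrow> nat) set). spl_weight k > 0"
      by (intro bexI[of _ "\<lambda>_. 0"]) (auto simp: spl_weight_def intro!: prod_pos)
    have "\<bar>L h x\<bar> \<le> (\<Sum>k\<in>spl_index. spl_weight k * \<bar>L (h / 2) (spl_shift h x k)\<bar>)"
      unfolding L_refine[OF h, of x] 
      by (rule order_trans[OF sum_abs]) (simp add: abs_mult spl_weight_nonneg)
    also have "\<dots> < (\<Sum>k\<in>(spl_index :: ('n \<Rightarrow> nat) set). spl_weight k * (c * (h / 2) ^ ?n))"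
    proof (rule sum_strict_mono_ex1)
      show "finite (spl_index :: ('n \<Rightarrow> nat) set)" by (auto intro!: finite_PiE)
      show "\<forall>k\<in>spl_index. spl_weight k * \<bar>L (h / 2) (spl_shift h x k)\<bar> \<le> spl_weight k * (c * (h / 2) ^ ?n)"
        using lt by (intro ballI mult_left_mono less_imp_le spl_weight_nonneg) auto
      show "\<exists>k\<in>spl_index. spl_weight k * \<bar>L (h / 2) (spl_shift h x k)\<bar> < spl_weight k * (c * (h / 2) ^ ?n)"
        using lt w by (meson mult_strict_left_mono)
    qed
    also have "\<dots> = 2 ^ ?n * (c * (h / 2) ^ ?n)"
      by (simp only: sum_distrib_right[symmetric] sum_spl_weight)
    also have "\<dots> = c * h ^ ?n" by (simp add: power_divide)
    finally show False using l by simp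
  qed
  have "\<exists>X. \<forall>m. \<bar>L (h0 / 2 ^ m) (X m)\<bar> \<ge> c * (h0 / 2 ^ m) ^ ?n \<and> Q (h0 / 2 ^ m) (X m) \<subseteq> Q h0 x0
       \<and> Q (h0 / 2 ^ Suc m) (X (Suc m)) \<subseteq> Q (h0 / 2 ^ m) (X m)"
  proof -
    have "\<exists>X. \<forall>m. (\<bar>L (h0 / 2 ^ m) (X m)\<bar> \<ge> c * (h0 / 2 ^ m) ^ ?n \<and> Q (h0 / 2 ^ m) (X m) \<subseteq> Q h0 x0)
       \<and> Q (h0 / 2 ^ Suc m) (X (Suc m)) \<subseteq> Q (h0 / 2 ^ m) (X m)"
    proof (rule dependent_nat_choice)
      show "\<exists>x. \<bar>L (h0 / 2 ^ 0) x\<bar> \<ge> c * (h0 / 2 ^ 0) ^ ?n \<and> Q (h0 / 2 ^ 0) x \<subseteq> Q h0 x0"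
        using h0 by (intro exI[of _ x0]) (simp add: c_def)
      fix x m assume a: "\<bar>L (h0 / 2 ^ m) x\<bar> \<ge> c * (h0 / 2 ^ m) ^ ?n \<and> Q (h0 / 2 ^ m) x \<subseteq> Q h0 x0"
      have "h0 / 2 ^ m > 0" using h0 by simp
      from step[OF this, of x] a obtain x' where x':
        "Q (h0 / 2 ^ m / 2) x' \<subseteq> Q (h0 / 2 ^ m) x" "\<bar>L (h0 / 2 ^ m / 2) x'\<bar> \<ge> c * (h0 / 2 ^ m / 2) ^ ?n" by blast
      have e: "h0 / 2 ^ m / 2 = h0 / 2 ^ Suc m" by simp
      show "\<exists>x'. (\<bar>L (h0 / 2 ^ Suc m) x'\<bar> \<ge> c * (h0 / 2 ^ Suc m) ^ ?n \<and> Q (h0 / 2 ^ Suc m) x' \<subseteq> Q h0 x0)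
        \<and> Q (h0 / 2 ^ Suc m) x' \<subseteq> Q (h0 / 2 ^ m) x"
        using a x'[unfolded e] by (blast intro: order_trans)
    qed
    then show ?thesis by blast
  qed
  then obtain X where XL: "\<And>m. \<bar>L (h0 / 2 ^ m) (X m)\<bar> \<ge> c * (h0 / 2 ^ m) ^ ?n"
    and XQ: "\<And>m. Q (h0 / 2 ^ m) (X m) \<subseteq> Q h0 x0"
    and XS: "\<And>m. Q (h0 / 2 ^ Suc m) (X (Suc m)) \<subseteq> Q (h0 / 2 ^ m) (X m)" by blast
  \<comment> \<open>The nested cubes meet in a point z; the differentiability of G is used only
    there.\<close>
  have "\<exists>z. \<forall>m. z \<in> Q (h0 / 2 ^ m) (X m)"
  proof -
    have "(\<Inter>m. Q (h0 / 2 ^ m) (X m)) \<noteq> {}"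
    proof (rule compact_nest)
      show "Q (h0 / 2 ^ n) (X n) \<subseteq> Q (h0 / 2 ^ m) (X m)" if "m \<le> n" for m n
        using lift_Suc_antimono_le[of "\<lambda>m. Q (h0 / 2 ^ m) (X m)" m n] XS that by blast
      show "Q (h0 / 2 ^ m) (X m) \<noteq> {}" for m
        using h0 by (auto simp: Q_def interval_ne_empty_cart)
    qed (simp add: Q_def)
    then show ?thesis by blast
  qed
  then obtain z where z: "\<And>m. z \<in> Q (h0 / 2 ^ m) (X m)" by blast
  obtain M where M: "M \<ge> 1" "\<And>s. \<bar>bspline s\<bar> \<le> M \<and> \<bar>bspline' s\<bar> \<le> M" using bspline_bounded by blast
  \<comment> \<open>Collects what a first-order expansion at z can cost: the spline bound, the
    factor h from |y - z| against 1/h from \<open>dspl\<close>, and the volume (3 h) ^ n. Then e is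
    taken so small that e C < c.\<close>
  define C where "C = (M ^ ?n + 3 * ?n * (?n * M ^ ?n)) * 3 ^ ?n"
  have C: "C > 0" using M by (auto simp: C_def intro!: mult_pos_pos add_pos_nonneg)
  define e where "e = c / (2 * C)"
  have e: "e > 0" "e * C < c" using c C by (auto simp: e_def)
  define A where "A = matrix (DG z)"
  have A: "DG z v = A *v v" for v 
    unfolding A_def using G[of z] by (simp add: has_derivative_linear matrix_works)
  have dz: "d z = (\<Sum>i\<in>UNIV. A$i$i)" by (simp add: d A_def matrix_def)
  have "\<exists>r>0. \<forall>y. norm (y - z) < r \<longrightarrow> norm (G y - G z - A *v (y - z)) \<le> e * norm (y - z)"
    using G[of z] e unfolding has_derivative_at_alt A by blast
  then obtain r1 where r1: "r1 > 0" "\<And>y. norm (y - z) < r1 \<Longrightarrow> norm (G y - G z - A *v (y - z)) \<le> e * norm (y - z)"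
    by blast
  have "\<exists>r>0. \<forall>y. dist y z < r \<longrightarrow> dist (d y) (d z) < e"
    using cd e unfolding continuous_on_iff by auto
  then obtain r2 where r2: "r2 > 0" "\<And>y. norm (y - z) < r2 \<Longrightarrow> \<bar>d y - d z\<bar> < e"
    by (auto simp: dist_norm)
  obtain m :: nat where m: "3 * h0 * ?n / min r1 r2 < 2 ^ m"
    using real_arch_pow[of 2] by auto
  define h where "h = h0 / 2 ^ m"
  define x where "x = X m"
  have h: "h > 0" using h0 by (simp add: h_def)
  have "3 * h * ?n < min r1 r2" using m r1 r2 by (simp add: h_def field_simps del: min_less_iff_conj)
  have close: "norm (y - z) \<le> 3 * h * ?n" if "y \<in> Q h x" for y
  proof -
    have "z \<in> Q h x" using z by (simp add: h_def x_def)
    then have "\<bar>(y - z) $ i\<bar> \<le> 3 * h" for i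
      using that by (auto simp: Q_def mem_box_cart abs_le_iff dest!: spec[of _ i])
    then have "(\<Sum>i\<in>UNIV. \<bar>(y - z) $ i\<bar>) \<le> (\<Sum>i\<in>(UNIV::'n set). 3 * h)" by (rule sum_mono)
    with norm_le_l1_cart[of "y - z"] show ?thesis by (simp add: mult.commute)
  qed
  have "L h x = integral (Q h x) (\<lambda>y. d y * spl h x y + G y \<bullet> dspl h x y)"
    unfolding L_def Q_def
  proof (rule integral_cbox_superset)
    show "cbox x (x + (3 * h) *\<^sub>R 1) \<subseteq> cbox x0 (x0 + (3 * h0) *\<^sub>R 1)"
      using XQ[of m] by (simp add: Q_def h_def x_def)
  qed (auto simp: spl_outside[OF h] intro!: continuous_intros)
  \<comment> \<open>Subtracting the affine term, which is zero, leaves only the oscillation of d and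
    the remainder of the derivative of G at z.\<close>
  also have "\<dots> = integral (Q h x) (\<lambda>y. d y * spl h x y + G y \<bullet> dspl h x y)
      - integral (Q h x) (\<lambda>y. (\<Sum>i\<in>UNIV. A$i$i) * spl h x y + (G z + A *v (y - z)) \<bullet> dspl h x y)"
    using affine_flux_zero[OF h, of x A "G z" z] by (simp add: Q_def)
  also have "\<dots> = integral (Q h x) (\<lambda>y. (d y * spl h x y + G y \<bullet> dspl h x y)
      - ((\<Sum>i\<in>UNIV. A$i$i) * spl h x y + (G z + A *v (y - z)) \<bullet> dspl h x y))"
    unfolding Q_def
    by (rule integral_diff[symmetric])
      (auto intro!: integrable_continuous continuous_intros cM)
  also have "norm \<dots> \<le> (e * M ^ ?n + e * (3 * h * ?n) * (?n * (M ^ ?n / h))) * measure lborel (Q h x)"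
    unfolding Q_def
  proof (rule integrable_bound)
    show "0 \<le> e * M ^ ?n + e * (3 * h * ?n) * (?n * (M ^ ?n / h))" using e M h by auto
    show "(\<lambda>y. (d y * spl h x y + G y \<bullet> dspl h x y)
      - ((\<Sum>i\<in>UNIV. A$i$i) * spl h x y + (G z + A *v (y - z)) \<bullet> dspl h x y)) integrable_on cbox x (x + (3 * h) *\<^sub>R 1)"
      by (auto intro!: integrable_continuous continuous_intros cM)
    fix y assume y: "y \<in> cbox x (x + (3 * h) *\<^sub>R 1)"
    then have cl: "norm (y - z) \<le> 3 * h * ?n" using close by (simp add: Q_def)
    then have lt: "norm (y - z) < r1" "norm (y - z) < r2" using \<open>3 * h * ?n < min r1 r2\<close> by auto
    have "norm ((d y * spl h x y + G y \<bullet> dspl h x y) - ((\<Sum>i\<in>UNIV. A$i$i) * spl h x y + (G z + A *v (y - z)) \<bullet> dspl h x y))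
      = norm ((d y - d z) * spl h x y + (G y - G z - A *v (y - z)) \<bullet> dspl h x y)"
      unfolding dz by (simp add: algebra_simps)
    also have "\<dots> \<le> \<bar>d y - d z\<bar> * \<bar>spl h x y\<bar> + norm (G y - G z - A *v (y - z)) * norm (dspl h x y)"
      using Cauchy_Schwarz_ineq2[of "G y - G z - A *v (y - z)" "dspl h x y"]
      by (simp add: abs_mult[symmetric] del: abs_mult)
    also have "\<dots> \<le> e * M ^ ?n + e * (3 * h * ?n) * (?n * (M ^ ?n / h))"
      using r1(2)[OF lt(1)] r2(2)[OF lt(2)] cl e M h spl_bounds[OF M(2,1) h, of x y]
      by (intro add_mono mult_mono order_trans[OF r1(2)[OF lt(1)]]) auto
    finally show "norm ((d y * spl h x y + G y \<bullet> dspl h x y)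
      - ((\<Sum>i\<in>UNIV. A$i$i) * spl h x y + (G z + A *v (y - z)) \<bullet> dspl h x y)) \<le> e * M ^ ?n + e * (3 * h * ?n) * (?n * (M ^ ?n / h))" .
  qed
  also have "measure lborel (Q h x) = (3 * h) ^ ?n"
  proof -
    have "Q h x \<noteq> {}" using h by (auto simp: Q_def interval_ne_empty_cart)
    then show ?thesis unfolding Q_def by (subst content_cbox_cart) auto
  qed
  also have "(e * M ^ ?n + e * (3 * h * ?n) * (?n * (M ^ ?n / h))) * (3 * h) ^ ?n = e * C * h ^ ?n"
    using h by (simp add: C_def power_mult_distrib field_simps)
  also have "\<dots> < c * h ^ ?n" using e h by simp
  finally show False using XL[of m] by (simp add: h_def x_def)
qed

text \<open>Splines of width 3/r centred at the origin tend to the constant (3/4) ^ n on the support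
  as r tends to 0, and their gradients tend to 0, so that \<open>spline_flux_zero\<close> passes to
  the limit.\<close>

theorem integral_divergence_zero:
  fixes G :: "real^'n \<Rightarrow> real^'n"
  assumes G: "\<And>y. (G has_derivative DG y) (at y)"
    and d: "\<And>y. d y = (\<Sum>i\<in>UNIV. DG y (axis i 1) $ i)" and cd: "continuous_on UNIV d"
    and z: "\<And>y. y \<notin> cbox a b \<Longrightarrow> G y = 0" "\<And>y. y \<notin> cbox a b \<Longrightarrow> d y = 0"
  shows "integral (cbox a b) d = 0"
proof -
  let ?n = "CARD('n)"
  have cG: "continuous_on UNIV G"
    by (meson has_derivative_continuous continuous_at_imp_continuous_on G)
  note ci [continuous_intros] = continuous_on_compose2[OF cG] continuous_on_compose2[OF cd]
  \<comment> \<open>Also meaningful at r = 0 and continuous in r, which turns the limit of wide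
    splines into continuity of a parameter integral.\<close>
  define F where "F r y = d y * (\<Prod>i\<in>UNIV. bspline (3/2 + r * y$i))
     + G y \<bullet> (\<chi> i. r * bspline' (3/2 + r * y$i) * (\<Prod>j\<in>UNIV-{i}. bspline (3/2 + r * y$j)))" for r y
  have cF: "continuous_on UNIV (\<lambda>r. integral (cbox a b) (F r))"
    unfolding F_def
    by (rule integral_continuous_on_param) (auto simp: split_beta intro!: continuous_intros)
  have F0: "integral (cbox a b) (F r) = 0" if r: "0 < r" "r * (norm a + norm b) \<le> 3/2" for r
  proof -
    define h x where "h = 1 / r" "x = ((-3/2) * h) *\<^sub>R (1::real^'n)"
    have h: "h > 0" "norm a + norm b \<le> 3/2 * h" using r by (auto simp: h_x_def field_simps)
    have e: "(y $ i - x $ i) / h = 3/2 + r * y$i" for y i using h r by (simp add: h_x_def field_simps)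
    have ab: "- (3/2 * h) \<le> a $ i \<and> b $ i \<le> 3/2 * h" for i
      using h component_le_norm_cart[of a i] component_le_norm_cart[of b i] norm_ge_zero[of a] norm_ge_zero[of b]
      by (smt (verit))
    have sub: "cbox a b \<subseteq> cbox x (x + (3 * h) *\<^sub>R 1)"
    proof
      fix y assume y: "y \<in> cbox a b"
      have "x $ i \<le> y $ i \<and> y $ i \<le> x $ i + 3 * h" for i
        using y ab[of i] by (auto simp: mem_box_cart h_x_def(2) dest!: spec[of _ i])
      then show "y \<in> cbox x (x + (3 * h) *\<^sub>R 1)" by (auto simp: mem_box_cart)
    qed
    have "F r = (\<lambda>y. d y * spl h x y + G y \<bullet> dspl h x y)"
      unfolding F_def spl_def dspl_def e fun_eq_iff by (simp add: h_x_def(1) mult.commute)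
    moreover have "integral (cbox x (x + (3 * h) *\<^sub>R 1)) (\<lambda>y. d y * spl h x y + G y \<bullet> dspl h x y) = 0"
      using spline_flux_zero[OF G d cd h(1)] by blast
    moreover have "integral (cbox x (x + (3 * h) *\<^sub>R 1)) (F r) = integral (cbox a b) (F r)"
      by (rule integral_cbox_superset[OF _ _ sub]) (auto simp: F_def z intro!: continuous_intros)
    ultimately show ?thesis by simp
  qed
  have lim: "((\<lambda>r. integral (cbox a b) (F r)) \<longlongrightarrow> integral (cbox a b) (F 0)) (at_right 0)"
    using cF by (meson UNIV_I continuous_on_def tendsto_within_subset subset_UNIV)
  have "\<forall>\<^sub>F r in at_right 0. integral (cbox a b) (F r) = 0"
  proof -
    define R where "R = (3/2) / (norm a + norm b + 1)"
    have "R > 0" by (auto simp: R_def intro!: divide_pos_pos add_nonneg_pos)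
    have "r * (norm a + norm b) \<le> 3/2" if "0 < r" "r < R" for r
    proof -
      have "r * (norm a + norm b) \<le> r * (norm a + norm b + 1)" using that by simp
      also have "\<dots> \<le> R * (norm a + norm b + 1)" using that by (intro mult_right_mono) auto
      also have "\<dots> = 3/2" unfolding R_def
        by (smt (verit) norm_ge_zero nonzero_eq_divide_eq)
      finally show ?thesis .
    qed
    then show ?thesis using F0 \<open>R > 0\<close> by (auto simp: eventually_at_right_field)
  qed
  then have "((\<lambda>r. integral (cbox a b) (F r)) \<longlongrightarrow> 0) (at_right 0)"
    by (rule tendsto_eventually)
  from tendsto_unique[OF trivial_limit_at_right_real lim this]
  have "integral (cbox a b) (F 0) = 0" .
  moreover have "F 0 = (\<lambda>y. d y * bspline (3/2) ^ ?n)"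
    by (auto simp: F_def fun_eq_iff zero_vec_def[symmetric])
  moreover have "bspline (3/2) = 3/4"
    by (simp add: bspline_def pos_part_def power2_eq_square)
  ultimately show ?thesis by simp
qed

section \<open>Faber--Krahn and Gagliardo--Nirenberg inequalities\<close>

lemma integral_box_le_support_box:
  fixes f :: "'a::euclidean_space \<Rightarrow> real"
  assumes "continuous_on UNIV f" "\<And>x. f x \<ge> 0" "\<And>x. x \<notin> cbox a b \<Longrightarrow> f x = 0"
  shows "integral (cbox c d) f \<le> integral (cbox a b) f"
proof -
  have i: "f integrable_on cbox a b" "f integrable_on cbox c d"
    by (auto intro!: integrable_continuous continuous_on_subset[OF assms(1)])
  have u: "(f has_integral integral (cbox a b) f) UNIV"
    using has_integral_on_superset[of f _ "cbox a b" UNIV] i(1) assms(3) by (auto simp: integrable_integral)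
  have "integral (cbox c d) f \<le> integral UNIV f"
    using i u assms(2) by (intro integral_subset_le) auto
  then show ?thesis using u by (simp add: integral_unique)
qed

lemma integral_translate_le:
  fixes f :: "'a::euclidean_space \<Rightarrow> real"
  assumes "continuous_on UNIV f" "\<And>x. f x \<ge> 0" "\<And>x. x \<notin> cbox a b \<Longrightarrow> f x = 0"
  shows "integral (cbox c d) (\<lambda>x. f (x + y)) \<le> integral (cbox a b) f"
proof -
  have "integral (cbox c d) (\<lambda>x. f (x + y)) = integral (cbox (c+y) (d+y)) f"
    using integral_shift_cbox_plus[of c d f y] by (simp add: o_def add.commute)
  then show ?thesis using integral_box_le_support_box[OF assms] by simp
qed

lemma segment_increment_le:
  fixes w :: "'a::euclidean_space \<Rightarrow> real"
  assumes w: "\<And>x. (w has_derivative (\<lambda>h. W x \<bullet> h)) (at x)" and W: "continuous_on UNIV W"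
  shows "w x \<le> w (x + z) + norm z * integral {0..1} (\<lambda>s. norm (W (x + s *\<^sub>R z)))"
proof -
  have c[continuous_intros]: "continuous_on A (\<lambda>s. W (x + s *\<^sub>R z))" for A :: "real set"
    by (intro continuous_on_compose2[OF W] continuous_intros) auto
  have "((\<lambda>s. W (x + s *\<^sub>R z) \<bullet> z) has_integral w (x + 1 *\<^sub>R z) - w (x + 0 *\<^sub>R z)) {0..1}"
  proof (rule fundamental_theorem_of_calculus)
    fix s :: real
    have "((\<lambda>s. w (x + s *\<^sub>R z)) has_derivative (\<lambda>h. W (x + s *\<^sub>R z) \<bullet> (h *\<^sub>R z))) (at s within {0..1})"
      by (rule has_derivative_compose[OF _ w]) (auto intro!: derivative_eq_intros)
    then show "((\<lambda>s. w (x + s *\<^sub>R z)) has_vector_derivative W (x + s *\<^sub>R z) \<bullet> z) (at s within {0..1})"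
      by (simp add: has_vector_derivative_def)
  qed simp
  then have e: "w (x + z) - w x = integral {0..1} (\<lambda>s. W (x + s *\<^sub>R z) \<bullet> z)"
    by (simp add: integral_unique)
  have "norm (integral {0..1} (\<lambda>s. W (x + s *\<^sub>R z) \<bullet> z)) \<le> integral {0..1} (\<lambda>s. norm z * norm (W (x + s *\<^sub>R z)))"
    by (rule integral_norm_bound_integral)
      (auto intro!: integrable_continuous_real continuous_intros
        intro: Cauchy_Schwarz_ineq2[THEN order_trans] simp: mult.commute[of "norm z"])
  then show ?thesis using e by simp
qed

lemma norm_le_cube:
  fixes h :: real
  assumes "z \<in> cbox 0 (h *\<^sub>R One)" "h > 0"
  shows "norm (z::'a::euclidean_space) \<le> DIM('a) * h"
proof -
  have "norm z \<le> (\<Sum>i\<in>Basis. \<bar>z \<bullet> i\<bar>)" by (rule norm_le_l1)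
  also have "\<dots> \<le> (\<Sum>i\<in>(Basis::'a set). h)"
    using assms by (intro sum_mono) (auto simp: mem_box)
  finally show ?thesis by simp
qed

lemma content_cube: "(h::real) > 0 \<Longrightarrow> measure lborel (cbox 0 (h *\<^sub>R One) :: 'a::euclidean_space set) = h ^ DIM('a)"
  by (subst content_cbox) auto

text \<open>Comparing $w$ with its average over a cube of volume at least $2\int\chi$, the average is
  too small to absorb more than half of the mass of $w$.\<close>

lemma faber_krahn:
  fixes w :: "'a::euclidean_space \<Rightarrow> real" and h :: real
  assumes w: "\<And>x. (w has_derivative (\<lambda>h. W x \<bullet> h)) (at x)" and W: "continuous_on UNIV W"
    and w0: "\<And>x. w x \<ge> 0" and ws: "\<And>x. x \<notin> cbox a b \<Longrightarrow> w x = 0" "\<And>x. x \<notin> cbox a b \<Longrightarrow> W x = 0"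
    and chi: "continuous_on (cbox a b) g" "\<And>x. x \<in> cbox a b \<Longrightarrow> g x \<ge> 0"
      "\<And>x. x \<in> cbox a b \<Longrightarrow> w x > 0 \<Longrightarrow> g x \<ge> 1"
    and h: "h > 0" "2 * integral (cbox a b) g \<le> h ^ DIM('a)"
  shows "integral (cbox a b) w \<le> 2 * DIM('a) * h * integral (cbox a b) (\<lambda>x. norm (W x))"
proof -
  let ?B = "cbox a b" and ?Q = "cbox 0 (h *\<^sub>R One) :: 'a set" and ?d = "real DIM('a)"
  let ?R = "cbox (0::'a, 0::real) (h *\<^sub>R One, 1)"
  have cw: "continuous_on UNIV w"
    by (meson has_derivative_continuous continuous_at_imp_continuous_on w)
  note [continuous_intros] = continuous_on_compose2[OF W] continuous_on_compose2[OF cw]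
  define m where "m = integral ?B w"
  define E where "E = integral ?B (\<lambda>x. norm (W x))"
  define J where "J x = integral ?R (\<lambda>(z,s). norm (W (x + s *\<^sub>R z)))" for x
  have cJ: "continuous_on A J" for A
    unfolding J_def
    by (rule integral_continuous_on_param) (auto simp: split_beta intro!: continuous_intros)
  have cI: "continuous_on A (\<lambda>z. integral {0..1} (\<lambda>s. norm (W (x + s *\<^sub>R z))))" for A x
    using integral_continuous_on_param[of A 0 "1::real" "\<lambda>z s. norm (W (x + s *\<^sub>R z))"]
    by (simp add: split_beta continuous_intros)
  have m0: "m \<ge> 0" unfolding m_def by (rule integral_nonneg) (auto intro!: integrable_continuous continuous_intros w0)
  \<comment> \<open>Integrate over the cube x + [0,h]^d: the values of w contribute at most the
    total mass m, the increments at most d h times the integrated gradient \<open>J x\<close>. The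
    factor g x \<ge> 1 is inserted only where w is positive.\<close>
  have pt: "h ^ DIM('a) * w x \<le> g x * m + ?d * h * J x" if x: "x \<in> ?B" for x
  proof (cases "w x > 0")
    case True
    have "h ^ DIM('a) * w x = integral ?Q (\<lambda>z. w x)"
      using content_cube[OF h(1), where 'a='a] by simp
    also have "\<dots> \<le> integral ?Q (\<lambda>z. w (z + x) + ?d * h * integral (cbox 0 1) (\<lambda>s. norm (W (x + s *\<^sub>R z))))"
    proof (rule integral_le)
      show "(\<lambda>z. w (z + x) + ?d * h * integral (cbox 0 1) (\<lambda>s. norm (W (x + s *\<^sub>R z)))) integrable_on ?Q"
        by (auto intro!: integrable_continuous continuous_intros cI)
      fix z assume "z \<in> ?Q"
      have "w x \<le> w (x + z) + norm z * integral {0..1} (\<lambda>s. norm (W (x + s *\<^sub>R z)))"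
        by (rule segment_increment_le[OF w W])
      also have "norm z * integral {0..1} (\<lambda>s. norm (W (x + s *\<^sub>R z))) \<le> ?d * h * integral {0..1} (\<lambda>s. norm (W (x + s *\<^sub>R z)))"
        by (intro mult_right_mono norm_le_cube \<open>z \<in> ?Q\<close> h integral_nonneg integrable_continuous_real continuous_intros) auto
      finally show "w x \<le> w (z + x) + ?d * h * integral (cbox 0 1) (\<lambda>s. norm (W (x + s *\<^sub>R z)))" by (simp add: add.commute)
    qed (auto intro!: integrable_continuous)
    also have "\<dots> = integral ?Q (\<lambda>z. w (z + x)) + ?d * h * integral ?Q (\<lambda>z. integral (cbox 0 1) (\<lambda>s. norm (W (x + s *\<^sub>R z))))"
      by (subst integral_add)
        (auto intro!: integrable_continuous continuous_intros cI)
    also have "integral ?Q (\<lambda>z. integral (cbox 0 1) (\<lambda>s. norm (W (x + s *\<^sub>R z)))) = J x"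
      unfolding J_def
      by (subst integral_prod_continuous) (auto simp: split_beta intro!: continuous_intros)
    also have "integral ?Q (\<lambda>z. w (z + x)) \<le> 1 * m"
      unfolding m_def using integral_translate_le[OF cw w0 ws(1)] by simp
    also have "1 * m \<le> g x * m" using chi(3)[OF x True] m0 by (intro mult_right_mono) auto
    finally show ?thesis by simp
  next
    case False
    then have "w x = 0" using w0[of x] by simp
    moreover have "J x \<ge> 0" unfolding J_def
      by (rule integral_nonneg) (auto intro!: integrable_continuous continuous_intros simp: split_beta)
    ultimately show ?thesis using chi(2)[OF x] m0 h by simp
  qed
  have "integral ?B (\<lambda>x. h ^ DIM('a) * w x) \<le> integral ?B (\<lambda>x. g x * m + ?d * h * J x)"
    by (rule integral_le) (auto intro!: integrable_continuous continuous_intros cJ chi pt)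
  also have "\<dots> = integral ?B g * m + ?d * h * integral ?B J"
    by (subst integral_add) (auto intro!: integrable_continuous continuous_intros cJ chi)
  also have "integral ?B J = integral ?R (\<lambda>zs. integral ?B (\<lambda>x. norm (W (x + snd zs *\<^sub>R fst zs))))"
    unfolding J_def split_beta
    by (subst integral_swap_continuous) (auto simp: split_beta intro!: continuous_intros)
  also have "\<dots> \<le> integral ?R (\<lambda>zs. E)"
  proof (rule integral_le)
    show "(\<lambda>zs. integral ?B (\<lambda>x. norm (W (x + snd zs *\<^sub>R fst zs)))) integrable_on ?R"
      by (intro integrable_continuous integral_continuous_on_param) (auto simp: split_beta intro!: continuous_intros)
    show "integral ?B (\<lambda>x. norm (W (x + snd zs *\<^sub>R fst zs))) \<le> E" for zs :: "'a \<times> real"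
      unfolding E_def by (rule integral_translate_le) (auto intro!: continuous_intros ws)
  qed (auto intro!: integrable_continuous)
  also have "\<dots> = h ^ DIM('a) * E"
    by (simp add: content_Pair content_cube[OF h(1), where 'a='a])
  finally have k: "h ^ DIM('a) * m \<le> integral ?B g * m + ?d * h * (h ^ DIM('a) * E)"
    using h by (simp add: m_def)
  \<comment> \<open>Half of the mass is absorbed on the left, since the integral of g is at most h ^
    d / 2.\<close>
  have "integral ?B g * m \<le> h ^ DIM('a) / 2 * m" using h m0 by (intro mult_right_mono) auto
  with k have "h ^ DIM('a) * m \<le> h ^ DIM('a) * (2 * ?d * h * E)" by (simp add: algebra_simps)
  then have "m \<le> 2 * ?d * h * E" using h by (simp only: mult_le_cancel_left_pos zero_less_power)
  then show ?thesis unfolding m_def E_def by simp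
qed

lemma continuous_on_powr_const:
  fixes f :: "'a::topological_space \<Rightarrow> real"
  assumes "continuous_on A f" "\<And>x. x \<in> A \<Longrightarrow> f x \<ge> 0" "p > 0"
  shows "continuous_on A (\<lambda>x. f x powr p)"
  using assms by (intro continuous_on_powr') auto

lemma sum_at_most_one_le:
  fixes f :: "'i \<Rightarrow> real"
  assumes "finite I" "c \<ge> 0" "\<And>i. i \<in> I \<Longrightarrow> f i \<le> c"
    and "\<And>i j. i \<in> I \<Longrightarrow> j \<in> I \<Longrightarrow> f i \<noteq> 0 \<Longrightarrow> f j \<noteq> 0 \<Longrightarrow> i = j"
  shows "sum f I \<le> c"
proof (cases "\<exists>i\<in>I. f i \<noteq> 0")
  case True
  then obtain i where i: "i \<in> I" "f i \<noteq> 0" by blast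
  then have "sum f I = f i + sum f (I - {i})" using assms(1) by (simp add: sum.remove)
  also have "sum f (I - {i}) = 0" using i assms(4) by (intro sum.neutral) auto
  finally show ?thesis using assms(3) i by simp
qed (use assms in auto)

text \<open>Faber--Krahn for the q-th power of a step function of v that switches on between the
  levels L and 2 L. Chebyshev's majorant (v / L) powr \<rho> plays the role of g, and its integral
  fixes the size h of the cubes. The factor with exponent q - 1 left by the chain rule is absorbed
  by Young with \<epsilon> = 1/2.\<close>

lemma level_set_estimate:
  fixes v :: "'a::euclidean_space \<Rightarrow> real" and q \<rho> L P :: real
  assumes v: "\<And>x. (v has_derivative (\<lambda>h. V x \<bullet> h)) (at x)" and V: "continuous_on UNIV V"
    and v0: "\<And>x. v x \<ge> 0" and vs: "\<And>x. x \<notin> cbox a b \<Longrightarrow> v x = 0" "\<And>x. x \<notin> cbox a b \<Longrightarrow> V x = 0"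
    and q: "q > 1" and \<rho>: "\<rho> > 0" and L: "L > 0"
    and P: "P = integral (cbox a b) (\<lambda>x. v x powr \<rho>)" "P > 0"
  shows "integral (cbox a b) (\<lambda>x. smoothstep (v x / L - 1) powr q)
    \<le> (4 * DIM('a) * q) powr q * 2 powr (q / DIM('a)) * (L powr (-\<rho>) * P) powr (q / DIM('a)) * L powr (-q)
      * integral (cbox a b) (\<lambda>x. (smoothstep' (v x / L - 1) * norm (V x)) powr q)"
proof -
  let ?B = "cbox a b" and ?d = "real DIM('a)"
  let ?S = "\<lambda>x. smoothstep (v x / L - 1)" and ?S' = "\<lambda>x. smoothstep' (v x / L - 1)"
  have cv: "continuous_on UNIV v"
    by (meson has_derivative_continuous continuous_at_imp_continuous_on v)
  note ci [continuous_intros] = continuous_on_subset[OF cv] continuous_on_subset[OF V]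
  have cS: "continuous_on A (\<lambda>x. ?S x powr p)" "continuous_on A (\<lambda>x. v x powr p)" if "p > 0" for p A
    using that L by (intro continuous_on_powr_const; auto intro!: continuous_intros simp: smoothstep_range v0)+
  have cS': "continuous_on A (\<lambda>x. ?S' x * norm (V x))" for A
    using L by (auto intro!: continuous_intros)
  define h where "h = (2 * (L powr (-\<rho>) * P)) powr (1 / ?d)"
  have h: "h > 0" using L P by (simp add: h_def)
  have hd: "h ^ DIM('a) = 2 * (L powr (-\<rho>) * P)"
    using L P by (simp add: h_def powr_powr flip: powr_realpow)
  define W where "W x = (q * ?S x powr (q - 1) * ?S' x / L) *\<^sub>R V x" for x
  define Y where "Y x = (2 * ?d * h * q / L) * (?S' x * norm (V x))" for x
  have Y0: "Y x \<ge> 0" for x unfolding Y_def using h q L smoothstep'_range by auto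
  have cY: "continuous_on A Y" for A unfolding Y_def by (intro continuous_intros cS')
  have cYq: "continuous_on A (\<lambda>x. Y x powr q)" for A using cY Y0 q by (intro continuous_on_powr_const) auto
  have "integral ?B (\<lambda>x. ?S x powr q) \<le> 2 * ?d * h * integral ?B (\<lambda>x. norm (W x))"
  proof -
    have "integral ?B (\<lambda>x. ?S x powr q) \<le> 2 * DIM('a) * h * integral ?B (\<lambda>x. norm (W x))"
    proof (rule faber_krahn[where g="\<lambda>x. L powr (-\<rho>) * v x powr \<rho>"])
      fix x
      have "((\<lambda>x. v x / L - 1) has_derivative (\<lambda>h. V x \<bullet> h / L)) (at x)"
        using L by (auto intro!: derivative_eq_intros v)
      from has_derivative_compose[OF this DERIV_smoothstep_powr[OF q, unfolded has_field_derivative_def]]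
      show "((\<lambda>x. ?S x powr q) has_derivative (\<lambda>h. W x \<bullet> h)) (at x)"
        by (simp add: W_def mult_ac)
      show "x \<notin> ?B \<Longrightarrow> ?S x powr q = 0" "x \<notin> ?B \<Longrightarrow> W x = 0"
        using vs by (auto simp: smoothstep_simps W_def)
      assume x: "x \<in> ?B" 
      show "L powr (-\<rho>) * v x powr \<rho> \<ge> 0" by simp
      assume "?S x powr q > 0"
      then have "v x > L" using L smoothstep_simps(1)[of "v x / L - 1"] by (auto simp: field_simps not_le[symmetric])
      then have "v x powr \<rho> \<ge> L powr \<rho>" using \<rho> L by (intro powr_mono2) auto
      then show "1 \<le> L powr (-\<rho>) * v x powr \<rho>" using L by (simp add: powr_minus field_simps)
    next
      show "continuous_on UNIV W" unfolding W_def using L q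
        by (intro continuous_intros cS) auto
      show "continuous_on ?B (\<lambda>x. L powr (-\<rho>) * v x powr \<rho>)" by (intro continuous_intros cS \<rho>)
      show "2 * integral ?B (\<lambda>x. L powr (-\<rho>) * v x powr \<rho>) \<le> h ^ DIM('a)" using hd P by simp
    qed (use h in auto)
    then show ?thesis by simp
  qed
  also have "\<dots> = integral ?B (\<lambda>x. ?S x powr (q - 1) * Y x)"
    unfolding integral_mult_right[symmetric]
    by (intro integral_cong) (use q L smoothstep'_range in \<open>auto simp: W_def Y_def abs_mult\<close>)
  also have "\<dots> \<le> integral ?B (\<lambda>x. 1/2 * ?S x powr q + (1/2) powr (1 - q) * Y x powr q)"
  proof (rule integral_le)
    show "(\<lambda>x. ?S x powr (q - 1) * Y x) integrable_on ?B"
      using q by (intro integrable_continuous continuous_on_mult cS(1) cY) simp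
    show "(\<lambda>x. 1/2 * ?S x powr q + (1/2) powr (1 - q) * Y x powr q) integrable_on ?B"
      using q by (intro integrable_continuous continuous_on_add continuous_on_mult_left cS(1) cYq) simp
  qed (use q in \<open>intro young_powr smoothstep_range Y0; simp\<close>)
  also have "\<dots> = 1/2 * integral ?B (\<lambda>x. ?S x powr q) + (1/2) powr (1 - q) * integral ?B (\<lambda>x. Y x powr q)"
    using q by (subst integral_add) (auto intro!: integrable_continuous continuous_intros cS cYq)
  finally have "integral ?B (\<lambda>x. ?S x powr q) \<le> 2 * (1/2) powr (1 - q) * integral ?B (\<lambda>x. Y x powr q)"
    by (simp add: field_simps)
  also have "2 * (1/2) powr (1 - q) = (2::real) powr q"
    by (simp add: powr_divide powr_diff)
  also have "integral ?B (\<lambda>x. Y x powr q) = (2 * ?d * h * q / L) powr q * integral ?B (\<lambda>x. (?S' x * norm (V x)) powr q)"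
    unfolding Y_def by (subst powr_mult) simp
  also have "(2 * ?d * h * q / L) powr q = (2 * ?d * q) powr q * h powr q * L powr (-q)"
    using h L q by (simp add: powr_mult powr_divide powr_minus_divide mult_ac)
  also have "2 powr q * ((2 * ?d * q) powr q * h powr q * L powr (-q) * integral ?B (\<lambda>x. (?S' x * norm (V x)) powr q))
     = (4 * ?d * q) powr q * h powr q * L powr (-q) * integral ?B (\<lambda>x. (?S' x * norm (V x)) powr q)"
    using powr_mult[of 2 "2 * ?d * q" q] q by (simp add: mult.assoc)
  also have "h powr q = 2 powr (q / ?d) * (L powr (-\<rho>) * P) powr (q / ?d)"
    using P by (simp add: h_def powr_powr powr_mult)
  finally show ?thesis by (simp add: mult_ac)
qed

text \<open>Dyadic truncation. On each level l the powers of l cancel exactly, because the exponent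
  is q + \<rho> q / d. The gradients of the truncations live on the disjoint shells l < v < 2 l, so
  summing over all levels costs only a constant.\<close>

theorem gagliardo_nirenberg:
  fixes q \<rho> :: real
  assumes "q > 1" "\<rho> > 0"
  obtains C where "C > 0" "\<And>(v :: 'a::euclidean_space \<Rightarrow> real) V a b. (\<And>x. (v has_derivative (\<lambda>h. V x \<bullet> h)) (at x)) \<Longrightarrow>
    continuous_on UNIV V \<Longrightarrow> (\<And>x. v x \<ge> 0) \<Longrightarrow> (\<And>x. x \<notin> cbox a b \<Longrightarrow> v x = 0) \<Longrightarrow> (\<And>x. x \<notin> cbox a b \<Longrightarrow> V x = 0) \<Longrightarrow>
    integral (cbox a b) (\<lambda>x. v x powr (q + \<rho> * q / DIM('a)))
     \<le> C * integral (cbox a b) (\<lambda>x. v x powr \<rho>) powr (q / DIM('a)) * integral (cbox a b) (\<lambda>x. norm (V x) powr q)"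
proof
  let ?d = "real DIM('a)"
  define \<kappa> where "\<kappa> = q + \<rho> * q / ?d"
  have k: "\<kappa> > 0" using assms by (auto simp: \<kappa>_def intro!: add_pos_nonneg)
  define C1 where "C1 = (4 * ?d * q) powr q * 2 powr (q / ?d)"
  have C1: "C1 > 0" using assms by (simp add: C1_def)
  show "4 powr \<kappa> * C1 * 2 powr q > 0" using C1 by simp
  fix v :: "'a \<Rightarrow> real" and V a b
  assume v: "\<And>x. (v has_derivative (\<lambda>h. V x \<bullet> h)) (at x)" and V: "continuous_on UNIV V"
    and v0: "\<And>x. v x \<ge> 0" and vs: "\<And>x. x \<notin> cbox a b \<Longrightarrow> v x = 0" "\<And>x. x \<notin> cbox a b \<Longrightarrow> V x = 0"
  let ?B = "cbox a b"
  define P where "P = integral ?B (\<lambda>x. v x powr \<rho>)"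
  define E where "E = integral ?B (\<lambda>x. norm (V x) powr q)"
  have cv: "continuous_on UNIV v"
    by (meson has_derivative_continuous continuous_at_imp_continuous_on v)
  note ci [continuous_intros] = continuous_on_subset[OF cv] continuous_on_subset[OF V]
  have cp: "continuous_on A (\<lambda>x. v x powr p)" "continuous_on A (\<lambda>x. norm (V x) powr p)" if "p > 0" for A p
    using that by (intro continuous_on_powr_const; auto intro!: continuous_intros v0)+
  have P0: "P \<ge> 0" and E0: "E \<ge> 0" unfolding P_def E_def using assms
    by (auto intro!: integral_nonneg integrable_continuous cp)
  have "integral ?B (\<lambda>x. v x powr \<kappa>) \<le> 4 powr \<kappa> * C1 * 2 powr q * P powr (q / ?d) * E"
  proof (cases "P = 0")
    case True
    \<comment> \<open>Either v vanishes on the box by continuity, or the box has no interior and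
      every integral over it is 0.\<close>
    have "integral ?B (\<lambda>x. v x powr \<kappa>) = 0"
    proof (cases "box a b = {}")
      case False
      then have "\<forall>x\<in>?B. v x powr \<rho> = 0"
        using True integral_cbox_eq_0_iff[of a b "\<lambda>x. v x powr \<rho>"] cp(1) assms unfolding P_def by auto
      then have "integral ?B (\<lambda>x. v x powr \<kappa>) = integral ?B (\<lambda>x. 0)"
        by (intro integral_cong) auto
      then show ?thesis by simp
    qed (intro integral_null, simp add: content_eq_0_interior interior_cbox)
    then show ?thesis using E0 C1 by simp
  next
    case False
    then have P1: "P > 0" using P0 by simp
    obtain Lm where Lm: "Lm > 0" "\<And>x. v x \<le> Lm"
    proof -
      have "compact (v ` ?B)" by (intro compact_continuous_image continuous_intros) auto
      then obtain L where L: "\<forall>y\<in>v ` ?B. norm y \<le> L" by (meson bounded_iff compact_imp_bounded)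
      have "v x \<le> max 1 L" for x using L vs(1)[of x] by (cases "x \<in> ?B") (auto simp: le_max_iff_disj)
      then show ?thesis by (intro that[of "max 1 L"]) auto
    qed
    \<comment> \<open>The truncation at level i equals 1 as soon as v \<ge> 2 l i = Lm / 2 ^ (i +
      1), and 4 l i = Lm / 2 ^ i bounds v on the part not yet covered after i steps. This is where
      the factor 4 powr \<kappa> comes from.\<close>
    define l where "l i = Lm / 2 ^ (i + 2)" for i :: nat
    have l: "l i > 0" for i using Lm by (simp add: l_def)
    let ?S = "\<lambda>i x. smoothstep (v x / l i - 1)" and ?S' = "\<lambda>i x. smoothstep' (v x / l i - 1)"
    have cS: "continuous_on A (\<lambda>x. ?S i x powr q)" "continuous_on A (\<lambda>x. (?S' i x * norm (V x)) powr q)" for i A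
      using assms l[of i] by (intro continuous_on_powr_const; auto intro!: continuous_intros simp: smoothstep_range smoothstep'_range)+
    have pt: "v x powr \<kappa> \<le> (Lm / 2 ^ m) powr \<kappa> + (\<Sum>i<m. 4 powr \<kappa> * l i powr \<kappa> * ?S i x powr q)" for m x
    proof (induction m)
      case 0
      show ?case using Lm k v0 by (simp add: powr_mono2)
    next
      case (Suc m)
      have t: "4 powr \<kappa> * l i powr \<kappa> * ?S i x powr q \<ge> 0" for i by simp
      show ?case
      proof (cases "v x \<le> Lm / 2 ^ Suc m")
        case True
        then have "v x powr \<kappa> \<le> (Lm / 2 ^ Suc m) powr \<kappa>" using k v0 by (intro powr_mono2) auto
        also have "0 \<le> (\<Sum>i<Suc m. 4 powr \<kappa> * l i powr \<kappa> * ?S i x powr q)" by (intro sum_nonneg t)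
        ultimately show ?thesis by linarith
      next
        case False
        then have "v x / l m - 1 \<ge> 1" using Lm by (simp add: l_def field_simps)
        then have "?S m x = 1" by (rule smoothstep_simps)
        moreover have "4 powr \<kappa> * l m powr \<kappa> = (Lm / 2 ^ m) powr \<kappa>"
          using Lm by (simp add: l_def flip: powr_mult)
        ultimately have "(\<Sum>i<Suc m. 4 powr \<kappa> * l i powr \<kappa> * ?S i x powr q)
            = (\<Sum>i<m. 4 powr \<kappa> * l i powr \<kappa> * ?S i x powr q) + (Lm / 2 ^ m) powr \<kappa>" by simp
        then show ?thesis using Suc powr_ge_zero[of "Lm / 2 ^ Suc m" \<kappa>] by linarith
      qed
    qed
    have bnd: "integral ?B (\<lambda>x. v x powr \<kappa>) \<le> (Lm / 2 ^ m) powr \<kappa> * measure lborel ?B + 4 powr \<kappa> * C1 * 2 powr q * P powr (q / ?d) * E" for m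
    proof -
      have "integral ?B (\<lambda>x. v x powr \<kappa>) \<le> integral ?B (\<lambda>x. (Lm / 2 ^ m) powr \<kappa> + (\<Sum>i<m. 4 powr \<kappa> * l i powr \<kappa> * ?S i x powr q))"
        by (intro integral_le integrable_continuous continuous_intros cS cp k pt)
      also have "\<dots> = (Lm / 2 ^ m) powr \<kappa> * measure lborel ?B + (\<Sum>i<m. 4 powr \<kappa> * l i powr \<kappa> * integral ?B (\<lambda>x. ?S i x powr q))"
      proof -
        have "integral ?B (\<lambda>x. \<Sum>i<m. 4 powr \<kappa> * l i powr \<kappa> * ?S i x powr q)
            = (\<Sum>i<m. integral ?B (\<lambda>x. 4 powr \<kappa> * l i powr \<kappa> * ?S i x powr q))"
          by (intro integral_sum integrable_continuous continuous_intros cS) auto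
        then show ?thesis
          by (subst integral_add) (auto intro!: integrable_continuous continuous_intros cS)
      qed
      also have "(\<Sum>i<m. 4 powr \<kappa> * l i powr \<kappa> * integral ?B (\<lambda>x. ?S i x powr q))
         \<le> (\<Sum>i<m. 4 powr \<kappa> * C1 * P powr (q / ?d) * integral ?B (\<lambda>x. (?S' i x * norm (V x)) powr q))"
      proof (rule sum_mono)
        fix i
        have "4 powr \<kappa> * l i powr \<kappa> * integral ?B (\<lambda>x. ?S i x powr q) \<le> 4 powr \<kappa> * l i powr \<kappa> *
          (C1 * (l i powr (-\<rho>) * P) powr (q / ?d) * l i powr (-q) * integral ?B (\<lambda>x. (?S' i x * norm (V x)) powr q))"
          using level_set_estimate[OF v V v0 vs assms l[of i] P_def P1] unfolding C1_def
          by (intro mult_left_mono) auto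
        also have "\<dots> = 4 powr \<kappa> * C1 * (l i powr \<kappa> * (l i powr (-\<rho>)) powr (q / ?d) * l i powr (-q)) * P powr (q / ?d)
            * integral ?B (\<lambda>x. (?S' i x * norm (V x)) powr q)"
          using P1 by (simp add: powr_mult mult_ac)
        also have "l i powr \<kappa> * (l i powr (-\<rho>)) powr (q / ?d) * l i powr (-q) = 1"
          using l[of i] by (simp add: powr_powr \<kappa>_def flip: powr_add)
        finally show "4 powr \<kappa> * l i powr \<kappa> * integral ?B (\<lambda>x. ?S i x powr q)
          \<le> 4 powr \<kappa> * C1 * P powr (q / ?d) * integral ?B (\<lambda>x. (?S' i x * norm (V x)) powr q)" by simp
      qed
      also have "\<dots> = 4 powr \<kappa> * C1 * P powr (q / ?d) * integral ?B (\<lambda>x. \<Sum>i<m. (?S' i x * norm (V x)) powr q)"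
        by (subst integral_sum) (auto intro!: integrable_continuous cS simp: sum_distrib_left)
      also have "integral ?B (\<lambda>x. \<Sum>i<m. (?S' i x * norm (V x)) powr q) \<le> integral ?B (\<lambda>x. 2 powr q * norm (V x) powr q)"
      proof (intro integral_le integrable_continuous continuous_on_sum continuous_on_mult_left cS cp)
        fix x
        show "(\<Sum>i<m. (?S' i x * norm (V x)) powr q) \<le> 2 powr q * norm (V x) powr q"
        proof (rule sum_at_most_one_le)
          fix i
          have "(?S' i x * norm (V x)) powr q \<le> (2 * norm (V x)) powr q"
            using assms smoothstep'_range by (intro powr_mono2 mult_right_mono) auto
          then show "(?S' i x * norm (V x)) powr q \<le> 2 powr q * norm (V x) powr q" by (simp add: powr_mult)
        next
          fix i j assume "(?S' i x * norm (V x)) powr q \<noteq> 0" "(?S' j x * norm (V x)) powr q \<noteq> 0"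
          then have "?S' i x \<noteq> 0" "?S' j x \<noteq> 0" by auto
          then have *: "l i < v x" "v x < 2 * l i" "l j < v x" "v x < 2 * l j"
            using smoothstep'_simps l[of i] l[of j] by (force simp: not_le[symmetric] field_simps)+
          have "i < j \<Longrightarrow> 2 * l j \<le> l i" for i j
          proof -
            assume "i < j"
            then have "(2::real) ^ Suc (i + 2) \<le> 2 ^ (j + 2)" by (intro power_increasing) auto
            then show "2 * l j \<le> l i" using Lm unfolding l_def by (simp add: field_simps)
          qed
          from this[of i j] this[of j i] * show "i = j" by (cases i j rule: linorder_cases) auto
        qed auto
      qed (use assms in auto)
      also have "integral ?B (\<lambda>x. 2 powr q * norm (V x) powr q) = 2 powr q * E" by (simp add: E_def)
      finally show ?thesis using C1 by (simp add: mult_ac mult_left_mono mult_right_mono)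
    qed
    have "(\<lambda>m. (Lm / 2 ^ m) powr \<kappa> * measure lborel ?B + 4 powr \<kappa> * C1 * 2 powr q * P powr (q / ?d) * E)
      \<longlonglongrightarrow> 0 powr \<kappa> * measure lborel ?B + 4 powr \<kappa> * C1 * 2 powr q * P powr (q / ?d) * E"
    proof (intro tendsto_intros tendsto_powr2)
      show "(\<lambda>m. Lm / 2 ^ m) \<longlonglongrightarrow> 0"
      proof -
        have "(\<lambda>m. Lm * (1/2) ^ m) \<longlonglongrightarrow> Lm * 0"
          by (intro tendsto_mult tendsto_const LIMSEQ_realpow_zero) auto
        then show ?thesis by (simp add: power_divide)
      qed
    qed (use Lm k in auto)
    from LIMSEQ_le_const[OF this] bnd
    have "integral ?B (\<lambda>x. v x powr \<kappa>) \<le> 0 powr \<kappa> * measure lborel ?B + 4 powr \<kappa> * C1 * 2 powr q * P powr (q / ?d) * E"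
      by blast
    then show ?thesis by simp
  qed
  then show "integral (cbox a b) (\<lambda>x. v x powr (q + \<rho> * q / DIM('a)))
     \<le> 4 powr \<kappa> * C1 * 2 powr q * integral (cbox a b) (\<lambda>x. v x powr \<rho>) powr (q / DIM('a)) * integral (cbox a b) (\<lambda>x. norm (V x) powr q)"
    unfolding P_def E_def \<kappa>_def .
qed

section \<open>The nonlinearity and differential inequalities\<close>

lemma expo_a_range:
  assumes "admissible_g c e N"
  shows "e N > 0" "0 < expo_a e N" "expo_a e N < 1"
proof -
  have "strict_mono_on {0..N} e" "N \<ge> 1" using assms by (auto simp: admissible_g_def)
  from strict_mono_onD[OF this(1), of 0 N] this(2) have "e 0 < e N" by simp
  then show "e N > 0" using assms by (simp add: admissible_g_def)
  then show "0 < expo_a e N" "expo_a e N < 1" by (auto simp: expo_a_def)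
qed

lemma gfun_facts:
  assumes g: "admissible_g c e N" and s: "s \<ge> 0"
  shows "gfun c e N s \<ge> c 0" "gfun c e N s \<ge> c N * s powr e N"
    "s \<ge> 1 \<Longrightarrow> gfun c e N s \<le> (\<Sum>i\<le>N. c i) * s powr e N" "s \<le> 1 \<Longrightarrow> gfun c e N s \<le> (\<Sum>i\<le>N. c i)"
proof -
  have c: "c i \<ge> 0" if "i \<le> N" for i using g that by (auto simp: admissible_g_def)
  have N: "N \<ge> 1" "c 0 > 0" using g by (auto simp: admissible_g_def)
  have e: "0 \<le> e i" "e i \<le> e N" if "i \<in> {1..N}" for i
  proof -
    have sm: "e j < e k" if "j < k" "k \<le> N" for j k
      using g that strict_mono_onD[of "{0..N}" e j k] by (simp add: admissible_g_def)
    have "e 0 < e i" using sm[of 0 i] that by simp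
    moreover have "e i \<le> e N" using sm[of i N] that by (cases "i = N") auto
    ultimately show "0 \<le> e i" "e i \<le> e N" using g by (auto simp: admissible_g_def)
  qed
  have split: "(\<Sum>i\<le>N. c i) = c 0 + (\<Sum>i=1..N. c i)"
    by (simp add: atMost_atLeast0 sum.atLeast_Suc_atMost)
  have t: "c i * s powr e i \<ge> 0" if "i \<in> {1..N}" for i using c that by auto
  show "gfun c e N s \<ge> c 0" using sum_nonneg[of "{1..N}" "\<lambda>i. c i * s powr e i"] t by (simp add: gfun_def)
  have "c N * s powr e N \<le> (\<Sum>i=1..N. c i * s powr e i)"
    using N t by (intro member_le_sum) auto
  then show "gfun c e N s \<ge> c N * s powr e N" unfolding gfun_def using N by simp
  show "gfun c e N s \<le> (\<Sum>i\<le>N. c i) * s powr e N" if "s \<ge> 1"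
  proof -
    have "(\<Sum>i=1..N. c i * s powr e i) \<le> (\<Sum>i=1..N. c i * s powr e N)"
      using c e that by (intro sum_mono mult_left_mono powr_mono) auto
    moreover have "c 0 \<le> c 0 * s powr e N"
      using that N expo_a_range[OF g] by (simp add: ge_one_powr_ge_zero)
    ultimately show ?thesis unfolding gfun_def split by (simp add: sum_distrib_right distrib_right)
  qed
  show "gfun c e N s \<le> (\<Sum>i\<le>N. c i)" if "s \<le> 1"
  proof -
    have "(\<Sum>i=1..N. c i * s powr e i) \<le> (\<Sum>i=1..N. c i * 1)"
      using c e that s by (intro sum_mono mult_left_mono powr_le1) auto
    then show ?thesis unfolding gfun_def split by simp
  qed
qed

text \<open>The map s g(s) is strictly increasing, so the description in \<open>sfun\<close> denotes
  its unique root. The bracket [0, \<xi> / c 0] for the intermediate value theorem comes from g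
  \<ge> c 0.\<close>

lemma sfun_facts:
  assumes g: "admissible_g c e N" and x: "\<xi> \<ge> 0"
  shows "sfun c e N \<xi> \<ge> 0" "sfun c e N \<xi> * gfun c e N (sfun c e N \<xi>) = \<xi>"
proof -
  have c: "c i \<ge> 0" if "i \<le> N" for i using g that by (auto simp: admissible_g_def)
  have c0: "c 0 > 0" using g by (auto simp: admissible_g_def)
  have e: "0 < e i" if "i \<in> {1..N}" for i
  proof -
    have "e 0 < e i" using g that strict_mono_onD[of "{0..N}" e 0 i] by (simp add: admissible_g_def)
    then show ?thesis using g by (simp add: admissible_g_def)
  qed
  let ?f = "\<lambda>s. s * gfun c e N s"
  have mono: "?f s < ?f t" if "0 \<le> s" "s < t" for s t
  proof -
    have "gfun c e N s \<le> gfun c e N t" unfolding gfun_def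
      using that c e by (intro add_left_mono sum_mono mult_left_mono powr_mono2) (auto simp: less_imp_le)
    moreover have "gfun c e N s > 0" using gfun_facts(1)[OF g that(1)] c0 by simp
    ultimately show ?thesis
      using that by (intro order_le_less_trans[OF mult_left_mono mult_strict_right_mono]) auto
  qed
  have "\<exists>s\<ge>0. s \<le> \<xi> / c 0 \<and> ?f s = \<xi>"
  proof (rule IVT')
    show "\<xi> \<le> \<xi> / c 0 * gfun c e N (\<xi> / c 0)"
      using gfun_facts(1)[OF g, of "\<xi> / c 0"] x c0 mult_left_mono[of "c 0" "gfun c e N (\<xi> / c 0)" "\<xi> / c 0"] by auto
    show "continuous_on {0..\<xi> / c 0} ?f"
      unfolding gfun_def by (intro continuous_intros continuous_on_powr') (auto intro!: e)
  qed (use x c0 in auto)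
  then have "\<exists>!s. s \<ge> 0 \<and> ?f s = \<xi>"
    using mono by (metis less_irrefl linorder_neqE_linordered_idom)
  from theI'[OF this] show "sfun c e N \<xi> \<ge> 0" "sfun c e N \<xi> * gfun c e N (sfun c e N \<xi>) = \<xi>"
    unfolding sfun_def by auto
qed

text \<open>Everything follows from K(\<xi>) \<xi> = s(\<xi>) and (1 + e N)(1 - a) = 1. Always \<xi>
  \<ge> c N times s powr (1 + e N), which gives the upper bound. For s \<ge> 1 also \<xi> \<le> G
  times that power, which gives the lower bound; for s < 1 the argument \<xi> is at most G, and k2
  pays for this range.\<close>

lemma Kfun_bounds:
  assumes g: "admissible_g c e N"
  defines "a \<equiv> expo_a e N"
  obtains k1 k2 k3 where "k1 > 0" "k2 > 0" "k3 > 0"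
    "\<And>\<xi>. \<xi> \<ge> 0 \<Longrightarrow> Kfun c e N \<xi> * \<xi>\<^sup>2 \<ge> k1 * \<xi> powr (2 - a) - k2"
    "\<And>\<xi>. \<xi> \<ge> 0 \<Longrightarrow> Kfun c e N \<xi> * \<xi> \<le> k3 * \<xi> powr (1 - a)"
    "\<And>\<xi>. \<xi> \<ge> 0 \<Longrightarrow> Kfun c e N \<xi> \<ge> 0"
proof
  define G where "G = (\<Sum>i\<le>N. c i)"
  have cN: "c N > 0" "c 0 > 0" "\<forall>i\<le>N. c i \<ge> 0" using g by (auto simp: admissible_g_def)
  have G: "G > 0" unfolding G_def using cN by (intro sum_pos2[of _ 0]) auto
  have a: "0 < a" "a < 1" "e N > 0" "1 / (1 + e N) = 1 - a"
    using expo_a_range[OF g] by (auto simp: a_def expo_a_def field_simps)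
  show "G powr (a - 1) > 0" "G powr (a - 1) * G powr (2 - a) > 0" "c N powr (a - 1) > 0" using G cN by auto
  fix \<xi> :: real assume x: "\<xi> \<ge> 0"
  define s where "s = sfun c e N \<xi>"
  have s: "s \<ge> 0" "s * gfun c e N s = \<xi>" using sfun_facts[OF g x] by (auto simp: s_def)
  have gp: "gfun c e N s > 0" using gfun_facts(1)[OF g s(1)] cN by simp
  have K: "Kfun c e N \<xi> * \<xi> = s" using gp s by (simp add: Kfun_def s_def[symmetric] field_simps)
  show "Kfun c e N \<xi> \<ge> 0" using gp by (simp add: Kfun_def s_def[symmetric])
  have sp: "(s powr (1 + e N)) powr (1 - a) = s" 
    using a s by (simp add: powr_powr flip: a(4))
  have s1: "s * s powr e N = s powr (1 + e N)" using s a by (cases "s = 0") (auto simp: powr_add)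
  have "c N * s powr (1 + e N) \<le> \<xi>"
    using mult_left_mono[OF gfun_facts(2)[OF g s(1)] s(1)] s unfolding s1[symmetric] by (simp add: mult_ac)
  then have "s powr (1 + e N) \<le> \<xi> / c N" using cN by (simp add: field_simps)
  then have "s \<le> (\<xi> / c N) powr (1 - a)"
    using powr_mono2[of "1 - a" "s powr (1 + e N)" "\<xi> / c N"] sp a by simp
  also have "\<dots> = c N powr (a - 1) * \<xi> powr (1 - a)"
    using cN x by (simp add: powr_divide powr_diff field_simps)
  finally show "Kfun c e N \<xi> * \<xi> \<le> c N powr (a - 1) * \<xi> powr (1 - a)" by (simp add: K)
  have KK: "Kfun c e N \<xi> * \<xi>\<^sup>2 = s * \<xi>" using K by (simp add: power2_eq_square flip: mult.assoc)
  show "G powr (a - 1) * \<xi> powr (2 - a) - G powr (a - 1) * G powr (2 - a) \<le> Kfun c e N \<xi> * \<xi>\<^sup>2"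
  proof (cases "s \<ge> 1")
    case True
    have "\<xi> \<le> G * s powr (1 + e N)"
      using mult_left_mono[OF gfun_facts(3)[OF g s(1) True] s(1)] s unfolding s1[symmetric] by (simp add: mult_ac G_def)
    then have "\<xi> / G \<le> s powr (1 + e N)" using G by (simp add: field_simps)
    then have "(\<xi> / G) powr (1 - a) \<le> s"
      using powr_mono2[of "1 - a" "\<xi> / G" "s powr (1 + e N)"] sp a x G by simp
    then have "(\<xi> / G) powr (1 - a) * \<xi> \<le> s * \<xi>" using x by (intro mult_right_mono) auto
    also have "(\<xi> / G) powr (1 - a) * \<xi> = G powr (a - 1) * \<xi> powr (2 - a)"
      using x G by (cases "\<xi> = 0") (auto simp: powr_divide powr_diff power2_eq_square field_simps)
    finally show ?thesis using KK G by (smt (verit) powr_ge_zero mult_nonneg_nonneg)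
  next
    case False
    then have "\<xi> \<le> 1 * G"
      using mult_mono[of s 1 "gfun c e N s" G] gfun_facts(4)[OF g s(1)] s gp by (simp add: G_def)
    then have "G powr (a - 1) * \<xi> powr (2 - a) \<le> G powr (a - 1) * G powr (2 - a)"
      using x a by (intro mult_left_mono powr_mono2) auto
    moreover have "s * \<xi> \<ge> 0" using s x by simp
    ultimately show ?thesis using KK by linarith
  qed
qed

section \<open>Comparison principles for scalar functions of time\<close>

lemma barrier_le:
  fixes f :: "real \<Rightarrow> real"
  assumes ab: "a \<le> b" and c: "continuous_on {a..b} f"
    and d: "\<And>t. a < t \<Longrightarrow> t < b \<Longrightarrow> (f has_real_derivative f' t) (at t)"
    and f': "\<And>t. a < t \<Longrightarrow> t < b \<Longrightarrow> f t > 0 \<Longrightarrow> f' t \<le> 0" and fa: "f a \<le> 0"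
  shows "f b \<le> 0"
proof (rule ccontr)
  assume b: "\<not> f b \<le> 0"
  \<comment> \<open>Take the last time s in S. After it f is positive, hence nonincreasing, and
    cannot climb above f s.\<close>
  define S where "S = {t\<in>{a..b}. f t \<le> 0}"
  have "closed S" unfolding S_def 
    using continuous_closed_preimage[OF c closed_real_atLeastAtMost, of "{..0}"] by (simp add: vimage_def Int_def)
  moreover have "bounded S" by (rule bounded_subset[of "{a..b}"]) (auto simp: S_def)
  moreover have ne: "S \<noteq> {}" using ab fa by (auto simp: S_def)
  ultimately obtain s where s: "s \<in> S" "\<And>t. t \<in> S \<Longrightarrow> t \<le> s"
    using compact_attains_sup compact_eq_bounded_closed by metis
  then have sb: "a \<le> s" "s < b" "f s \<le> 0" using b by (auto simp: S_def less_le)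
  have pos: "f t > 0" if "s < t" "t < b" for t using s(2)[of t] that sb by (force simp: S_def)
  have "f b \<le> f s"
  proof (rule DERIV_nonpos_imp_decreasing_open[where f=f and a=s and b=b])
    show "s \<le> b" using sb by simp
    show "\<exists>y. (f has_real_derivative y) (at x) \<and> y \<le> 0" if "s < x" "x < b" for x
      using d[of x] f'[of x] pos[of x] that sb by auto
    show "continuous_on {s..b} f" using sb by (intro continuous_on_subset[OF c]) auto
  qed
  then show False using b sb by simp
qed

text \<open>While positive, f loses at least \<delta> per unit of time, so it reaches 0 by time T0 +
  f(T0)/\<delta>. From then on \<open>barrier_le\<close> keeps it there.\<close>

lemma eventually_barrier_le:
  fixes f :: "real \<Rightarrow> real"
  assumes d: "\<And>t. t > 0 \<Longrightarrow> (f has_real_derivative f' t) (at t)"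
    and T0: "T0 > 0" and \<delta>: "\<delta> > 0" and f': "\<And>t. t \<ge> T0 \<Longrightarrow> f t > 0 \<Longrightarrow> f' t \<le> - \<delta>"
  shows "\<exists>T\<ge>T0. \<forall>t\<ge>T. f t \<le> 0"
proof -
  have c: "continuous_on {0<..} f"
    using d by (auto intro!: DERIV_continuous continuous_at_imp_continuous_on simp: DERIV_isCont)
  have "\<exists>t1\<ge>T0. f t1 \<le> 0"
  proof (rule ccontr)
    assume "\<not> ?thesis"
    then have pos: "\<And>t. t \<ge> T0 \<Longrightarrow> f t > 0" by force
    define t where "t = T0 + f T0 / \<delta>"
    have t: "t > T0" using pos[of T0] \<delta> by (simp add: t_def)
    have "f t + \<delta> * t \<le> f T0 + \<delta> * T0"
    proof (rule DERIV_nonpos_imp_nonincreasing[where f="\<lambda>t. f t + \<delta> * t"])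
      show "T0 \<le> t" using t by simp
      show "\<exists>y. ((\<lambda>t. f t + \<delta> * t) has_real_derivative y) (at x) \<and> y \<le> 0" if "T0 \<le> x" "x \<le> t" for x
        using d[of x] f'[of x] pos[of x] that T0
        by (intro exI[of _ "f' x + \<delta>"]) (auto intro!: derivative_eq_intros)
    qed
    moreover have "\<delta> * t = \<delta> * T0 + f T0" using \<delta> by (simp add: t_def distrib_left)
    ultimately have "f t \<le> 0" by linarith
    then show False using pos[of t] t by simp
  qed
  then obtain t1 where t1: "t1 \<ge> T0" "f t1 \<le> 0" by blast
  have "f t \<le> 0" if "t \<ge> t1" for t
  proof (rule barrier_le[OF that, of f f'])
    show "continuous_on {t1..t} f" using t1 T0 by (intro continuous_on_subset[OF c]) auto
    show "f' x \<le> 0" if "t1 < x" "x < t" "f x > 0" for x using f'[of x] that t1 \<delta> by simp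
    show "f t1 \<le> 0" by (rule t1)
  qed (use d t1 T0 in auto)
  then show ?thesis using t1 by blast
qed

section \<open>Truncated powers and the local energy identity\<close>

text \<open>A C^2 substitute for s_+ powr \<alpha>: comparable to it for s \<ge> d, but of order s
  powr (\<alpha> + 1) near 0, so that \<alpha> = 2 is covered. \<open>phi1\<close> and
  \<open>phi2\<close> are its first two derivatives.\<close>

definition phi0 :: "real \<Rightarrow> real \<Rightarrow> real \<Rightarrow> real" where
  "phi0 \<alpha> d s = max 0 s powr (\<alpha> + 1) / (d + max 0 s)"

definition phi1 :: "real \<Rightarrow> real \<Rightarrow> real \<Rightarrow> real" where
  "phi1 \<alpha> d s = max 0 s powr \<alpha> * (\<alpha> * max 0 s + (\<alpha> + 1) * d) / (d + max 0 s)\<^sup>2"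

definition phi2 :: "real \<Rightarrow> real \<Rightarrow> real \<Rightarrow> real" where
  "phi2 \<alpha> d s = max 0 s powr (\<alpha> - 1) *
     ((\<alpha>\<^sup>2 - \<alpha>) * (max 0 s)\<^sup>2 + (2 * \<alpha>\<^sup>2 - 2) * max 0 s * d + (\<alpha>\<^sup>2 + \<alpha>) * d\<^sup>2) / (d + max 0 s) ^ 3"

lemma phi_nonpos: "s \<le> 0 \<Longrightarrow> phi0 \<alpha> d s = 0" "s \<le> 0 \<Longrightarrow> phi1 \<alpha> d s = 0" "s \<le> 0 \<Longrightarrow> phi2 \<alpha> d s = 0"
  by (auto simp: phi0_def phi1_def phi2_def max_def)

lemma ratio_powr:
  assumes "(s::real) > 0" "d > 0"
  shows "s powr (\<beta> + 1) / (d + s) = s powr \<beta> * (s / (d + s))"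
  using assms by (simp add: powr_add)

lemma phi0_eq: "s > 0 \<Longrightarrow> d > 0 \<Longrightarrow> phi0 \<alpha> d s = s powr \<alpha> * (s / (d + s))"
  by (simp add: phi0_def powr_add)

lemma phi1_bounds:
  assumes "s > 0" "d > 0" "\<alpha> \<ge> 2"
  shows "0 \<le> phi1 \<alpha> d s" "phi1 \<alpha> d s \<le> (\<alpha> + 1) * (s powr (\<alpha> - 1) * (s / (d + s)))"
proof -
  have e: "s powr (\<alpha> - 1) * (s / (d + s)) = s powr \<alpha> * (d + s) / (d + s)\<^sup>2"
    using assms by (simp add: powr_diff power2_eq_square)
  show "0 \<le> phi1 \<alpha> d s" using assms by (auto simp: phi1_def)
  have "\<alpha> * s + (\<alpha> + 1) * d \<le> (\<alpha> + 1) * (d + s)" using assms by (simp add: algebra_simps)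
  then have "s powr \<alpha> * (\<alpha> * s + (\<alpha> + 1) * d) / (d + s)\<^sup>2 \<le> s powr \<alpha> * ((\<alpha> + 1) * (d + s)) / (d + s)\<^sup>2"
    by (intro divide_right_mono mult_left_mono) auto
  then show "phi1 \<alpha> d s \<le> (\<alpha> + 1) * (s powr (\<alpha> - 1) * (s / (d + s)))"
    unfolding e using assms by (simp add: phi1_def mult_ac)
qed

text \<open>The quadratic numerator is rewritten as a multiple of (d + s)^2 plus, respectively
  minus, nonnegative terms.\<close>

lemma phi2_bounds:
  assumes "s > 0" "d > 0" "\<alpha> \<ge> 2"
  shows "(\<alpha>\<^sup>2 - \<alpha>) * (s powr (\<alpha> - 2) * (s / (d + s))) \<le> phi2 \<alpha> d s"
    "phi2 \<alpha> d s \<le> (\<alpha>\<^sup>2 + \<alpha>) * (s powr (\<alpha> - 2) * (s / (d + s)))"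
proof -
  let ?b = "(\<alpha>\<^sup>2 - \<alpha>) * s\<^sup>2 + (2 * \<alpha>\<^sup>2 - 2) * s * d + (\<alpha>\<^sup>2 + \<alpha>) * d\<^sup>2"
  have "s powr (\<alpha> - 2) * (s / (d + s)) = s powr (\<alpha> - 1) / (d + s)"
    using assms ratio_powr[of s d "\<alpha> - 2"] by simp
  also have "\<dots> = s powr (\<alpha> - 1) * (d + s)\<^sup>2 / (d + s) ^ 3"
    using assms by (simp add: power2_eq_square power3_eq_cube)
  finally have e: "s powr (\<alpha> - 2) * (s / (d + s)) = s powr (\<alpha> - 1) * (d + s)\<^sup>2 / (d + s) ^ 3" .
  have b: "?b = (\<alpha>\<^sup>2 - \<alpha>) * (d + s)\<^sup>2 + 2 * (\<alpha> - 1) * s * d + 2 * \<alpha> * d\<^sup>2"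
    "?b = (\<alpha>\<^sup>2 + \<alpha>) * (d + s)\<^sup>2 - 2 * \<alpha> * s\<^sup>2 - 2 * (\<alpha> + 1) * s * d"
    by (auto simp: power2_eq_square algebra_simps)
  have "(\<alpha>\<^sup>2 - \<alpha>) * (d + s)\<^sup>2 \<le> ?b" unfolding b(1) using assms by auto
  then have "s powr (\<alpha> - 1) * ((\<alpha>\<^sup>2 - \<alpha>) * (d + s)\<^sup>2) / (d + s) ^ 3 \<le> s powr (\<alpha> - 1) * ?b / (d + s) ^ 3"
    using assms by (intro divide_right_mono mult_left_mono) auto
  then show "(\<alpha>\<^sup>2 - \<alpha>) * (s powr (\<alpha> - 2) * (s / (d + s))) \<le> phi2 \<alpha> d s"
    unfolding e using assms by (simp add: phi2_def mult_ac)
  have "?b \<le> (\<alpha>\<^sup>2 + \<alpha>) * (d + s)\<^sup>2" 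
  proof -
    have "0 \<le> 2 * \<alpha> * s\<^sup>2" "0 \<le> 2 * (\<alpha> + 1) * s * d" using assms by auto
    then show ?thesis unfolding b(2) by linarith
  qed
  then have "s powr (\<alpha> - 1) * ?b / (d + s) ^ 3 \<le> s powr (\<alpha> - 1) * ((\<alpha>\<^sup>2 + \<alpha>) * (d + s)\<^sup>2) / (d + s) ^ 3"
    using assms by (intro divide_right_mono mult_left_mono) auto
  then show "phi2 \<alpha> d s \<le> (\<alpha>\<^sup>2 + \<alpha>) * (s powr (\<alpha> - 2) * (s / (d + s)))"
    unfolding e using assms by (simp add: phi2_def mult_ac)
qed

lemma phi_nonneg:
  assumes "d > 0" "\<alpha> \<ge> 2"
  shows "phi0 \<alpha> d s \<ge> 0" "phi1 \<alpha> d s \<ge> 0" "phi2 \<alpha> d s \<ge> 0"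
proof -
  have a: "\<alpha>\<^sup>2 - \<alpha> \<ge> 0" using assms by (simp add: power2_eq_square)
  have "phi2 \<alpha> d s \<ge> 0" if "s > 0"
    using phi2_bounds(1)[OF that assms] a assms that
    by (smt (verit) divide_nonneg_pos mult_nonneg_nonneg powr_ge_zero)
  then show "phi2 \<alpha> d s \<ge> 0" using phi_nonpos(3)[of s \<alpha> d] by (cases "s > 0") auto
  show "phi1 \<alpha> d s \<ge> 0" using phi1_bounds(1)[of s d \<alpha>] phi_nonpos(2)[of s \<alpha> d] assms by (cases "s > 0") auto
qed (use assms in \<open>auto simp: phi0_def\<close>)

text \<open>Errors carrying \<open>phi1\<close> can thus be absorbed by the dissipation, which
  carries \<open>phi2\<close>. The factor 2 rests on \<alpha> + 1 \<le> 2 (\<alpha>^2 - \<alpha>), a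
  consequence of (\<alpha> - 2)(2 \<alpha> + 1) \<ge> 0.\<close>

lemma phi1_le_phi2:
  assumes "d > 0" "\<alpha> \<ge> 2"
  shows "phi1 \<alpha> d s \<le> 2 * max 0 s * phi2 \<alpha> d s"
proof (cases "s > 0")
  case True
  let ?x = "s powr (\<alpha> - 2) * (s / (d + s))"
  have x: "?x \<ge> 0" using True assms by auto
  have "phi1 \<alpha> d s \<le> (\<alpha> + 1) * (s * ?x)"
    using phi1_bounds(2)[OF True assms] True ratio_powr[of s d "\<alpha> - 1"] by (simp add: powr_diff power2_eq_square)
  also have "\<dots> \<le> (2 * (\<alpha>\<^sup>2 - \<alpha>)) * (s * ?x)"
  proof -
    have "0 \<le> (\<alpha> - 2) * (2 * \<alpha> + 1)" using assms by simp
    then have "\<alpha> + 1 \<le> 2 * (\<alpha>\<^sup>2 - \<alpha>)" by (simp add: power2_eq_square algebra_simps)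
    moreover have "0 \<le> s * ?x" by (rule mult_nonneg_nonneg[OF less_imp_le[OF True] x])
    ultimately show ?thesis by (rule mult_right_mono)
  qed
  also have "\<dots> = 2 * s * ((\<alpha>\<^sup>2 - \<alpha>) * ?x)" by simp
  also have "\<dots> \<le> 2 * s * phi2 \<alpha> d s"
    using phi2_bounds(1)[OF True assms] True by (intro mult_left_mono) auto
  finally show ?thesis using True by simp
qed (simp add: phi_nonpos)

lemma DERIV_phi0:
  assumes "d > 0" "\<alpha> \<ge> 2"
  shows "(phi0 \<alpha> d has_real_derivative phi1 \<alpha> d s) (at s)"
proof (rule DERIV_extend_by_zero[where K="1/d" and \<beta>="\<alpha> + 1"])
  fix s :: real assume s: "s > 0"
  have "((\<lambda>s. s powr (\<alpha> + 1) / (d + s)) has_real_derivative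
      ((\<alpha> + 1) * s powr \<alpha> * (d + s) - s powr (\<alpha> + 1) * 1) / ((d + s) * (d + s))) (at s)"
    using s assms by (auto intro!: derivative_eq_intros simp: field_simps)
  also have "((\<alpha> + 1) * s powr \<alpha> * (d + s) - s powr (\<alpha> + 1) * 1) / ((d + s) * (d + s)) = phi1 \<alpha> d s"
    using s by (simp add: phi1_def powr_add power2_eq_square algebra_simps)
  finally show "(phi0 \<alpha> d has_real_derivative phi1 \<alpha> d s) (at s)"
    by (rule has_field_derivative_transform_within_open[of _ _ _ "{0<..}"]) (use s in \<open>auto simp: phi0_def\<close>)
  have "s powr (\<alpha> + 1) / (d + s) \<le> s powr (\<alpha> + 1) / d"
    using s assms by (intro divide_left_mono) auto
  then show "\<bar>phi0 \<alpha> d s\<bar> \<le> 1 / d * s powr (\<alpha> + 1)"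
    using s assms by (simp add: phi0_def)
qed (use assms in \<open>auto simp: phi_nonpos\<close>)

lemma DERIV_phi1:
  assumes "d > 0" "\<alpha> \<ge> 2"
  shows "(phi1 \<alpha> d has_real_derivative phi2 \<alpha> d s) (at s)"
proof (rule DERIV_extend_by_zero[where K="(\<alpha> + 1)/d" and \<beta>="\<alpha>"])
  fix s :: real assume s: "s > 0"
  have "((\<lambda>s. s powr \<alpha> * (\<alpha> * s + (\<alpha> + 1) * d) / (d + s)\<^sup>2) has_real_derivative
      ((\<alpha> * s powr (\<alpha> - 1) * (\<alpha> * s + (\<alpha> + 1) * d) + s powr \<alpha> * \<alpha>) * (d + s)\<^sup>2
        - s powr \<alpha> * (\<alpha> * s + (\<alpha> + 1) * d) * (2 * (d + s))) / ((d + s)\<^sup>2 * (d + s)\<^sup>2)) (at s)"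
    using s assms by (auto intro!: derivative_eq_intros simp: algebra_simps)
  also have "((\<alpha> * s powr (\<alpha> - 1) * (\<alpha> * s + (\<alpha> + 1) * d) + s powr \<alpha> * \<alpha>) * (d + s)\<^sup>2
        - s powr \<alpha> * (\<alpha> * s + (\<alpha> + 1) * d) * (2 * (d + s))) / ((d + s)\<^sup>2 * (d + s)\<^sup>2)
      = (d + s) * (s powr (\<alpha> - 1) * ((\<alpha> * (\<alpha> * s + (\<alpha> + 1) * d) + s * \<alpha>) * (d + s)
        - s * (\<alpha> * s + (\<alpha> + 1) * d) * 2)) / ((d + s) * (d + s) ^ 3)"
  proof -
    have "s powr \<alpha> = s powr (\<alpha> - 1) * s" using s by (simp add: powr_diff)
    then show ?thesis by (intro arg_cong2[where f="(/)"]) (simp_all add: power2_eq_square power3_eq_cube algebra_simps)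
  qed
  also have "\<dots> = s powr (\<alpha> - 1) * ((\<alpha> * (\<alpha> * s + (\<alpha> + 1) * d) + s * \<alpha>) * (d + s)
        - s * (\<alpha> * s + (\<alpha> + 1) * d) * 2) / (d + s) ^ 3"
    using s assms by (intro mult_divide_mult_cancel_left) simp
  also have "(\<alpha> * (\<alpha> * s + (\<alpha> + 1) * d) + s * \<alpha>) * (d + s) - s * (\<alpha> * s + (\<alpha> + 1) * d) * 2
      = (\<alpha>\<^sup>2 - \<alpha>) * s\<^sup>2 + (2 * \<alpha>\<^sup>2 - 2) * s * d + (\<alpha>\<^sup>2 + \<alpha>) * d\<^sup>2"
    by (simp add: power2_eq_square algebra_simps)
  also have "s powr (\<alpha> - 1) * \<dots> / (d + s) ^ 3 = phi2 \<alpha> d s"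
    using s by (simp add: phi2_def)
  finally show "(phi1 \<alpha> d has_real_derivative phi2 \<alpha> d s) (at s)"
    by (rule has_field_derivative_transform_within_open[of _ _ _ "{0<..}"]) (use s in \<open>auto simp: phi1_def\<close>)
  have "\<bar>phi1 \<alpha> d s\<bar> \<le> (\<alpha> + 1) * (s powr (\<alpha> - 1) * (s / (d + s)))"
    using phi1_bounds[OF s assms] by simp
  also have "s powr (\<alpha> - 1) * (s / (d + s)) = s powr \<alpha> / (d + s)" using s by (simp add: powr_diff)
  also have "\<dots> \<le> s powr \<alpha> / d" using s assms by (intro divide_left_mono) auto
  finally show "\<bar>phi1 \<alpha> d s\<bar> \<le> (\<alpha> + 1) / d * s powr \<alpha>" using assms by (simp add: mult_left_mono)
qed (use assms in \<open>auto simp: phi_nonpos\<close>)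

lemma continuous_phi:
  assumes "d > 0" "\<alpha> \<ge> 2" "continuous_on A f"
  shows "continuous_on A (\<lambda>x. phi0 \<alpha> d (f x))" "continuous_on A (\<lambda>x. phi1 \<alpha> d (f x))" "continuous_on A (\<lambda>x. phi2 \<alpha> d (f x))"
proof -
  have "d + max 0 (f x) \<noteq> 0" for x using assms(1) by (auto simp: max_def)
  then show "continuous_on A (\<lambda>x. phi0 \<alpha> d (f x))" "continuous_on A (\<lambda>x. phi1 \<alpha> d (f x))" "continuous_on A (\<lambda>x. phi2 \<alpha> d (f x))"
    unfolding phi0_def phi1_def phi2_def using assms
    by (auto intro!: continuous_intros continuous_on_powr')
qed

text \<open>The power s_+ powr r, regularised like \<open>phi0\<close>. Being C^1 is enough here,
  because only its gradient enters Gagliardo--Nirenberg.\<close>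

definition vfun :: "real \<Rightarrow> real \<Rightarrow> real \<Rightarrow> real" where
  "vfun r d s = max 0 s powr (r + 1) / (d + max 0 s)"

definition vfun' :: "real \<Rightarrow> real \<Rightarrow> real \<Rightarrow> real" where
  "vfun' r d s = max 0 s powr r * (r * max 0 s + (r + 1) * d) / (d + max 0 s)\<^sup>2"

lemma vfun_nonpos: "s \<le> 0 \<Longrightarrow> vfun r d s = 0" "s \<le> 0 \<Longrightarrow> vfun' r d s = 0"
  by (auto simp: vfun_def vfun'_def max_def)

lemma vfun_nonneg: "d > 0 \<Longrightarrow> r > 0 \<Longrightarrow> vfun r d s \<ge> 0" "d > 0 \<Longrightarrow> r > 0 \<Longrightarrow> vfun' r d s \<ge> 0"
  by (auto simp: vfun_def vfun'_def intro!: divide_nonneg_nonneg mult_nonneg_nonneg add_nonneg_nonneg)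

lemma DERIV_vfun:
  assumes "d > 0" "r > 0"
  shows "(vfun r d has_real_derivative vfun' r d s) (at s)"
proof (rule DERIV_extend_by_zero[where K="1/d" and \<beta>="r + 1"])
  fix s :: real assume s: "s > 0"
  have "((\<lambda>s. s powr (r + 1) / (d + s)) has_real_derivative
      ((r + 1) * s powr r * (d + s) - s powr (r + 1) * 1) / ((d + s) * (d + s))) (at s)"
    using s assms by (auto intro!: derivative_eq_intros simp: field_simps)
  also have "((r + 1) * s powr r * (d + s) - s powr (r + 1) * 1) / ((d + s) * (d + s)) = vfun' r d s"
    using s by (simp add: vfun'_def powr_add power2_eq_square algebra_simps)
  finally show "(vfun r d has_real_derivative vfun' r d s) (at s)"
    by (rule has_field_derivative_transform_within_open[of _ _ _ "{0<..}"]) (use s in \<open>auto simp: vfun_def\<close>)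
  have "s powr (r + 1) / (d + s) \<le> s powr (r + 1) / d"
    using s assms by (intro divide_left_mono) auto
  then show "\<bar>vfun r d s\<bar> \<le> 1 / d * s powr (r + 1)"
    using s assms by (simp add: vfun_def)
qed (use assms in \<open>auto simp: vfun_nonpos\<close>)

lemma continuous_vfun:
  assumes "d > 0" "r > 0" "continuous_on A f"
  shows "continuous_on A (\<lambda>x. vfun r d (f x))" "continuous_on A (\<lambda>x. vfun' r d (f x))"
proof -
  have "d + max 0 (f x) \<noteq> 0" for x using assms(1) by (auto simp: max_def)
  then show "continuous_on A (\<lambda>x. vfun r d (f x))" "continuous_on A (\<lambda>x. vfun' r d (f x))"
    unfolding vfun_def vfun'_def using assms
    by (auto intro!: continuous_intros continuous_on_powr')
qed

lemma vfun_eq: "s > 0 \<Longrightarrow> d > 0 \<Longrightarrow> vfun r d s = s powr r * (s / (d + s))"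
  by (simp add: vfun_def powr_add)

text \<open>With $r = (\alpha-a)/q$ and $q = 2-a$, the chain rule turns the dissipation
  $\Phi''(u)|\nabla u|^q$ into $|\nabla v|^q$.\<close>

lemma vfun_bounds:
  assumes "d > 0" "\<alpha> \<ge> 2" "1 < q" "q \<le> 2" and r: "r * q = \<alpha> - 2 + q"
  shows "vfun r d s powr q \<le> max 0 s powr (\<alpha> - 2 + q)"
    "vfun r d s powr (\<alpha> / r) \<le> phi0 \<alpha> d s"
    "vfun' r d s powr q \<le> (r + 1) powr q * phi2 \<alpha> d s"
    "s \<ge> d \<Longrightarrow> k > 0 \<Longrightarrow> s powr (r * k) \<le> 2 powr k * vfun r d s powr k"
proof -
  have rp: "r > 0" using assms by (smt (verit) mult_less_0_iff zero_less_mult_iff)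
  have "r \<le> \<alpha>"
  proof -
    have "r \<le> r * q" using assms(3) rp by simp
    also have "\<dots> \<le> \<alpha>" using r assms(4) by simp
    finally show ?thesis .
  qed
  then have ar: "\<alpha> / r \<ge> 1" using rp by simp
  have "vfun r d s powr q \<le> s powr (\<alpha> - 2 + q) \<and> vfun r d s powr (\<alpha> / r) \<le> phi0 \<alpha> d s
    \<and> vfun' r d s powr q \<le> (r + 1) powr q * phi2 \<alpha> d s" if s: "s > 0"
  proof (intro conjI)
    define X where "X = s / (d + s)"
    have x: "0 \<le> X" "X \<le> 1" using s assms by (auto simp: X_def)
    have vX: "vfun r d s = s powr r * X" "phi0 \<alpha> d s = s powr \<alpha> * X"
      using s assms by (simp_all add: vfun_eq phi0_eq X_def)
    \<comment> \<open>The factor X = s/(d + s) \<le> 1 may be raised to any power at least 1 and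
      still be bounded by X. This is what \<alpha> / r \<ge> 1 and q > 1 are for.\<close>
    have xp: "X powr k \<le> X" if "k \<ge> 1" for k
    proof -
      have "X powr k \<le> X powr 1" using x that by (intro powr_mono') auto
      also have "X powr 1 = X" using x(1) by (rule powr_one)
      finally show ?thesis .
    qed
    have "vfun r d s powr q = s powr (\<alpha> - 2 + q) * X powr q"
      using s assms x r by (simp add: vX powr_mult powr_powr)
    also have "\<dots> \<le> s powr (\<alpha> - 2 + q) * 1" using x assms by (intro mult_left_mono powr_le1) auto
    finally show "vfun r d s powr q \<le> s powr (\<alpha> - 2 + q)" by simp
    have "vfun r d s powr (\<alpha> / r) = s powr \<alpha> * X powr (\<alpha> / r)"
      using s assms x rp by (simp add: vX powr_mult powr_powr)
    also have "\<dots> \<le> s powr \<alpha> * X" using xp[OF ar] by (intro mult_left_mono) auto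
    finally show "vfun r d s powr (\<alpha> / r) \<le> phi0 \<alpha> d s" by (simp add: vX)
    have "r * s + (r + 1) * d \<le> (r + 1) * (d + s)" using s by (simp add: algebra_simps)
    then have "s powr r * (r * s + (r + 1) * d) / (d + s)\<^sup>2 \<le> s powr r * ((r + 1) * (d + s)) / (d + s)\<^sup>2"
      by (intro divide_right_mono mult_left_mono) auto
    also have "\<dots> = (r + 1) * (s powr (r - 1) * X)"
      using s assms by (simp add: powr_diff power2_eq_square X_def)
    finally have "vfun' r d s \<le> (r + 1) * (s powr (r - 1) * X)" using s by (simp add: vfun'_def)
    then have "vfun' r d s powr q \<le> ((r + 1) * (s powr (r - 1) * X)) powr q"
      using assms vfun_nonneg(2)[OF assms(1) rp] by (intro powr_mono2) auto
    also have "\<dots> = (r + 1) powr q * (s powr (\<alpha> - 2) * X powr q)"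
      using s x rp r by (simp add: powr_mult powr_powr left_diff_distrib)
    also have "\<dots> \<le> (r + 1) powr q * (s powr (\<alpha> - 2) * X)"
      using xp[of q] assms by (intro mult_left_mono) auto
    also have "\<dots> \<le> (r + 1) powr q * phi2 \<alpha> d s"
    proof (intro mult_left_mono)
      have "1 * 2 \<le> (\<alpha> - 1) * \<alpha>" using assms by (intro mult_mono) auto
      then have "1 \<le> \<alpha>\<^sup>2 - \<alpha>" by (simp add: power2_eq_square algebra_simps)
      then have "1 * (s powr (\<alpha> - 2) * X) \<le> (\<alpha>\<^sup>2 - \<alpha>) * (s powr (\<alpha> - 2) * X)"
        using x by (intro mult_right_mono) auto
      also have "\<dots> \<le> phi2 \<alpha> d s" using phi2_bounds(1)[OF s assms(1,2)] by (simp add: X_def)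
      finally show "s powr (\<alpha> - 2) * X \<le> phi2 \<alpha> d s" by simp
    qed auto
    finally show "vfun' r d s powr q \<le> (r + 1) powr q * phi2 \<alpha> d s" .
  qed
  then show "vfun r d s powr q \<le> max 0 s powr (\<alpha> - 2 + q)"
    "vfun r d s powr (\<alpha> / r) \<le> phi0 \<alpha> d s" "vfun' r d s powr q \<le> (r + 1) powr q * phi2 \<alpha> d s"
    using vfun_nonpos[of s r d] phi_nonpos[of s \<alpha> d] by (cases "s > 0"; auto)+
  assume s: "s \<ge> d" and k: "k > 0"
  have "s powr (r * k) = 2 powr k * (s powr r * (1/2)) powr k"
    using s assms by (simp add: powr_powr powr_divide)
  also have "\<dots> \<le> 2 powr k * vfun r d s powr k"
  proof (intro mult_left_mono powr_mono2)
    have "1/2 \<le> s / (d + s)" using s assms by (simp add: field_simps)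
    then show "s powr r * (1/2) \<le> vfun r d s"
      using mult_left_mono[of "1/2" "s / (d + s)" "s powr r"] s assms vfun_eq[of s d r] by simp
  qed (use k in auto)
  finally show "s powr (r * k) \<le> 2 powr k * vfun r d s powr k" .
qed

section \<open>Extension by zero, integration by parts and differentiation under the
  integral\<close>

definition ext :: "'a set \<Rightarrow> ('a \<Rightarrow> 'b::zero) \<Rightarrow> 'a \<Rightarrow> 'b" where
  "ext U f x = (if x \<in> U then f x else 0)"

text \<open>U and the complement of S are open and together cover the space, and the extension is
  zero on the second. Differentiability is a local question on each of them, and no regularity of f
  at the frontier of U enters.\<close>

lemma ext_has_derivative:
  fixes f :: "'a::real_normed_vector \<Rightarrow> 'b::real_normed_vector"
  assumes U: "open U" "closed S" "S \<subseteq> U"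
    and f: "\<And>x. x \<in> U \<Longrightarrow> (f has_derivative f' x) (at x)"
    and z: "\<And>x. x \<in> U - S \<Longrightarrow> f x = 0"
  shows "(ext U f has_derivative (if x \<in> U then f' x else (\<lambda>_. 0))) (at x)"
proof (cases "x \<in> U")
  case True
  have "(ext U f has_derivative f' x) (at x)"
    by (rule has_derivative_transform_within_open[OF f[OF True] U(1) True]) (simp add: ext_def)
  then show ?thesis using True by simp
next
  case False
  have "(ext U f has_derivative (\<lambda>_. 0)) (at x)"
    by (rule has_derivative_transform_within_open[OF has_derivative_const[of 0], of "- S"])
      (use False U z in \<open>auto simp: ext_def\<close>)
  then show ?thesis using False by simp
qed

lemma ext_continuous_on_param:
  fixes f :: "'t::metric_space \<Rightarrow> 'a::metric_space \<Rightarrow> 'b::real_normed_vector"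
  assumes U: "open U" "closed S" "S \<subseteq> U"
    and f: "continuous_on (I \<times> U) (\<lambda>(t, x). f t x)"
    and z: "\<And>t x. t \<in> I \<Longrightarrow> x \<in> U - S \<Longrightarrow> f t x = 0"
  shows "continuous_on (I \<times> A) (\<lambda>(t, x). ext U (f t) x)"
proof -
  have 1: "continuous_on (I \<times> U) (\<lambda>(t, x). ext U (f t) x)"
    by (rule continuous_on_eq[OF f]) (auto simp: ext_def)
  have 2: "continuous_on (I \<times> (- S)) (\<lambda>(t, x). ext U (f t) x)"
    by (rule continuous_on_eq[of _ "\<lambda>_. 0"]) (use z in \<open>auto simp: ext_def\<close>)
  have "continuous_on (I \<times> U \<union> I \<times> (- S)) (\<lambda>(t, x). ext U (f t) x)"
  proof (rule continuous_on_Un_local_open)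
    show "openin (top_of_set (I \<times> U \<union> I \<times> - S)) (I \<times> U)"
      unfolding openin_open using U by (intro exI[of _ "UNIV \<times> U"]) (auto simp: open_Times)
    show "openin (top_of_set (I \<times> U \<union> I \<times> - S)) (I \<times> - S)"
      unfolding openin_open using U by (intro exI[of _ "UNIV \<times> - S"]) (auto simp: open_Times open_Compl)
  qed (use 1 2 in auto)
  moreover have "I \<times> U \<union> I \<times> (- S) = I \<times> UNIV" using U by auto
  ultimately show ?thesis by (auto intro: continuous_on_subset)
qed

lemma continuous_on_Pair_left: "continuous_on A (Pair t)"
proof -
  have "continuous_on A (\<lambda>x. (t, x))"
    by (intro continuous_on_Pair continuous_on_const continuous_on_id)
  then show ?thesis by simp
qed

lemma ext_continuous_on:
  fixes f :: "'a::metric_space \<Rightarrow> 'b::real_normed_vector"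
  assumes "open U" "closed S" "S \<subseteq> U" "continuous_on U f" "\<And>x. x \<in> U - S \<Longrightarrow> f x = 0"
  shows "continuous_on A (ext U f)"
proof -
  have "continuous_on ({0::real} \<times> A) (\<lambda>(t, x). ext U ((\<lambda>_. f) t) x)"
    by (rule ext_continuous_on_param[OF assms(1-3)])
      (auto simp: split_beta assms intro!: continuous_on_compose2[OF assms(4)] continuous_intros)
  from continuous_on_compose2[OF this continuous_on_Pair_left[of A 0]] show ?thesis by auto
qed

text \<open>The field H F, extended by zero, is differentiable everywhere and has continuous
  divergence, so \<open>integral_divergence_zero\<close> applies to it although the partial
  derivatives of F may be discontinuous.\<close>

lemma integral_ext_by_parts:
  fixes F :: "real^'n \<Rightarrow> real^'n" and H :: "real^'n \<Rightarrow> real"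
  assumes U: "open U" "closed S" "S \<subseteq> U" "U \<subseteq> cbox lo hi"
    and F: "\<And>x. x \<in> U \<Longrightarrow> (F has_derivative DF x) (at x)"
    and d: "\<And>x. x \<in> U \<Longrightarrow> d x = (\<Sum>i\<in>UNIV. DF x (axis i 1) $ i)" and cd: "continuous_on U d"
    and H: "\<And>x. x \<in> U \<Longrightarrow> (H has_derivative (\<lambda>h. DH x \<bullet> h)) (at x)" and cDH: "continuous_on U DH"
    and z: "\<And>x. x \<in> U - S \<Longrightarrow> H x = 0" "\<And>x. x \<in> U - S \<Longrightarrow> DH x = 0"
  shows "integral (cbox lo hi) (ext U (\<lambda>x. H x * d x)) = - integral (cbox lo hi) (ext U (\<lambda>x. F x \<bullet> DH x))"
proof -
  let ?B = "cbox lo hi"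
  have cF: "continuous_on U F" "continuous_on U H"
    using has_derivative_continuous[OF F] has_derivative_continuous[OF H] by (auto intro!: continuous_at_imp_continuous_on)
  let ?D = "\<lambda>x h. H x *\<^sub>R DF x h + (DH x \<bullet> h) *\<^sub>R F x"
  have "(ext U (\<lambda>x. H x *\<^sub>R F x) has_derivative (if x \<in> U then ?D x else (\<lambda>_. 0))) (at x)" for x
    by (rule ext_has_derivative[OF U(1-3)]) (use z in \<open>auto intro!: derivative_eq_intros F H\<close>)
  moreover have "ext U (\<lambda>x. H x * d x + F x \<bullet> DH x) x = (\<Sum>i\<in>UNIV. (if x \<in> U then ?D x else (\<lambda>_. 0)) (axis i 1) $ i)" for x
  proof -
    have "F x \<bullet> DH x = (\<Sum>i\<in>UNIV. DH x $ i * F x $ i)" by (simp add: inner_vec_def mult.commute)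
    then show ?thesis by (auto simp: ext_def d sum.distrib sum_distrib_left inner_axis)
  qed
  moreover have "continuous_on UNIV (ext U (\<lambda>x. H x * d x + F x \<bullet> DH x))"
    by (rule ext_continuous_on[OF U(1-3)]) (auto intro!: continuous_intros cF cd cDH simp: z)
  ultimately have "integral ?B (ext U (\<lambda>x. H x * d x + F x \<bullet> DH x)) = 0"
    by (rule integral_divergence_zero) (use U in \<open>auto simp: ext_def\<close>)
  moreover have "ext U (\<lambda>x. H x * d x + F x \<bullet> DH x) = (\<lambda>x. ext U (\<lambda>x. H x * d x) x + ext U (\<lambda>x. F x \<bullet> DH x) x)"
    by (auto simp: ext_def fun_eq_iff)
  moreover have "ext U (\<lambda>x. H x * d x) integrable_on ?B" "ext U (\<lambda>x. F x \<bullet> DH x) integrable_on ?B"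
    by (intro integrable_continuous ext_continuous_on[OF U(1-3)]; auto intro!: continuous_intros cF cd cDH simp: z)+
  ultimately show ?thesis by (simp add: integral_add)
qed

lemma ext_integral_continuous:
  fixes f :: "'t::metric_space \<Rightarrow> 'a::euclidean_space \<Rightarrow> real"
  assumes U: "open U" "closed S" "S \<subseteq> U"
    and f: "continuous_on (I \<times> U) (\<lambda>(t, x). f t x)"
    and z: "\<And>t x. t \<in> I \<Longrightarrow> x \<in> U - S \<Longrightarrow> f t x = 0"
  shows "continuous_on I (\<lambda>t. integral (cbox lo hi) (ext U (f t)))"
  by (rule integral_continuous_on_param) (rule ext_continuous_on_param[OF assms])

lemma ext_leibniz:
  fixes f :: "real \<Rightarrow> 'a::euclidean_space \<Rightarrow> real"
  assumes U: "open U" "closed S" "S \<subseteq> U" and I: "convex I" "t \<in> I"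
    and f: "\<And>t x. t \<in> I \<Longrightarrow> x \<in> U \<Longrightarrow> ((\<lambda>s. f s x) has_real_derivative f' t x) (at t within I)"
    and c: "continuous_on (I \<times> U) (\<lambda>(t, x). f t x)" and c': "continuous_on (I \<times> U) (\<lambda>(t, x). f' t x)"
    and z: "\<And>t x. t \<in> I \<Longrightarrow> x \<in> U - S \<Longrightarrow> f t x = 0" "\<And>t x. t \<in> I \<Longrightarrow> x \<in> U - S \<Longrightarrow> f' t x = 0"
  shows "((\<lambda>t. integral (cbox lo hi) (ext U (f t))) has_real_derivative integral (cbox lo hi) (ext U (f' t))) (at t within I)"
proof (rule leibniz_rule_field_derivative[OF _ _ _ I(2,1)])
  fix s x assume s: "s \<in> I"
  show "((\<lambda>s. ext U (f s) x) has_field_derivative ext U (f' s) x) (at s within I)"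
    using f[OF s] by (cases "x \<in> U") (auto simp: ext_def)
  have cs: "continuous_on U (f s)"
    using continuous_on_compose2[OF c continuous_on_Pair_left[of U s]] s by auto
  show "ext U (f s) integrable_on cbox lo hi"
    by (intro integrable_continuous ext_continuous_on[OF U cs]) (use z s in auto)
next
  show "continuous_on (I \<times> cbox lo hi) (\<lambda>(x, t). ext U (f' x) t)"
    by (rule ext_continuous_on_param[OF U c' z(2)])
qed

text \<open>A common frame for the local and the global estimate. Off S, which is compact as a
  closed subset of a box, either the cut-off vanishes (local use) or u is nonpositive (global use).
  The flux F and its divergence dv are separate from u because in the global use u is p - \<Psi> - 1
  while F is still the flux of p.\<close>

locale energy_setting =
  fixes U S :: "(real^'n) set" and lo hi :: "real^'n" and I :: "real set"
    and u ut :: "real \<Rightarrow> real^'n \<Rightarrow> real" and gu F :: "real \<Rightarrow> real^'n \<Rightarrow> real^'n"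
    and dv :: "real \<Rightarrow> real^'n \<Rightarrow> real"
    and \<zeta> \<zeta>t :: "real \<Rightarrow> real^'n \<Rightarrow> real" and g\<zeta> :: "real \<Rightarrow> real^'n \<Rightarrow> real^'n"
    and \<alpha> d :: real
  assumes U: "open U" "closed S" "S \<subseteq> U" "U \<subseteq> cbox lo hi" and I: "convex I"
    and ad: "\<alpha> \<ge> 2" "d > 0"
    and u_x: "\<And>t x. t \<in> I \<Longrightarrow> x \<in> U \<Longrightarrow> (u t has_derivative (\<lambda>h. gu t x \<bullet> h)) (at x)"
    and u_t: "\<And>t x. t \<in> I \<Longrightarrow> x \<in> U \<Longrightarrow> ((\<lambda>s. u s x) has_real_derivative ut t x) (at t within I)"
    and u_cont: "continuous_on (I \<times> U) (\<lambda>(t, x). u t x)" "continuous_on (I \<times> U) (\<lambda>(t, x). gu t x)"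
      "continuous_on (I \<times> U) (\<lambda>(t, x). ut t x)"
    and z_x: "\<And>t x. t \<in> I \<Longrightarrow> x \<in> U \<Longrightarrow> (\<zeta> t has_derivative (\<lambda>h. g\<zeta> t x \<bullet> h)) (at x)"
    and z_t: "\<And>t x. t \<in> I \<Longrightarrow> x \<in> U \<Longrightarrow> ((\<lambda>s. \<zeta> s x) has_real_derivative \<zeta>t t x) (at t within I)"
    and z_cont: "continuous_on (I \<times> U) (\<lambda>(t, x). \<zeta> t x)" "continuous_on (I \<times> U) (\<lambda>(t, x). g\<zeta> t x)"
      "continuous_on (I \<times> U) (\<lambda>(t, x). \<zeta>t t x)"
    and z_range: "\<And>t x. 0 \<le> \<zeta> t x" "\<And>t x. \<zeta> t x \<le> 1"
    and flux: "\<And>t. t \<in> I \<Longrightarrow> \<exists>DF. \<forall>x\<in>U. (F t has_derivative DF x) (at x) \<and> dv t x = (\<Sum>i\<in>UNIV. DF x (axis i 1) $ i)"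
    and dv_cont: "continuous_on (I \<times> U) (\<lambda>(t, x). dv t x)"
    and zero: "\<And>t x. t \<in> I \<Longrightarrow> x \<in> U - S \<Longrightarrow> \<zeta> t x = 0 \<or> u t x \<le> 0"
begin

abbreviation "B \<equiv> cbox lo hi"

lemma cont_slice:
  assumes "continuous_on (I \<times> U) (\<lambda>(t, x). f t x)" "t \<in> I"
  shows "continuous_on U (f t)"
  using continuous_on_compose2[OF assms(1) continuous_on_Pair_left[of U t]] assms(2) by auto

lemma cont [continuous_intros]:
  "continuous_on (I \<times> U) (\<lambda>z. u (fst z) (snd z))" "continuous_on (I \<times> U) (\<lambda>z. gu (fst z) (snd z))"
  "continuous_on (I \<times> U) (\<lambda>z. ut (fst z) (snd z))" "continuous_on (I \<times> U) (\<lambda>z. \<zeta> (fst z) (snd z))"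
  "continuous_on (I \<times> U) (\<lambda>z. g\<zeta> (fst z) (snd z))" "continuous_on (I \<times> U) (\<lambda>z. \<zeta>t (fst z) (snd z))"
  "continuous_on (I \<times> U) (\<lambda>z. dv (fst z) (snd z))"
  using u_cont z_cont dv_cont by (auto simp: split_beta)

lemmas cont_phi [continuous_intros] = continuous_phi[OF ad(2,1)]

definition J :: "real \<Rightarrow> real" where
  "J t = integral B (ext U (\<lambda>x. (\<zeta> t x)\<^sup>2 * phi0 \<alpha> d (u t x)))"

text \<open>Differentiation under the integral followed by one integration by parts in the term with
  dv. The difference ut - dv is 0 in the local use and minus the time derivative of \<Psi> in the
  global one.\<close>

lemma energy_identity:
  assumes t: "t \<in> I"
  shows "(J has_real_derivative integral B (ext U (\<lambda>x. 2 * \<zeta> t x * \<zeta>t t x * phi0 \<alpha> d (u t x)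
      + (\<zeta> t x)\<^sup>2 * phi1 \<alpha> d (u t x) * (ut t x - dv t x)
      - F t x \<bullet> ((2 * \<zeta> t x * phi1 \<alpha> d (u t x)) *\<^sub>R g\<zeta> t x + ((\<zeta> t x)\<^sup>2 * phi2 \<alpha> d (u t x)) *\<^sub>R gu t x)))) (at t within I)"
proof -
  have z0: "\<zeta> t x = 0 \<or> phi0 \<alpha> d (u t x) = 0" "\<zeta> t x = 0 \<or> phi1 \<alpha> d (u t x) = 0" "\<zeta> t x = 0 \<or> phi2 \<alpha> d (u t x) = 0"
    if "t \<in> I" "x \<in> U - S" for t x
    using zero[OF that] phi_nonpos by blast+
  let ?f' = "\<lambda>t x. 2 * \<zeta> t x * \<zeta>t t x * phi0 \<alpha> d (u t x) + (\<zeta> t x)\<^sup>2 * (phi1 \<alpha> d (u t x) * ut t x)"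
  have 1: "(J has_real_derivative integral B (ext U (?f' t))) (at t within I)"
    unfolding J_def
  proof (rule ext_leibniz[OF U(1-3) I t])
    fix t x assume tx: "t \<in> I" "x \<in> U"
    have "((\<lambda>s. phi0 \<alpha> d (u s x)) has_real_derivative phi1 \<alpha> d (u t x) * ut t x) (at t within I)"
      using DERIV_chain2[OF DERIV_phi0[OF ad(2,1)] u_t[OF tx]] by simp
    then show "((\<lambda>s. (\<zeta> s x)\<^sup>2 * phi0 \<alpha> d (u s x)) has_real_derivative ?f' t x) (at t within I)"
      by (auto intro!: derivative_eq_intros z_t tx)
  next
    show "t \<in> I \<Longrightarrow> x \<in> U - S \<Longrightarrow> (\<zeta> t x)\<^sup>2 * phi0 \<alpha> d (u t x) = 0" for t x using z0(1)[of t x] by auto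
    show "t \<in> I \<Longrightarrow> x \<in> U - S \<Longrightarrow> ?f' t x = 0" for t x using z0[of t x] by auto
  qed (auto simp: split_beta intro!: continuous_intros)
  obtain DF where DF: "\<And>x. x \<in> U \<Longrightarrow> (F t has_derivative DF x) (at x)"
    "\<And>x. x \<in> U \<Longrightarrow> dv t x = (\<Sum>i\<in>UNIV. DF x (axis i 1) $ i)" using flux[OF t] by blast
  let ?H = "\<lambda>x. (\<zeta> t x)\<^sup>2 * phi1 \<alpha> d (u t x)"
  let ?DH = "\<lambda>x. (2 * \<zeta> t x * phi1 \<alpha> d (u t x)) *\<^sub>R g\<zeta> t x + ((\<zeta> t x)\<^sup>2 * phi2 \<alpha> d (u t x)) *\<^sub>R gu t x"
  have ct [continuous_intros]: "continuous_on U (u t)" "continuous_on U (gu t)" "continuous_on U (ut t)" "continuous_on U (\<zeta> t)"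
    "continuous_on U (g\<zeta> t)" "continuous_on U (\<zeta>t t)" "continuous_on U (dv t)"
    using u_cont z_cont dv_cont t by (auto intro!: cont_slice)
  have cF [continuous_intros]: "continuous_on U (F t)"
    using has_derivative_continuous[OF DF(1)] by (auto intro!: continuous_at_imp_continuous_on)
  have zH: "x \<in> U - S \<Longrightarrow> ?H x = 0" "x \<in> U - S \<Longrightarrow> ?DH x = 0" "x \<in> U - S \<Longrightarrow> ?f' t x = 0" for x
    using z0[OF t, of x] by auto
  have 2: "integral B (ext U (\<lambda>x. ?H x * dv t x)) = - integral B (ext U (\<lambda>x. F t x \<bullet> ?DH x))"
  proof (rule integral_ext_by_parts[OF U DF])
    fix x assume x: "x \<in> U"
    have "((\<lambda>x. phi1 \<alpha> d (u t x)) has_derivative (\<lambda>h. phi2 \<alpha> d (u t x) * (gu t x \<bullet> h))) (at x)"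
      using has_derivative_compose[OF u_x[OF t x] DERIV_phi1[OF ad(2,1), unfolded has_field_derivative_def]] by simp
    then show "(?H has_derivative (\<lambda>h. ?DH x \<bullet> h)) (at x)"
      by (auto intro!: derivative_eq_intros z_x[OF t x] simp: inner_add_left fun_eq_iff algebra_simps)
  qed (use zH in \<open>auto intro!: continuous_intros\<close>)
  have int: "ext U (?f' t) integrable_on B" "ext U (\<lambda>x. ?H x * dv t x) integrable_on B" "ext U (\<lambda>x. F t x \<bullet> ?DH x) integrable_on B"
    using zH by (intro integrable_continuous ext_continuous_on[OF U(1-3)]; auto intro!: continuous_intros)+
  have "integral B (ext U (?f' t)) = integral B (ext U (?f' t)) - integral B (ext U (\<lambda>x. ?H x * dv t x)) - integral B (ext U (\<lambda>x. F t x \<bullet> ?DH x))"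
    using 2 by simp
  also have "\<dots> = integral B (\<lambda>x. ext U (?f' t) x - ext U (\<lambda>x. ?H x * dv t x) x - ext U (\<lambda>x. F t x \<bullet> ?DH x) x)"
    using int by (simp add: integral_diff integrable_diff)
  also have "(\<lambda>x. ext U (?f' t) x - ext U (\<lambda>x. ?H x * dv t x) x - ext U (\<lambda>x. F t x \<bullet> ?DH x) x)
    = ext U (\<lambda>x. 2 * \<zeta> t x * \<zeta>t t x * phi0 \<alpha> d (u t x)
      + (\<zeta> t x)\<^sup>2 * phi1 \<alpha> d (u t x) * (ut t x - dv t x) - F t x \<bullet> ?DH x)"
    by (auto simp: ext_def fun_eq_iff algebra_simps)
  finally show ?thesis using 1 by simp
qed

end

text \<open>Names the inequality so that its constant can be fixed before any solution is introduced
  and then handed on as a hypothesis; the \<open>itself\<close> argument carries the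
  dimension.\<close>

definition gn_bound :: "'a::euclidean_space itself \<Rightarrow> real \<Rightarrow> real \<Rightarrow> real \<Rightarrow> bool" where
  "gn_bound T C q \<rho> \<longleftrightarrow> (\<forall>(v :: 'a \<Rightarrow> real) V a b. (\<forall>x. (v has_derivative (\<lambda>h. V x \<bullet> h)) (at x)) \<longrightarrow>
    continuous_on UNIV V \<longrightarrow> (\<forall>x. v x \<ge> 0) \<longrightarrow> (\<forall>x. x \<notin> cbox a b \<longrightarrow> v x = 0) \<longrightarrow> (\<forall>x. x \<notin> cbox a b \<longrightarrow> V x = 0) \<longrightarrow>
    integral (cbox a b) (\<lambda>x. v x powr (q + \<rho> * q / DIM('a)))
     \<le> C * integral (cbox a b) (\<lambda>x. v x powr \<rho>) powr (q / DIM('a)) * integral (cbox a b) (\<lambda>x. norm (V x) powr q))"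

lemma gn_bound_exists:
  assumes "q > 1" "\<rho> > 0"
  shows "\<exists>C>0. gn_bound TYPE('a::euclidean_space) C q \<rho>"
  unfolding gn_bound_def by (rule gagliardo_nirenberg[OF assms, where 'a='a]) blast

lemma powr_add_le:
  assumes "(x::real) \<ge> 0" "y \<ge> 0" "q > 0"
  shows "(x + y) powr q \<le> 2 powr q * (x powr q + y powr q)"
proof -
  have "(x + y) powr q \<le> (2 * max x y) powr q" using assms by (intro powr_mono2) auto
  also have "\<dots> = 2 powr q * max x y powr q" using assms by (simp add: powr_mult)
  also have "max x y powr q \<le> x powr q + y powr q" by (simp add: max_def)
  finally show ?thesis by (simp add: mult_left_mono)
qed

lemma powr_le_self: "0 \<le> (x::real) \<Longrightarrow> x \<le> 1 \<Longrightarrow> q \<ge> 1 \<Longrightarrow> x powr q \<le> x"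
  using powr_mono'[of 1 q x] by simp

context energy_setting
begin

lemma ct:
  assumes "t \<in> I"
  shows "continuous_on U (u t)" "continuous_on U (gu t)" "continuous_on U (ut t)" "continuous_on U (\<zeta> t)"
    "continuous_on U (g\<zeta> t)" "continuous_on U (\<zeta>t t)" "continuous_on U (dv t)"
  using u_cont z_cont dv_cont assms by (auto intro!: cont_slice)

lemma ext_int:
  fixes f :: "real^'n \<Rightarrow> real"
  assumes "continuous_on U f" "\<And>x. x \<in> U - S \<Longrightarrow> f x = 0"
  shows "ext U f integrable_on cbox lo' hi'"
  by (intro integrable_continuous ext_continuous_on[OF U(1-3) assms])

lemma ext_mono:
  assumes "continuous_on U f" "\<And>x. x \<in> U - S \<Longrightarrow> f x = 0" "continuous_on U g" "\<And>x. x \<in> U - S \<Longrightarrow> g x = 0"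
    and "\<And>x. x \<in> U \<Longrightarrow> f x \<le> (g x :: real)"
  shows "integral B (ext U f) \<le> integral B (ext U g)"
  by (rule integral_le) (use assms in \<open>auto intro!: ext_int simp: ext_def\<close>)

lemma z0:
  assumes "t \<in> I" "x \<in> U - S"
  shows "\<zeta> t x = 0 \<or> phi0 \<alpha> d (u t x) = 0" "\<zeta> t x = 0 \<or> phi1 \<alpha> d (u t x) = 0" "\<zeta> t x = 0 \<or> phi2 \<alpha> d (u t x) = 0"
    "\<zeta> t x = 0 \<or> vfun r d (u t x) = 0" "\<zeta> t x = 0 \<or> vfun' r d (u t x) = 0" "\<zeta> t x = 0 \<or> max 0 (u t x) = 0"
  using zero[OF assms] phi_nonpos vfun_nonpos by (auto simp: max_def)

definition Diss :: "real \<Rightarrow> real \<Rightarrow> real" where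
  "Diss q t = integral B (ext U (\<lambda>x. (\<zeta> t x)\<^sup>2 * phi2 \<alpha> d (u t x) * norm (gu t x) powr q))"

lemma J_nonneg: "t \<in> I \<Longrightarrow> J t \<ge> 0"
  unfolding J_def using z0 ct
  by (intro integral_nonneg ext_int) (auto simp: ext_def phi_nonneg[OF ad(2,1)] intro!: continuous_intros)

lemma cX: "continuous_on A f \<Longrightarrow> q > 0 \<Longrightarrow> continuous_on A (\<lambda>z. norm (f z) powr q)"
  for f :: "'z::topological_space \<Rightarrow> 'y::real_normed_vector" and q :: real
  by (intro continuous_on_powr_const) (auto intro!: continuous_intros)

lemma Diss_cont: "q > 0 \<Longrightarrow> continuous_on I (Diss q)"
  unfolding Diss_def using z0
  by (intro ext_integral_continuous[OF U(1-3)]) (auto simp: split_beta intro!: continuous_on_mult cX cont cont_phi continuous_on_power)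

lemma Diss_nonneg: "t \<in> I \<Longrightarrow> q > 0 \<Longrightarrow> Diss q t \<ge> 0"
  unfolding Diss_def using z0 ct
  by (intro integral_nonneg ext_int)
    (auto simp: ext_def phi_nonneg[OF ad(2,1)] intro!: continuous_on_mult cX cont_phi continuous_on_power)

lemma energy_gn:
  assumes q: "1 < q" "q \<le> 2" and r: "r * q = \<alpha> - 2 + q" and t: "t \<in> I"
    and gn: "gn_bound TYPE(real^'n) C q (\<alpha> / r)" "C > 0"
  shows "integral B (ext U (\<lambda>x. ((\<zeta> t x)\<^sup>2 * vfun r d (u t x)) powr (q + \<alpha> / r * q / CARD('n))))
    \<le> C * J t powr (q / CARD('n)) * (2 powr q * (2 powr q + (r + 1) powr q) *
       (Diss q t + integral B (ext U (\<lambda>x. \<zeta> t x * max 0 (u t x) powr (\<alpha> - 2 + q) * norm (g\<zeta> t x) powr q))))"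
proof -
  let ?n = "real CARD('n)" and ?k = "q + \<alpha> / r * q / CARD('n)"
  have rp: "r > 0" using ad q r by (smt (verit) mult_less_0_iff zero_less_mult_iff)
  have "r \<le> \<alpha>"
  proof -
    have "r \<le> r * q" using q rp by simp
    also have "\<dots> \<le> \<alpha>" using r q by simp
    finally show ?thesis .
  qed
  then have ar: "\<alpha> / r \<ge> 1" using rp by simp
  have k: "?k > 0" using q rp ad by (auto intro!: add_pos_nonneg divide_nonneg_nonneg mult_nonneg_nonneg)
  note c = ct[OF t]
  note cv = continuous_vfun[OF ad(2) rp]
  define v where "v = ext U (\<lambda>x. (\<zeta> t x)\<^sup>2 * vfun r d (u t x))"
  define Vr where "Vr x = (2 * \<zeta> t x * vfun r d (u t x)) *\<^sub>R g\<zeta> t x + ((\<zeta> t x)\<^sup>2 * vfun' r d (u t x)) *\<^sub>R gu t x" for x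
  define V where "V = ext U Vr"
  have zV: "x \<in> U - S \<Longrightarrow> (\<zeta> t x)\<^sup>2 * vfun r d (u t x) = 0" "x \<in> U - S \<Longrightarrow> Vr x = 0" for x
    using z0(4,5)[OF t, of x r] by (auto simp: Vr_def)
  have vd: "(v has_derivative (\<lambda>h. V x \<bullet> h)) (at x)" for x
  proof -
    have "(v has_derivative (if x \<in> U then (\<lambda>h. Vr x \<bullet> h) else (\<lambda>_. 0))) (at x)"
      unfolding v_def
    proof (rule ext_has_derivative[OF U(1-3) _ zV(1)])
      fix x assume x: "x \<in> U"
      have "((\<lambda>x. vfun r d (u t x)) has_derivative (\<lambda>h. vfun' r d (u t x) * (gu t x \<bullet> h))) (at x)"
        using has_derivative_compose[OF u_x[OF t x] DERIV_vfun[OF ad(2) rp, unfolded has_field_derivative_def]] by simp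
      then show "((\<lambda>x. (\<zeta> t x)\<^sup>2 * vfun r d (u t x)) has_derivative (\<lambda>h. Vr x \<bullet> h)) (at x)"
        unfolding Vr_def
        by (auto intro!: derivative_eq_intros z_x[OF t x] simp: inner_add_left fun_eq_iff algebra_simps)
    qed auto
    then show ?thesis by (cases "x \<in> U") (auto simp: V_def ext_def)
  qed
  have cVr: "continuous_on U Vr" unfolding Vr_def
    by (intro continuous_intros c cv)
  have cV: "continuous_on UNIV V" unfolding V_def
    by (rule ext_continuous_on[OF U(1-3) cVr zV(2)])
  have v0: "v x \<ge> 0" for x by (auto simp: v_def ext_def vfun_nonneg[OF ad(2) rp])
  have G: "integral B (\<lambda>x. v x powr ?k) \<le> C * integral B (\<lambda>x. v x powr (\<alpha> / r)) powr (q / ?n) * integral B (\<lambda>x. norm (V x) powr q)"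
  proof -
    have out: "v x = 0" "V x = 0" if "x \<notin> B" for x using that U(4) by (auto simp: v_def V_def ext_def)
    show ?thesis using gn(1)[unfolded gn_bound_def, rule_format, of v V lo hi, OF vd cV v0 out] by simp
  qed
  have 1: "integral B (\<lambda>x. v x powr (\<alpha> / r)) \<le> J t"
    unfolding J_def
  proof (rule integral_le)
    show "(\<lambda>x. v x powr (\<alpha> / r)) integrable_on B"
      using ar v0 by (intro integrable_continuous continuous_on_powr_const)
        (auto intro: continuous_at_imp_continuous_on has_derivative_continuous[OF vd])
    show "ext U (\<lambda>x. (\<zeta> t x)\<^sup>2 * phi0 \<alpha> d (u t x)) integrable_on B"
      using z0(1)[OF t] by (intro ext_int) (auto intro!: continuous_intros c)
    fix x
    show "v x powr (\<alpha> / r) \<le> ext U (\<lambda>x. (\<zeta> t x)\<^sup>2 * phi0 \<alpha> d (u t x)) x"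
    proof (cases "x \<in> U")
      case True
      have "((\<zeta> t x)\<^sup>2) powr (\<alpha> / r) \<le> (\<zeta> t x)\<^sup>2"
        using z_range ar by (intro powr_le_self) (auto simp: power_le_one)
      moreover have "vfun r d (u t x) powr (\<alpha> / r) \<le> phi0 \<alpha> d (u t x)"
        by (rule vfun_bounds(2)[OF ad(2,1) q r])
      ultimately have "((\<zeta> t x)\<^sup>2) powr (\<alpha> / r) * vfun r d (u t x) powr (\<alpha> / r) \<le> (\<zeta> t x)\<^sup>2 * phi0 \<alpha> d (u t x)"
        by (intro mult_mono) auto
      then show ?thesis using True vfun_nonneg[OF ad(2) rp] by (simp add: v_def ext_def powr_mult)
    qed (simp add: v_def ext_def)
  qed
  let ?D = "\<lambda>x. (\<zeta> t x)\<^sup>2 * phi2 \<alpha> d (u t x) * norm (gu t x) powr q"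
  let ?E = "\<lambda>x. \<zeta> t x * max 0 (u t x) powr (\<alpha> - 2 + q) * norm (g\<zeta> t x) powr q"
  have zDE: "x \<in> U - S \<Longrightarrow> ?D x = 0" "x \<in> U - S \<Longrightarrow> ?E x = 0" for x
    using z0(3,6)[OF t, of x] by auto
  have cDE: "continuous_on U ?D" "continuous_on U ?E"
    using q ad by (auto intro!: continuous_on_mult cX c cont_phi continuous_on_power continuous_on_powr_const continuous_on_max continuous_on_const)
  have 2: "integral B (\<lambda>x. norm (V x) powr q) \<le> integral B (\<lambda>x. 2 powr q * (2 powr q + (r + 1) powr q) * (ext U ?D x + ext U ?E x))"
  proof (rule integral_le)
    show "(\<lambda>x. norm (V x) powr q) integrable_on B"
      using q by (intro integrable_continuous cX continuous_on_subset[OF cV]) auto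
    show "(\<lambda>x. 2 powr q * (2 powr q + (r + 1) powr q) * (ext U ?D x + ext U ?E x)) integrable_on B"
      by (intro integrable_continuous continuous_on_mult_left continuous_on_add ext_continuous_on[OF U(1-3)] cDE)
        (use zDE in auto)
    fix x
    show "norm (V x) powr q \<le> 2 powr q * (2 powr q + (r + 1) powr q) * (ext U ?D x + ext U ?E x)"
    proof (cases "x \<in> U")
      case True
      let ?z = "\<zeta> t x" and ?V = "vfun r d (u t x)" and ?V' = "vfun' r d (u t x)"
      have nn: "?z \<ge> 0" "?z \<le> 1" "?V \<ge> 0" "?V' \<ge> 0" using z_range vfun_nonneg[OF ad(2) rp] by auto
      have "norm (V x) \<le> 2 * ?z * ?V * norm (g\<zeta> t x) + ?z\<^sup>2 * ?V' * norm (gu t x)"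
        using True nn norm_triangle_ineq[of "(2 * ?z * ?V) *\<^sub>R g\<zeta> t x" "(?z\<^sup>2 * ?V') *\<^sub>R gu t x"]
        by (simp add: V_def Vr_def ext_def)
      then have "norm (V x) powr q \<le> (2 * ?z * ?V * norm (g\<zeta> t x) + ?z\<^sup>2 * ?V' * norm (gu t x)) powr q"
        using q by (intro powr_mono2) auto
      also have "\<dots> \<le> 2 powr q * ((2 * ?z * ?V * norm (g\<zeta> t x)) powr q + (?z\<^sup>2 * ?V' * norm (gu t x)) powr q)"
        using q nn by (intro powr_add_le) auto
      also have "(2 * ?z * ?V * norm (g\<zeta> t x)) powr q = 2 powr q * (?z powr q * ?V powr q * norm (g\<zeta> t x) powr q)"
        using nn by (simp add: powr_mult)
      also have "?z powr q * ?V powr q * norm (g\<zeta> t x) powr q \<le> ?E x"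
        using nn q vfun_bounds(1)[OF ad(2,1) q r, of "u t x"]
        by (intro mult_right_mono mult_mono powr_le_self) auto
      also have "(?z\<^sup>2 * ?V' * norm (gu t x)) powr q = (?z\<^sup>2) powr q * ?V' powr q * norm (gu t x) powr q"
        using nn by (simp add: powr_mult)
      also have "\<dots> \<le> ?z\<^sup>2 * ((r + 1) powr q * phi2 \<alpha> d (u t x)) * norm (gu t x) powr q"
        using nn q vfun_bounds(3)[OF ad(2,1) q r, of "u t x"]
        by (intro mult_right_mono mult_mono powr_le_self) (auto simp: power_le_one)
      also have "2 powr q * (2 powr q * ?E x + ?z\<^sup>2 * ((r + 1) powr q * phi2 \<alpha> d (u t x)) * norm (gu t x) powr q)
        = 2 powr q * (2 powr q * ?E x + (r + 1) powr q * ?D x)" by (simp add: mult_ac)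
      also have "\<dots> \<le> 2 powr q * ((2 powr q + (r + 1) powr q) * (?D x + ?E x))"
        using nn phi_nonneg(3)[OF ad(2,1), of "u t x"] by (intro mult_left_mono) (auto simp: algebra_simps)
      finally show ?thesis using True by (simp add: ext_def mult.assoc mult_left_mono)
    qed (simp add: V_def ext_def)
  qed
  also have "\<dots> = 2 powr q * (2 powr q + (r + 1) powr q) * (Diss q t + integral B (ext U ?E))"
    unfolding Diss_def integral_mult_right using zDE cDE by (subst integral_add) (auto intro!: ext_int)
  finally have 2: "integral B (\<lambda>x. norm (V x) powr q) \<le> 2 powr q * (2 powr q + (r + 1) powr q) * (Diss q t + integral B (ext U ?E))" .
  have "ext U (\<lambda>x. ((\<zeta> t x)\<^sup>2 * vfun r d (u t x)) powr ?k) = (\<lambda>x. v x powr ?k)"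
    by (auto simp: v_def ext_def fun_eq_iff)
  then have "integral B (ext U (\<lambda>x. ((\<zeta> t x)\<^sup>2 * vfun r d (u t x)) powr ?k))
    \<le> C * integral B (\<lambda>x. v x powr (\<alpha> / r)) powr (q / ?n) * integral B (\<lambda>x. norm (V x) powr q)" using G by simp
  also have "\<dots> \<le> C * J t powr (q / ?n) * (2 powr q * (2 powr q + (r + 1) powr q) * (Diss q t + integral B (ext U ?E)))"
  proof (intro mult_mono 2)
    show "integral B (\<lambda>x. v x powr (\<alpha> / r)) powr (q / ?n) \<le> J t powr (q / ?n)"
    proof (rule powr_mono2)
      show "0 \<le> integral B (\<lambda>x. v x powr (\<alpha> / r))"
        using ar v0 by (intro integral_nonneg integrable_continuous continuous_on_powr_const)
          (auto intro: continuous_at_imp_continuous_on has_derivative_continuous[OF vd])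
    qed (use 1 q in auto)
    show "0 \<le> integral B (\<lambda>x. norm (V x) powr q)"
      using q by (intro integral_nonneg integrable_continuous cX continuous_on_subset[OF cV]) auto
  qed (use gn in auto)
  finally show ?thesis .
qed

end

section \<open>De Giorgi iteration\<close>

text \<open>Here u is p minus the midpoint of two consecutive levels and d is half their distance,
  so u + d and u - d measure the excess over the lower and over the upper level. The weights
  \<open>xi\<close>, \<zeta>, \<open>xi'\<close> are successively narrower.\<close>

locale degiorgi_step = energy_setting U S lo hi "{T0..T1}" u ut gu "\<lambda>t x. K (norm (gu t x)) *\<^sub>R gu t x" ut \<zeta> \<zeta>t g\<zeta> \<alpha> d
  for U S :: "(real^'n) set" and lo hi T0 T1 u ut gu K \<zeta> \<zeta>t g\<zeta> \<alpha> d +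
  fixes xi xi' :: "real \<Rightarrow> real^'n \<Rightarrow> real" and q k1 k2 k3 G H :: real
  assumes T: "T0 \<le> T1" and q: "1 < q" "q \<le> 2" and k: "k1 > 0" "k2 > 0" "k3 > 0"
    and K1: "\<And>X. X \<ge> 0 \<Longrightarrow> K X * X\<^sup>2 \<ge> k1 * X powr q - k2"
    and K2: "\<And>X. X \<ge> 0 \<Longrightarrow> K X * X \<le> k3 * X powr (q - 1)"
    and K3: "\<And>X. X \<ge> 0 \<Longrightarrow> K X \<ge> 0"
    and z_init: "\<And>x. x \<in> U \<Longrightarrow> \<zeta> T0 x = 0"
    and GH: "G \<ge> 0" "H \<ge> 0" "\<And>t x. t \<in> {T0..T1} \<Longrightarrow> x \<in> U \<Longrightarrow> norm (g\<zeta> t x) \<le> G" "\<And>t x. t \<in> {T0..T1} \<Longrightarrow> x \<in> U \<Longrightarrow> \<bar>\<zeta>t t x\<bar> \<le> H"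
    and xi_cont: "continuous_on ({T0..T1} \<times> U) (\<lambda>(t, x). xi t x)" "continuous_on ({T0..T1} \<times> U) (\<lambda>(t, x). xi' t x)"
    and xi_range: "\<And>t x. 0 \<le> xi t x" "\<And>t x. 0 \<le> xi' t x" "\<And>t x. xi' t x \<le> 1"
    and xi_zero: "\<And>t x. t \<in> {T0..T1} \<Longrightarrow> x \<in> U - S \<Longrightarrow> xi t x = 0"
    and xi_one: "\<And>t x. t \<in> {T0..T1} \<Longrightarrow> x \<in> U \<Longrightarrow> \<zeta> t x > 0 \<Longrightarrow> xi t x = 1"
    and xi'_one: "\<And>t x. t \<in> {T0..T1} \<Longrightarrow> x \<in> U \<Longrightarrow> xi' t x > 0 \<Longrightarrow> \<zeta> t x = 1"
begin

text \<open>The price of one step: H for the time derivative of the cut-off, G powr q times d powr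
  (q - 2) for its gradient after Chebyshev, and d powr (-2) for the defect k2 in the coercivity.
  \<open>Ca\<close> collects the structural factors.\<close>

definition "B0 = H + G powr q * d powr (q - 2) + d powr (- 2)"
definition "Ca = 2 + (\<alpha>\<^sup>2 + \<alpha>) * ((k1 / 2) powr (1 - q) * (4 * k3) powr q + k2)"
definition "W t = integral B (ext U (\<lambda>x. xi t x * max 0 (u t x + d) powr \<alpha>))"
definition "Y = integral {T0..T1} W"

lemma B0_nonneg: "B0 \<ge> 0" unfolding B0_def using GH(1,2) by auto
lemma Ca_pos: "Ca > 0" unfolding Ca_def using ad k by (auto intro!: add_pos_nonneg mult_nonneg_nonneg add_nonneg_nonneg)

text \<open>Young's inequality for z X multiplied by z powr (2 - q): this turns z powr q into z^2,
  the power of the cut-off in the dissipation. It uses q \<le> 2.\<close>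

lemma young_absorb:
  assumes z: "0 < z" "z \<le> 1" and w: "w > 0" and X: "X \<ge> 0" and f: "f \<ge> 0"
  shows "4 * k3 * G * z * w * f * X powr (q - 1) \<le> k1 / 2 * (z\<^sup>2 * f * X powr q)
    + (k1 / 2) powr (1 - q) * (4 * k3) powr q * G powr q * (w powr q * f)"
proof -
  have "(z * X) powr (q - 1) * (4 * k3 * G * w) \<le> k1 / 2 * (z * X) powr q + (k1 / 2) powr (1 - q) * (4 * k3 * G * w) powr q"
    using assms k GH(1,2) q by (intro young_powr) auto
  then have "f * z powr (2 - q) * ((z * X) powr (q - 1) * (4 * k3 * G * w))
    \<le> f * z powr (2 - q) * (k1 / 2 * (z * X) powr q + (k1 / 2) powr (1 - q) * (4 * k3 * G * w) powr q)"
    using f by (intro mult_left_mono) auto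
  also have "f * z powr (2 - q) * ((z * X) powr (q - 1) * (4 * k3 * G * w))
    = (z powr (2 - q) * z powr (q - 1)) * (f * X powr (q - 1) * (4 * k3 * G * w))"
    using z X by (simp add: powr_mult)
  also have "z powr (2 - q) * z powr (q - 1) = z" using z by (simp flip: powr_add)
  also have "f * z powr (2 - q) * (k1 / 2 * (z * X) powr q + (k1 / 2) powr (1 - q) * (4 * k3 * G * w) powr q)
    = k1 / 2 * (f * (z powr (2 - q) * z powr q) * X powr q) + z powr (2 - q) * ((k1 / 2) powr (1 - q) * ((4 * k3) powr q * G powr q * w powr q) * f)"
    using z X k GH(1,2) w by (simp add: powr_mult algebra_simps)
  also have "z powr (2 - q) * z powr q = z\<^sup>2" using z by (simp flip: powr_add)
  also have "z powr (2 - q) * ((k1 / 2) powr (1 - q) * ((4 * k3) powr q * G powr q * w powr q) * f)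
     \<le> 1 * ((k1 / 2) powr (1 - q) * ((4 * k3) powr q * G powr q * w powr q) * f)"
    using z q f by (intro mult_right_mono powr_le1) auto
  finally show ?thesis by (simp add: mult_ac)
qed

text \<open>Chebyshev in pointwise form: where u = w > 0 the excess over the lower level is w + d
  \<ge> d, so each missing power b costs a factor d powr (-b).\<close>

lemma powr_shift_bounds:
  assumes w: "w > 0"
  shows "w powr \<alpha> \<le> (w + d) powr \<alpha>" "w powr q * (w powr (\<alpha> - 2)) \<le> d powr (q - 2) * (w + d) powr \<alpha>"
    "w powr (\<alpha> - 2) \<le> d powr (- 2) * (w + d) powr \<alpha>"
proof -
  have m: "w powr (\<alpha> - b) \<le> d powr (- b) * (w + d) powr \<alpha>" if "0 \<le> b" "b \<le> \<alpha>" for b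
  proof -
    have "w powr (\<alpha> - b) \<le> (w + d) powr (\<alpha> - b)" using that w ad by (intro powr_mono2) auto
    also have "\<dots> = (w + d) powr (- b) * (w + d) powr \<alpha>" by (simp flip: powr_add)
    also have "\<dots> \<le> d powr (- b) * (w + d) powr \<alpha>"
      using that w ad by (intro mult_right_mono powr_mono2') auto
    finally show ?thesis .
  qed
  show "w powr \<alpha> \<le> (w + d) powr \<alpha>" using w ad by (intro powr_mono2) auto
  show "w powr (\<alpha> - 2) \<le> d powr (- 2) * (w + d) powr \<alpha>" using m[of 2] ad by simp
  have "w powr q * (w powr (\<alpha> - 2)) = w powr (\<alpha> - (2 - q))" by (simp flip: powr_add add: algebra_simps)
  also have "\<dots> \<le> d powr (q - 2) * (w + d) powr \<alpha>" using m[of "2 - q"] ad q by simp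
  finally show "w powr q * (w powr (\<alpha> - 2)) \<le> d powr (q - 2) * (w + d) powr \<alpha>" .
qed

lemma phi_upper:
  assumes w: "w > 0"
  shows "phi0 \<alpha> d w \<le> w powr \<alpha>" "phi2 \<alpha> d w \<le> (\<alpha>\<^sup>2 + \<alpha>) * w powr (\<alpha> - 2)"
proof -
  have x: "w / (d + w) \<le> 1" using w ad by simp
  show "phi0 \<alpha> d w \<le> w powr \<alpha>"
    unfolding phi0_eq[OF w ad(2)] using x by (intro mult_left_le) auto
  have "w powr (\<alpha> - 2) * (w / (d + w)) \<le> w powr (\<alpha> - 2)" using x by (intro mult_left_le) auto
  then have "(\<alpha>\<^sup>2 + \<alpha>) * (w powr (\<alpha> - 2) * (w / (d + w))) \<le> (\<alpha>\<^sup>2 + \<alpha>) * w powr (\<alpha> - 2)"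
    using ad by (intro mult_left_mono) auto
  then show "phi2 \<alpha> d w \<le> (\<alpha>\<^sup>2 + \<alpha>) * w powr (\<alpha> - 2)"
    using phi2_bounds(2)[OF w ad(2,1)] by linarith
qed

text \<open>\<open>t1\<close> treats the time derivative of the cut-off, \<open>t2\<close> the flux
  against its gradient, \<open>t3\<close> the coercivity, which yields the dissipation and the k2
  term, and \<open>t4\<close> the remainder of Young's inequality. Half of the dissipation is spent
  on \<open>t2\<close>.\<close>

lemma integrand_bound:
  assumes t: "t \<in> {T0..T1}" and x: "x \<in> U"
  shows "2 * \<zeta> t x * \<zeta>t t x * phi0 \<alpha> d (u t x)
      + (\<zeta> t x)\<^sup>2 * phi1 \<alpha> d (u t x) * (ut t x - ut t x)
      - (K (norm (gu t x)) *\<^sub>R gu t x) \<bullet> ((2 * \<zeta> t x * phi1 \<alpha> d (u t x)) *\<^sub>R g\<zeta> t x + ((\<zeta> t x)\<^sup>2 * phi2 \<alpha> d (u t x)) *\<^sub>R gu t x)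
    \<le> Ca * B0 * (xi t x * max 0 (u t x + d) powr \<alpha>) - k1 / 2 * ((\<zeta> t x)\<^sup>2 * phi2 \<alpha> d (u t x) * norm (gu t x) powr q)"
    (is "?L \<le> ?R")
proof (cases "\<zeta> t x = 0 \<or> u t x \<le> 0")
  case True
  then have "?L = 0" "k1 / 2 * ((\<zeta> t x)\<^sup>2 * phi2 \<alpha> d (u t x) * norm (gu t x) powr q) = 0"
    using phi_nonpos by auto
  moreover have "Ca * B0 * (xi t x * max 0 (u t x + d) powr \<alpha>) \<ge> 0"
    using Ca_pos B0_nonneg xi_range by auto
  ultimately show ?thesis by linarith
next
  case False
  define z w X where "z = \<zeta> t x" and "w = u t x" and "X = norm (gu t x)"
  define f0 f1 f2 where "f0 = phi0 \<alpha> d w" and "f1 = phi1 \<alpha> d w" and "f2 = phi2 \<alpha> d w"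
  define P where "P = (w + d) powr \<alpha>"
  have z: "0 < z" "z \<le> 1" using False z_range[of t x] by (auto simp: z_def less_le)
  have w: "w > 0" using False by (simp add: w_def)
  have X: "X \<ge> 0" by (simp add: X_def)
  have P: "P \<ge> 0" by (simp add: P_def)
  have f: "f0 \<ge> 0" "f1 \<ge> 0" "f2 \<ge> 0" using phi_nonneg[OF ad(2,1)] by (auto simp: f0_def f1_def f2_def)
  have f12: "f1 \<le> 2 * w * f2" using phi1_le_phi2[OF ad(2,1), of w] w by (simp add: f1_def f2_def)
  have ps: "w powr \<alpha> \<le> P" "w powr q * w powr (\<alpha> - 2) \<le> d powr (q - 2) * P" "w powr (\<alpha> - 2) \<le> d powr (- 2) * P"
    using powr_shift_bounds[OF w] by (auto simp: P_def)
  have fu: "f0 \<le> w powr \<alpha>" "f2 \<le> (\<alpha>\<^sup>2 + \<alpha>) * w powr (\<alpha> - 2)" using phi_upper[OF w] by (auto simp: f0_def f2_def)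
  have aa: "\<alpha>\<^sup>2 + \<alpha> \<ge> 0" using ad by auto
  have t1: "2 * z * \<zeta>t t x * f0 \<le> 2 * H * P"
  proof -
    have "z * \<zeta>t t x \<le> z * H" using GH(4)[OF t x] z by (intro mult_left_mono) auto
    also have "\<dots> \<le> 1 * H" using z GH(1,2) by (intro mult_right_mono) auto
    finally have "(2 * (z * \<zeta>t t x)) * f0 \<le> (2 * (1 * H)) * f0" using f by (intro mult_right_mono) auto
    then have "2 * z * \<zeta>t t x * f0 \<le> 2 * 1 * H * f0" by (simp add: mult.assoc)
    also have "\<dots> \<le> 2 * 1 * H * P" using fu(1) ps(1) GH(1,2) by (intro mult_left_mono) auto
    finally show ?thesis by simp
  qed
  have t2: "- (K X * (2 * z * f1 * (gu t x \<bullet> g\<zeta> t x))) \<le> 4 * k3 * G * z * w * f2 * X powr (q - 1)"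
  proof -
    define i where "i = gu t x \<bullet> g\<zeta> t x"
    define p where "p = X powr (q - 1)"
    have i: "- i \<le> X * G"
      using Cauchy_Schwarz_ineq2[of "gu t x" "g\<zeta> t x"] mult_left_mono[OF GH(3)[OF t x] X] by (auto simp: X_def i_def abs_le_iff)
    have "K X * (2 * z * f1) * (- i) \<le> K X * (2 * z * f1) * (X * G)"
      by (rule mult_left_mono[OF i]) (use K3[OF X] z f in auto)
    moreover have "(K X * X) * (2 * z * G * f1) \<le> (k3 * p) * (2 * z * G * (2 * w * f2))"
    proof (rule mult_mono)
      show "K X * X \<le> k3 * p" using K2[OF X] by (simp add: p_def)
      show "2 * z * G * f1 \<le> 2 * z * G * (2 * w * f2)"
        by (rule mult_left_mono[OF f12]) (use z GH(1) in auto)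
      show "0 \<le> k3 * p" using k by (simp add: p_def)
      show "0 \<le> 2 * z * G * f1" using z GH(1) f by auto
    qed
    moreover have "K X * (2 * z * f1) * (X * G) = (K X * X) * (2 * z * G * f1)"
      "K X * (2 * z * f1) * (- i) = - (K X * (2 * z * f1 * i))"
      "(k3 * p) * (2 * z * G * (2 * w * f2)) = 4 * k3 * G * z * w * f2 * p" by algebra+
    ultimately show ?thesis unfolding i_def[symmetric] p_def[symmetric] by linarith
  qed
  have t3: "- (K X * (z\<^sup>2 * f2 * X\<^sup>2)) \<le> - (k1 * (z\<^sup>2 * f2 * X powr q)) + k2 * ((\<alpha>\<^sup>2 + \<alpha>) * d powr (- 2) * P)"
  proof -
    have "z\<^sup>2 * f2 * (k1 * X powr q - k2) \<le> z\<^sup>2 * f2 * (K X * X\<^sup>2)"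
      using K1[OF X] f by (intro mult_left_mono) auto
    moreover have "z\<^sup>2 * f2 \<le> 1 * ((\<alpha>\<^sup>2 + \<alpha>) * (d powr (- 2) * P))"
    proof (rule mult_mono)
      have "(\<alpha>\<^sup>2 + \<alpha>) * w powr (\<alpha> - 2) \<le> (\<alpha>\<^sup>2 + \<alpha>) * (d powr (- 2) * P)"
        using ps(3) aa by (intro mult_left_mono) auto
      then show "f2 \<le> (\<alpha>\<^sup>2 + \<alpha>) * (d powr (- 2) * P)" using fu(2) by linarith
    qed (use z f in \<open>auto simp: power_le_one\<close>)
    then have "k2 * (z\<^sup>2 * f2) \<le> k2 * ((\<alpha>\<^sup>2 + \<alpha>) * d powr (- 2) * P)"
      using k by (intro mult_left_mono) (auto simp: mult_ac)
    ultimately show ?thesis by (simp add: algebra_simps)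
  qed
  have t4: "(k1 / 2) powr (1 - q) * (4 * k3) powr q * G powr q * (w powr q * f2)
     \<le> (k1 / 2) powr (1 - q) * (4 * k3) powr q * G powr q * ((\<alpha>\<^sup>2 + \<alpha>) * (d powr (q - 2) * P))"
  proof (intro mult_left_mono)
    have "w powr q * f2 \<le> (\<alpha>\<^sup>2 + \<alpha>) * (w powr q * w powr (\<alpha> - 2))"
      using mult_left_mono[OF fu(2), of "w powr q"] by (simp add: mult_ac)
    also have "\<dots> \<le> (\<alpha>\<^sup>2 + \<alpha>) * (d powr (q - 2) * P)" using ps(2) aa by (intro mult_left_mono)
    finally show "w powr q * f2 \<le> (\<alpha>\<^sup>2 + \<alpha>) * (d powr (q - 2) * P)" .
  qed auto
  have sum: "2 * H * P + (k1 / 2) powr (1 - q) * (4 * k3) powr q * G powr q * ((\<alpha>\<^sup>2 + \<alpha>) * (d powr (q - 2) * P))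
     + k2 * ((\<alpha>\<^sup>2 + \<alpha>) * d powr (- 2) * P) \<le> Ca * B0 * P"
  proof -
    define c1 where "c1 = (\<alpha>\<^sup>2 + \<alpha>) * ((k1 / 2) powr (1 - q) * (4 * k3) powr q)"
    define c2 where "c2 = (\<alpha>\<^sup>2 + \<alpha>) * k2"
    have c: "c1 \<ge> 0" "c2 \<ge> 0" "Ca = 2 + c1 + c2" using aa k by (auto simp: c1_def c2_def Ca_def distrib_left)
    have "2 * H + c1 * (G powr q * d powr (q - 2)) + c2 * d powr (- 2) \<le> Ca * B0"
      using c GH(1,2) unfolding B0_def by (simp add: algebra_simps)
    from mult_right_mono[OF this P] show ?thesis by (simp add: c1_def c2_def algebra_simps)
  qed
  have "?L = 2 * z * \<zeta>t t x * f0 - K X * (2 * z * f1 * (gu t x \<bullet> g\<zeta> t x)) - K X * (z\<^sup>2 * f2 * X\<^sup>2)"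
    by (simp add: z_def f0_def f1_def f2_def w_def X_def inner_add_right power2_norm_eq_inner algebra_simps)
  also have "\<dots> \<le> Ca * B0 * P - k1 / 2 * (z\<^sup>2 * f2 * X powr q)"
    using t1 t2 t3 t4 sum young_absorb[OF z w X f(3)] by linarith
  also have "P = xi t x * max 0 (u t x + d) powr \<alpha>"
    using xi_one[OF t x] z w ad by (simp add: P_def z_def w_def)
  finally show ?thesis by (simp add: z_def f2_def w_def X_def)
qed

end

lemma integrable_on_cmult_real:
  fixes f :: "'a::euclidean_space \<Rightarrow> real"
  shows "f integrable_on S \<Longrightarrow> (\<lambda>x. c * f x) integrable_on S"
  using integrable_cmul[of f S c] by simp

lemma has_integral_deriv_le:
  fixes J J' R :: "real \<Rightarrow> real"
  assumes "a \<le> t" "t \<le> b" and d: "\<And>s. s \<in> {a..b} \<Longrightarrow> (J has_real_derivative J' s) (at s within {a..b})"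
    and le: "\<And>s. s \<in> {a..b} \<Longrightarrow> J' s \<le> R s" and c: "continuous_on {a..b} R"
  shows "J t - J a \<le> integral {a..t} R"
proof -
  have "(J' has_integral J t - J a) {a..t}"
    using assms(1,2) by (intro fundamental_theorem_of_calculus)
      (auto simp flip: has_real_derivative_iff_has_vector_derivative intro: has_field_derivative_subset[OF d])
  moreover have "(R has_integral integral {a..t} R) {a..t}"
    using assms(1,2) by (intro integrable_integral integrable_continuous_real continuous_on_subset[OF c]) auto
  ultimately show ?thesis by (rule has_integral_le) (use le assms(2) in auto)
qed

context degiorgi_step
begin

lemma W_cont: "continuous_on {T0..T1} W"
  unfolding W_def using xi_zero xi_cont(1) ad
  by (intro ext_integral_continuous[OF U(1-3)])
    (auto simp: split_beta intro!: continuous_on_mult continuous_on_powr_const continuous_on_max continuous_on_add continuous_on_const cont)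

lemma W_slice_cont: "t \<in> {T0..T1} \<Longrightarrow> continuous_on U (\<lambda>x. xi t x * max 0 (u t x + d) powr \<alpha>)"
  using ad cont_slice[OF xi_cont(1)] ct
  by (auto intro!: continuous_on_mult continuous_on_powr_const continuous_on_max continuous_on_add continuous_on_const)

lemma W_nonneg: "t \<in> {T0..T1} \<Longrightarrow> W t \<ge> 0"
  unfolding W_def using xi_zero xi_range W_slice_cont by (intro integral_nonneg ext_int) (auto simp: ext_def)

text \<open>Integrate in time from T0, where the cut-off makes J vanish. The left side is a sum of
  two nonnegative terms, and dropping either one gives one of the two bounds.\<close>

lemma energy_bounds:
  shows "t \<in> {T0..T1} \<Longrightarrow> J t \<le> Ca * B0 * Y" "k1 / 2 * integral {T0..T1} (Diss q) \<le> Ca * B0 * Y"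
proof -
  define R where "R t = Ca * B0 * W t - k1 / 2 * Diss q t" for t
  have cR: "continuous_on {T0..T1} R" unfolding R_def
    using q by (intro continuous_intros W_cont Diss_cont) auto
  note cc = W_cont Diss_cont[of q]
  obtain J' where J': "\<And>t. t \<in> {T0..T1} \<Longrightarrow> (J has_real_derivative J' t) (at t within {T0..T1})" "\<And>t. t \<in> {T0..T1} \<Longrightarrow> J' t \<le> R t"
  proof
    fix t assume t: "t \<in> {T0..T1}"
    note c = ct[OF t]
    show "(J has_real_derivative integral B (ext U (\<lambda>x. 2 * \<zeta> t x * \<zeta>t t x * phi0 \<alpha> d (u t x)
      + (\<zeta> t x)\<^sup>2 * phi1 \<alpha> d (u t x) * (ut t x - ut t x)
      - (K (norm (gu t x)) *\<^sub>R gu t x) \<bullet> ((2 * \<zeta> t x * phi1 \<alpha> d (u t x)) *\<^sub>R g\<zeta> t x + ((\<zeta> t x)\<^sup>2 * phi2 \<alpha> d (u t x)) *\<^sub>R gu t x))))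
      (at t within {T0..T1})" by (rule energy_identity[OF t])
    have cF: "continuous_on U (\<lambda>x. K (norm (gu t x)) *\<^sub>R gu t x)"
    proof -
      obtain DF where DF: "\<And>x. x \<in> U \<Longrightarrow> ((\<lambda>x. K (norm (gu t x)) *\<^sub>R gu t x) has_derivative DF x) (at x)"
        using flux[OF t] by blast
      show ?thesis using has_derivative_continuous[OF DF] by (auto intro!: continuous_at_imp_continuous_on)
    qed
    have zD: "x \<in> U - S \<Longrightarrow> (\<zeta> t x)\<^sup>2 * phi2 \<alpha> d (u t x) * norm (gu t x) powr q = 0" for x
      using z0(3)[OF t, of x] by auto
    have cD: "continuous_on U (\<lambda>x. (\<zeta> t x)\<^sup>2 * phi2 \<alpha> d (u t x) * norm (gu t x) powr q)"
      using q by (auto intro!: continuous_on_mult cX c cont_phi continuous_on_power)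
    have "integral B (ext U (\<lambda>x. 2 * \<zeta> t x * \<zeta>t t x * phi0 \<alpha> d (u t x)
      + (\<zeta> t x)\<^sup>2 * phi1 \<alpha> d (u t x) * (ut t x - ut t x)
      - (K (norm (gu t x)) *\<^sub>R gu t x) \<bullet> ((2 * \<zeta> t x * phi1 \<alpha> d (u t x)) *\<^sub>R g\<zeta> t x + ((\<zeta> t x)\<^sup>2 * phi2 \<alpha> d (u t x)) *\<^sub>R gu t x)))
      \<le> integral B (ext U (\<lambda>x. Ca * B0 * (xi t x * max 0 (u t x + d) powr \<alpha>) - k1 / 2 * ((\<zeta> t x)\<^sup>2 * phi2 \<alpha> d (u t x) * norm (gu t x) powr q)))"
    proof (rule ext_mono)
      show "continuous_on U (\<lambda>x. 2 * \<zeta> t x * \<zeta>t t x * phi0 \<alpha> d (u t x)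
        + (\<zeta> t x)\<^sup>2 * phi1 \<alpha> d (u t x) * (ut t x - ut t x)
        - (K (norm (gu t x)) *\<^sub>R gu t x) \<bullet> ((2 * \<zeta> t x * phi1 \<alpha> d (u t x)) *\<^sub>R g\<zeta> t x + ((\<zeta> t x)\<^sup>2 * phi2 \<alpha> d (u t x)) *\<^sub>R gu t x))"
        by (intro continuous_on_diff continuous_on_inner[OF cF] continuous_on_add continuous_on_mult continuous_on_scaleR
            continuous_on_power continuous_on_const cont_phi c)
      show "continuous_on U (\<lambda>x. Ca * B0 * (xi t x * max 0 (u t x + d) powr \<alpha>) - k1 / 2 * ((\<zeta> t x)\<^sup>2 * phi2 \<alpha> d (u t x) * norm (gu t x) powr q))"
        by (intro continuous_on_diff continuous_on_mult_left W_slice_cont[OF t] cD)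
      fix x assume x: "x \<in> U - S"
      show "2 * \<zeta> t x * \<zeta>t t x * phi0 \<alpha> d (u t x)
        + (\<zeta> t x)\<^sup>2 * phi1 \<alpha> d (u t x) * (ut t x - ut t x)
        - (K (norm (gu t x)) *\<^sub>R gu t x) \<bullet> ((2 * \<zeta> t x * phi1 \<alpha> d (u t x)) *\<^sub>R g\<zeta> t x + ((\<zeta> t x)\<^sup>2 * phi2 \<alpha> d (u t x)) *\<^sub>R gu t x) = 0"
        using z0(1)[OF t x] z0(2)[OF t x] z0(3)[OF t x] by (cases "\<zeta> t x = 0") simp_all
      show "Ca * B0 * (xi t x * max 0 (u t x + d) powr \<alpha>) - k1 / 2 * ((\<zeta> t x)\<^sup>2 * phi2 \<alpha> d (u t x) * norm (gu t x) powr q) = 0"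
        using zD[OF x] xi_zero[OF t x] by simp
    qed (rule integrand_bound[OF t])
    also have "\<dots> = integral B (\<lambda>x. Ca * B0 * ext U (\<lambda>x. xi t x * max 0 (u t x + d) powr \<alpha>) x
        - k1 / 2 * ext U (\<lambda>x. (\<zeta> t x)\<^sup>2 * phi2 \<alpha> d (u t x) * norm (gu t x) powr q) x)"
      by (rule integral_cong) (auto simp: ext_def)
    also have "\<dots> = R t"
    proof -
      have "ext U (\<lambda>x. xi t x * max 0 (u t x + d) powr \<alpha>) integrable_on B"
        "ext U (\<lambda>x. (\<zeta> t x)\<^sup>2 * phi2 \<alpha> d (u t x) * norm (gu t x) powr q) integrable_on B"
        using xi_zero[OF t] zD cD W_slice_cont[OF t] by (auto intro!: ext_int)
      then show ?thesis unfolding R_def W_def Diss_def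
        by (subst integral_diff) (auto intro: integrable_on_cmult_real)
    qed
    finally show "integral B (ext U (\<lambda>x. 2 * \<zeta> t x * \<zeta>t t x * phi0 \<alpha> d (u t x)
      + (\<zeta> t x)\<^sup>2 * phi1 \<alpha> d (u t x) * (ut t x - ut t x)
      - (K (norm (gu t x)) *\<^sub>R gu t x) \<bullet> ((2 * \<zeta> t x * phi1 \<alpha> d (u t x)) *\<^sub>R g\<zeta> t x + ((\<zeta> t x)\<^sup>2 * phi2 \<alpha> d (u t x)) *\<^sub>R gu t x)))
      \<le> R t" .
  qed
  have "J T0 = integral B (\<lambda>x. 0)" unfolding J_def
    by (rule integral_cong) (auto simp: ext_def z_init)
  then have J0: "J T0 = 0" by simp
  have key: "J t + k1 / 2 * integral {T0..t} (Diss q) \<le> Ca * B0 * Y" if t: "t \<in> {T0..T1}" for t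
  proof -
    have i: "W integrable_on {T0..t}" "Diss q integrable_on {T0..t}" "W integrable_on {T0..T1}"
      using t q by (auto intro!: integrable_continuous_real continuous_on_subset[OF W_cont] continuous_on_subset[OF Diss_cont])
    have "J t - J T0 \<le> integral {T0..t} R"
      using t by (intro has_integral_deriv_le[OF _ _ J' cR]) auto
    also have "integral {T0..t} R = Ca * B0 * integral {T0..t} W - k1 / 2 * integral {T0..t} (Diss q)"
      unfolding R_def using i by (subst integral_diff) (auto intro: integrable_on_cmult_real)
    also have "Ca * B0 * integral {T0..t} W \<le> Ca * B0 * Y"
      unfolding Y_def using t i W_nonneg Ca_pos B0_nonneg
      by (intro mult_left_mono integral_subset_le) auto
    finally show ?thesis using J0 by simp
  qed
  show "J t \<le> Ca * B0 * Y" if t: "t \<in> {T0..T1}"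
  proof -
    have "integral {T0..t} (Diss q) \<ge> 0"
      using t q by (intro integral_nonneg integrable_continuous_real continuous_on_subset[OF Diss_cont] Diss_nonneg) auto
    then show ?thesis using key[OF t] k by (smt (verit) divide_nonneg_nonneg mult_nonneg_nonneg)
  qed
  show "k1 / 2 * integral {T0..T1} (Diss q) \<le> Ca * B0 * Y"
    using key[of T1] J_nonneg[of T1] T by simp
qed

text \<open>J is bounded by a multiple of B0 Y at every time, and the dissipation by one after
  integration in time. Gagliardo--Nirenberg multiplies J powr \<gamma> by the dissipation, whence
  the superlinear power 1 + \<gamma>. Above the upper level u > d holds, and there the surplus
  exponent \<kappa>0 - \<alpha> is traded for d powr (\<alpha> - \<kappa>0).\<close>

lemma degiorgi_step:
  assumes r: "r * q = \<alpha> - 2 + q" and gn: "gn_bound TYPE(real^'n) C q (\<alpha> / r)" "C > 0"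
    and k0: "\<kappa>0 = \<alpha> - 2 + q + \<alpha> * q / CARD('n)" "\<kappa>0 > \<alpha>"
  defines "\<gamma> \<equiv> q / CARD('n)"
  shows "integral {T0..T1} (\<lambda>t. integral B (ext U (\<lambda>x. xi' t x * max 0 (u t x - d) powr \<alpha>)))
    \<le> (2 powr (\<kappa>0 / r) * C * (2 powr q * (2 powr q + (r + 1) powr q)) * Ca powr \<gamma> * (2 * Ca / k1 + 1))
       * d powr (\<alpha> - \<kappa>0) * (B0 * Y) powr (1 + \<gamma>)"
proof -
  have rp: "r > 0" using ad q r by (smt (verit) mult_less_0_iff zero_less_mult_iff)
  define \<kappa> where "\<kappa> = q + \<alpha> / r * q / CARD('n)"
  define C2 where "C2 = C * (2 powr q * (2 powr q + (r + 1) powr q))"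
  have C2: "C2 \<ge> 0" using gn by (simp add: C2_def)
  \<comment> \<open>The Gagliardo--Nirenberg exponent \<kappa> of v corresponds to the exponent r
    \<kappa> = \<kappa>0 of u.\<close>
  have "r * \<kappa> = r * q + \<alpha> * q / CARD('n)" using rp by (simp add: \<kappa>_def distrib_left)
  then have rk: "r * \<kappa> = \<kappa>0" by (simp add: r k0)
  have kp: "\<kappa> > 0" using rk k0(2) ad rp by (smt (verit) mult_nonneg_nonpos)
  have g: "\<gamma> > 0" using q by (simp add: \<gamma>_def)
  note cv = continuous_vfun[OF ad(2) rp]
  define V where "V t = integral B (ext U (\<lambda>x. ((\<zeta> t x)\<^sup>2 * vfun r d (u t x)) powr \<kappa>))" for t
  define E where "E t = integral B (ext U (\<lambda>x. \<zeta> t x * max 0 (u t x) powr (\<alpha> - 2 + q) * norm (g\<zeta> t x) powr q))" for t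
  define Out where "Out t = integral B (ext U (\<lambda>x. xi' t x * max 0 (u t x - d) powr \<alpha>))" for t
  have Y0: "Y \<ge> 0" unfolding Y_def using T W_nonneg by (intro integral_nonneg integrable_continuous_real W_cont) auto
  have BY: "B0 * Y \<ge> 0" using Y0 B0_nonneg by simp
  have EW: "E t \<le> B0 * W t" if t: "t \<in> {T0..T1}" for t
  proof -
    note c = ct[OF t]
    have "E t \<le> integral B (ext U (\<lambda>x. B0 * (xi t x * max 0 (u t x + d) powr \<alpha>)))"
      unfolding E_def
    proof (rule ext_mono)
      show "continuous_on U (\<lambda>x. \<zeta> t x * max 0 (u t x) powr (\<alpha> - 2 + q) * norm (g\<zeta> t x) powr q)"
        using q ad by (auto intro!: continuous_on_mult cX c continuous_on_powr_const continuous_on_max continuous_on_const)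
      show "continuous_on U (\<lambda>x. B0 * (xi t x * max 0 (u t x + d) powr \<alpha>))"
        by (intro continuous_on_mult_left W_slice_cont t)
      fix x assume x: "x \<in> U"
      show "\<zeta> t x * max 0 (u t x) powr (\<alpha> - 2 + q) * norm (g\<zeta> t x) powr q \<le> B0 * (xi t x * max 0 (u t x + d) powr \<alpha>)"
      proof (cases "\<zeta> t x = 0 \<or> u t x \<le> 0")
        case True
        then have "\<zeta> t x * max 0 (u t x) powr (\<alpha> - 2 + q) * norm (g\<zeta> t x) powr q = 0" by auto
        moreover have "B0 * (xi t x * max 0 (u t x + d) powr \<alpha>) \<ge> 0" using B0_nonneg xi_range by auto
        ultimately show ?thesis by linarith
      next
        case False
        then have z: "0 < \<zeta> t x" "\<zeta> t x \<le> 1" and w: "u t x > 0" using z_range[of t x] by (auto simp: less_le)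
        have "\<zeta> t x * (u t x) powr (\<alpha> - 2 + q) * norm (g\<zeta> t x) powr q \<le> 1 * (d powr (q - 2) * (u t x + d) powr \<alpha>) * G powr q"
        proof (intro mult_mono)
          show "u t x powr (\<alpha> - 2 + q) \<le> d powr (q - 2) * (u t x + d) powr \<alpha>"
            using powr_shift_bounds(2)[OF w] by (simp flip: powr_add add: add.commute)
          show "norm (g\<zeta> t x) powr q \<le> G powr q" using GH(3)[OF t x] q by (intro powr_mono2) auto
        qed (use z in auto)
        also have "\<dots> = (G powr q * d powr (q - 2)) * (u t x + d) powr \<alpha>" by simp
        also have "\<dots> \<le> B0 * (u t x + d) powr \<alpha>"
          unfolding B0_def using GH(1,2) by (intro mult_right_mono) auto
        finally show ?thesis using w ad xi_one[OF t x z(1)] by simp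
      qed
    qed (use z0(6)[OF t] xi_zero[OF t] in auto)
    also have "\<dots> = integral B (\<lambda>x. B0 * ext U (\<lambda>x. xi t x * max 0 (u t x + d) powr \<alpha>) x)"
      by (rule integral_cong) (auto simp: ext_def)
    finally show ?thesis by (simp add: W_def)
  qed
  have V_le: "V t \<le> C2 * (Ca * (B0 * Y)) powr \<gamma> * (Diss q t + B0 * W t)" if t: "t \<in> {T0..T1}" for t
  proof -
    have "V t \<le> C * J t powr \<gamma> * (2 powr q * (2 powr q + (r + 1) powr q) * (Diss q t + E t))"
      unfolding V_def E_def \<kappa>_def \<gamma>_def by (rule energy_gn[OF q r t gn])
    also have "\<dots> = C2 * J t powr \<gamma> * (Diss q t + E t)" by (simp add: C2_def)
    also have "\<dots> \<le> C2 * (Ca * (B0 * Y)) powr \<gamma> * (Diss q t + B0 * W t)"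
    proof (intro mult_mono powr_mono2)
      show "J t \<le> Ca * (B0 * Y)" using energy_bounds(1)[OF t] by simp
      show "0 \<le> Diss q t + E t"
      proof -
        have "E t \<ge> 0" unfolding E_def using z_range z0(6)[OF t] ct[OF t] q ad
          by (intro integral_nonneg ext_int)
            (auto simp: ext_def intro!: continuous_on_mult cX continuous_on_powr_const continuous_on_max continuous_on_const)
        then show ?thesis using Diss_nonneg[OF t, of q] q by simp
      qed
    qed (use C2 J_nonneg[OF t] EW[OF t] g Ca_pos BY in auto)
    finally show ?thesis .
  qed
  have Out_le: "Out t \<le> 2 powr \<kappa> * d powr (\<alpha> - \<kappa>0) * V t" if t: "t \<in> {T0..T1}" for t
  proof -
    note c = ct[OF t]
    have cx': "continuous_on U (xi' t)" by (rule cont_slice[OF xi_cont(2) t])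
    have "Out t \<le> integral B (ext U (\<lambda>x. 2 powr \<kappa> * d powr (\<alpha> - \<kappa>0) * ((\<zeta> t x)\<^sup>2 * vfun r d (u t x)) powr \<kappa>))"
      unfolding Out_def
    proof (rule ext_mono)
      show "continuous_on U (\<lambda>x. xi' t x * max 0 (u t x - d) powr \<alpha>)"
        using ad by (auto intro!: continuous_on_mult cx' continuous_on_powr_const continuous_on_max continuous_on_const continuous_on_diff c)
      show "continuous_on U (\<lambda>x. 2 powr \<kappa> * d powr (\<alpha> - \<kappa>0) * ((\<zeta> t x)\<^sup>2 * vfun r d (u t x)) powr \<kappa>)"
        using kp vfun_nonneg(1)[OF ad(2) rp]
        by (auto intro!: continuous_on_mult_left continuous_on_mult continuous_on_powr_const continuous_on_power c cv)
      fix x assume x: "x \<in> U"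
      show "xi' t x * max 0 (u t x - d) powr \<alpha> \<le> 2 powr \<kappa> * d powr (\<alpha> - \<kappa>0) * ((\<zeta> t x)\<^sup>2 * vfun r d (u t x)) powr \<kappa>"
      proof (cases "xi' t x > 0 \<and> u t x > d")
        case False
        then have "xi' t x * max 0 (u t x - d) powr \<alpha> = 0" using xi_range(2)[of t x] by (auto simp: max_def)
        moreover have "0 \<le> 2 powr \<kappa> * d powr (\<alpha> - \<kappa>0) * ((\<zeta> t x)\<^sup>2 * vfun r d (u t x)) powr \<kappa>" by simp
        ultimately show ?thesis by linarith
      next
        case True
        have "xi' t x * max 0 (u t x - d) powr \<alpha> \<le> 1 * u t x powr \<alpha>"
          using True xi_range ad by (intro mult_mono powr_mono2) auto
        also have "\<dots> = u t x powr (\<alpha> - \<kappa>0) * u t x powr (r * \<kappa>)" using True ad by (simp add: rk flip: powr_add)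
        also have "\<dots> \<le> d powr (\<alpha> - \<kappa>0) * (2 powr \<kappa> * vfun r d (u t x) powr \<kappa>)"
          using True ad k0 kp vfun_bounds(4)[OF ad(2,1) q r, of "u t x" \<kappa>]
          by (intro mult_mono powr_mono2') auto
        finally show ?thesis using xi'_one[OF t x] True by (simp add: mult_ac)
      qed
    next
      fix x assume x: "x \<in> U - S"
      have "xi' t x = 0 \<or> u t x \<le> 0"
        using xi'_one[OF t, of x] zero[OF t x] xi_range(2)[of t x] x by force
      then show "xi' t x * max 0 (u t x - d) powr \<alpha> = 0" using ad by (auto simp: max_def)
      show "2 powr \<kappa> * d powr (\<alpha> - \<kappa>0) * ((\<zeta> t x)\<^sup>2 * vfun r d (u t x)) powr \<kappa> = 0"
        using z0(4)[OF t x, of r] by auto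
    qed
    also have "\<dots> = integral B (\<lambda>x. 2 powr \<kappa> * d powr (\<alpha> - \<kappa>0) * ext U (\<lambda>x. ((\<zeta> t x)\<^sup>2 * vfun r d (u t x)) powr \<kappa>) x)"
      by (rule integral_cong) (auto simp: ext_def)
    finally show ?thesis by (simp add: V_def)
  qed
  have cOut: "continuous_on {T0..T1} Out" unfolding Out_def
  proof (rule ext_integral_continuous[OF U(1-3)])
    show "continuous_on ({T0..T1} \<times> U) (\<lambda>(t, x). xi' t x * max 0 (u t x - d) powr \<alpha>)"
      using ad xi_cont(2) by (auto simp: split_beta intro!: continuous_on_mult continuous_on_powr_const continuous_on_max continuous_on_const continuous_on_diff cont)
    fix t x assume tx: "t \<in> {T0..T1}" "x \<in> U - S"
    have "xi' t x = 0 \<or> u t x \<le> 0"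
      using xi'_one[OF tx(1), of x] zero[OF tx] xi_range(2)[of t x] tx by force
    then show "xi' t x * max 0 (u t x - d) powr \<alpha> = 0" using ad by (auto simp: max_def)
  qed
  have cD: "continuous_on {T0..T1} (Diss q)" using q by (intro Diss_cont) auto
  define M where "M = 2 powr \<kappa> * d powr (\<alpha> - \<kappa>0) * (C2 * (Ca * (B0 * Y)) powr \<gamma>)"
  have M: "M \<ge> 0" using C2 by (simp add: M_def)
  have "integral {T0..T1} Out \<le> integral {T0..T1} (\<lambda>t. M * (Diss q t + B0 * W t))"
  proof (rule integral_le)
    fix t assume t: "t \<in> {T0..T1}"
    have "Out t \<le> 2 powr \<kappa> * d powr (\<alpha> - \<kappa>0) * V t" by (rule Out_le[OF t])
    also have "\<dots> \<le> 2 powr \<kappa> * d powr (\<alpha> - \<kappa>0) * (C2 * (Ca * (B0 * Y)) powr \<gamma> * (Diss q t + B0 * W t))"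
      by (intro mult_left_mono V_le t) auto
    finally show "Out t \<le> M * (Diss q t + B0 * W t)" by (simp add: M_def mult_ac)
  qed (auto intro!: integrable_continuous_real cOut continuous_on_mult_left continuous_on_add cD W_cont)
  also have "\<dots> = M * (integral {T0..T1} (Diss q) + B0 * Y)"
    unfolding Y_def integral_mult_right
    by (subst integral_add) (auto intro!: integrable_continuous_real continuous_on_mult_left cD W_cont)
  also have "\<dots> \<le> M * ((2 * Ca / k1 + 1) * (B0 * Y))"
  proof (intro mult_left_mono M)
    have "integral {T0..T1} (Diss q) \<le> 2 * Ca / k1 * (B0 * Y)"
      using energy_bounds(2) k by (simp add: field_simps)
    then show "integral {T0..T1} (Diss q) + B0 * Y \<le> (2 * Ca / k1 + 1) * (B0 * Y)"
      by (simp add: distrib_right)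
  qed
  also have "\<dots> = (2 powr \<kappa> * C2 * Ca powr \<gamma> * (2 * Ca / k1 + 1)) * d powr (\<alpha> - \<kappa>0) * (B0 * Y) powr (1 + \<gamma>)"
    using BY Ca_pos by (cases "B0 * Y = 0") (auto simp: M_def powr_mult powr_add)
  also have "\<kappa> = \<kappa>0 / r" using rk rp by (simp add: field_simps)
  finally show ?thesis unfolding Out_def C2_def by (simp add: mult.assoc)
qed

end

text \<open>Fast geometric convergence: with \<rho> = b powr (-1/\<gamma>) the growth b ^ j is
  exactly cancelled by (\<rho> ^ j) powr \<gamma>, so the smallness of Y 0 lets the bound Y j \<le>
  Y 0 \<rho> ^ j reproduce itself.\<close>

lemma degiorgi_sequence:
  fixes Y :: "nat \<Rightarrow> real"
  assumes Y0: "\<And>j. Y j \<ge> 0" and A: "A \<ge> 0" and b: "b > 1" and g: "\<gamma> > 0"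
    and step: "\<And>j. Y (Suc j) \<le> A * b ^ j * Y j powr (1 + \<gamma>)"
    and small: "A * Y 0 powr \<gamma> * b powr (1 / \<gamma>) \<le> 1"
  shows "Y \<longlonglongrightarrow> 0"
proof -
  define \<rho> where "\<rho> = b powr (- (1 / \<gamma>))"
  have \<rho>: "0 < \<rho>" "\<rho> < 1" using b g by (auto simp: \<rho>_def powr_minus_divide intro: gr_one_powr)
  have \<rho>g: "\<rho> powr \<gamma> = 1 / b" 
  proof -
    have "\<rho> powr \<gamma> = b powr (- 1)" using g by (simp add: \<rho>_def powr_powr)
    then show ?thesis using b by (simp add: powr_minus_divide)
  qed
  have s: "A * Y 0 powr \<gamma> \<le> \<rho>" using small b by (simp add: \<rho>_def powr_minus_divide field_simps)
  have "Y j \<le> Y 0 * \<rho> ^ j" for j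
  proof (induction j)
    case (Suc j)
    have "Y (Suc j) \<le> A * b ^ j * Y j powr (1 + \<gamma>)" by (rule step)
    also have "\<dots> \<le> A * b ^ j * (Y 0 * \<rho> ^ j) powr (1 + \<gamma>)"
      using Suc A b g Y0 by (intro mult_left_mono powr_mono2) auto
    also have "(Y 0 * \<rho> ^ j) powr (1 + \<gamma>) = (Y 0 * \<rho> ^ j) * (Y 0 powr \<gamma> * (\<rho> powr \<gamma>) ^ j)"
    proof -
      have "(\<rho> ^ j) powr \<gamma> = (\<rho> powr \<gamma>) ^ j"
        using \<rho> by (simp add: powr_powr mult.commute flip: powr_realpow)
      then show ?thesis using Y0[of 0] \<rho> by (cases "Y 0 = 0") (auto simp: powr_add powr_mult)
    qed
    also have "A * b ^ j * ((Y 0 * \<rho> ^ j) * (Y 0 powr \<gamma> * (\<rho> powr \<gamma>) ^ j)) = (A * Y 0 powr \<gamma>) * (Y 0 * \<rho> ^ j)"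
      using b by (simp add: \<rho>g power_divide)
    also have "\<dots> \<le> \<rho> * (Y 0 * \<rho> ^ j)" using s Y0 \<rho> by (intro mult_right_mono) auto
    finally show ?case by (simp add: mult_ac)
  qed simp
  moreover have "(\<lambda>j. Y 0 * \<rho> ^ j) \<longlonglongrightarrow> Y 0 * 0"
    using \<rho> by (intro tendsto_mult tendsto_const LIMSEQ_realpow_zero) auto
  ultimately show ?thesis
    by (intro tendsto_sandwich[of "\<lambda>_. 0" Y sequentially "\<lambda>j. Y 0 * \<rho> ^ j"]) (auto simp: Y0)
qed

section \<open>A C^1 cut-off and the iteration over levels\<close>

lemma smooth_cutoff_exists:
  fixes U K :: "'a::euclidean_space set"
  assumes "open U" "compact K" "K \<subseteq> U"
  obtains \<eta> :: "'a \<Rightarrow> real" and g\<eta> S G where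
    "\<And>x. (\<eta> has_derivative (\<lambda>h. g\<eta> x \<bullet> h)) (at x)" "continuous_on UNIV g\<eta>"
    "\<And>x. 0 \<le> \<eta> x" "\<And>x. \<eta> x \<le> 1" "\<And>x. x \<in> K \<Longrightarrow> \<eta> x = 1" "compact S" "S \<subseteq> U" "\<And>x. x \<notin> S \<Longrightarrow> \<eta> x = 0"
    "G \<ge> 1" "\<And>x. norm (g\<eta> x) \<le> G"
proof -
  have "\<exists>r>0. cball x (2 * r) \<subseteq> U" if "x \<in> K" for x
  proof -
    obtain e where "e > 0" "cball x e \<subseteq> U" using assms \<open>x \<in> K\<close> open_contains_cball by (metis subsetD)
    then show ?thesis by (intro exI[of _ "e / 2"]) auto
  qed
  then obtain r where r: "\<And>x. x \<in> K \<Longrightarrow> r x > 0 \<and> cball x (2 * r x) \<subseteq> U" by metis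
  have "\<exists>D. D \<subseteq> K \<and> finite D \<and> K \<subseteq> (\<Union>x\<in>D. ball x (r x))"
  proof (rule compactE_image[OF assms(2), of K "\<lambda>x. ball x (r x)"])
    show "K \<subseteq> (\<Union>x\<in>K. ball x (r x))" using r by force
  qed auto
  then obtain D where D: "D \<subseteq> K" "finite D" "K \<subseteq> (\<Union>x\<in>D. ball x (r x))" by blast
  \<comment> \<open>At least 1 on the ball of radius r c and at most 0 outside radius 2 r c. The sum
    of the resulting bumps is at least 1 on K, and a second \<open>smoothstep\<close> flattens it to
    exactly 1.\<close>
  define a where "a c x = 2 - inverse ((r c)\<^sup>2) * ((x - c) \<bullet> (x - c))" for c x
  define \<sigma> where "\<sigma> x = (\<Sum>c\<in>D. smoothstep (a c x))" for x
  define g\<sigma> where "g\<sigma> x = (\<Sum>c\<in>D. (smoothstep' (a c x) * (- (2 * inverse ((r c)\<^sup>2)))) *\<^sub>R (x - c))" for x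
  define S where "S = (\<Union>c\<in>D. cball c (2 * r c))"
  have S: "compact S" "S \<subseteq> U" using D r by (auto simp: S_def intro!: compact_UN)
  have d\<sigma>: "(\<sigma> has_derivative (\<lambda>h. g\<sigma> x \<bullet> h)) (at x)" for x
  proof -
    have "((\<lambda>x. smoothstep (a c x)) has_derivative (\<lambda>h. smoothstep' (a c x) * (- (inverse ((r c)\<^sup>2) * (2 * ((x - c) \<bullet> h)))))) (at x)" if "c \<in> D" for c
    proof -
      have "(a c has_derivative (\<lambda>h. - (inverse ((r c)\<^sup>2) * (2 * ((x - c) \<bullet> h))))) (at x)"
        unfolding a_def by (auto intro!: derivative_eq_intros simp: inner_commute)
      from has_derivative_compose[OF this DERIV_smoothstep[unfolded has_field_derivative_def]]
      show ?thesis .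
    qed
    then have "((\<lambda>x. \<Sum>c\<in>D. smoothstep (a c x)) has_derivative
        (\<lambda>h. \<Sum>c\<in>D. smoothstep' (a c x) * (- (inverse ((r c)\<^sup>2) * (2 * ((x - c) \<bullet> h)))))) (at x)"
      by (rule has_derivative_sum)
    moreover have "(\<Sum>c\<in>D. smoothstep' (a c x) * (- (inverse ((r c)\<^sup>2) * (2 * ((x - c) \<bullet> h))))) = g\<sigma> x \<bullet> h" for h
      unfolding g\<sigma>_def inner_sum_left by (intro sum.cong) (auto simp: mult_ac)
    ultimately show ?thesis unfolding \<sigma>_def[abs_def] by simp
  qed
  have c\<sigma>: "continuous_on UNIV g\<sigma>" "continuous_on UNIV \<sigma>"
    unfolding g\<sigma>_def \<sigma>_def a_def divide_inverse by (intro continuous_intros)+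
  define \<eta> where "\<eta> x = smoothstep (\<sigma> x)" for x
  define g\<eta> where "g\<eta> x = smoothstep' (\<sigma> x) *\<^sub>R g\<sigma> x" for x
  have z: "\<sigma> x = 0" if "x \<notin> S" for x
    unfolding \<sigma>_def
  proof (rule sum.neutral, rule ballI)
    fix c assume c: "c \<in> D"
    then have rc: "r c > 0" using r D by auto
    have "2 * r c < norm (x - c)" using that c by (auto simp: S_def dist_norm norm_minus_commute)
    then have "(2 * r c)\<^sup>2 < (norm (x - c))\<^sup>2" using rc by (intro power_strict_mono) auto
    then have "4 * (r c)\<^sup>2 < (x - c) \<bullet> (x - c)" by (simp add: power2_norm_eq_inner power_mult_distrib)
    then have "2 * (r c)\<^sup>2 \<le> (x - c) \<bullet> (x - c)" using zero_le_power2[of "r c"] by linarith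
    then have "a c x \<le> 0" using rc by (simp add: a_def field_simps)
    then show "smoothstep (a c x) = 0" by (rule smoothstep_simps)
  qed
  have cg: "continuous_on UNIV g\<eta>" unfolding g\<eta>_def by (intro continuous_intros c\<sigma>)
  have "compact (g\<eta> ` S)" using S by (intro compact_continuous_image continuous_on_subset[OF cg]) auto
  then obtain G where G: "\<forall>y\<in>g\<eta> ` S. norm y \<le> G" by (meson bounded_iff compact_imp_bounded)
  show thesis
  proof (rule that[of \<eta> g\<eta> S "max 1 G"])
    show "(\<eta> has_derivative (\<lambda>h. g\<eta> x \<bullet> h)) (at x)" for x
      using has_derivative_compose[OF d\<sigma> DERIV_smoothstep[unfolded has_field_derivative_def], of x]
      unfolding \<eta>_def[abs_def] g\<eta>_def by simp
    show "\<eta> x = 1" if x: "x \<in> K" for x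
    proof -
      obtain c where c: "c \<in> D" "x \<in> ball c (r c)" using D x by auto
      have "norm (x - c) < r c" using c by (auto simp: dist_norm norm_minus_commute)
      then have "(norm (x - c))\<^sup>2 < (r c)\<^sup>2" by (intro power_strict_mono) auto
      then have "a c x \<ge> 1" using r[of c] c D by (auto simp: a_def power2_norm_eq_inner field_simps)
      then have "1 = smoothstep (a c x)" by (simp add: smoothstep_simps)
      also have "\<dots> \<le> \<sigma> x" unfolding \<sigma>_def using c D smoothstep_range by (intro member_le_sum) auto
      finally show ?thesis by (simp add: \<eta>_def smoothstep_simps)
    qed
    show "norm (g\<eta> x) \<le> max 1 G" for x
      using G z[of x] by (cases "x \<in> S") (auto simp: g\<eta>_def smoothstep'_simps le_max_iff_disj)
  qed (use S cg z in \<open>auto simp: \<eta>_def smoothstep_range smoothstep_simps\<close>)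
qed

text \<open>The interior content of \<open>classical_solution\<close>, with time as the first
  argument and the derivatives as parameters. It is invariant under p \<mapsto> - p, so an upper
  bound for all flows is a two-sided bound.\<close>

definition flow :: "(real^'n) set \<Rightarrow> (real \<Rightarrow> real) \<Rightarrow> (real \<Rightarrow> real^'n \<Rightarrow> real) \<Rightarrow> (real \<Rightarrow> real^'n \<Rightarrow> real^'n) \<Rightarrow> (real \<Rightarrow> real^'n \<Rightarrow> real) \<Rightarrow> bool" where
  "flow U K p gp pt \<longleftrightarrow>
    (\<forall>t>0. \<forall>x\<in>U. (p t has_derivative (\<lambda>h. gp t x \<bullet> h)) (at x)) \<and>
    (\<forall>t>0. \<forall>x\<in>U. ((\<lambda>s. p s x) has_real_derivative pt t x) (at t)) \<and>
    continuous_on ({0<..} \<times> U) (\<lambda>(t, x). p t x) \<and> continuous_on ({0<..} \<times> U) (\<lambda>(t, x). gp t x) \<and>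
    continuous_on ({0<..} \<times> U) (\<lambda>(t, x). pt t x) \<and>
    (\<forall>t>0. \<exists>DF. \<forall>x\<in>U. ((\<lambda>x. K (norm (gp t x)) *\<^sub>R gp t x) has_derivative DF x) (at x) \<and>
       pt t x = (\<Sum>i\<in>UNIV. DF x (axis i 1) $ i))"

lemma flow_uminus:
  assumes "flow U K p gp pt"
  shows "flow U K (\<lambda>t x. - p t x) (\<lambda>t x. - gp t x) (\<lambda>t x. - pt t x)"
proof -
  have F: "\<exists>DF. \<forall>x\<in>U. ((\<lambda>x. K (norm (- gp t x)) *\<^sub>R - gp t x) has_derivative DF x) (at x) \<and>
       - pt t x = (\<Sum>i\<in>UNIV. DF x (axis i 1) $ i)" if t: "t > 0" for t
  proof -
    obtain DF where DF: "\<forall>x\<in>U. ((\<lambda>x. K (norm (gp t x)) *\<^sub>R gp t x) has_derivative DF x) (at x) \<and>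
       pt t x = (\<Sum>i\<in>UNIV. DF x (axis i 1) $ i)" using assms t unfolding flow_def by blast
    then show ?thesis
      by (intro exI[of _ "\<lambda>x h. - DF x h"]) (auto simp: sum_negf intro: has_derivative_minus)
  qed
  show ?thesis using assms F unfolding flow_def
    by (auto simp: split_beta intro!: continuous_on_minus has_derivative_minus derivative_eq_intros)
qed

locale degiorgi_iteration =
  fixes U S :: "(real^'n) set" and lo hi :: "real^'n" and \<eta> :: "real^'n \<Rightarrow> real" and g\<eta> G0
    and \<alpha> q k1 k2 k3 :: real and K p gp pt and \<sigma> t0 :: real
  assumes U: "open U" "closed S" "S \<subseteq> U" "U \<subseteq> cbox lo hi" and al: "\<alpha> \<ge> 2"
    and \<eta>: "\<And>x. (\<eta> has_derivative (\<lambda>h. g\<eta> x \<bullet> h)) (at x)" "continuous_on UNIV g\<eta>"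
      "\<And>x. 0 \<le> \<eta> x" "\<And>x. \<eta> x \<le> 1" "\<And>x. x \<notin> S \<Longrightarrow> \<eta> x = 0" "G0 \<ge> 1" "\<And>x. norm (g\<eta> x) \<le> G0"
    and q: "1 < q" "q \<le> 2" and k: "k1 > 0" "k2 > 0" "k3 > 0"
    and K1: "\<And>X. X \<ge> 0 \<Longrightarrow> K X * X\<^sup>2 \<ge> k1 * X powr q - k2"
    and K2: "\<And>X. X \<ge> 0 \<Longrightarrow> K X * X \<le> k3 * X powr (q - 1)"
    and K3: "\<And>X. X \<ge> 0 \<Longrightarrow> K X \<ge> 0"
    and fl: "flow U K p gp pt" and \<sigma>: "0 < \<sigma>" "\<sigma> \<le> 1" "\<sigma> < t0"
begin

abbreviation "I \<equiv> {t0 - \<sigma>..t0}"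
text \<open>Reaches 1 at time t0 - \<sigma>/2, so the cut-off is fully open on the last half of the
  time interval.\<close>

definition "ramp t = smoothstep (2 / \<sigma> * (t - (t0 - \<sigma>)))"
definition "\<Theta> t x = \<eta> x * ramp t"
definition "cc j = (1 - 1 / 2 ^ j :: real)" for j :: nat
text \<open>All cut-offs are functions of the single quantity \<Theta>. The gap between
  \<open>cc j\<close> and \<open>cc (Suc j)\<close> is twice 1 / 2 ^ (j + 2): \<xi> j rises over its
  first half and \<zeta> j over its second, so \<xi> of the next step becomes positive only where
  \<zeta> j has reached 1.\<close>

definition "\<xi> j t x = smoothstep (2 ^ (j + 2) * (\<Theta> t x - cc j))"
definition "\<zeta> j t x = smoothstep (2 ^ (j + 2) * (\<Theta> t x - cc j) - 1)"
definition "g\<zeta> j t x = (smoothstep' (2 ^ (j + 2) * (\<Theta> t x - cc j) - 1) * 2 ^ (j + 2) * ramp t) *\<^sub>R g\<eta> x"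
definition "\<zeta>t j t x = smoothstep' (2 ^ (j + 2) * (\<Theta> t x - cc j) - 1) * (2 ^ (j + 2) * (\<eta> x * (smoothstep' (2 / \<sigma> * (t - (t0 - \<sigma>))) * (2 / \<sigma>))))"
text \<open>The levels increase from 0 towards M while the cut-offs close in on the set where
  \<Theta> = 1.\<close>

definition "YY M j = integral I (\<lambda>t. integral (cbox lo hi) (ext U (\<lambda>x. \<xi> j t x * max 0 (p t x - M * (1 - 1 / 2 ^ j)) powr \<alpha>)))" for M and j :: nat

lemma lam_range: "0 \<le> ramp t" "ramp t \<le> 1" by (auto simp: ramp_def smoothstep_range)

lemma cc_nonneg: "cc j \<ge> 0" by (simp add: cc_def)

lemma eta_cont: "continuous_on A \<eta>"
  using has_derivative_continuous[OF \<eta>(1)] by (auto intro!: continuous_at_imp_continuous_on)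

lemma Theta_cont: "continuous_on A (\<lambda>z. \<Theta> (fst z) (snd z))"
  unfolding \<Theta>_def ramp_def
  by (intro continuous_intros continuous_on_compose2[OF eta_cont[of UNIV]]) auto

text \<open>The slope 2 ^ (j + 2) times the maximal slope 2 of \<open>smoothstep\<close> gives 2 ^
  (j + 3) G0 for the gradient. The time derivative has two further factors from the ramp, the
  maximal slope 2 and 2 / \<sigma>.\<close>

lemma step_instance:
  assumes M: "M \<ge> 1"
  shows "degiorgi_step U S lo hi (t0 - \<sigma>) t0 (\<lambda>t x. p t x - M * (1 - 1 / 2 ^ j) - M / 2 ^ (j + 2)) pt gp K
     (\<zeta> j) (\<zeta>t j) (g\<zeta> j) \<alpha> (M / 2 ^ (j + 2)) (\<xi> j) (\<xi> (Suc j)) q k1 k2 k3 (2 ^ (j + 3) * G0) (2 ^ (j + 5) / \<sigma>)"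
proof
  note f = fl[unfolded flow_def]
  have sub: "I \<times> U \<subseteq> {0<..} \<times> U" using \<sigma> by auto
  show "open U" "closed S" "S \<subseteq> U" "U \<subseteq> cbox lo hi" "\<alpha> \<ge> 2" using U al by auto
  show "convex I" by simp
  show "0 < M / 2 ^ (j + 2)" using M by simp
  fix t x
  show "((\<lambda>x. p t x - M * (1 - 1 / 2 ^ j) - M / 2 ^ (j + 2)) has_derivative (\<bullet>) (gp t x)) (at x)" if "t \<in> I" "x \<in> U"
  proof -
    have "(p t has_derivative (\<lambda>h. gp t x \<bullet> h)) (at x)" using f that \<sigma> by auto
    from has_derivative_diff[OF has_derivative_diff[OF this has_derivative_const] has_derivative_const] show ?thesis by simp
  qed
  show "((\<lambda>s. p s x - M * (1 - 1 / 2 ^ j) - M / 2 ^ (j + 2)) has_real_derivative pt t x) (at t within I)" if "t \<in> I" "x \<in> U"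
  proof -
    have "((\<lambda>s. p s x) has_real_derivative pt t x) (at t)" using f that \<sigma> by auto
    from DERIV_diff[OF DERIV_diff[OF this DERIV_const] DERIV_const] show ?thesis
      by (simp add: has_field_derivative_at_within)
  qed
  have fc: "continuous_on (I \<times> U) (\<lambda>(t, x). p t x)" "continuous_on (I \<times> U) (\<lambda>(t, x). gp t x)" "continuous_on (I \<times> U) (\<lambda>(t, x). pt t x)"
    using f continuous_on_subset[OF _ sub] by blast+
  show "continuous_on (I \<times> U) (\<lambda>(t, x). p t x - M * (1 - 1 / 2 ^ j) - M / 2 ^ (j + 2))"
    using fc(1) by (auto simp: split_beta intro!: continuous_on_diff continuous_on_const)
  show "continuous_on (I \<times> U) (\<lambda>(t, x). gp t x)" "continuous_on (I \<times> U) (\<lambda>(t, x). pt t x)"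
    using fc by auto
  have dl: "(ramp has_real_derivative smoothstep' (2 / \<sigma> * (t - (t0 - \<sigma>))) * (2 / \<sigma>)) (at t)"
  proof -
    have "((\<lambda>t. 2 / \<sigma> * (t - (t0 - \<sigma>))) has_real_derivative 2 / \<sigma>) (at t)"
      by (rule DERIV_cong[OF DERIV_cmult[OF DERIV_diff[OF DERIV_ident DERIV_const]]]) simp
    from DERIV_chain2[OF DERIV_smoothstep this] show ?thesis unfolding ramp_def[abs_def] .
  qed
  show "(\<zeta> j t has_derivative (\<bullet>) (g\<zeta> j t x)) (at x)"
  proof -
    have "((\<lambda>x. 2 ^ (j + 2) * (\<eta> x * ramp t - cc j) - 1) has_derivative (\<lambda>h. 2 ^ (j + 2) * ((g\<eta> x \<bullet> h) * ramp t))) (at x)"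
      by (rule has_derivative_eq_rhs[OF has_derivative_diff[OF has_derivative_mult_right[OF has_derivative_diff[OF
            has_derivative_mult_left[OF \<eta>(1)] has_derivative_const]] has_derivative_const]])
        (simp only: diff_zero)
    from has_derivative_compose[OF this DERIV_smoothstep[unfolded has_field_derivative_def]]
    show ?thesis unfolding \<zeta>_def[abs_def] g\<zeta>_def \<Theta>_def
      by (rule has_derivative_eq_rhs) (simp add: fun_eq_iff mult_ac)
  qed
  show "((\<lambda>s. \<zeta> j s x) has_real_derivative \<zeta>t j t x) (at t within I)"
  proof -
    have "((\<lambda>t. 2 ^ (j + 2) * (\<eta> x * ramp t - cc j) - 1) has_real_derivative
        2 ^ (j + 2) * (\<eta> x * (smoothstep' (2 / \<sigma> * (t - (t0 - \<sigma>))) * (2 / \<sigma>)))) (at t)"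
      by (rule DERIV_cong[OF DERIV_diff[OF DERIV_cmult[OF DERIV_diff[OF DERIV_cmult[OF dl] DERIV_const]] DERIV_const]])
        (simp only: diff_zero)
    from DERIV_chain2[OF DERIV_smoothstep this]
    show ?thesis unfolding \<zeta>_def \<zeta>t_def \<Theta>_def by (rule has_field_derivative_at_within)
  qed
  have cT: "continuous_on (I \<times> U) (\<lambda>z. \<Theta> (fst z) (snd z))" by (rule Theta_cont)
  show "continuous_on (I \<times> U) (\<lambda>(t, x). \<zeta> j t x)" "continuous_on (I \<times> U) (\<lambda>(t, x). \<xi> j t x)" "continuous_on (I \<times> U) (\<lambda>(t, x). \<xi> (Suc j) t x)"
    unfolding split_beta \<zeta>_def \<xi>_def by (intro continuous_intros cT)+
  show "continuous_on (I \<times> U) (\<lambda>(t, x). g\<zeta> j t x)"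
    unfolding split_beta g\<zeta>_def ramp_def by (intro continuous_intros cT continuous_on_compose2[OF \<eta>(2)]) auto
  show "continuous_on (I \<times> U) (\<lambda>(t, x). \<zeta>t j t x)"
    unfolding split_beta \<zeta>t_def by (intro continuous_intros cT continuous_on_compose2[OF eta_cont[of UNIV]]) auto
  show "0 \<le> \<zeta> j t x" "\<zeta> j t x \<le> 1" "0 \<le> \<xi> j t x" "0 \<le> \<xi> (Suc j) t x" "\<xi> (Suc j) t x \<le> 1"
    by (auto simp: \<zeta>_def \<xi>_def smoothstep_range)
  show "\<exists>DF. \<forall>x\<in>U. ((\<lambda>x. K (norm (gp t x)) *\<^sub>R gp t x) has_derivative DF x) (at x) \<and> pt t x = (\<Sum>i\<in>UNIV. DF x (axis i 1) $ i)" if "t \<in> I"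
    using f that \<sigma> by auto
  have Th0: "\<Theta> t x = 0" if "x \<in> U - S" using \<eta>(5)[of x] that by (simp add: \<Theta>_def)
  have neg: "2 ^ (j + 2) * (0 - cc j) \<le> 0" using cc_nonneg[of j] by (simp add: mult_le_0_iff)
  show "\<zeta> j t x = 0 \<or> p t x - M * (1 - 1 / 2 ^ j) - M / 2 ^ (j + 2) \<le> 0" if "t \<in> I" "x \<in> U - S"
    using neg unfolding \<zeta>_def Th0[OF that(2)] by (intro disjI1 smoothstep_simps(1)) linarith
  show "\<xi> j t x = 0" if "t \<in> I" "x \<in> U - S"
    using neg unfolding \<xi>_def Th0[OF that(2)] by (intro smoothstep_simps(1)) linarith
  show "t0 - \<sigma> \<le> t0" using \<sigma> by simp
  show "1 < q" "q \<le> 2" "k1 > 0" "k2 > 0" "k3 > 0" using q k by auto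
  show "X \<ge> 0 \<Longrightarrow> K X * X\<^sup>2 \<ge> k1 * X powr q - k2" "X \<ge> 0 \<Longrightarrow> K X * X \<le> k3 * X powr (q - 1)" "X \<ge> 0 \<Longrightarrow> K X \<ge> 0" for X
    using K1 K2 K3 by auto
  show "\<zeta> j (t0 - \<sigma>) x = 0"
  proof -
    have e: "\<Theta> (t0 - \<sigma>) x = 0" by (simp add: \<Theta>_def ramp_def smoothstep_simps)
    show ?thesis using neg unfolding \<zeta>_def e by (intro smoothstep_simps(1)) linarith
  qed
  show "2 ^ (j + 3) * G0 \<ge> 0" "2 ^ (j + 5) / \<sigma> \<ge> 0" using \<eta>(6) \<sigma> by auto
  have s2: "smoothstep' y * 2 ^ (j + 2) \<le> 2 ^ (j + 3)" "smoothstep' y * 2 ^ (j + 2) \<ge> 0" for y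
    using smoothstep'_range[of y] mult_right_mono[of "smoothstep' y" 2 "2 ^ (j + 2)"] by (auto simp: power_add)
  show "norm (g\<zeta> j t x) \<le> 2 ^ (j + 3) * G0"
  proof -
    define s where "s = smoothstep' (2 ^ (j + 2) * (\<Theta> t x - cc j) - 1) * 2 ^ (j + 2)"
    have q1: "0 \<le> s" "s \<le> 2 ^ (j + 3)" unfolding s_def by (rule s2)+
    have "s * ramp t \<le> 2 ^ (j + 3) * 1" using q1 lam_range[of t] by (intro mult_mono) auto
    moreover have "s * ramp t \<ge> 0" using q1 lam_range[of t] by (intro mult_nonneg_nonneg) auto
    moreover have "norm (g\<zeta> j t x) = (s * ramp t) * norm (g\<eta> x)"
      using \<open>s * ramp t \<ge> 0\<close> unfolding g\<zeta>_def norm_scaleR s_def by simp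
    ultimately show ?thesis using mult_mono[of "s * ramp t" "2 ^ (j + 3)" "norm (g\<eta> x)" G0] \<eta>(7)[of x] by simp
  qed
  show "\<bar>\<zeta>t j t x\<bar> \<le> 2 ^ (j + 5) / \<sigma>"
  proof -
    define s where "s = smoothstep' (2 ^ (j + 2) * (\<Theta> t x - cc j) - 1) * 2 ^ (j + 2)"
    define s' where "s' = smoothstep' (2 / \<sigma> * (t - (t0 - \<sigma>)))"
    have s: "0 \<le> s" "s \<le> 2 ^ (j + 3)" "0 \<le> s'" "s' \<le> 2" unfolding s_def s'_def by (rule s2 smoothstep'_range)+
    have e: "\<zeta>t j t x = s * (\<eta> x * s') * (2 / \<sigma>)" by (simp add: \<zeta>t_def s_def s'_def)
    have "s * (\<eta> x * s') \<le> 2 ^ (j + 3) * (1 * 2)"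
      using s \<eta>(3,4)[of x] by (intro mult_mono) auto
    then have "s * (\<eta> x * s') * (2 / \<sigma>) \<le> 2 ^ (j + 3) * (1 * 2) * (2 / \<sigma>)"
      using \<sigma> by (intro mult_right_mono) auto
    also have "\<dots> = 2 ^ (j + 5) / \<sigma>" by (simp add: power_add)
    finally have "\<zeta>t j t x \<le> 2 ^ (j + 5) / \<sigma>" by (simp add: e)
    moreover have "\<zeta>t j t x \<ge> 0" unfolding e using s \<eta>(3)[of x] \<sigma> by auto
    ultimately show ?thesis by simp
  qed
  show "\<xi> j t x = 1" if "\<zeta> j t x > 0"
  proof -
    have "\<not> 2 ^ (j + 2) * (\<Theta> t x - cc j) - 1 \<le> 0" using that smoothstep_simps(1) unfolding \<zeta>_def by force
    then show ?thesis unfolding \<xi>_def by (intro smoothstep_simps(2)) simp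
  qed
  show "\<zeta> j t x = 1" if "\<xi> (Suc j) t x > 0"
  proof -
    have "\<not> 2 ^ (Suc j + 2) * (\<Theta> t x - cc (Suc j)) \<le> 0" using that smoothstep_simps(1) unfolding \<xi>_def by force
    then have "\<Theta> t x > cc (Suc j)" by (simp add: zero_less_mult_iff not_le)
    moreover have "cc (Suc j) = cc j + 1 / 2 ^ (j + 1)" by (simp add: cc_def)
    ultimately have "2 ^ (j + 2) * (\<Theta> t x - cc j) \<ge> 2 ^ (j + 2) * (1 / 2 ^ (j + 1))" by (intro mult_left_mono) auto
    also have "2 ^ (j + 2) * (1 / 2 ^ (j + 1)) = (2::real)" by simp
    finally show ?thesis unfolding \<zeta>_def by (intro smoothstep_simps(2)) simp
  qed
qed

end

context degiorgi_iteration
begin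

definition "CaE = 2 + (\<alpha>\<^sup>2 + \<alpha>) * ((k1 / 2) powr (1 - q) * (4 * k3) powr q + k2)"
definition "Cst C r \<kappa>0 = (2 powr (\<kappa>0 / r) * C * (2 powr q * (2 powr q + (r + 1) powr q)) * CaE powr (q / CARD('n)) * (2 * CaE / k1 + 1))"
  for C r \<kappa>0 :: real

lemma YY_nonneg: "M \<ge> 1 \<Longrightarrow> YY M j \<ge> 0"
proof -
  assume M: "M \<ge> 1"
  interpret D: degiorgi_step U S lo hi "t0 - \<sigma>" t0 "\<lambda>t x. p t x - M * (1 - 1 / 2 ^ j) - M / 2 ^ (j + 2)" pt gp K
     "\<zeta> j" "\<zeta>t j" "g\<zeta> j" \<alpha> "M / 2 ^ (j + 2)" "\<xi> j" "\<xi> (Suc j)" q k1 k2 k3 "2 ^ (j + 3) * G0" "2 ^ (j + 5) / \<sigma>"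
    by (rule step_instance[OF M])
  have "YY M j = integral I D.W" unfolding YY_def D.W_def by simp
  also have "\<dots> \<ge> 0" by (intro integral_nonneg integrable_continuous_real D.W_cont D.W_nonneg) auto
  finally show ?thesis .
qed

text \<open>B0 is at most (48 + 256 G0^2) 8 ^ j / \<sigma>. Here 32 stems from the time derivative,
  256 G0^2 from the squared gradient times 2 ^ (j + 2), and 16 from d powr (-2); M \<ge> 1 enters
  through d \<ge> 1 / 2 ^ (j + 2). The factor M powr (\<alpha> - \<kappa>0) is what a large M later
  makes small.\<close>

lemma YY_step:
  assumes M: "M \<ge> 1" and r: "r * q = \<alpha> - 2 + q" and gn: "gn_bound TYPE(real^'n) C q (\<alpha> / r)" "C > 0"
    and k0: "\<kappa>0 = \<alpha> - 2 + q + \<alpha> * q / CARD('n)" "\<kappa>0 > \<alpha>" and rp: "r > 0"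
  defines "\<gamma> \<equiv> q / CARD('n)"
  shows "YY M (Suc j) \<le> (Cst C r \<kappa>0 * (M powr (\<alpha> - \<kappa>0) * 4 powr (\<kappa>0 - \<alpha>)) * ((48 + 256 * G0\<^sup>2) / \<sigma>) powr (1 + \<gamma>))
      * (2 powr (\<kappa>0 - \<alpha>) * 8 powr (1 + \<gamma>)) ^ j * YY M j powr (1 + \<gamma>)"
proof -
  interpret D: degiorgi_step U S lo hi "t0 - \<sigma>" t0 "\<lambda>t x. p t x - M * (1 - 1 / 2 ^ j) - M / 2 ^ (j + 2)" pt gp K
     "\<zeta> j" "\<zeta>t j" "g\<zeta> j" \<alpha> "M / 2 ^ (j + 2)" "\<xi> j" "\<xi> (Suc j)" q k1 k2 k3 "2 ^ (j + 3) * G0" "2 ^ (j + 5) / \<sigma>"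
    by (rule step_instance[OF M])
  define d where "d = M / 2 ^ (j + 2)"
  define e where "e = 1 / (2::real) ^ (j + 2)"
  have e: "e > 0" "e \<le> d" using M by (auto simp: e_def d_def divide_right_mono)
  have d0: "d > 0" using e by simp
  have Y: "D.Y = YY M j" unfolding D.Y_def D.W_def YY_def by simp
  have CaE: "D.Ca = CaE" unfolding D.Ca_def CaE_def by simp
  have CaEp: "CaE > 0" using D.Ca_pos CaE by simp
  have lev: "p t x - M * (1 - 1 / 2 ^ j) - M / 2 ^ (j + 2) - M / 2 ^ (j + 2) = p t x - M * (1 - 1 / 2 ^ Suc j)" for t x
    by (simp add: field_simps)
  have "YY M (Suc j) = integral I (\<lambda>t. integral (cbox lo hi) (ext U (\<lambda>x. \<xi> (Suc j) t x * max 0 (p t x - M * (1 - 1 / 2 ^ j) - M / 2 ^ (j + 2) - M / 2 ^ (j + 2)) powr \<alpha>)))"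
    unfolding YY_def lev ..
  also have "\<dots> \<le> Cst C r \<kappa>0 * d powr (\<alpha> - \<kappa>0) * (D.B0 * YY M j) powr (1 + \<gamma>)"
    using D.degiorgi_step[OF r gn k0] unfolding Cst_def CaE Y d_def \<gamma>_def .
  also have "\<dots> \<le> Cst C r \<kappa>0 * d powr (\<alpha> - \<kappa>0) * (((48 + 256 * G0\<^sup>2) / \<sigma> * 8 ^ j) * YY M j) powr (1 + \<gamma>)"
  proof (intro mult_left_mono powr_mono2 mult_right_mono)
    have "(2 ^ (j + 3) * G0) powr q \<le> (2 ^ (j + 3) * G0) powr 2"
    proof (rule powr_mono)
      have "1 * 1 \<le> 2 ^ (j + 3) * G0" using \<eta>(6) by (intro mult_mono) auto
      then show "1 \<le> 2 ^ (j + 3) * G0" by simp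
    qed (use q in auto)
    also have "(2 ^ (j + 3) * G0) powr 2 = (2 ^ (j + 3) * G0)\<^sup>2" using \<eta>(6) by (intro powr_numeral) auto
    finally have b1: "(2 ^ (j + 3) * G0) powr q \<le> (2 ^ (j + 3) * G0)\<^sup>2" .
    have "d powr (q - 2) \<le> e powr (q - 2)" using e q by (intro powr_mono2') auto
    also have "e powr (q - 2) = (2 ^ (j + 2)) powr (2 - q)"
      unfolding e_def by (subst powr_divide) (auto simp: powr_minus_divide[symmetric])
    also have "\<dots> \<le> (2 ^ (j + 2)) powr 1"
    proof (rule powr_mono)
      show "1 \<le> (2::real) ^ (j + 2)" by (rule one_le_power) simp
    qed (use q in auto)
    finally have b2: "d powr (q - 2) \<le> 2 ^ (j + 2)" by simp
    have "d powr (- 2) \<le> e powr (- 2)" using e by (intro powr_mono2') auto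
    also have "e powr (- 2) = (2 ^ (j + 2)) powr 2"
      unfolding e_def by (subst powr_divide) (auto simp: powr_minus_divide)
    also have "\<dots> = (2 ^ (j + 2))\<^sup>2" by (intro powr_numeral) auto
    finally have b3: "d powr (- 2) \<le> (2 ^ (j + 2))\<^sup>2" .
    have "(2 ^ (j + 3) * G0) powr q * d powr (q - 2) \<le> (2 ^ (j + 3) * G0)\<^sup>2 * 2 ^ (j + 2)"
      using b1 b2 by (intro mult_mono) auto
    also have "(2 ^ (j + 3) * G0)\<^sup>2 * 2 ^ (j + 2) = 256 * G0\<^sup>2 * 8 ^ j"
    proof -
      have "(8::real) ^ j = (2 ^ j) ^ 3" by (simp add: power_mult[symmetric] mult.commute[of j] power_mult)
      then show ?thesis by (simp add: power_add power_mult_distrib power2_eq_square power3_eq_cube)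
    qed
    finally have B: "(2 ^ (j + 3) * G0) powr q * d powr (q - 2) \<le> 256 * G0\<^sup>2 * 8 ^ j" .
    have p: "(2::real) ^ j \<le> 8 ^ j" "((2::real) ^ j)\<^sup>2 \<le> 8 ^ j"
      by (auto intro: power_mono simp: power2_eq_square simp flip: power_mult_distrib)
    have A: "2 ^ (j + 5) / \<sigma> \<le> 32 * 8 ^ j / \<sigma>" using p(1) \<sigma> by (intro divide_right_mono) (auto simp: power_add)
    have C: "(2 ^ (j + 2))\<^sup>2 \<le> 16 * (8::real) ^ j" using p(2) by (simp add: power_add power_mult_distrib)
    have up: "y \<le> y / \<sigma>" if "y \<ge> 0" for y :: real using that \<sigma> by (simp add: field_simps mult_left_le_one_le)
    have "D.B0 \<le> 32 * 8 ^ j / \<sigma> + 256 * G0\<^sup>2 * 8 ^ j + 16 * 8 ^ j"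
    proof -
      have "D.B0 = 2 ^ (j + 5) / \<sigma> + (2 ^ (j + 3) * G0) powr q * d powr (q - 2) + d powr (- 2)"
        unfolding D.B0_def d_def ..
      then show ?thesis using A B C b3 by linarith
    qed
    also have "\<dots> \<le> 32 * 8 ^ j / \<sigma> + 256 * G0\<^sup>2 * 8 ^ j / \<sigma> + 16 * 8 ^ j / \<sigma>"
      using up[of "256 * G0\<^sup>2 * 8 ^ j"] up[of "16 * 8 ^ j"] by simp
    also have "\<dots> = (48 + 256 * G0\<^sup>2) / \<sigma> * 8 ^ j" using \<sigma> by (simp add: field_simps)
    finally show "D.B0 \<le> (48 + 256 * G0\<^sup>2) / \<sigma> * 8 ^ j" .
    show "YY M j \<ge> 0" by (rule YY_nonneg[OF M])
    then show "0 \<le> D.B0 * YY M j" using D.B0_nonneg by simp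
    show "0 \<le> 1 + \<gamma>" using q by (simp add: \<gamma>_def)
    show "0 \<le> Cst C r \<kappa>0 * d powr (\<alpha> - \<kappa>0)" unfolding Cst_def using gn CaEp k by auto
  qed
  also have "(((48 + 256 * G0\<^sup>2) / \<sigma> * 8 ^ j) * YY M j) powr (1 + \<gamma>)
      = ((48 + 256 * G0\<^sup>2) / \<sigma>) powr (1 + \<gamma>) * (8 powr (1 + \<gamma>)) ^ j * YY M j powr (1 + \<gamma>)"
  proof -
    have "(8 ^ j) powr (1 + \<gamma>) = (8 powr (1 + \<gamma>)) ^ j"
      by (simp add: powr_powr mult.commute flip: powr_realpow)
    then show ?thesis by (simp only: powr_mult)
  qed
  also have "d powr (\<alpha> - \<kappa>0) = M powr (\<alpha> - \<kappa>0) * 4 powr (\<kappa>0 - \<alpha>) * (2 powr (\<kappa>0 - \<alpha>)) ^ j"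
  proof -
    define N where "N = (2::real) ^ (j + 2)"
    have N: "N = 4 * 2 ^ j" by (simp add: N_def power_add)
    have "d powr (\<alpha> - \<kappa>0) = M powr (\<alpha> - \<kappa>0) / N powr (\<alpha> - \<kappa>0)"
      unfolding d_def N_def[symmetric] by (rule powr_divide)
    also have "\<dots> = M powr (\<alpha> - \<kappa>0) * N powr (- (\<alpha> - \<kappa>0))"
      by (simp only: powr_minus divide_inverse)
    also have "N powr (- (\<alpha> - \<kappa>0)) = (4::real) powr (\<kappa>0 - \<alpha>) * (2 ^ j) powr (\<kappa>0 - \<alpha>)"
      unfolding N minus_diff_eq by (simp only: powr_mult)
    also have "((2::real) ^ j) powr (\<kappa>0 - \<alpha>) = (2 powr (\<kappa>0 - \<alpha>)) ^ j"
      by (simp add: powr_powr mult.commute flip: powr_realpow)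
    finally show ?thesis by simp
  qed
  finally show ?thesis by (simp add: power_mult_distrib mult_ac)
qed

text \<open>If p exceeded M at (t0, x1), by continuity it would exceed M + m on a small space-time
  box on which all cut-offs equal 1. Then every \<open>YY M j\<close> would stay above a fixed
  positive number, against \<open>degiorgi_sequence\<close>. The bound therefore holds at every
  point, not only almost everywhere.\<close>

lemma level_bound:
  assumes M: "M \<ge> 1" and r: "r * q = \<alpha> - 2 + q" and gn: "gn_bound TYPE(real^'n) C q (\<alpha> / r)" "C > 0"
    and k0: "\<kappa>0 = \<alpha> - 2 + q + \<alpha> * q / CARD('n)" "\<kappa>0 > \<alpha>" and rp: "r > 0"
  defines "\<gamma> \<equiv> q / CARD('n)"
  assumes small: "(Cst C r \<kappa>0 * (M powr (\<alpha> - \<kappa>0) * 4 powr (\<kappa>0 - \<alpha>)) * ((48 + 256 * G0\<^sup>2) / \<sigma>) powr (1 + \<gamma>))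
      * YY M 0 powr \<gamma> * (2 powr (\<kappa>0 - \<alpha>) * 8 powr (1 + \<gamma>)) powr (1 / \<gamma>) \<le> 1"
    and V: "open V" "x1 \<in> V" "V \<subseteq> U" "\<And>x. x \<in> V \<Longrightarrow> \<eta> x = 1"
  shows "p t0 x1 \<le> M"
proof (rule ccontr)
  assume "\<not> p t0 x1 \<le> M"
  define m where "m = (p t0 x1 - M) / 2"
  have m: "m > 0" "p t0 x1 > M + m" using \<open>\<not> p t0 x1 \<le> M\<close> by (auto simp: m_def field_simps)
  have CaEp: "CaE > 0" unfolding CaE_def using al k by (auto intro!: add_pos_nonneg mult_nonneg_nonneg add_nonneg_nonneg)
  have g: "\<gamma> > 0" using q by (simp add: \<gamma>_def)
  have "YY M \<longlonglongrightarrow> 0"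
  proof (rule degiorgi_sequence[OF YY_nonneg[OF M] _ _ g YY_step[OF M r gn k0 rp, folded \<gamma>_def] small])
    show "0 \<le> Cst C r \<kappa>0 * (M powr (\<alpha> - \<kappa>0) * 4 powr (\<kappa>0 - \<alpha>)) * ((48 + 256 * G0\<^sup>2) / \<sigma>) powr (1 + \<gamma>)"
      unfolding Cst_def using gn CaEp k by auto
    have "1 < (8::real) powr (1 + \<gamma>)" using g by (intro gr_one_powr) auto
    moreover have "1 \<le> (2::real) powr (\<kappa>0 - \<alpha>)" using k0 by (intro ge_one_powr_ge_zero) auto
    moreover have "1 * 8 powr (1 + \<gamma>) \<le> 2 powr (\<kappa>0 - \<alpha>) * 8 powr (1 + \<gamma>)"
      using calculation(2) by (rule mult_right_mono) simp
    ultimately show "1 < 2 powr (\<kappa>0 - \<alpha>) * 8 powr (1 + \<gamma>)" by linarith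
  qed
  define P where "P = (({0<..} \<times> U) \<inter> (\<lambda>(t, x). p t x) -` {M + m<..}) \<inter> (UNIV \<times> V)"
  have "open P" unfolding P_def using fl V U
    by (intro open_Int continuous_open_preimage open_Times) (auto simp: flow_def)
  moreover have "(t0, x1) \<in> P" using m \<sigma> V by (auto simp: P_def)
  ultimately obtain A1 A2 where A: "open A1" "open A2" "(t0, x1) \<in> A1 \<times> A2" "A1 \<times> A2 \<subseteq> P"
    by (rule open_prod_elim)
  have A3: "t0 \<in> A1" "x1 \<in> A2" using A(3) by auto
  obtain e where e: "e > 0" "ball t0 e \<subseteq> A1" by (rule openE[OF A(1) A3(1)])
  obtain a b where ab': "cbox a b \<subseteq> A2" "x1 \<in> box a b" "\<forall>i\<in>Basis. a \<bullet> i < b \<bullet> i"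
    by (rule open_contains_cbox[OF A(2) A3(2)])
  note ab = ab'(2,1)
  \<comment> \<open>At most \<sigma> / 2, which keeps the time slab inside the region where the ramp
    equals 1.\<close>
  define \<epsilon> where "\<epsilon> = min (e / 2) (\<sigma> / 2)"
  have \<epsilon>: "\<epsilon> > 0" "\<epsilon> < e" "\<epsilon> \<le> \<sigma> / 2" using e \<sigma> by (auto simp: \<epsilon>_def min_def)
  have "x \<in> V" if "x \<in> cbox a b" for x
  proof -
    have "(t0, x) \<in> A1 \<times> A2" using that ab(2) A3 by auto
    then have "(t0, x) \<in> P" using A(4) by blast
    then show ?thesis by (simp add: P_def)
  qed
  then have Q: "cbox a b \<subseteq> V" "cbox a b \<subseteq> U" "cbox a b \<subseteq> cbox lo hi" using V(3) U(4) by auto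
  have cont: "measure lborel (cbox a b) > 0"
    using ab'(3) by (rule content_pos_lt)
  have lower: "\<epsilon> * (m powr \<alpha> * measure lborel (cbox a b)) \<le> YY M j" for j
  proof -
    interpret D: degiorgi_step U S lo hi "t0 - \<sigma>" t0 "\<lambda>t x. p t x - M * (1 - 1 / 2 ^ j) - M / 2 ^ (j + 2)" pt gp K
       "\<zeta> j" "\<zeta>t j" "g\<zeta> j" \<alpha> "M / 2 ^ (j + 2)" "\<xi> j" "\<xi> (Suc j)" q k1 k2 k3 "2 ^ (j + 3) * G0" "2 ^ (j + 5) / \<sigma>"
      by (rule step_instance[OF M])
    have Y: "YY M j = integral I D.W" unfolding D.W_def YY_def by simp
    have sub: "{t0 - \<epsilon>..t0} \<subseteq> I" using \<epsilon> \<sigma> by auto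
    have "m powr \<alpha> * measure lborel (cbox a b) \<le> D.W t" if t: "t \<in> {t0 - \<epsilon>..t0}" for t
    proof -
      have tI: "t \<in> I" using t sub by auto
      have "ramp t = 1" unfolding ramp_def using t \<epsilon> \<sigma> by (intro smoothstep_simps(2)) (auto simp: field_simps)
      have xi1: "\<xi> j t x = 1" if "x \<in> cbox a b" for x
      proof -
        have "\<Theta> t x = 1" using that Q V(4) \<open>ramp t = 1\<close> by (auto simp: \<Theta>_def)
        then show ?thesis unfolding \<xi>_def by (intro smoothstep_simps(2)) (simp add: cc_def power_add)
      qed
      have pm: "p t x > M + m" if "x \<in> cbox a b" for x
      proof -
        have "t \<in> ball t0 e" using t \<epsilon> by (auto simp: dist_real_def)
        then have "(t, x) \<in> A1 \<times> A2" using that e(2) ab(2) by blast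
        then have "(t, x) \<in> P" using A(4) by blast
        then show ?thesis by (auto simp: P_def)
      qed
      define f where "f = ext U (\<lambda>x. \<xi> j t x * max 0 (p t x - M * (1 - 1 / 2 ^ j)) powr \<alpha>)"
      have f: "D.W t = integral (cbox lo hi) f" unfolding D.W_def f_def by simp
      have fi: "f integrable_on cbox l' h'" for l' h'
        unfolding f_def using D.W_slice_cont[OF tI] D.xi_zero[OF tI] by (intro D.ext_int) auto
      have f0: "f x \<ge> 0" for x unfolding f_def ext_def by (auto simp: \<xi>_def smoothstep_range)
      have "m powr \<alpha> * measure lborel (cbox a b) = integral (cbox a b) (\<lambda>_. m powr \<alpha>)" by simp
      also have "\<dots> \<le> integral (cbox a b) f"
      proof (rule integral_le[OF integrable_const fi])
        fix x assume x: "x \<in> cbox a b"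
        have "M * (1 - 1 / 2 ^ j) \<le> M * 1" using M by (intro mult_left_mono) auto
        then have "m \<le> max 0 (p t x - M * (1 - 1 / 2 ^ j))" using pm[OF x] by simp
        then have "m powr \<alpha> \<le> max 0 (p t x - M * (1 - 1 / 2 ^ j)) powr \<alpha>" using m al by (intro powr_mono2) auto
        then show "m powr \<alpha> \<le> f x" using Q(2) x by (auto simp: f_def ext_def xi1)
      qed
      also have "\<dots> \<le> integral (cbox lo hi) f"
        using f0 Q(3) fi by (intro integral_subset_le) auto
      finally show ?thesis unfolding f .
    qed
    moreover define Wf where "Wf = D.W"
    ultimately have W_ge: "m powr \<alpha> * measure lborel (cbox a b) \<le> Wf t" if "t \<in> {t0 - \<epsilon>..t0}" for t
      using that by simp
    have Wi: "Wf integrable_on {t0 - \<epsilon>..t0}" "Wf integrable_on I"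
      unfolding Wf_def by (intro integrable_continuous_real continuous_on_subset[OF D.W_cont] sub order_refl)+
    have W0: "Wf t \<ge> 0" if "t \<in> I" for t unfolding Wf_def by (rule D.W_nonneg[OF that])
    have "integral {t0 - \<epsilon>..t0} (\<lambda>t. m powr \<alpha> * measure lborel (cbox a b)) \<le> integral {t0 - \<epsilon>..t0} Wf"
      by (rule integral_le[OF _ Wi(1) W_ge]) auto
    also have "\<dots> \<le> integral I Wf"
      by (rule integral_subset_le[OF sub Wi]) (use W0 in blast)
    finally show ?thesis using Y \<epsilon> by (simp add: Wf_def mult_ac)
  qed
  have "\<epsilon> * (m powr \<alpha> * measure lborel (cbox a b)) \<le> 0"
    by (rule LIMSEQ_le_const[OF \<open>YY M \<longlonglongrightarrow> 0\<close>]) (use lower in auto)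
  moreover have "\<epsilon> * (m powr \<alpha> * measure lborel (cbox a b)) > 0" using \<epsilon> m cont by simp
  ultimately show False by simp
qed

end

section \<open>The global energy inequality\<close>

text \<open>The weight \<delta> is free. Used pointwise with a \<delta> that is constant in x and
  then integrated, it gives Hoelder's inequality up to a factor 2.\<close>

lemma weighted_young:
  assumes "(x::real) \<ge> 0" "y \<ge> 0" "\<delta> > 0" "0 \<le> s" "s < 1"
  shows "x powr s * y powr (1 - s) \<le> \<delta> powr (1 - s) * x + \<delta> powr (- s) * y"
proof (cases "x = 0 \<or> y = 0")
  case False
  then have xy: "x > 0" "y > 0" using assms by auto
  show ?thesis
  proof (cases "y \<le> \<delta> * x")
    case True
    have "x powr s * y powr (1 - s) \<le> x powr s * (\<delta> * x) powr (1 - s)"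
      using True xy assms by (intro mult_left_mono powr_mono2) auto
    also have "\<dots> = \<delta> powr (1 - s) * x" using xy assms by (simp add: powr_mult flip: powr_add)
    also have "\<dots> \<le> \<delta> powr (1 - s) * x + \<delta> powr (- s) * y" using xy by simp
    finally show ?thesis .
  next
    case False
    then have "x \<le> y / \<delta>" using assms by (simp add: field_simps)
    then have "x powr s * y powr (1 - s) \<le> (y / \<delta>) powr s * y powr (1 - s)"
      using xy assms by (intro mult_right_mono powr_mono2) auto
    also have "\<dots> = (y powr s * y powr (1 - s)) / \<delta> powr s" using xy assms by (simp add: powr_divide)
    also have "y powr s * y powr (1 - s) = y" using xy by (simp flip: powr_add)
    also have "y / \<delta> powr s = \<delta> powr (- s) * y" by (simp add: powr_minus_divide)
    also have "\<dots> \<le> \<delta> powr (1 - s) * x + \<delta> powr (- s) * y" using xy by simp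
    finally show ?thesis .
  qed
qed (use assms in auto)

text \<open>The choice \<delta> = G / F balances the two terms, each being equal to the interpolated
  product.\<close>

lemma weighted_young_opt:
  assumes "(F::real) > 0" "G > 0" "0 \<le> s" "s < 1"
  shows "(G / F) powr (1 - s) * F + (G / F) powr (- s) * G = 2 * (F powr s * G powr (1 - s))"
proof -
  have "(G / F) powr (1 - s) * F = G powr (1 - s) * F powr s"
    using assms by (simp add: powr_divide powr_diff)
  moreover have "(G / F) powr (- s) * G = F powr s * G powr (1 - s)"
    using assms by (simp add: powr_divide powr_diff powr_minus field_simps)
  ultimately show ?thesis by simp
qed

lemma emeasure_lebesgue_on_finite:
  assumes "open U" "bounded (U :: 'a::euclidean_space set)"
  shows "emeasure (lebesgue_on U) U < \<infinity>"
proof -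
  have Ul: "U \<in> sets lebesgue" using assms(1) by (simp add: lborelD)
  have "emeasure lebesgue U < \<infinity>"
    using fmeasurableD2[OF lmeasurable_open[OF assms(2,1)]] by (simp add: top.not_eq_extremum)
  moreover have "emeasure (lebesgue_on U) U = emeasure lebesgue U"
    by (rule emeasure_restrict_space) (use Ul in auto)
  ultimately show ?thesis by simp
qed

text \<open>Bridge between the gauge integral over the box, used for the calculus, and the Lebesgue
  integral over U used in \<open>Afun\<close> and \<open>Lnorm\<close>. Integrability holds because
  f vanishes off a compact subset of U.\<close>

lemma (in energy_setting) ext_lebesgue:
  assumes "continuous_on U f" "\<And>x. x \<in> U - S \<Longrightarrow> f x = (0::real)"
  shows "integral B (ext U f) = integral\<^sup>L (lebesgue_on U) f" "integrable (lebesgue_on U) f"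
proof -
  have Ul: "U \<in> sets lebesgue" using U(1) by (simp add: lborelD)
  have fS: "f x = 0 \<or> x \<in> S" if "x \<in> U" for x using assms(2) that by blast
  have cS: "compact S" using U by (meson bounded_cbox bounded_subset compact_eq_bounded_closed)
  have "compact (f ` S)" using U by (intro compact_continuous_image[OF continuous_on_subset[OF assms(1)] cS])
  then obtain M where M: "\<And>x. x \<in> S \<Longrightarrow> norm (f x) \<le> M"
    by (meson bounded_iff compact_imp_bounded imageI)
  show i: "integrable (lebesgue_on U) f"
  proof (rule integrableI_bounded_set[where A=U and B="max 0 M"])
    show "f \<in> borel_measurable (lebesgue_on U)"
      using Ul assms(1) by (intro continuous_imp_measurable_on_sets_lebesgue) auto
    show "emeasure (lebesgue_on U) U < \<infinity>"
      using U bounded_subset[OF bounded_cbox] by (intro emeasure_lebesgue_on_finite)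
    show "AE x\<in>U in lebesgue_on U. norm (f x) \<le> max 0 M"
      using fS M by (intro AE_I2) (force simp: le_max_iff_disj)
  qed (use Ul in auto)
  have "integral\<^sup>L (lebesgue_on U) f = integral U f" by (rule lebesgue_integral_eq_integral[OF i Ul])
  also have "\<dots> = integral B (ext U f)"
    unfolding ext_def[abs_def] using U(4) by (subst integral_restrict_Int) (simp add: Int_absorb2)
  finally show "integral B (ext U f) = integral\<^sup>L (lebesgue_on U) f" ..
qed

lemma integrable_bounded_continuous:
  fixes f :: "'a::euclidean_space \<Rightarrow> real"
  assumes U: "open U" "bounded U" and f: "continuous_on (closure U) f"
  shows "integrable (lebesgue_on U) f"
proof -
  have Ul: "U \<in> sets lebesgue" using U(1) by (simp add: lborelD)
  have "compact (f ` closure U)" using U by (intro compact_continuous_image[OF f]) simp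
  then obtain M where M: "\<And>x. x \<in> closure U \<Longrightarrow> norm (f x) \<le> M"
    by (meson bounded_iff compact_imp_bounded imageI)
  show ?thesis
  proof (rule integrableI_bounded_set[where A=U and B=M])
    show "f \<in> borel_measurable (lebesgue_on U)"
      using Ul continuous_on_subset[OF f closure_subset] by (intro continuous_imp_measurable_on_sets_lebesgue) auto
    show "emeasure (lebesgue_on U) U < \<infinity>"
      using U by (intro emeasure_lebesgue_on_finite)
    show "AE x\<in>U in lebesgue_on U. norm (f x) \<le> M"
      using M closure_subset by (intro AE_I2) blast
  qed (use Ul in auto)
qed

locale global_setting =
  fixes U :: "(real^'n) set" and lo hi :: "real^'n" and \<alpha> q k1 k2 k3 :: real and K
    and p :: "real \<Rightarrow> real^'n \<Rightarrow> real" and gp pt and \<Psi> :: "real \<Rightarrow> real^'n \<Rightarrow> real" and g\<Psi> \<Psi>t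
  assumes U: "open U" "U \<subseteq> cbox lo hi" and al: "\<alpha> \<ge> 2"
    and q: "1 < q" "q < 2" and k: "k1 > 0" "k2 > 0" "k3 > 0"
    and K1: "\<And>X. X \<ge> 0 \<Longrightarrow> K X * X\<^sup>2 \<ge> k1 * X powr q - k2"
    and K2: "\<And>X. X \<ge> 0 \<Longrightarrow> K X * X \<le> k3 * X powr (q - 1)"
    and K3: "\<And>X. X \<ge> 0 \<Longrightarrow> K X \<ge> 0"
    and fl: "flow U K p gp pt" and p_cont: "continuous_on ({0..} \<times> closure U) (\<lambda>(t, x). p t x)"
    and Psi_x: "\<And>t x. t > 0 \<Longrightarrow> x \<in> U \<Longrightarrow> (\<Psi> t has_derivative (\<lambda>h. g\<Psi> t x \<bullet> h)) (at x)"
    and Psi_t: "\<And>t x. t > 0 \<Longrightarrow> x \<in> U \<Longrightarrow> ((\<lambda>s. \<Psi> s x) has_real_derivative \<Psi>t t x) (at t)"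
    and Psi_cont: "continuous_on ({0..} \<times> closure U) (\<lambda>(t, x). \<Psi> t x)"
      "continuous_on ({0..} \<times> closure U) (\<lambda>(t, x). g\<Psi> t x)" "continuous_on ({0..} \<times> closure U) (\<lambda>(t, x). \<Psi>t t x)"
    and bd: "\<And>t x. t > 0 \<Longrightarrow> x \<in> frontier U \<Longrightarrow> p t x = \<Psi> t x"
begin

text \<open>Subtracting 1 lifts the truncation strictly above the boundary values, so the set where
  u is positive keeps away from the frontier.\<close>

definition "u t x = p t x - \<Psi> t x - 1"
definition "z t = integral (cbox lo hi) (ext U (\<lambda>x. phi0 \<alpha> 1 (u t x)))"
text \<open>The summand 1 keeps the quantities positive, as the optimal weights of
  \<open>weighted_young_opt\<close> require.\<close>

definition "G1 t = 1 + integral\<^sup>L (lebesgue_on U) (\<lambda>x. norm (g\<Psi> t x) powr (\<alpha> * q / 2))"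
definition "H1 t = 1 + integral\<^sup>L (lebesgue_on U) (\<lambda>x. \<bar>\<Psi>t t x\<bar> powr \<alpha>)"
definition "mU = measure lebesgue U"
text \<open>By \<open>phi_w_bound\<close> an upper bound for the integral of u_+ powr \<alpha> over
  U.\<close>

definition "F t = 2 * z t + mU + 1"

lemma bU: "bounded U" using U(2) bounded_subset bounded_cbox by blast

text \<open>The set where p - \<Psi> \<ge> 1 is compact in [T1,T2] times the closure of U, and it
  misses the frontier, where p = \<Psi>. Its spatial projection serves as S. T1 > 0 is required
  because the boundary condition holds for positive times.\<close>

lemma compact_support:
  assumes "0 < T1"
  obtains S where "compact S" "S \<subseteq> U" "\<And>t x. t \<in> {T1..T2} \<Longrightarrow> x \<in> U - S \<Longrightarrow> u t x \<le> 0"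
proof
  define Z where "Z = {y \<in> {T1..T2} \<times> closure U. (case y of (t, x) \<Rightarrow> p t x - \<Psi> t x) \<in> {1..}}"
  have "closed Z" unfolding Z_def
  proof (rule continuous_closed_preimage[of "{T1..T2} \<times> closure U" _ "{1..}", unfolded vimage_def Int_def mem_Collect_eq])
    show "continuous_on ({T1..T2} \<times> closure U) (\<lambda>y. case y of (t, x) \<Rightarrow> p t x - \<Psi> t x)"
      using assms by (auto simp: split_beta intro!: continuous_on_diff
          continuous_on_subset[OF p_cont[unfolded split_beta]] continuous_on_subset[OF Psi_cont(1)[unfolded split_beta]])
  qed (auto intro!: closed_Times)
  moreover have "bounded Z"
    by (rule bounded_subset[of "{T1..T2} \<times> closure U"]) (auto simp: Z_def bU intro!: bounded_Times)
  ultimately have "compact Z" using compact_eq_bounded_closed by blast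
  then show "compact (snd ` Z)" by (intro compact_continuous_image continuous_intros)
  show "snd ` Z \<subseteq> U"
  proof
    fix x assume "x \<in> snd ` Z"
    then obtain t where t: "t \<in> {T1..T2}" "x \<in> closure U" "p t x - \<Psi> t x \<ge> 1" by (auto simp: Z_def)
    then have "x \<notin> frontier U" using bd[of t x] assms by force
    then show "x \<in> U" using t(2) U(1) by (simp add: frontier_def interior_open)
  qed
  fix t x assume tx: "t \<in> {T1..T2}" "x \<in> U - snd ` Z"
  then have "(t, x) \<notin> Z" by force
  then have "\<not> p t x - \<Psi> t x \<ge> 1" using tx closure_subset[of U] by (auto simp: Z_def)
  then show "u t x \<le> 0" by (simp add: u_def)
qed

text \<open>The cut-off is identically 1; compact support comes from u alone.\<close>

lemma energy_instance:
  assumes T: "0 < T1" and S: "compact S" "S \<subseteq> U" "\<And>t x. t \<in> {T1..T2} \<Longrightarrow> x \<in> U - S \<Longrightarrow> u t x \<le> 0"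
  shows "energy_setting U S lo hi {T1..T2} u (\<lambda>t x. pt t x - \<Psi>t t x) (\<lambda>t x. gp t x - g\<Psi> t x)
    (\<lambda>t x. K (norm (gp t x)) *\<^sub>R gp t x) pt (\<lambda>t x. 1) (\<lambda>t x. 0) (\<lambda>t x. 0) \<alpha> 1"
proof
  note f = fl[unfolded flow_def]
  have sub: "{T1..T2} \<times> U \<subseteq> {0<..} \<times> U" "{T1..T2} \<times> U \<subseteq> {0..} \<times> closure U" using T closure_subset by auto
  have fc: "continuous_on ({T1..T2} \<times> U) (\<lambda>(t, x). p t x)" "continuous_on ({T1..T2} \<times> U) (\<lambda>(t, x). gp t x)" "continuous_on ({T1..T2} \<times> U) (\<lambda>(t, x). pt t x)"
    using f continuous_on_subset[OF _ sub(1)] by blast+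
  note gc = continuous_on_subset[OF Psi_cont(1) sub(2)] continuous_on_subset[OF Psi_cont(2) sub(2)] continuous_on_subset[OF Psi_cont(3) sub(2)]
  show "open U" "closed S" "S \<subseteq> U" "U \<subseteq> cbox lo hi" "\<alpha> \<ge> 2" "convex {T1..T2}" "(0::real) < 1"
    using U S al by (auto intro: compact_imp_closed)
  show "continuous_on ({T1..T2} \<times> U) (\<lambda>(t, x). u t x)"
    using fc(1) gc(1) by (auto simp: u_def split_beta intro!: continuous_intros)
  show "continuous_on ({T1..T2} \<times> U) (\<lambda>(t, x). gp t x - g\<Psi> t x)" "continuous_on ({T1..T2} \<times> U) (\<lambda>(t, x). pt t x - \<Psi>t t x)"
    using fc gc by (auto simp: split_beta intro!: continuous_intros)
  show "continuous_on ({T1..T2} \<times> U) (\<lambda>(t, x). pt t x)" by (rule fc(3))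
  show "continuous_on ({T1..T2} \<times> U) (\<lambda>(t, x). 1::real)" "continuous_on ({T1..T2} \<times> U) (\<lambda>(t, x). 0::real^'n)" "continuous_on ({T1..T2} \<times> U) (\<lambda>(t, x). 0::real)"
    by (auto simp: split_beta)
  fix t x
  show "(u t has_derivative (\<bullet>) (gp t x - g\<Psi> t x)) (at x)" if "t \<in> {T1..T2}" "x \<in> U"
  proof -
    have "(p t has_derivative (\<lambda>h. gp t x \<bullet> h)) (at x)" "(\<Psi> t has_derivative (\<lambda>h. g\<Psi> t x \<bullet> h)) (at x)"
      using f Psi_x that T by auto
    from has_derivative_diff[OF has_derivative_diff[OF this] has_derivative_const[of 1]] show ?thesis
      unfolding u_def[abs_def] by (rule has_derivative_eq_rhs) (simp add: fun_eq_iff inner_diff_left)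
  qed
  show "((\<lambda>s. u s x) has_real_derivative pt t x - \<Psi>t t x) (at t within {T1..T2})" if "t \<in> {T1..T2}" "x \<in> U"
  proof -
    have "((\<lambda>s. p s x) has_real_derivative pt t x) (at t)" "((\<lambda>s. \<Psi> s x) has_real_derivative \<Psi>t t x) (at t)" using f Psi_t that T by auto
    from DERIV_diff[OF DERIV_diff[OF this] DERIV_const[of 1]] show ?thesis
      unfolding u_def by (simp add: has_field_derivative_at_within)
  qed
  show "((\<lambda>x. 1::real) has_derivative (\<bullet>) 0) (at x)"
    by (rule has_derivative_eq_rhs[OF has_derivative_const]) auto
  show "((\<lambda>s. 1) has_real_derivative 0) (at t within {T1..T2})" by simp
  show "\<exists>DF. \<forall>x\<in>U. ((\<lambda>x. K (norm (gp t x)) *\<^sub>R gp t x) has_derivative DF x) (at x) \<and> pt t x = (\<Sum>i\<in>UNIV. DF x (axis i 1) $ i)" if "t \<in> {T1..T2}"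
    using f that T by auto
  show "(1::real) = 0 \<or> u t x \<le> 0" if "t \<in> {T1..T2}" "x \<in> U - S" using S(3)[OF that] by simp
qed auto

end

text \<open>\<open>weighted_young\<close> for F powr \<theta> and G powr \<nu>, with the weight
  tuned so that the first coefficient is at most \<epsilon>. For \<theta> = (\<alpha> - a)/\<alpha>
  and s = (\<alpha> - 2)/\<alpha> or (\<alpha> - 1)/\<alpha>, the exponent \<nu> is the first or the
  second outer exponent in \<open>Afun\<close>.\<close>

lemma absorb_powr:
  fixes A \<epsilon> s \<theta> \<nu> :: real
  assumes "A \<ge> 0" "\<epsilon> > 0" "0 \<le> s" "s < \<theta>" and \<nu>: "\<nu> = (1 - s) / (1 - s / \<theta>)"
  shows "\<exists>C\<ge>0. \<forall>F>0. \<forall>G>0. A * (F powr s * G powr (1 - s)) \<le> \<epsilon> * F powr \<theta> + C * G powr \<nu>"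
proof -
  define \<sigma> where "\<sigma> = s / \<theta>"
  have "\<theta> > 0" using assms by linarith
  then have \<sigma>: "0 \<le> \<sigma>" "\<sigma> < 1" using assms by (simp_all add: \<sigma>_def)
  \<comment> \<open>The denominator is A + 1 because A may be 0.\<close>
  define \<delta> where "\<delta> = (\<epsilon> / (A + 1)) powr (1 / (1 - \<sigma>))"
  have \<delta>: "\<delta> > 0" using assms by (simp add: \<delta>_def)
  have \<delta>1: "A * \<delta> powr (1 - \<sigma>) \<le> \<epsilon>"
  proof -
    have e: "\<delta> powr (1 - \<sigma>) = \<epsilon> / (A + 1)" using \<sigma> assms by (simp add: \<delta>_def powr_powr)
    show ?thesis unfolding e using assms(1,2) by (simp add: field_simps)
  qed
  show ?thesis
  proof (intro exI[of _ "A * \<delta> powr (- \<sigma>)"] conjI allI impI)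
    show "0 \<le> A * \<delta> powr (- \<sigma>)" using assms by simp
    fix F G :: real assume FG: "F > 0" "G > 0"
    have "F powr s = (F powr \<theta>) powr \<sigma>" using assms by (simp add: powr_powr \<sigma>_def)
    moreover have "G powr (1 - s) = (G powr \<nu>) powr (1 - \<sigma>)"
    proof -
      have "\<nu> * (1 - \<sigma>) = 1 - s" unfolding \<nu> \<sigma>_def[symmetric] using \<sigma> by simp
      then show ?thesis by (simp only: powr_powr)
    qed
    ultimately have "F powr s * G powr (1 - s) \<le> \<delta> powr (1 - \<sigma>) * F powr \<theta> + \<delta> powr (- \<sigma>) * G powr \<nu>"
      using weighted_young[of "F powr \<theta>" "G powr \<nu>" \<delta> \<sigma>] \<delta> \<sigma> by simp
    then have "A * (F powr s * G powr (1 - s)) \<le> A * (\<delta> powr (1 - \<sigma>) * F powr \<theta> + \<delta> powr (- \<sigma>) * G powr \<nu>)"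
      using assms by (intro mult_left_mono)
    also have "\<dots> = (A * \<delta> powr (1 - \<sigma>)) * F powr \<theta> + A * \<delta> powr (- \<sigma>) * G powr \<nu>" by (simp add: distrib_left)
    also have "\<dots> \<le> \<epsilon> * F powr \<theta> + A * \<delta> powr (- \<sigma>) * G powr \<nu>"
      using \<delta>1 by (intro add_right_mono mult_right_mono) auto
    finally show "A * (F powr s * G powr (1 - s)) \<le> \<epsilon> * F powr \<theta> + A * \<delta> powr (- \<sigma>) * G powr \<nu>" .
  qed
qed

text \<open>The hypothesis splits z at an arbitrary level l. Choosing l with b l powr \<alpha> = z /
  2 absorbs the first term, and what remains is a lower bound for D by a power of z. If z \<le> 2 b
  this l may drop below 1, but then the constant term is enough.\<close>

lemma dissipation_lower:
  fixes z :: real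
  assumes b: "b > 0" and al: "\<alpha> > 0" and z: "z \<ge> 0" and D: "D \<ge> 0" "C3 \<ge> 0" and th: "\<theta> = \<kappa>0 / \<alpha> - \<gamma>" "\<theta> > 0"
    and h: "\<And>l. l \<ge> 1 \<Longrightarrow> z \<le> b * l powr \<alpha> + l powr (\<alpha> - \<kappa>0) * C3 * z powr \<gamma> * D"
  shows "z powr \<theta> \<le> (2 * b) powr \<theta> + 2 * (2 * b) powr ((\<kappa>0 - \<alpha>) / \<alpha>) * C3 * D"
proof (cases "z \<le> 2 * b")
  case True
  then have "z powr \<theta> \<le> (2 * b) powr \<theta>" using z th by (intro powr_mono2) auto
  moreover have "0 \<le> 2 * (2 * b) powr ((\<kappa>0 - \<alpha>) / \<alpha>) * C3 * D" using D by auto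
  ultimately show ?thesis by linarith
next
  case False
  define l where "l = (z / (2 * b)) powr (1 / \<alpha>)"
  have zb: "z / (2 * b) \<ge> 1" using False b by (simp add: field_simps)
  have l1: "l \<ge> 1" unfolding l_def using zb al by (intro ge_one_powr_ge_zero) auto
  have "l powr \<alpha> = (z / (2 * b)) powr 1" using al by (simp add: l_def powr_powr)
  also have "\<dots> = z / (2 * b)" using zb by (intro powr_one) linarith
  finally have la: "l powr \<alpha> = z / (2 * b)" .
  have lk: "l powr (\<alpha> - \<kappa>0) = (z / (2 * b)) powr ((\<alpha> - \<kappa>0) / \<alpha>)" by (simp add: l_def powr_powr)
  have zp: "z > 0" using False b by simp
  have "z / 2 \<le> (z / (2 * b)) powr ((\<alpha> - \<kappa>0) / \<alpha>) * C3 * z powr \<gamma> * D"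
    using h[OF l1] b unfolding la lk by simp
  also have "(z / (2 * b)) powr ((\<alpha> - \<kappa>0) / \<alpha>) = z powr ((\<alpha> - \<kappa>0) / \<alpha>) * (2 * b) powr ((\<kappa>0 - \<alpha>) / \<alpha>)"
  proof -
    have "(z / (2 * b)) powr ((\<alpha> - \<kappa>0) / \<alpha>) = z powr ((\<alpha> - \<kappa>0) / \<alpha>) / (2 * b) powr ((\<alpha> - \<kappa>0) / \<alpha>)"
      using zp b by (simp add: powr_divide)
    also have "\<dots> = z powr ((\<alpha> - \<kappa>0) / \<alpha>) * (2 * b) powr (- ((\<alpha> - \<kappa>0) / \<alpha>))"
      unfolding powr_minus divide_inverse ..
    also have "- ((\<alpha> - \<kappa>0) / \<alpha>) = (\<kappa>0 - \<alpha>) / \<alpha>" by (simp add: minus_divide_left)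
    finally show ?thesis .
  qed
  finally have "z \<le> z powr ((\<alpha> - \<kappa>0) / \<alpha> + \<gamma>) * (2 * (2 * b) powr ((\<kappa>0 - \<alpha>) / \<alpha>) * C3 * D)"
    by (simp add: powr_add mult_ac)
  then have "z powr (\<theta> - 1) * z \<le> z powr (\<theta> - 1) * (z powr ((\<alpha> - \<kappa>0) / \<alpha> + \<gamma>) * (2 * (2 * b) powr ((\<kappa>0 - \<alpha>) / \<alpha>) * C3 * D))"
    by (intro mult_left_mono) auto
  also have "\<dots> = (z powr (\<theta> - 1) * z powr ((\<alpha> - \<kappa>0) / \<alpha> + \<gamma>)) * (2 * (2 * b) powr ((\<kappa>0 - \<alpha>) / \<alpha>) * C3 * D)" by simp
  also have "z powr (\<theta> - 1) * z powr ((\<alpha> - \<kappa>0) / \<alpha> + \<gamma>) = z powr 0"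
  proof -
    have "\<theta> - 1 + ((\<alpha> - \<kappa>0) / \<alpha> + \<gamma>) = 0" using al by (simp add: th(1) diff_divide_distrib)
    then show ?thesis by (simp only: powr_add[symmetric])
  qed
  also have "z powr (\<theta> - 1) * z = z powr \<theta>" using zp by (simp add: powr_diff)
  finally have "z powr \<theta> \<le> 2 * (2 * b) powr ((\<kappa>0 - \<alpha>) / \<alpha>) * C3 * D" using zp by simp
  then show ?thesis by (simp add: add_increasing)
qed

context global_setting
begin

definition "c0 = k1 / 2 * 2 powr (- q)"
definition "C0 = k1 / 2 + (k1 / 2) powr (1 - q) * k3 powr q"

text \<open>Coercivity in the gradient X of p must become coercivity in X - g, where g is the
  gradient of \<Psi>. The cross term is absorbed by Young with half of k1, and the other half is
  passed to X - g through the triangle inequality for q-th powers.\<close>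

lemma flux_bound:
  fixes X :: "real^'n"
  shows "- ((K (norm X) *\<^sub>R X) \<bullet> (X - g)) \<le> - c0 * norm (X - g) powr q + k2 + C0 * norm g powr q"
proof -
  define x y where "x = norm X" and "y = norm g"
  have xy: "x \<ge> 0" "y \<ge> 0" by (auto simp: x_def y_def)
  have "- ((K (norm X) *\<^sub>R X) \<bullet> (X - g)) = - (K x * x\<^sup>2) + K x * (X \<bullet> g)"
    by (simp add: x_def inner_diff_right power2_norm_eq_inner algebra_simps)
  also have "K x * (X \<bullet> g) \<le> K x * (x * y)"
    using norm_cauchy_schwarz[of X g] K3[OF xy(1)] by (intro mult_left_mono) (auto simp: x_def y_def)
  also have "K x * (x * y) = (K x * x) * y" by simp
  also have "\<dots> \<le> (k3 * x powr (q - 1)) * y" using K2[OF xy(1)] xy by (intro mult_right_mono)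
  also have "\<dots> = x powr (q - 1) * (k3 * y)" by simp
  also have "\<dots> \<le> k1 / 2 * x powr q + (k1 / 2) powr (1 - q) * (k3 * y) powr q"
    using xy k q by (intro young_powr) auto
  also have "(k3 * y) powr q = k3 powr q * y powr q" using xy k by (simp add: powr_mult)
  finally have 1: "- ((K (norm X) *\<^sub>R X) \<bullet> (X - g)) \<le> - (k1 / 2 * x powr q) + k2 + (k1 / 2) powr (1 - q) * (k3 powr q * y powr q)"
    using K1[OF xy(1)] by simp
  have "norm (X - g) powr q \<le> (x + y) powr q"
    using norm_triangle_ineq4[of X g] q by (intro powr_mono2) (auto simp: x_def y_def)
  also have "\<dots> \<le> 2 powr q * (x powr q + y powr q)" using xy q by (intro powr_add_le) auto
  finally have "2 powr (- q) * norm (X - g) powr q \<le> 2 powr (- q) * (2 powr q * (x powr q + y powr q))"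
    by (intro mult_left_mono) auto
  also have "\<dots> = x powr q + y powr q" by (simp add: mult.assoc[symmetric] flip: powr_add)
  finally have "k1 / 2 * (2 powr (- q) * norm (X - g) powr q) \<le> k1 / 2 * (x powr q + y powr q)"
    using k by (intro mult_left_mono) auto
  then show ?thesis using 1 by (simp add: c0_def C0_def y_def algebra_simps)
qed

lemma phi_w_bound: "max 0 s powr \<alpha> \<le> 2 * phi0 \<alpha> 1 s + 1"
proof (cases "s \<ge> 1")
  case True
  then have "1/2 \<le> s / (1 + s)" by (simp add: field_simps)
  then have "s powr \<alpha> * (1/2) \<le> s powr \<alpha> * (s / (1 + s))" by (intro mult_left_mono) auto
  moreover have "phi0 \<alpha> 1 s = s powr \<alpha> * (s / (1 + s))" using True by (intro phi0_eq) auto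
  moreover have "max 0 s powr \<alpha> = s powr \<alpha>" using True by simp
  ultimately show ?thesis by linarith
next
  case False
  then have "max 0 s powr \<alpha> \<le> 1" using al by (intro powr_le1) auto
  then show ?thesis using phi_nonneg(1)[of 1 \<alpha> s] al by simp
qed

lemma phi12_bound:
  assumes w: "w > 0"
  shows "phi2 \<alpha> 1 w \<le> (\<alpha>\<^sup>2 + \<alpha>) * w powr (\<alpha> - 2)" "phi1 \<alpha> 1 w \<le> (\<alpha> + 1) * w powr (\<alpha> - 1)"
proof -
  have m: "c * (y * (w / (1 + w))) \<le> c * y" if "c \<ge> 0" "y \<ge> 0" for c y
    using that w by (intro mult_left_mono mult_left_le) auto
  show "phi2 \<alpha> 1 w \<le> (\<alpha>\<^sup>2 + \<alpha>) * w powr (\<alpha> - 2)"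
    using phi2_bounds(2)[OF w zero_less_one al] m[of "\<alpha>\<^sup>2 + \<alpha>" "w powr (\<alpha> - 2)"] al by simp
  show "phi1 \<alpha> 1 w \<le> (\<alpha> + 1) * w powr (\<alpha> - 1)"
    using phi1_bounds(2)[OF w zero_less_one al] m[of "\<alpha> + 1" "w powr (\<alpha> - 1)"] al by simp
qed

lemma slice_cont:
  assumes "continuous_on ({0..} \<times> closure U) (\<lambda>(t, x). f t x)" "t \<ge> 0"
  shows "continuous_on (closure U) (f t)"
  using continuous_on_compose2[OF assms(1) continuous_on_Pair_left[of "closure U" t]] assms(2) by auto

lemma data_int:
  assumes "t \<ge> 0"
  shows "integrable (lebesgue_on U) (\<lambda>x. norm (g\<Psi> t x) powr (\<alpha> * q / 2))" "integrable (lebesgue_on U) (\<lambda>x. \<bar>\<Psi>t t x\<bar> powr \<alpha>)"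
    "integrable (lebesgue_on U) (\<lambda>x. 1 :: real)"
  using slice_cont[OF Psi_cont(2) assms] slice_cont[OF Psi_cont(3) assms] al q
  by (auto intro!: integrable_bounded_continuous[OF U(1) bU] continuous_on_powr_const continuous_on_norm continuous_on_rabs)

lemma data_pos: "G1 t \<ge> 1" "H1 t \<ge> 1" "mU \<ge> 0"
  unfolding G1_def H1_def mU_def by (auto intro!: Bochner_Integration.integral_nonneg)

text \<open>Testing with \<open>phi1\<close>(u) leaves three data terms, from k2, from the gradient
  and from the time derivative of \<Psi>. Each is treated pointwise by Young with a weight built
  from F and the respective data integral, so that integration produces products of powers. The last
  clause, one bound for each level l, is the input of \<open>dissipation_lower\<close>.\<close>

lemma z_inequality:
  assumes t: "t > 0" and r: "r * q = \<alpha> - 2 + q" and gn: "gn_bound TYPE(real^'n) C q (\<alpha> / r)" "C > 0"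
    and k0: "\<kappa>0 = \<alpha> - 2 + q + \<alpha> * q / CARD('n)" "\<kappa>0 > \<alpha>" and rp: "r > 0"
  obtains z' D where "(z has_real_derivative z') (at t)" "D \<ge> 0" "z t \<ge> 0"
    "z' \<le> - c0 * D + 2 * (\<alpha>\<^sup>2 + \<alpha>) * k2 * (F t powr ((\<alpha> - 2) / \<alpha>) * (mU + 1) powr (1 - (\<alpha> - 2) / \<alpha>))
      + 2 * (\<alpha>\<^sup>2 + \<alpha>) * C0 * (F t powr ((\<alpha> - 2) / \<alpha>) * G1 t powr (1 - (\<alpha> - 2) / \<alpha>))
      + 2 * (\<alpha> + 1) * (F t powr ((\<alpha> - 1) / \<alpha>) * H1 t powr (1 - (\<alpha> - 1) / \<alpha>))"
    "\<And>l. l \<ge> 1 \<Longrightarrow> z t \<le> measure lborel (cbox lo hi) * l powr \<alpha>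
       + l powr (\<alpha> - \<kappa>0) * (2 powr (\<kappa>0 / r) * (C * (2 powr q * (2 powr q + (r + 1) powr q)))) * z t powr (q / CARD('n)) * D"
proof -
  \<comment> \<open>The time interval contains t in its interior, which makes the derivative
    two-sided, and stays away from time 0, where the boundary condition is not assumed.\<close>
  obtain S where S: "compact S" "S \<subseteq> U" "\<And>s x. s \<in> {t/2..t+1} \<Longrightarrow> x \<in> U - S \<Longrightarrow> u s x \<le> 0"
    using compact_support[of "t/2" "t+1"] t by (metis half_gt_zero)
  interpret E: energy_setting U S lo hi "{t/2..t+1}" u "\<lambda>t x. pt t x - \<Psi>t t x" "\<lambda>t x. gp t x - g\<Psi> t x"
    "\<lambda>t x. K (norm (gp t x)) *\<^sub>R gp t x" pt "\<lambda>t x. 1" "\<lambda>t x. 0" "\<lambda>t x. 0" \<alpha> 1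
    by (rule energy_instance[OF _ S]) (use t in auto)
  have tI: "t \<in> {t/2..t+1}" using t by auto
  have Jz: "E.J = z" by (simp add: fun_eq_iff E.J_def z_def)
  define f where "f x = - (phi1 \<alpha> 1 (u t x) * \<Psi>t t x) - (K (norm (gp t x)) *\<^sub>R gp t x) \<bullet> (phi2 \<alpha> 1 (u t x) *\<^sub>R (gp t x - g\<Psi> t x))" for x
  have der: "(z has_real_derivative integral (cbox lo hi) (ext U f)) (at t)"
  proof -
    have "(z has_real_derivative integral (cbox lo hi) (ext U f)) (at t within {t/2..t+1})"
      using E.energy_identity[OF tI] unfolding Jz f_def by (simp add: algebra_simps)
    then show ?thesis using t by (simp add: at_within_Icc_at)
  qed
  note cE = E.ct[OF tI]
  have tc: "t \<ge> 0" using t by simp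
  have cU: "continuous_on U (\<lambda>x. g\<Psi> t x)" "continuous_on U (\<lambda>x. \<Psi>t t x)"
    using slice_cont[OF Psi_cont(2) tc] slice_cont[OF Psi_cont(3) tc] closure_subset by (auto intro: continuous_on_subset)
  have cgp: "continuous_on U (gp t)"
  proof -
    have "continuous_on U (\<lambda>x. (gp t x - g\<Psi> t x) + g\<Psi> t x)" by (intro continuous_on_add cE cU)
    then show ?thesis by simp
  qed
  have cF: "continuous_on U (\<lambda>x. K (norm (gp t x)) *\<^sub>R gp t x)"
  proof -
    obtain DF where DF: "\<And>x. x \<in> U \<Longrightarrow> ((\<lambda>x. K (norm (gp t x)) *\<^sub>R gp t x) has_derivative DF x) (at x)"
      using E.flux[OF tI] by blast
    show ?thesis using has_derivative_continuous[OF DF] by (auto intro!: continuous_at_imp_continuous_on)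
  qed
  have cf: "continuous_on U f" unfolding f_def
    by (intro continuous_on_diff continuous_on_minus continuous_on_mult continuous_on_inner[OF cF] continuous_on_scaleR E.cont_phi cE cU)
  have zS: "phi0 \<alpha> 1 (u t x) = 0" "phi1 \<alpha> 1 (u t x) = 0" "phi2 \<alpha> 1 (u t x) = 0" if "x \<in> U - S" for x
    using S(3)[OF tI that] phi_nonpos by auto
  have zf: "x \<in> U - S \<Longrightarrow> f x = 0" for x using zS by (simp add: f_def)
  define D where "D = E.Diss q t"
  have cD: "continuous_on U (\<lambda>x. phi2 \<alpha> 1 (u t x) * norm (gp t x - g\<Psi> t x) powr q)"
    using q by (intro continuous_on_mult E.cX E.cont_phi cE) auto
  have cz: "continuous_on U (\<lambda>x. phi0 \<alpha> 1 (u t x))" by (intro E.cont_phi cE)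
  note Lf = E.ext_lebesgue[OF cf zf]
  have LD: "D = integral\<^sup>L (lebesgue_on U) (\<lambda>x. phi2 \<alpha> 1 (u t x) * norm (gp t x - g\<Psi> t x) powr q)"
    "integrable (lebesgue_on U) (\<lambda>x. phi2 \<alpha> 1 (u t x) * norm (gp t x - g\<Psi> t x) powr q)"
    using E.ext_lebesgue[OF cD] zS by (auto simp: D_def E.Diss_def)
  have Lz: "z t = integral\<^sup>L (lebesgue_on U) (\<lambda>x. phi0 \<alpha> 1 (u t x))" "integrable (lebesgue_on U) (\<lambda>x. phi0 \<alpha> 1 (u t x))"
    using E.ext_lebesgue[OF cz] zS by (auto simp: z_def)
  have z0: "z t \<ge> 0" unfolding Lz(1) using al by (intro Bochner_Integration.integral_nonneg phi_nonneg) auto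
  have Fp: "F t > 0" using z0 data_pos(3) by (simp add: F_def)
  define s where "s = (\<alpha> - 2) / \<alpha>"
  define s' where "s' = (\<alpha> - 1) / \<alpha>"
  have s: "0 \<le> s" "s < 1" "0 \<le> s'" "s' < 1" "\<alpha> * s = \<alpha> - 2" "\<alpha> * s' = \<alpha> - 1" "\<alpha> * (1 - s) = 2" "\<alpha> * (1 - s') = 1"
    using al by (auto simp: s_def s'_def field_simps)
  \<comment> \<open>The balancing weights of \<open>weighted_young_opt\<close>, one for each data
    term; they are constant in x.\<close>
  define d1 d2 d3 where "d1 = (mU + 1) / F t" and "d2 = G1 t / F t" and "d3 = H1 t / F t"
  have d: "d1 > 0" "d2 > 0" "d3 > 0" using Fp data_pos(1,2)[of t] data_pos(3) by (auto simp: d1_def d2_def d3_def intro!: divide_pos_pos)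
  define A2 A3 where "A2 = \<alpha>\<^sup>2 + \<alpha>" and "A3 = \<alpha> + 1"
  have A: "A2 \<ge> 0" "A3 \<ge> 0" using al by (auto simp: A2_def A3_def)
  have C0: "C0 \<ge> 0" using k by (simp add: C0_def)
  let ?W = "\<lambda>x. 2 * phi0 \<alpha> 1 (u t x) + 1"
  let ?g = "\<lambda>x. norm (g\<Psi> t x) powr (\<alpha> * q / 2)" and ?h = "\<lambda>x. \<bar>\<Psi>t t x\<bar> powr \<alpha>"
  let ?R = "\<lambda>x. A2 * k2 * (d1 powr (1 - s) * ?W x + d1 powr (- s) * 1)
     + A2 * C0 * (d2 powr (1 - s) * ?W x + d2 powr (- s) * ?g x) + A3 * (d3 powr (1 - s') * ?W x + d3 powr (- s') * ?h x)"
  have pt: "f x \<le> - c0 * (phi2 \<alpha> 1 (u t x) * norm (gp t x - g\<Psi> t x) powr q) + ?R x" for x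
  proof (cases "u t x > 0")
    case False
    then have "phi0 \<alpha> 1 (u t x) = 0" "phi1 \<alpha> 1 (u t x) = 0" "phi2 \<alpha> 1 (u t x) = 0" using phi_nonpos by auto
    then show ?thesis using A C0 k by (auto simp: f_def intro!: add_nonneg_nonneg mult_nonneg_nonneg)
  next
    case True
    define w where "w = u t x"
    have w: "w > 0" using True by (simp add: w_def)
    have Ww: "w powr \<alpha> \<le> ?W x" using phi_w_bound[of w] w by (simp add: w_def)
    have p2: "phi2 \<alpha> 1 w \<ge> 0" "phi1 \<alpha> 1 w \<ge> 0" using phi_nonneg al by auto
    have yW: "w powr (\<alpha> * \<sigma>) * y powr (1 - \<sigma>) \<le> \<delta> powr (1 - \<sigma>) * ?W x + \<delta> powr (- \<sigma>) * y"
      if "y \<ge> 0" "\<delta> > 0" "0 \<le> \<sigma>" "\<sigma> < 1" for y \<delta> \<sigma>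
    proof -
      have "w powr (\<alpha> * \<sigma>) * y powr (1 - \<sigma>) = (w powr \<alpha>) powr \<sigma> * y powr (1 - \<sigma>)" by (simp add: powr_powr)
      also have "\<dots> \<le> \<delta> powr (1 - \<sigma>) * w powr \<alpha> + \<delta> powr (- \<sigma>) * y"
        using that by (intro weighted_young) auto
      also have "\<dots> \<le> \<delta> powr (1 - \<sigma>) * ?W x + \<delta> powr (- \<sigma>) * y"
        using Ww by (intro add_right_mono mult_left_mono) auto
      finally show ?thesis .
    qed
    have 1: "w powr (\<alpha> - 2) \<le> d1 powr (1 - s) * ?W x + d1 powr (- s) * 1"
      using yW[of 1 d1 s] d s by simp
    have 2: "w powr (\<alpha> - 2) * norm (g\<Psi> t x) powr q \<le> d2 powr (1 - s) * ?W x + d2 powr (- s) * ?g x"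
    proof -
      have "\<alpha> * q / 2 * (1 - s) = (\<alpha> * (1 - s)) * q / 2" by simp
      also have "\<dots> = q" using s(7) by simp
      finally have e: "\<alpha> * q / 2 * (1 - s) = q" .
      have "?g x powr (1 - s) = norm (g\<Psi> t x) powr q" by (simp only: powr_powr e)
      then show ?thesis using yW[of "?g x" d2 s] d s by simp
    qed
    have 3: "w powr (\<alpha> - 1) * \<bar>\<Psi>t t x\<bar> \<le> d3 powr (1 - s') * ?W x + d3 powr (- s') * ?h x"
      using yW[of "?h x" d3 s'] d s by (simp add: powr_powr)
    have "f x = - (phi1 \<alpha> 1 w * \<Psi>t t x) + phi2 \<alpha> 1 w * (- ((K (norm (gp t x)) *\<^sub>R gp t x) \<bullet> (gp t x - g\<Psi> t x)))"
      by (simp add: f_def w_def)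
    also have "\<dots> \<le> phi1 \<alpha> 1 w * \<bar>\<Psi>t t x\<bar> + phi2 \<alpha> 1 w * (- c0 * norm (gp t x - g\<Psi> t x) powr q + k2 + C0 * norm (g\<Psi> t x) powr q)"
      using p2 mult_left_mono[of "- \<Psi>t t x" "\<bar>\<Psi>t t x\<bar>" "phi1 \<alpha> 1 w"]
      by (intro add_mono mult_left_mono flux_bound) auto
    also have "\<dots> = - c0 * (phi2 \<alpha> 1 w * norm (gp t x - g\<Psi> t x) powr q) + phi2 \<alpha> 1 w * (k2 + C0 * norm (g\<Psi> t x) powr q) + phi1 \<alpha> 1 w * \<bar>\<Psi>t t x\<bar>"
      by (simp add: algebra_simps)
    also have "phi2 \<alpha> 1 w * (k2 + C0 * norm (g\<Psi> t x) powr q) \<le> (A2 * w powr (\<alpha> - 2)) * (k2 + C0 * norm (g\<Psi> t x) powr q)"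
      using phi12_bound(1)[OF w] k C0 unfolding A2_def by (intro mult_right_mono) auto
    also have "\<dots> = A2 * k2 * w powr (\<alpha> - 2) + A2 * C0 * (w powr (\<alpha> - 2) * norm (g\<Psi> t x) powr q)" by (simp add: algebra_simps)
    also have "phi1 \<alpha> 1 w * \<bar>\<Psi>t t x\<bar> \<le> A3 * w powr (\<alpha> - 1) * \<bar>\<Psi>t t x\<bar>"
      using phi12_bound(2)[OF w] unfolding A3_def by (intro mult_right_mono) auto
    also have "A3 * w powr (\<alpha> - 1) * \<bar>\<Psi>t t x\<bar> = A3 * (w powr (\<alpha> - 1) * \<bar>\<Psi>t t x\<bar>)" by simp
    finally have "f x \<le> - c0 * (phi2 \<alpha> 1 w * norm (gp t x - g\<Psi> t x) powr q) + (A2 * k2 * w powr (\<alpha> - 2) + A2 * C0 * (w powr (\<alpha> - 2) * norm (g\<Psi> t x) powr q))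
       + A3 * (w powr (\<alpha> - 1) * \<bar>\<Psi>t t x\<bar>)" by simp
    also have "\<dots> \<le> - c0 * (phi2 \<alpha> 1 w * norm (gp t x - g\<Psi> t x) powr q)
       + (A2 * k2 * (d1 powr (1 - s) * ?W x + d1 powr (- s) * 1) + A2 * C0 * (d2 powr (1 - s) * ?W x + d2 powr (- s) * ?g x))
       + A3 * (d3 powr (1 - s') * ?W x + d3 powr (- s') * ?h x)"
      using A C0 k 1 2 3 by (intro add_mono mult_left_mono order_refl) auto
    finally show ?thesis by (simp add: w_def add.assoc)
  qed
  note di = data_int[OF tc]
  have Wi: "integrable (lebesgue_on U) ?W" using Lz(2) di(3) by auto
  have IW: "integral\<^sup>L (lebesgue_on U) ?W \<le> F t"
  proof -
    have "integral\<^sup>L (lebesgue_on U) ?W = 2 * z t + integral\<^sup>L (lebesgue_on U) (\<lambda>x. 1)"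
      using Lz di(3) by simp
    also have "integral\<^sup>L (lebesgue_on U) (\<lambda>x. 1) = mU"
      using U(1) by (simp add: mU_def measure_restrict_space lborelD)
    finally show ?thesis by (simp add: F_def)
  qed
  have I1: "integral\<^sup>L (lebesgue_on U) (\<lambda>x. 1) \<le> mU + 1"
    using U(1) by (simp add: mU_def measure_restrict_space lborelD)
  have hb: "has_bochner_integral (lebesgue_on U) (\<lambda>x. - c0 * (phi2 \<alpha> 1 (u t x) * norm (gp t x - g\<Psi> t x) powr q) + ?R x)
     (- c0 * D + (A2 * k2 * (d1 powr (1 - s) * integral\<^sup>L (lebesgue_on U) ?W + d1 powr (- s) * integral\<^sup>L (lebesgue_on U) (\<lambda>x. 1))
     + A2 * C0 * (d2 powr (1 - s) * integral\<^sup>L (lebesgue_on U) ?W + d2 powr (- s) * integral\<^sup>L (lebesgue_on U) ?g)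
     + A3 * (d3 powr (1 - s') * integral\<^sup>L (lebesgue_on U) ?W + d3 powr (- s') * integral\<^sup>L (lebesgue_on U) ?h)))"
    unfolding LD(1)
    by (intro has_bochner_integral_add has_bochner_integral_mult_right has_bochner_integral_integrable LD(2) Wi di)
  have "integral (cbox lo hi) (ext U f) = integral\<^sup>L (lebesgue_on U) f" by (rule Lf(1))
  also have "\<dots> \<le> integral\<^sup>L (lebesgue_on U) (\<lambda>x. - c0 * (phi2 \<alpha> 1 (u t x) * norm (gp t x - g\<Psi> t x) powr q) + ?R x)"
    by (rule integral_mono[OF Lf(2) integrable.intros[OF hb] pt])
  also have "\<dots> = - c0 * D + (A2 * k2 * (d1 powr (1 - s) * integral\<^sup>L (lebesgue_on U) ?W + d1 powr (- s) * integral\<^sup>L (lebesgue_on U) (\<lambda>x. 1))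
     + A2 * C0 * (d2 powr (1 - s) * integral\<^sup>L (lebesgue_on U) ?W + d2 powr (- s) * integral\<^sup>L (lebesgue_on U) ?g)
     + A3 * (d3 powr (1 - s') * integral\<^sup>L (lebesgue_on U) ?W + d3 powr (- s') * integral\<^sup>L (lebesgue_on U) ?h))"
    by (rule has_bochner_integral_integral_eq[OF hb])
  also have "\<dots> \<le> - c0 * D + (A2 * k2 * (d1 powr (1 - s) * F t + d1 powr (- s) * (mU + 1))
     + A2 * C0 * (d2 powr (1 - s) * F t + d2 powr (- s) * G1 t) + A3 * (d3 powr (1 - s') * F t + d3 powr (- s') * H1 t))"
    using IW I1 A C0 k by (intro add_mono mult_left_mono order_refl) (auto simp: G1_def H1_def)
  also have "d1 powr (1 - s) * F t + d1 powr (- s) * (mU + 1) = 2 * (F t powr s * (mU + 1) powr (1 - s))"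
    unfolding d1_def using Fp data_pos(3) s by (intro weighted_young_opt) auto
  also have "d2 powr (1 - s) * F t + d2 powr (- s) * G1 t = 2 * (F t powr s * G1 t powr (1 - s))"
    unfolding d2_def using Fp data_pos(1)[of t] s by (intro weighted_young_opt) auto
  also have "d3 powr (1 - s') * F t + d3 powr (- s') * H1 t = 2 * (F t powr s' * H1 t powr (1 - s'))"
    unfolding d3_def using Fp data_pos(2)[of t] s by (intro weighted_young_opt) auto
  finally have ineq: "integral (cbox lo hi) (ext U f) \<le> - c0 * D + 2 * A2 * k2 * (F t powr s * (mU + 1) powr (1 - s))
      + 2 * A2 * C0 * (F t powr s * G1 t powr (1 - s)) + 2 * A3 * (F t powr s' * H1 t powr (1 - s'))"
    by (simp add: mult_ac)
  have D0: "D \<ge> 0" unfolding D_def using q by (intro E.Diss_nonneg tI) auto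
  define \<kappa> where "\<kappa> = q + \<alpha> / r * q / CARD('n)"
  have "r * \<kappa> = r * q + \<alpha> * q / CARD('n)" using rp by (simp add: \<kappa>_def distrib_left)
  then have rk: "r * \<kappa> = \<kappa>0" by (simp add: r k0)
  have kp: "\<kappa> > 0" using rk k0(2) al rp by (smt (verit) mult_nonneg_nonpos)
  have qq: "1 < q" "q \<le> 2" using q by auto
  define VV where "VV = integral (cbox lo hi) (ext U (\<lambda>x. vfun r 1 (u t x) powr \<kappa>))"
  have VV: "VV \<le> C * z t powr (q / CARD('n)) * (2 powr q * (2 powr q + (r + 1) powr q) * D)"
  proof -
    have e0: "ext U (\<lambda>x. (0::real)) = (\<lambda>x. 0)" by (auto simp: ext_def)
    show ?thesis using E.energy_gn[OF qq r tI gn] unfolding VV_def D_def Jz \<kappa>_def by (simp add: e0)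
  qed
  have cV: "continuous_on U (\<lambda>x. vfun r 1 (u t x) powr \<kappa>)"
    using kp vfun_nonneg(1)[of 1 r] rp by (intro continuous_on_powr_const continuous_vfun cE) auto
  \<comment> \<open>Where u \<le> l the integrand is at most l powr \<alpha>. Where u > l, the bound
    l \<ge> 1 = d puts u in the range in which \<open>vfun\<close> is comparable to u powr r, and
    the surplus exponent gives l powr (\<alpha> - \<kappa>0).\<close>
  have GN: "z t \<le> measure lborel (cbox lo hi) * l powr \<alpha>
       + l powr (\<alpha> - \<kappa>0) * (2 powr (\<kappa>0 / r) * (C * (2 powr q * (2 powr q + (r + 1) powr q)))) * z t powr (q / CARD('n)) * D"
    if l: "l \<ge> 1" for l
  proof -
    have iV: "ext U (\<lambda>x. vfun r 1 (u t x) powr \<kappa>) integrable_on cbox lo hi"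
      by (rule E.ext_int[OF cV]) (use S(3)[OF tI] vfun_nonpos in auto)
    have "z t \<le> integral (cbox lo hi) (\<lambda>x. l powr \<alpha> + l powr (\<alpha> - \<kappa>0) * 2 powr \<kappa> * ext U (\<lambda>x. vfun r 1 (u t x) powr \<kappa>) x)"
      unfolding z_def
    proof (rule integral_le)
      show "ext U (\<lambda>x. phi0 \<alpha> 1 (u t x)) integrable_on cbox lo hi" by (rule E.ext_int[OF cz]) (use zS in auto)
      show "(\<lambda>x. l powr \<alpha> + l powr (\<alpha> - \<kappa>0) * 2 powr \<kappa> * ext U (\<lambda>x. vfun r 1 (u t x) powr \<kappa>) x) integrable_on cbox lo hi"
        by (intro integrable_add integrable_const integrable_on_cmult_real iV)
      fix x
      show "ext U (\<lambda>x. phi0 \<alpha> 1 (u t x)) x \<le> l powr \<alpha> + l powr (\<alpha> - \<kappa>0) * 2 powr \<kappa> * ext U (\<lambda>x. vfun r 1 (u t x) powr \<kappa>) x"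
      proof (cases "x \<in> U \<and> u t x > 0")
        case False
        then have "ext U (\<lambda>x. phi0 \<alpha> 1 (u t x)) x = 0" using phi_nonpos by (auto simp: ext_def)
        then show ?thesis by (auto simp: ext_def)
      next
        case True
        define w where "w = u t x"
        have w: "w > 0" using True by (simp add: w_def)
        have "phi0 \<alpha> 1 w = w powr \<alpha> * (w / (1 + w))" using w by (intro phi0_eq) auto
        also have "\<dots> \<le> w powr \<alpha>" using w by (intro mult_left_le) auto
        also have "w powr \<alpha> \<le> l powr \<alpha> + l powr (\<alpha> - \<kappa>0) * 2 powr \<kappa> * vfun r 1 w powr \<kappa>"
        proof (cases "w \<le> l")
          case True
          then have "w powr \<alpha> \<le> l powr \<alpha>" using w al by (intro powr_mono2) auto
          then show ?thesis by (simp add: add_increasing2)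
        next
          case False
          have "w powr \<alpha> = w powr (\<alpha> - \<kappa>0) * w powr (r * \<kappa>)" using w by (simp add: rk flip: powr_add)
          also have "\<dots> \<le> l powr (\<alpha> - \<kappa>0) * (2 powr \<kappa> * vfun r 1 w powr \<kappa>)"
            using False l k0 kp vfun_bounds(4)[OF zero_less_one al qq r, of w \<kappa>] by (intro mult_mono powr_mono2') auto
          finally show ?thesis by (simp add: add_increasing mult.assoc)
        qed
        finally show ?thesis using True by (simp add: ext_def w_def)
      qed
    qed
    also have "\<dots> = measure lborel (cbox lo hi) * l powr \<alpha> + l powr (\<alpha> - \<kappa>0) * 2 powr \<kappa> * VV"
      unfolding VV_def by (subst integral_add) (auto intro!: integrable_on_cmult_real iV)
    also have "\<dots> \<le> measure lborel (cbox lo hi) * l powr \<alpha> + l powr (\<alpha> - \<kappa>0) * 2 powr \<kappa> *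
        (C * z t powr (q / CARD('n)) * (2 powr q * (2 powr q + (r + 1) powr q) * D))"
      using VV by (intro add_left_mono mult_left_mono) auto
    also have "\<kappa> = \<kappa>0 / r" using rk rp by (simp add: field_simps)
    finally show ?thesis by (simp add: mult_ac)
  qed
  show thesis
    by (rule that[OF der D0 z0 ineq[unfolded s_def s'_def A2_def A3_def] GN])
qed

end

text \<open>M is defined so that the smallness condition of \<open>level_bound\<close> becomes
  visible: M powr (\<alpha> - \<kappa>0) cancels the negative power of \<sigma>, the constant Q0 and
  the power of Yb. The summands 1 in 1 + Q0 and 1 + Yb guarantee M \<ge> 1, which the iteration
  assumes.\<close>

lemma local_sup_bound:
  fixes U U' :: "(real^'n) set" and K :: "real \<Rightarrow> real"
  assumes U: "open U" "U \<subseteq> cbox lo hi" and U': "open U'" "closure U' \<subseteq> U" and al: "\<alpha> \<ge> 2"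
    and q: "1 < q" "q < 2" and k: "k1 > 0" "k2 > 0" "k3 > 0"
    and K1: "\<And>X. X \<ge> 0 \<Longrightarrow> K X * X\<^sup>2 \<ge> k1 * X powr q - k2"
    and K2: "\<And>X. X \<ge> 0 \<Longrightarrow> K X * X \<le> k3 * X powr (q - 1)"
    and K3: "\<And>X. X \<ge> 0 \<Longrightarrow> K X \<ge> 0"
    and k0: "\<kappa>0 = \<alpha> - 2 + q + \<alpha> * q / CARD('n)" "\<kappa>0 > \<alpha>"
  defines "\<gamma> \<equiv> q / CARD('n)"
  obtains Cs where "Cs \<ge> 1"
    "\<And>p gp pt \<sigma> t0 Yb x1. flow U K p gp pt \<Longrightarrow> 0 < \<sigma> \<Longrightarrow> \<sigma> \<le> 1 \<Longrightarrow> \<sigma> < t0 \<Longrightarrow>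
      (\<And>t. t \<in> {t0-\<sigma>..t0} \<Longrightarrow> integrable (lebesgue_on U) (\<lambda>x. \<bar>p t x\<bar> powr \<alpha>)) \<Longrightarrow>
      continuous_on {t0-\<sigma>..t0} (\<lambda>t. integral\<^sup>L (lebesgue_on U) (\<lambda>x. \<bar>p t x\<bar> powr \<alpha>)) \<Longrightarrow>
      integral {t0-\<sigma>..t0} (\<lambda>t. integral\<^sup>L (lebesgue_on U) (\<lambda>x. \<bar>p t x\<bar> powr \<alpha>)) \<le> Yb \<Longrightarrow> x1 \<in> U' \<Longrightarrow>
      p t0 x1 \<le> Cs * \<sigma> powr (- ((1 + \<gamma>) / (\<kappa>0 - \<alpha>))) * (1 + Yb) powr (\<gamma> / (\<kappa>0 - \<alpha>))"
proof -
  define r where "r = (\<alpha> - 2 + q) / q"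
  have r: "r * q = \<alpha> - 2 + q" "r > 0" using q al by (auto simp: r_def)
  have "\<alpha> / r > 0" using r al by simp
  then obtain C where gn: "gn_bound TYPE(real^'n) C q (\<alpha> / r)" "C > 0"
    using gn_bound_exists[of q "\<alpha> / r", where 'a="real^'n"] q by auto
  have "bounded U'" using U' U(2) closure_subset[of U'] bounded_subset[OF bounded_cbox] by (meson order_trans)
  then have cU': "compact (closure U')" by simp
  obtain \<eta> :: "real^'n \<Rightarrow> real" and g\<eta> S G0 where \<eta>: "\<And>x. (\<eta> has_derivative (\<lambda>h. g\<eta> x \<bullet> h)) (at x)" "continuous_on UNIV g\<eta>"
    "\<And>x. 0 \<le> \<eta> x" "\<And>x. \<eta> x \<le> 1" "\<And>x. x \<in> closure U' \<Longrightarrow> \<eta> x = 1" "compact S" "S \<subseteq> U" "\<And>x. x \<notin> S \<Longrightarrow> \<eta> x = 0"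
    "G0 \<ge> 1" "\<And>x. norm (g\<eta> x) \<le> G0"
    by (rule smooth_cutoff_exists[OF U(1) cU' U'(2)]) blast
  define Ce where "Ce = 2 + (\<alpha>\<^sup>2 + \<alpha>) * ((k1 / 2) powr (1 - q) * (4 * k3) powr q + k2)"
  have Ce: "Ce > 0" unfolding Ce_def using al k by (auto intro!: add_pos_nonneg mult_nonneg_nonneg add_nonneg_nonneg)
  define Cst where "Cst = (2 powr (\<kappa>0 / r) * C * (2 powr q * (2 powr q + (r + 1) powr q)) * Ce powr \<gamma> * (2 * Ce / k1 + 1))"
  define b where "b = (2 powr (\<kappa>0 - \<alpha>) * 8 powr (1 + \<gamma>)) powr (1 / \<gamma>)"
  define Q0 where "Q0 = Cst * 4 powr (\<kappa>0 - \<alpha>) * (48 + 256 * G0\<^sup>2) powr (1 + \<gamma>) * b"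
  have Q0: "Q0 \<ge> 0" unfolding Q0_def Cst_def b_def using gn Ce k by auto
  have g: "\<gamma> > 0" using q by (simp add: \<gamma>_def)
  define \<delta> where "\<delta> = \<kappa>0 - \<alpha>"
  have d: "\<delta> > 0" using k0 by (simp add: \<delta>_def)
  define Cs where "Cs = (1 + Q0) powr (1 / \<delta>)"
  have Cs: "Cs \<ge> 1" unfolding Cs_def using Q0 d by (intro ge_one_powr_ge_zero) auto
  show thesis
  proof (rule that[OF Cs])
    fix p :: "real \<Rightarrow> real^'n \<Rightarrow> real" and gp pt and \<sigma> t0 Yb :: real and x1
    assume fl: "flow U K p gp pt" and \<sigma>: "0 < \<sigma>" "\<sigma> \<le> 1" "\<sigma> < t0"
      and int: "\<And>t. t \<in> {t0-\<sigma>..t0} \<Longrightarrow> integrable (lebesgue_on U) (\<lambda>x. \<bar>p t x\<bar> powr \<alpha>)"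
      and cont: "continuous_on {t0-\<sigma>..t0} (\<lambda>t. integral\<^sup>L (lebesgue_on U) (\<lambda>x. \<bar>p t x\<bar> powr \<alpha>))"
      and Yb: "integral {t0-\<sigma>..t0} (\<lambda>t. integral\<^sup>L (lebesgue_on U) (\<lambda>x. \<bar>p t x\<bar> powr \<alpha>)) \<le> Yb" and x1: "x1 \<in> U'"
    interpret D: degiorgi_iteration U S lo hi \<eta> g\<eta> G0 \<alpha> q k1 k2 k3 K p gp pt \<sigma> t0
    proof
      show "closed S" using \<eta>(6) by (rule compact_imp_closed)
    qed (use U al q k K1 K2 K3 fl \<sigma> \<eta> in auto)
    have Yb0: "Yb \<ge> 0"
    proof -
      have "0 \<le> integral {t0-\<sigma>..t0} (\<lambda>t. integral\<^sup>L (lebesgue_on U) (\<lambda>x. \<bar>p t x\<bar> powr \<alpha>))"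
        by (intro integral_nonneg integrable_continuous_real cont Bochner_Integration.integral_nonneg) auto
      then show ?thesis using Yb by linarith
    qed
    define M where "M = Cs * \<sigma> powr (- ((1 + \<gamma>) / \<delta>)) * (1 + Yb) powr (\<gamma> / \<delta>)"
    have M: "M \<ge> 1"
    proof -
      have "1 \<le> \<sigma> powr (- ((1 + \<gamma>) / \<delta>))"
      proof -
        have "\<sigma> powr ((1 + \<gamma>) / \<delta>) \<le> 1" using \<sigma> g d by (intro powr_le1) auto
        moreover have "\<sigma> powr ((1 + \<gamma>) / \<delta>) > 0" using \<sigma> by simp
        ultimately show ?thesis by (simp add: powr_minus one_le_inverse)
      qed
      moreover have "1 \<le> (1 + Yb) powr (\<gamma> / \<delta>)" using Yb0 g d by (intro ge_one_powr_ge_zero) auto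
      ultimately have "1 * 1 * 1 \<le> M" unfolding M_def using Cs by (intro mult_mono) auto
      then show ?thesis by simp
    qed
    \<comment> \<open>At j = 0 the level is 0 and the cut-off is at most 1, so the start of the
      iteration is bounded by the space-time integral of |p| powr \<alpha>.\<close>
    have Y0: "D.YY M 0 \<le> Yb"
    proof -
      interpret E: degiorgi_step U S lo hi "t0 - \<sigma>" t0 "\<lambda>t x. p t x - M * (1 - 1 / 2 ^ 0) - M / 2 ^ (0 + 2)" pt gp K
        "D.\<zeta> 0" "D.\<zeta>t 0" "D.g\<zeta> 0" \<alpha> "M / 2 ^ (0 + 2)" "D.\<xi> 0" "D.\<xi> (Suc 0)" q k1 k2 k3 "2 ^ (0 + 3) * G0" "2 ^ (0 + 5) / \<sigma>"
        by (rule D.step_instance[OF M])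
      have "D.YY M 0 = integral {t0-\<sigma>..t0} E.W" unfolding D.YY_def E.W_def by simp
      also have "\<dots> \<le> integral {t0-\<sigma>..t0} (\<lambda>t. integral\<^sup>L (lebesgue_on U) (\<lambda>x. \<bar>p t x\<bar> powr \<alpha>))"
      proof (rule integral_le)
        show "E.W integrable_on {t0-\<sigma>..t0}" by (intro integrable_continuous_real E.W_cont)
        show "(\<lambda>t. integral\<^sup>L (lebesgue_on U) (\<lambda>x. \<bar>p t x\<bar> powr \<alpha>)) integrable_on {t0-\<sigma>..t0}"
          by (intro integrable_continuous_real cont)
        fix t assume t: "t \<in> {t0-\<sigma>..t0}"
        define f where "f x = D.\<xi> 0 t x * max 0 (p t x - M * (1 - 1 / 2 ^ 0) - M / 2 ^ (0 + 2) + M / 2 ^ (0 + 2)) powr \<alpha>" for x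
        have f: "continuous_on U f" "\<And>x. x \<in> U - S \<Longrightarrow> f x = 0"
          unfolding f_def using E.W_slice_cont[OF t] E.xi_zero[OF t] by auto
        have "E.W t = integral\<^sup>L (lebesgue_on U) f"
          unfolding E.W_def using E.ext_lebesgue(1)[OF f] unfolding f_def .
        also have "\<dots> \<le> integral\<^sup>L (lebesgue_on U) (\<lambda>x. \<bar>p t x\<bar> powr \<alpha>)"
        proof (rule integral_mono[OF E.ext_lebesgue(2)[OF f] int[OF t]])
          fix x
          have "f x \<le> 1 * max 0 (p t x) powr \<alpha>"
            unfolding f_def by (intro mult_mono) (auto simp: D.\<xi>_def smoothstep_range)
          also have "\<dots> \<le> \<bar>p t x\<bar> powr \<alpha>" using al by (simp add: powr_mono2)
          finally show "f x \<le> \<bar>p t x\<bar> powr \<alpha>" .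
        qed
        finally show "E.W t \<le> integral\<^sup>L (lebesgue_on U) (\<lambda>x. \<bar>p t x\<bar> powr \<alpha>)" .
      qed
      finally show ?thesis using Yb by linarith
    qed
    have Ynn: "D.YY M 0 \<ge> 0" by (rule D.YY_nonneg[OF M])
    have MM: "M powr (\<alpha> - \<kappa>0) = \<sigma> powr (1 + \<gamma>) / ((1 + Q0) * (1 + Yb) powr \<gamma>)"
    proof -
      have "Cs powr (- \<delta>) = 1 / (1 + Q0)"
        using d Q0 by (simp add: Cs_def powr_powr powr_minus divide_inverse)
      moreover have "(\<sigma> powr (- ((1 + \<gamma>) / \<delta>))) powr (- \<delta>) = \<sigma> powr (1 + \<gamma>)" using d by (simp add: powr_powr add.commute)
      moreover have "((1 + Yb) powr (\<gamma> / \<delta>)) powr (- \<delta>) = 1 / (1 + Yb) powr \<gamma>" using d by (simp add: powr_powr powr_minus_divide)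
      ultimately have "M powr (- \<delta>) = 1 / (1 + Q0) * \<sigma> powr (1 + \<gamma>) * (1 / (1 + Yb) powr \<gamma>)"
        unfolding M_def by (simp only: powr_mult)
      moreover have "\<alpha> - \<kappa>0 = - \<delta>" by (simp add: \<delta>_def)
      ultimately show ?thesis by simp
    qed
    have "(D.Cst C r \<kappa>0 * (M powr (\<alpha> - \<kappa>0) * 4 powr (\<kappa>0 - \<alpha>)) * ((48 + 256 * G0\<^sup>2) / \<sigma>) powr (1 + \<gamma>)) * D.YY M 0 powr \<gamma> * b
       = Q0 * (M powr (\<alpha> - \<kappa>0) / \<sigma> powr (1 + \<gamma>)) * D.YY M 0 powr \<gamma>"
    proof -
      have "D.Cst C r \<kappa>0 = Cst" unfolding D.Cst_def D.CaE_def Cst_def Ce_def \<gamma>_def ..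
      moreover have "((48 + 256 * G0\<^sup>2) / \<sigma>) powr (1 + \<gamma>) = (48 + 256 * G0\<^sup>2) powr (1 + \<gamma>) / \<sigma> powr (1 + \<gamma>)"
        by (rule powr_divide)
      ultimately show ?thesis by (simp add: Q0_def)
    qed
    also have "M powr (\<alpha> - \<kappa>0) / \<sigma> powr (1 + \<gamma>) = 1 / ((1 + Q0) * (1 + Yb) powr \<gamma>)"
      unfolding MM using \<sigma> by simp
    also have "Q0 * (1 / ((1 + Q0) * (1 + Yb) powr \<gamma>)) * D.YY M 0 powr \<gamma> = (Q0 / (1 + Q0)) * (D.YY M 0 powr \<gamma> / (1 + Yb) powr \<gamma>)"
      by simp
    also have "\<dots> \<le> 1 * 1"
    proof (rule mult_mono)
      have "D.YY M 0 powr \<gamma> \<le> (1 + Yb) powr \<gamma>" using Y0 Ynn g by (intro powr_mono2) auto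
      then show "D.YY M 0 powr \<gamma> / (1 + Yb) powr \<gamma> \<le> 1" using Yb0 by (simp add: divide_le_eq)
    qed (use Q0 in auto)
    finally have small: "(D.Cst C r \<kappa>0 * (M powr (\<alpha> - \<kappa>0) * 4 powr (\<kappa>0 - \<alpha>)) * ((48 + 256 * G0\<^sup>2) / \<sigma>) powr (1 + q / CARD('n)))
      * D.YY M 0 powr (q / CARD('n)) * (2 powr (\<kappa>0 - \<alpha>) * 8 powr (1 + q / CARD('n))) powr (1 / (q / CARD('n))) \<le> 1"
      unfolding b_def \<gamma>_def by simp
    have "p t0 x1 \<le> M"
      by (rule D.level_bound[OF M r(1) gn k0 r(2) small U'(1) x1]) (use U' closure_subset[of U'] \<eta>(5) in auto)
    then show "p t0 x1 \<le> Cs * \<sigma> powr (- ((1 + \<gamma>) / (\<kappa>0 - \<alpha>))) * (1 + Yb) powr (\<gamma> / (\<kappa>0 - \<alpha>))"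
      unfolding M_def \<delta>_def .
  qed
qed

text \<open>The quantity \<open>F\<close> of \<open>global_setting\<close>, stated outside the
  locale so that it can be used for p and for - p at once.\<close>

definition excess :: "(real^'n) set \<Rightarrow> real^'n \<Rightarrow> real^'n \<Rightarrow> real \<Rightarrow> (real \<Rightarrow> real^'n \<Rightarrow> real) \<Rightarrow> (real \<Rightarrow> real^'n \<Rightarrow> real) \<Rightarrow> real \<Rightarrow> real" where
  "excess U lo hi \<alpha> p \<Psi> t = 2 * integral (cbox lo hi) (ext U (\<lambda>x. phi0 \<alpha> 1 (p t x - \<Psi> t x - 1))) + measure lebesgue U + 1"

text \<open>By \<open>dissipation_lower\<close> the dissipation is worth 4 \<epsilon> F powr
  \<theta> up to a constant, where \<theta> = \<kappa>0/\<alpha> - \<gamma> = (\<alpha> -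
  a)/\<alpha>. The three data terms consume one \<epsilon> each and one survives. Passing from z to
  \<open>excess\<close> doubles the inequality.\<close>

lemma global_energy:
  fixes U :: "(real^'n) set" and K :: "real \<Rightarrow> real"
  assumes b: "measure lborel (cbox lo hi :: (real^'n) set) > 0" and al: "\<alpha> \<ge> 2"
    and q: "1 < q" "q < 2" and k: "k1 > 0" "k2 > 0" "k3 > 0"
    and k0: "\<kappa>0 = \<alpha> - 2 + q + \<alpha> * q / CARD('n)" "\<kappa>0 > \<alpha>"
  obtains c1 C1 where "c1 > 0" "C1 > 0"
    "\<And>p gp pt \<Psi> g\<Psi> \<Psi>t t. global_setting U lo hi \<alpha> q k1 k2 k3 K p gp pt \<Psi> g\<Psi> \<Psi>t \<Longrightarrow> t > 0 \<Longrightarrow>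
      \<exists>z'. (excess U lo hi \<alpha> p \<Psi> has_real_derivative z') (at t) \<and>
        z' \<le> - c1 * excess U lo hi \<alpha> p \<Psi> t powr ((\<alpha> - 2 + q) / \<alpha>) + C1 * (1 + Afun U (2 - q) \<alpha> (\<lambda>x t. g\<Psi> t x) (\<lambda>x t. \<Psi>t t x) t)"
proof -
  define r where "r = (\<alpha> - 2 + q) / q"
  have r: "r * q = \<alpha> - 2 + q" "r > 0" using q al by (auto simp: r_def)
  have "\<alpha> / r > 0" using r al by simp
  then obtain C where gn: "gn_bound TYPE(real^'n) C q (\<alpha> / r)" "C > 0"
    using gn_bound_exists[of q "\<alpha> / r", where 'a="real^'n"] q by auto
  define bb where "bb = measure lborel (cbox lo hi :: (real^'n) set)"
  define \<theta> where "\<theta> = (\<alpha> - 2 + q) / \<alpha>"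
  define C3 where "C3 = 2 powr (\<kappa>0 / r) * (C * (2 powr q * (2 powr q + (r + 1) powr q)))"
  define m where "m = measure lebesgue U + 1"
  define s s' where "s = (\<alpha> - 2) / \<alpha>" and "s' = (\<alpha> - 1) / \<alpha>"
  define \<nu> \<nu>' where "\<nu> = 2 * (\<alpha> - (2 - q)) / (\<alpha> * (2 - (2 - q)))" and "\<nu>' = (\<alpha> - (2 - q)) / (\<alpha> * (1 - (2 - q)))"
  define c0 C0 where "c0 = k1 / 2 * 2 powr (- q)" and "C0 = k1 / 2 + (k1 / 2) powr (1 - q) * k3 powr q"
  have th: "\<theta> = \<kappa>0 / \<alpha> - q / CARD('n)" "\<theta> > 0" using al q by (auto simp: \<theta>_def k0 field_simps)
  have s: "0 \<le> s" "s < \<theta>" "0 \<le> s'" "s' < \<theta>" using al q by (auto simp: s_def s'_def \<theta>_def divide_right_mono intro!: divide_strict_right_mono)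
  have nu: "\<nu> = (1 - s) / (1 - s / \<theta>)" "\<nu>' = (1 - s') / (1 - s' / \<theta>)" "\<nu> > 0" "\<nu>' > 0"
  proof -
    have a: "\<alpha> > 0" "\<alpha> - 2 + q > 0" using al q by auto
    have st: "s / \<theta> = (\<alpha> - 2) / (\<alpha> - 2 + q)" "s' / \<theta> = (\<alpha> - 1) / (\<alpha> - 2 + q)" using a by (auto simp: s_def s'_def \<theta>_def)
    have e: "1 - s / \<theta> = q / (\<alpha> - 2 + q)" "1 - s' / \<theta> = (q - 1) / (\<alpha> - 2 + q)"
      unfolding st using a by (auto simp: field_simps)
    have e': "1 - s = 2 / \<alpha>" "1 - s' = 1 / \<alpha>" using a by (auto simp: s_def s'_def field_simps)
    show "\<nu> = (1 - s) / (1 - s / \<theta>)" "\<nu>' = (1 - s') / (1 - s' / \<theta>)"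
      unfolding e e' \<nu>_def \<nu>'_def using a q by (auto simp: field_simps)
    show "\<nu> > 0" "\<nu>' > 0" using a q by (auto simp: \<nu>_def \<nu>'_def intro!: divide_pos_pos mult_pos_pos)
  qed
  define E1 where "E1 = 2 * (2 * bb) powr ((\<kappa>0 - \<alpha>) / \<alpha>) * C3"
  have C3: "C3 > 0" using gn r by (auto simp: C3_def intro!: mult_pos_pos add_pos_nonneg)
  have E1: "E1 > 0" using C3 b by (auto simp: E1_def bb_def)
  define M1 M2 where "M1 = 2 powr \<theta> * 2 powr \<theta> * E1" and "M2 = 2 powr \<theta> * (2 powr \<theta> * (2 * bb) powr \<theta> + m powr \<theta>)"
  have M1: "M1 > 0" using E1 by (simp add: M1_def)
  have M2: "M2 \<ge> 0" by (simp add: M2_def)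
  have c0: "c0 > 0" "C0 \<ge> 0" using k by (auto simp: c0_def C0_def)
  define \<epsilon> where "\<epsilon> = c0 / (4 * M1)"
  have eps: "\<epsilon> > 0" using c0 M1 by (simp add: \<epsilon>_def)
  have aa: "0 \<le> 2 * (\<alpha>\<^sup>2 + \<alpha>) * k2" "0 \<le> 2 * (\<alpha>\<^sup>2 + \<alpha>) * C0" "0 \<le> 2 * (\<alpha> + 1)" using al k c0 by auto
  obtain D1 where D1: "D1 \<ge> 0" "\<And>F G. F > 0 \<Longrightarrow> G > 0 \<Longrightarrow> 2 * (\<alpha>\<^sup>2 + \<alpha>) * k2 * (F powr s * G powr (1 - s)) \<le> \<epsilon> * F powr \<theta> + D1 * G powr \<nu>"
    using absorb_powr[OF aa(1) eps s(1,2) nu(1)] by blast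
  obtain D2 where D2: "D2 \<ge> 0" "\<And>F G. F > 0 \<Longrightarrow> G > 0 \<Longrightarrow> 2 * (\<alpha>\<^sup>2 + \<alpha>) * C0 * (F powr s * G powr (1 - s)) \<le> \<epsilon> * F powr \<theta> + D2 * G powr \<nu>"
    using absorb_powr[OF aa(2) eps s(1,2) nu(1)] by blast
  obtain D3 where D3: "D3 \<ge> 0" "\<And>F G. F > 0 \<Longrightarrow> G > 0 \<Longrightarrow> 2 * (\<alpha> + 1) * (F powr s' * G powr (1 - s')) \<le> \<epsilon> * F powr \<theta> + D3 * G powr \<nu>'"
    using absorb_powr[OF aa(3) eps s(3,4) nu(2)] by blast
  define H where "H = c0 * M2 / M1 + D1 * m powr \<nu> + D2 * 2 powr \<nu> + D3 * 2 powr \<nu>' + 1"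
  have H: "H > 0" unfolding H_def using c0 M1 M2 D1 D2 D3 by (intro add_nonneg_pos add_nonneg_nonneg) auto
  show thesis
  proof (rule that[of "2 * \<epsilon>" "2 * H"])
    show "2 * \<epsilon> > 0" "2 * H > 0" using eps H by auto
    fix p gp pt \<Psi> g\<Psi> \<Psi>t and t :: real
    assume gs: "global_setting U lo hi \<alpha> q k1 k2 k3 K p gp pt \<Psi> g\<Psi> \<Psi>t" and t: "t > 0"
    interpret G: global_setting U lo hi \<alpha> q k1 k2 k3 K p gp pt \<Psi> g\<Psi> \<Psi>t by (rule gs)
    have FE: "excess U lo hi \<alpha> p \<Psi> = (\<lambda>t. 2 * G.z t + G.mU + 1)"
      by (simp add: fun_eq_iff excess_def G.z_def G.u_def G.mU_def)
    obtain z' D where z': "(G.z has_real_derivative z') (at t)" "D \<ge> 0" "G.z t \<ge> 0"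
      and ineq: "z' \<le> - G.c0 * D + 2 * (\<alpha>\<^sup>2 + \<alpha>) * k2 * (G.F t powr ((\<alpha> - 2) / \<alpha>) * (G.mU + 1) powr (1 - (\<alpha> - 2) / \<alpha>))
      + 2 * (\<alpha>\<^sup>2 + \<alpha>) * G.C0 * (G.F t powr ((\<alpha> - 2) / \<alpha>) * G.G1 t powr (1 - (\<alpha> - 2) / \<alpha>))
      + 2 * (\<alpha> + 1) * (G.F t powr ((\<alpha> - 1) / \<alpha>) * G.H1 t powr (1 - (\<alpha> - 1) / \<alpha>))"
      and gnz: "\<And>l. l \<ge> 1 \<Longrightarrow> G.z t \<le> measure lborel (cbox lo hi) * l powr \<alpha>
       + l powr (\<alpha> - \<kappa>0) * (2 powr (\<kappa>0 / r) * (C * (2 powr q * (2 powr q + (r + 1) powr q)))) * G.z t powr (q / CARD('n)) * D"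
      by (rule G.z_inequality[OF t r(1) gn k0 r(2)]) blast
    have mm: "G.mU + 1 = m" "G.c0 = c0" "G.C0 = C0" by (simp_all add: G.mU_def m_def G.c0_def c0_def G.C0_def C0_def)
    have F: "G.F t = 2 * G.z t + m" "m \<ge> 1" "G.F t > 0" using z'(3) G.data_pos(3) by (auto simp: G.F_def mm(1)[symmetric])
    have zl: "G.z t powr \<theta> \<le> (2 * bb) powr \<theta> + E1 * D"
      using dissipation_lower[of bb \<alpha> "G.z t" D C3 \<theta> \<kappa>0 "q / CARD('n)"] b al z' C3 th gnz
      by (simp add: bb_def C3_def E1_def)
    have FD: "G.F t powr \<theta> \<le> M1 * D + M2"
    proof -
      have "G.F t powr \<theta> \<le> 2 powr \<theta> * ((2 * G.z t) powr \<theta> + m powr \<theta>)"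
        unfolding F(1) using z'(3) F(2) th by (intro powr_add_le) auto
      also have "(2 * G.z t) powr \<theta> = 2 powr \<theta> * G.z t powr \<theta>" by (simp only: powr_mult)
      also have "2 powr \<theta> * (2 powr \<theta> * G.z t powr \<theta> + m powr \<theta>) \<le> 2 powr \<theta> * (2 powr \<theta> * ((2 * bb) powr \<theta> + E1 * D) + m powr \<theta>)"
        using zl by (intro mult_left_mono add_right_mono) auto
      also have "\<dots> = M1 * D + M2" by (simp add: M1_def M2_def algebra_simps)
      finally show ?thesis .
    qed
    have cD: "- c0 * D \<le> - (4 * \<epsilon>) * G.F t powr \<theta> + c0 * M2 / M1"
    proof -
      have "c0 / M1 * G.F t powr \<theta> \<le> c0 / M1 * (M1 * D + M2)" using FD c0 M1 by (intro mult_left_mono) auto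
      also have "\<dots> = c0 * D + c0 * M2 / M1" using M1 by (simp add: distrib_left)
      finally show ?thesis using M1 by (simp add: \<epsilon>_def)
    qed
    define gI where "gI = integral\<^sup>L (lebesgue_on U) (\<lambda>x. norm (g\<Psi> t x) powr (\<alpha> * q / 2))"
    define hI where "hI = integral\<^sup>L (lebesgue_on U) (\<lambda>x. \<bar>\<Psi>t t x\<bar> powr \<alpha>)"
    have gh: "gI \<ge> 0" "hI \<ge> 0" unfolding gI_def hI_def by (auto intro!: Bochner_Integration.integral_nonneg)
    have A: "Afun U (2 - q) \<alpha> (\<lambda>x t. g\<Psi> t x) (\<lambda>x t. \<Psi>t t x) t = gI powr \<nu> + hI powr \<nu>'"
      by (simp add: Afun_def gI_def hI_def \<nu>_def \<nu>'_def)
    have G1: "G.G1 t powr \<nu> \<le> 2 powr \<nu> * (1 + gI powr \<nu>)"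
      using powr_add_le[of 1 gI \<nu>] gh nu by (simp add: G.G1_def gI_def)
    have H1: "G.H1 t powr \<nu>' \<le> 2 powr \<nu>' * (1 + hI powr \<nu>')"
      using powr_add_le[of 1 hI \<nu>'] gh nu by (simp add: G.H1_def hI_def)
    have mp: "m > 0" "G.G1 t > 0" "G.H1 t > 0" using F(2) G.data_pos(1,2)[of t] by auto
    have "z' \<le> - c0 * D + 2 * (\<alpha>\<^sup>2 + \<alpha>) * k2 * (G.F t powr s * m powr (1 - s))
      + 2 * (\<alpha>\<^sup>2 + \<alpha>) * C0 * (G.F t powr s * G.G1 t powr (1 - s)) + 2 * (\<alpha> + 1) * (G.F t powr s' * G.H1 t powr (1 - s'))"
      using ineq unfolding mm s_def s'_def .
    also have "\<dots> \<le> (- (4 * \<epsilon>) * G.F t powr \<theta> + c0 * M2 / M1) + (\<epsilon> * G.F t powr \<theta> + D1 * m powr \<nu>)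
       + (\<epsilon> * G.F t powr \<theta> + D2 * G.G1 t powr \<nu>) + (\<epsilon> * G.F t powr \<theta> + D3 * G.H1 t powr \<nu>')"
      by (intro add_mono cD D1(2) D2(2) D3(2) F(3) mp)
    also have "\<dots> \<le> (- (4 * \<epsilon>) * G.F t powr \<theta> + c0 * M2 / M1) + (\<epsilon> * G.F t powr \<theta> + D1 * m powr \<nu>)
       + (\<epsilon> * G.F t powr \<theta> + D2 * (2 powr \<nu> * (1 + gI powr \<nu>))) + (\<epsilon> * G.F t powr \<theta> + D3 * (2 powr \<nu>' * (1 + hI powr \<nu>')))"
      using G1 H1 D2(1) D3(1) by (intro add_mono mult_left_mono order_refl)
    also have "\<dots> \<le> - \<epsilon> * G.F t powr \<theta> + H * (1 + (gI powr \<nu> + hI powr \<nu>'))"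
    proof -
      have h2: "D2 * 2 powr \<nu> \<le> H" "D3 * 2 powr \<nu>' \<le> H"
        unfolding H_def using c0 M1 M2 D1(1) D2(1) D3(1) by (auto intro!: add_nonneg_nonneg simp: add_increasing add_increasing2)
      have "D2 * 2 powr \<nu> * gI powr \<nu> \<le> H * gI powr \<nu>" "D3 * 2 powr \<nu>' * hI powr \<nu>' \<le> H * hI powr \<nu>'"
        using h2 by (intro mult_right_mono; simp)+
      then show ?thesis by (simp add: H_def algebra_simps)
    qed
    finally have "z' \<le> - \<epsilon> * G.F t powr \<theta> + H * (1 + (gI powr \<nu> + hI powr \<nu>'))" .
    then have fin: "2 * z' \<le> - (2 * \<epsilon>) * G.F t powr \<theta> + 2 * H * (1 + (gI powr \<nu> + hI powr \<nu>'))" by simp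
    have "(excess U lo hi \<alpha> p \<Psi> has_real_derivative 2 * z') (at t)"
      unfolding FE using z'(1) by (auto intro!: derivative_eq_intros)
    moreover have "G.F t = excess U lo hi \<alpha> p \<Psi> t" by (simp add: FE G.F_def)
    ultimately show "\<exists>z'. (excess U lo hi \<alpha> p \<Psi> has_real_derivative z') (at t) \<and>
        z' \<le> - (2 * \<epsilon>) * excess U lo hi \<alpha> p \<Psi> t powr ((\<alpha> - 2 + q) / \<alpha>) + 2 * H * (1 + Afun U (2 - q) \<alpha> (\<lambda>x t. g\<Psi> t x) (\<lambda>x t. \<Psi>t t x) t)"
      using fin unfolding A \<theta>_def by auto
  qed
qed

section \<open>The supremum bound\<close>

text \<open>Since the closure of U is compact, f s converges to f t uniformly on it as s tends to t;
  the measure of U is finite.\<close>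

lemma LINT_param_continuous:
  fixes f :: "real \<Rightarrow> 'a::euclidean_space \<Rightarrow> real"
  assumes U: "open U" "bounded U" and f: "continuous_on (I \<times> closure U) (\<lambda>(t, x). f t x)"
  shows "continuous_on I (\<lambda>t. integral\<^sup>L (lebesgue_on U) (f t))"
proof (rule continuous_onI)
  fix t e :: real assume t: "t \<in> I" and e: "e > 0"
  have Ul: "U \<in> sets lebesgue" using U(1) by (simp add: lborelD)
  define m where "m = measure (lebesgue_on U) U"
  define e' where "e' = e / (m + 1)"
  have m: "m \<ge> 0" by (simp add: m_def)
  have e': "e' > 0" "e' * m \<le> e" using e m by (auto simp: e'_def field_simps)
  have i: "integrable (lebesgue_on U) (f s)" if "s \<in> I" for s
  proof (rule integrable_bounded_continuous[OF U])
    show "continuous_on (closure U) (f s)"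
      using continuous_on_compose2[OF f continuous_on_Pair_left[of "closure U" s]] that by auto
  qed
  obtain X0 where X0: "t \<in> X0" "open X0" "\<forall>s\<in>X0 \<inter> I. \<forall>x\<in>closure U. dist (case (s, x) of (t, x) \<Rightarrow> f t x) (case (t, x) of (t, x) \<Rightarrow> f t x) \<le> e'"
    using continuous_on_prod_compactE[OF f _ t e'(1)] U(2) by (metis compact_closure)
  obtain d where d: "d > 0" "ball t d \<subseteq> X0" using X0 openE by blast
  show "\<exists>d>0. \<forall>s\<in>I. dist s t < d \<longrightarrow> dist (integral\<^sup>L (lebesgue_on U) (f s)) (integral\<^sup>L (lebesgue_on U) (f t)) \<le> e"
  proof (intro exI[of _ d] conjI d ballI impI)
    fix s assume s: "s \<in> I" "dist s t < d"
    then have sX: "s \<in> X0 \<inter> I" using d(2) by (auto simp: dist_commute)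
    have "dist (integral\<^sup>L (lebesgue_on U) (f s)) (integral\<^sup>L (lebesgue_on U) (f t))
       = \<bar>integral\<^sup>L (lebesgue_on U) (\<lambda>x. f s x - f t x)\<bar>"
      using i[OF s(1)] i[OF t] by (simp add: dist_real_def)
    also have "\<dots> \<le> integral\<^sup>L (lebesgue_on U) (\<lambda>x. \<bar>f s x - f t x\<bar>)" by (rule integral_abs_bound)
    also have "\<dots> \<le> integral\<^sup>L (lebesgue_on U) (\<lambda>x. e')"
    proof (rule integral_mono)
      show "integrable (lebesgue_on U) (\<lambda>x. \<bar>f s x - f t x\<bar>)" using i[OF s(1)] i[OF t] by auto
      show "integrable (lebesgue_on U) (\<lambda>x. e')" by (rule integrable_bounded_continuous[OF U]) simp
      fix x assume "x \<in> space (lebesgue_on U)"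
      then show "\<bar>f s x - f t x\<bar> \<le> e'" using X0(3) sX closure_subset[of U] by (auto simp: dist_real_def)
    qed
    also have "\<dots> = e' * m" by (simp add: m_def)
    finally show "dist (integral\<^sup>L (lebesgue_on U) (f s)) (integral\<^sup>L (lebesgue_on U) (f t)) \<le> e" using e'(2) by linarith
  qed
qed

lemma ext_integral_LINT:
  fixes f :: "'a::euclidean_space \<Rightarrow> real"
  assumes U: "open U" "U \<subseteq> cbox lo hi" and f: "continuous_on (closure U) f"
  shows "integral (cbox lo hi) (ext U f) = integral\<^sup>L (lebesgue_on U) f"
proof -
  have Ul: "U \<in> sets lebesgue" using U(1) by (simp add: lborelD)
  have i: "integrable (lebesgue_on U) f"
    using U bounded_subset[OF bounded_cbox] by (intro integrable_bounded_continuous f) auto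
  have "integral\<^sup>L (lebesgue_on U) f = integral U f" by (rule lebesgue_integral_eq_integral[OF i Ul])
  also have "\<dots> = integral (cbox lo hi) (ext U f)"
    unfolding ext_def[abs_def] using U(2) by (subst integral_restrict_Int) (simp add: Int_absorb2)
  finally show ?thesis ..
qed

text \<open>Passes from the completed measure to \<open>lborel\<close>, for which the product
  structure needed by Fubini is at hand. Extended by zero from the open set, f is Borel, so both
  integrals agree.\<close>

lemma LINT_open_eq_indicator:
  fixes f :: "'a::euclidean_space \<Rightarrow> real"
  assumes U: "open U" and f: "continuous_on U f"
  shows "integral\<^sup>L (lebesgue_on U) f = integral\<^sup>L lborel (\<lambda>x. indicator U x *\<^sub>R f x)"
    "integrable (lebesgue_on U) f \<longleftrightarrow> integrable lborel (\<lambda>x. indicator U x *\<^sub>R f x)"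
proof -
  have Ul: "U \<in> sets lebesgue" using U(1) by (simp add: lborelD)
  have m: "(\<lambda>x. indicator U x *\<^sub>R f x) \<in> borel_measurable lborel"
    using borel_measurable_continuous_on_indicator[OF _ f] U by simp
  have "integral\<^sup>L (lebesgue_on U) f = integral\<^sup>L lebesgue (\<lambda>x. indicator U x *\<^sub>R f x)"
    using Ul by (intro integral_restrict_space) simp
  then show "integral\<^sup>L (lebesgue_on U) f = integral\<^sup>L lborel (\<lambda>x. indicator U x *\<^sub>R f x)"
    by (simp only: integral_completion[OF m])
  have "integrable (lebesgue_on U) f \<longleftrightarrow> integrable lebesgue (\<lambda>x. indicator U x *\<^sub>R f x)"
    using Ul by (intro integrable_restrict_space) simp
  then show "integrable (lebesgue_on U) f \<longleftrightarrow> integrable lborel (\<lambda>x. indicator U x *\<^sub>R f x)"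
    by (simp only: integrable_completion[OF m])
qed

lemma LINT_interval:
  fixes h :: "real \<Rightarrow> real"
  assumes "continuous_on {a..b} h"
  shows "integral\<^sup>L (lebesgue_on {a<..<b}) h = integral {a..b} h"
proof -
  have "continuous_on (closure {a<..<b}) h"
    by (rule continuous_on_subset[OF assms]) (cases "a < b"; simp)
  then have "integrable (lebesgue_on {a<..<b}) h" by (intro integrable_bounded_continuous) auto
  then have "integral\<^sup>L (lebesgue_on {a<..<b}) h = integral {a<..<b} h" by (intro lebesgue_integral_eq_integral) (auto simp: lborelD)
  then show ?thesis by (simp add: integral_open_interval_real)
qed

text \<open>Fubini, identifying the space-time norm of \<Psi> in the theorem with a time integral of
  slice integrals, the form in which the local estimate uses it.\<close>

lemma LINT_slices:
  fixes f :: "real \<Rightarrow> 'a::euclidean_space \<Rightarrow> real"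
  assumes U: "open U" "bounded U" and f: "continuous_on ({a..b} \<times> closure U) (\<lambda>(t, x). f t x)"
  shows "integral\<^sup>L (lebesgue_on (U \<times> {a<..<b})) (\<lambda>z. f (snd z) (fst z)) = integral {a..b} (\<lambda>t. integral\<^sup>L (lebesgue_on U) (f t))"
proof -
  define Q where "Q = U \<times> {a<..<b}"
  define g where "g z = f (snd z) (fst z)" for z
  have Q: "open Q" "bounded Q" using U by (auto simp: Q_def open_Times bounded_Times)
  have "closure {a<..<b} \<subseteq> {a..b}" by (intro closure_minimal) auto
  then have cl: "closure Q \<subseteq> closure U \<times> {a..b}" by (auto simp: Q_def closure_Times)
  have g: "continuous_on (closure Q) g" unfolding g_def
    using cl by (intro continuous_on_compose2[OF f[unfolded split_beta], of "closure Q" "\<lambda>z. (snd z, fst z)", simplified] continuous_intros) auto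
  have gQ: "continuous_on Q g" by (rule continuous_on_subset[OF g closure_subset])
  have i: "integrable (lborel \<Otimes>\<^sub>M lborel) (\<lambda>z. indicator Q z *\<^sub>R g z)"
    using integrable_bounded_continuous[OF Q g] LINT_open_eq_indicator(2)[OF Q(1) gQ] by (simp add: lborel_prod)
  have "integral\<^sup>L (lebesgue_on Q) g = integral\<^sup>L (lborel \<Otimes>\<^sub>M lborel) (\<lambda>(x, t). indicator Q (x, t) *\<^sub>R g (x, t))"
    using LINT_open_eq_indicator(1)[OF Q(1) gQ] by (simp add: lborel_prod case_prod_unfold)
  also have "\<dots> = (LINT t|lborel. LINT x|lborel. indicator Q (x, t) *\<^sub>R g (x, t))"
    using lborel_pair.integral_snd[of "\<lambda>x t. indicator Q (x, t) *\<^sub>R g (x, t)"] i by (simp add: case_prod_unfold)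
  also have "\<dots> = (LINT t|lborel. indicator {a<..<b} t *\<^sub>R integral\<^sup>L (lebesgue_on U) (f t))"
  proof (rule Bochner_Integration.integral_cong[OF refl])
    fix t
    show "(LINT x|lborel. indicator Q (x, t) *\<^sub>R g (x, t)) = indicator {a<..<b} t *\<^sub>R integral\<^sup>L (lebesgue_on U) (f t)"
    proof (cases "t \<in> {a<..<b}")
      case True
      then have t: "t \<in> {a..b}" by simp
      have "Pair t ` U \<subseteq> {a..b} \<times> closure U" using t closure_subset[of U] by blast
      from continuous_on_compose2[OF f continuous_on_Pair_left this] have "continuous_on U (f t)" by simp
      then show ?thesis using True LINT_open_eq_indicator(1)[OF U(1), of "f t"]
        by (simp add: Q_def g_def indicator_times)
    qed (simp add: Q_def indicator_times)
  qed
  also have "\<dots> = integral\<^sup>L (lebesgue_on {a<..<b}) (\<lambda>t. integral\<^sup>L (lebesgue_on U) (f t))"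
    by (rule LINT_open_eq_indicator(1)[symmetric]) (auto intro: continuous_on_subset[OF LINT_param_continuous[OF U f]])
  also have "\<dots> = integral {a..b} (\<lambda>t. integral\<^sup>L (lebesgue_on U) (f t))"
    by (rule LINT_interval[OF LINT_param_continuous[OF U f]])
  finally show ?thesis unfolding Q_def g_def .
qed

lemma Linf_norm_le:
  fixes f :: "'a::euclidean_space \<Rightarrow> real"
  assumes "open S" "continuous_on S f" "\<And>x. x \<in> S \<Longrightarrow> \<bar>f x\<bar> \<le> c"
  shows "Linf_norm S f \<le> ereal c"
  unfolding Linf_norm_def
proof (rule esssup_I)
  have "(\<lambda>x. \<bar>f x\<bar>) \<in> borel_measurable (lebesgue_on S)"
    using assms by (intro continuous_imp_measurable_on_sets_lebesgue) (auto simp: lborelD intro: continuous_on_rabs)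
  then show "(\<lambda>x. ereal \<bar>f x\<bar>) \<in> borel_measurable (lebesgue_on S)" by simp
  show "AE x in lebesgue_on S. ereal \<bar>f x\<bar> \<le> ereal c"
    using assms(3) by (intro AE_I2) auto
qed

lemma Lnorm_powr:
  assumes "q > 0"
  shows "Lnorm M q f powr q = integral\<^sup>L M (\<lambda>x. \<bar>f x\<bar> powr q)" "Lnorm M q f \<ge> 0"
  using assms by (auto simp: Lnorm_def powr_powr intro!: powr_one Bochner_Integration.integral_nonneg)

section \<open>Three consequences of the differential inequality for Z\<close>

lemma ode_bounded:
  fixes Z A :: "real \<Rightarrow> real"
  assumes Zc: "continuous_on {0..} Z" and Z0: "Z 0 \<ge> 0" and c: "c1 > 0" "C1 > 0" "\<theta> > 0"
    and ode: "\<And>s. s > 0 \<Longrightarrow> \<exists>z'. (Z has_real_derivative z') (at s) \<and> z' \<le> - c1 * Z s powr \<theta> + C1 * (1 + A s)"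
    and A: "\<And>s. 0 < s \<Longrightarrow> s \<le> t \<Longrightarrow> A s \<le> F" and F: "F \<ge> 0" and s: "0 \<le> s" "s \<le> t"
  shows "Z s \<le> Z 0 + (C1 * (1 + F) / c1) powr (1 / \<theta>)"
proof -
  \<comment> \<open>The equilibrium of the inequality under the constant forcing F: at or above it
    the right-hand side is nonpositive, so Z 0 + k is a barrier.\<close>
  define k where "k = (C1 * (1 + F) / c1) powr (1 / \<theta>)"
  have k: "k powr \<theta> = C1 * (1 + F) / c1" "k \<ge> 0" using c F by (auto simp: k_def powr_powr)
  obtain Z' where Z': "\<And>s. s > 0 \<Longrightarrow> (Z has_real_derivative Z' s) (at s)" "\<And>s. s > 0 \<Longrightarrow> Z' s \<le> - c1 * Z s powr \<theta> + C1 * (1 + A s)"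
    using ode by metis
  have "Z s - (Z 0 + k) \<le> 0"
  proof (rule barrier_le[of 0 s "\<lambda>r. Z r - (Z 0 + k)" Z'])
    show "continuous_on {0..s} (\<lambda>r. Z r - (Z 0 + k))" by (intro continuous_intros continuous_on_subset[OF Zc]) auto
    fix r assume r: "0 < r" "r < s"
    show "((\<lambda>r. Z r - (Z 0 + k)) has_real_derivative Z' r) (at r)"
      using Z'(1)[OF r(1)] by (auto intro!: derivative_eq_intros)
    assume "Z r - (Z 0 + k) > 0"
    then have "k \<le> Z r" using Z0 by linarith
    then have "k powr \<theta> \<le> Z r powr \<theta>" using k c by (intro powr_mono2) auto
    then have "c1 * (C1 * (1 + F) / c1) \<le> c1 * Z r powr \<theta>" unfolding k(1) using c by (intro mult_left_mono) auto
    moreover have "c1 * (C1 * (1 + F) / c1) = C1 * (1 + F)" using c by simp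
    moreover have "C1 * (1 + A r) \<le> C1 * (1 + F)" using A[of r] r s c by (intro mult_left_mono) auto
    ultimately show "Z' r \<le> 0" using Z'(2)[OF r(1)] by linarith
  qed (use s k in auto)
  then show ?thesis by (simp add: k_def)
qed

text \<open>Doubling the equilibrium term makes the derivative at most - C1 (1 + F) above the
  barrier, so the initial value is forgotten after a finite time.\<close>

lemma ode_eventually_bounded:
  fixes Z A :: "real \<Rightarrow> real"
  assumes c: "c1 > 0" "C1 > 0" "\<theta> > 0"
    and ode: "\<And>s. s > 0 \<Longrightarrow> \<exists>z'. (Z has_real_derivative z') (at s) \<and> z' \<le> - c1 * Z s powr \<theta> + C1 * (1 + A s)"
    and A: "\<And>s. s \<ge> T0 \<Longrightarrow> A s \<le> F" and F: "F \<ge> 0" and T0: "T0 > 0"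
  shows "\<exists>T\<ge>T0. \<forall>t\<ge>T. Z t \<le> (2 * C1 * (1 + F) / c1) powr (1 / \<theta>)"
proof -
  define k where "k = (2 * C1 * (1 + F) / c1) powr (1 / \<theta>)"
  have k: "k powr \<theta> = 2 * C1 * (1 + F) / c1" "k \<ge> 0" using c F by (auto simp: k_def powr_powr)
  obtain Z' where Z': "\<And>s. s > 0 \<Longrightarrow> (Z has_real_derivative Z' s) (at s)" "\<And>s. s > 0 \<Longrightarrow> Z' s \<le> - c1 * Z s powr \<theta> + C1 * (1 + A s)"
    using ode by metis
  have "\<exists>T\<ge>T0. \<forall>t\<ge>T. Z t - k \<le> 0"
  proof (rule eventually_barrier_le[of "\<lambda>t. Z t - k" Z' T0 "C1 * (1 + F)"])
    show "C1 * (1 + F) > 0" using c F by simp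
    fix r assume r: "T0 \<le> r" "Z r - k > 0"
    then have "k powr \<theta> \<le> Z r powr \<theta>" using k c by (intro powr_mono2) auto
    then have "c1 * (2 * C1 * (1 + F) / c1) \<le> c1 * Z r powr \<theta>" unfolding k(1) using c by (intro mult_left_mono) auto
    moreover have "c1 * (2 * C1 * (1 + F) / c1) = 2 * (C1 * (1 + F))" using c by simp
    moreover have "C1 * (1 + A r) \<le> C1 * (1 + F)" using A[of r] r c by (intro mult_left_mono) auto
    moreover have "Z' r \<le> - c1 * Z r powr \<theta> + C1 * (1 + A r)" using Z'(2)[of r] r T0 by simp
    ultimately show "Z' r \<le> - (C1 * (1 + F))" by linarith
  qed (use T0 Z' in \<open>auto intro!: derivative_eq_intros\<close>)
  then show ?thesis by (simp add: k_def)
qed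

text \<open>The barrier H powr (1/\<theta>) with H = 2 C1 (1 + A)/c1 + b moves with A, so A need not
  be bounded; only the rate at which it decreases matters. The barrier falls at a rate of at most a
  multiple of B times H powr (1/\<theta> - 1), and b is taken so large that this is at most c1 H /
  2. That needs 2 - 1/\<theta> > 0, that is \<theta> > 1/2, which for \<theta> = (\<alpha> -
  a)/\<alpha> means \<alpha> > 2 a.\<close>

lemma ode_tracks_forcing:
  fixes Z A dA :: "real \<Rightarrow> real"
  assumes c: "c1 > 0" "C1 > 0" "1/2 < \<theta>" "\<theta> \<le> 1"
    and ode: "\<And>s. s > 0 \<Longrightarrow> \<exists>z'. (Z has_real_derivative z') (at s) \<and> z' \<le> - c1 * Z s powr \<theta> + C1 * (1 + A s)"
    and A: "\<And>s. A s \<ge> 0" "\<And>s. s > 0 \<Longrightarrow> (A has_real_derivative dA s) (at s)"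
    and B: "\<And>s. s \<ge> T0 \<Longrightarrow> - dA s \<le> B" "B > 0" and T0: "T0 > 0"
  shows "\<exists>T\<ge>T0. \<forall>t\<ge>T. Z t \<le> (2 * C1 * (1 + A t) / c1 + (4 * C1 * B / (\<theta> * c1\<^sup>2)) powr (1 / (2 - 1 / \<theta>))) powr (1 / \<theta>)"
proof -
  define \<mu> where "\<mu> = 2 - 1 / \<theta>"
  have mu: "\<mu> > 0" using c by (simp add: \<mu>_def field_simps)
  define b where "b = (4 * C1 * B / (\<theta> * c1\<^sup>2)) powr (1 / \<mu>)"
  have b: "b > 0" "b powr \<mu> = 4 * C1 * B / (\<theta> * c1\<^sup>2)" using c B mu by (auto simp: b_def powr_powr)
  define H where "H t = 2 * C1 * (1 + A t) / c1 + b" for t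
  have H: "H t \<ge> b" "H t > 0" for t using A(1)[of t] c b by (auto simp: H_def intro!: add_nonneg_pos)
  obtain Z' where Z': "\<And>s. s > 0 \<Longrightarrow> (Z has_real_derivative Z' s) (at s)" "\<And>s. s > 0 \<Longrightarrow> Z' s \<le> - c1 * Z s powr \<theta> + C1 * (1 + A s)"
    using ode by metis
  have "\<exists>T\<ge>T0. \<forall>t\<ge>T. Z t - H t powr (1 / \<theta>) \<le> 0"
  proof (rule eventually_barrier_le[of "\<lambda>t. Z t - H t powr (1 / \<theta>)" "\<lambda>t. Z' t - (1 / \<theta>) * H t powr (1 / \<theta> - 1) * (2 * C1 * dA t / c1)" T0 "c1 * b / 2"])
    show "c1 * b / 2 > 0" using c b by simp
    fix r :: real
    { assume r: "r > 0"
      have Hd: "(H has_real_derivative 2 * C1 * dA r / c1) (at r)" unfolding H_def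
        using A(2)[OF r] c by (auto intro!: derivative_eq_intros)
      have "((\<lambda>t. H t powr (1 / \<theta>)) has_real_derivative (1 / \<theta>) * H r powr (1 / \<theta> - 1) * (2 * C1 * dA r / c1)) (at r)"
        using DERIV_fun_powr[OF Hd H(2), of "1 / \<theta>"] by simp
      then show "((\<lambda>t. Z t - H t powr (1 / \<theta>)) has_real_derivative Z' r - (1 / \<theta>) * H r powr (1 / \<theta> - 1) * (2 * C1 * dA r / c1)) (at r)"
        by (intro DERIV_diff Z'(1) r) }
    assume r: "T0 \<le> r" "Z r - H r powr (1 / \<theta>) > 0"
    have r0: "r > 0" using r T0 by simp
    have "(H r powr (1 / \<theta>)) powr \<theta> \<le> Z r powr \<theta>" using r c by (intro powr_mono2) auto
    then have 1: "c1 * H r \<le> c1 * Z r powr \<theta>" using c H(2)[of r] by (simp add: powr_powr)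
    have 2: "C1 * (1 + A r) = c1 * (H r - b) / 2" using c by (simp add: H_def)
    have "b powr \<mu> \<le> H r powr \<mu>" using H[of r] b mu by (intro powr_mono2) auto
    then have "4 * C1 * B / (\<theta> * c1\<^sup>2) * H r powr (1 / \<theta> - 1) \<le> H r powr \<mu> * H r powr (1 / \<theta> - 1)"
      unfolding b(2) by (intro mult_right_mono) auto
    also have "\<dots> = H r" using H(2)[of r] by (simp add: \<mu>_def flip: powr_add)
    finally have "c1 / 2 * (4 * C1 * B / (\<theta> * c1\<^sup>2) * H r powr (1 / \<theta> - 1)) \<le> c1 / 2 * H r" using c by (intro mult_left_mono) auto
    moreover have "c1 / 2 * (4 * C1 * B / (\<theta> * c1\<^sup>2) * H r powr (1 / \<theta> - 1)) = (1 / \<theta>) * H r powr (1 / \<theta> - 1) * (2 * C1 * B / c1)"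
      using c by (simp add: field_simps power2_eq_square)
    moreover have "(1 / \<theta>) * H r powr (1 / \<theta> - 1) * (2 * C1 * (- dA r) / c1) \<le> (1 / \<theta>) * H r powr (1 / \<theta> - 1) * (2 * C1 * B / c1)"
      using B(1)[OF r(1)] c by (intro mult_left_mono divide_right_mono) auto
    ultimately have 3: "- ((1 / \<theta>) * H r powr (1 / \<theta> - 1) * (2 * C1 * dA r / c1)) \<le> c1 / 2 * H r" by simp
    have 4: "c1 * (H r - b) / 2 = c1 / 2 * H r - c1 * b / 2" "c1 * H r = c1 / 2 * H r + c1 / 2 * H r" by (simp_all add: field_simps)
    show "Z' r - (1 / \<theta>) * H r powr (1 / \<theta> - 1) * (2 * C1 * dA r / c1) \<le> - (c1 * b / 2)"
      using Z'(2)[OF r0] 1 2 3 4 by linarith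
  qed (use T0 in auto)
  then show ?thesis by (simp add: H_def b_def \<mu>_def)
qed

lemma LINT_const_on:
  assumes "open U"
  shows "integral\<^sup>L (lebesgue_on U) (\<lambda>x. c :: real) = c * measure lebesgue U"
  using assms by (simp add: measure_restrict_space lborelD)

lemma global_setting_uminus:
  assumes "global_setting U lo hi \<alpha> q k1 k2 k3 K p gp pt \<Psi> g\<Psi> \<Psi>t"
  shows "global_setting U lo hi \<alpha> q k1 k2 k3 K (\<lambda>t x. - p t x) (\<lambda>t x. - gp t x) (\<lambda>t x. - pt t x)
    (\<lambda>t x. - \<Psi> t x) (\<lambda>t x. - g\<Psi> t x) (\<lambda>t x. - \<Psi>t t x)"
proof -
  interpret global_setting U lo hi \<alpha> q k1 k2 k3 K p gp pt \<Psi> g\<Psi> \<Psi>t by (rule assms)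
  show ?thesis
  proof
    fix t :: real and x assume tx: "0 < t" "x \<in> U"
    show "((\<lambda>x. - \<Psi> t x) has_derivative (\<lambda>h. - g\<Psi> t x \<bullet> h)) (at x)"
      using has_derivative_minus[OF Psi_x[OF tx]] by simp
    show "((\<lambda>s. - \<Psi> s x) has_real_derivative - \<Psi>t t x) (at t)" by (intro DERIV_minus Psi_t tx)
  qed (use U al q k K1 K2 K3 flow_uminus[OF fl] bd p_cont Psi_cont in \<open>auto simp: split_beta intro: continuous_on_minus\<close>)
qed

section \<open>The excesses of p and - p, and the integral of |p| powr \<alpha>\<close>

context global_setting
begin

lemma slices:
  assumes "t \<ge> 0"
  shows "continuous_on (closure U) (p t)" "continuous_on (closure U) (\<Psi> t)"
  using slice_cont[OF p_cont assms] slice_cont[OF Psi_cont(1) assms] by auto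

lemma excess_LINT:
  assumes "t \<ge> 0"
  shows "excess U lo hi \<alpha> p \<Psi> t = 2 * integral\<^sup>L (lebesgue_on U) (\<lambda>x. phi0 \<alpha> 1 (p t x - \<Psi> t x - 1)) + mU + 1"
    "integrable (lebesgue_on U) (\<lambda>x. phi0 \<alpha> 1 (p t x - \<Psi> t x - 1))"
proof -
  have c: "continuous_on (closure U) (\<lambda>x. phi0 \<alpha> 1 (p t x - \<Psi> t x - 1))"
    using al by (intro continuous_phi continuous_on_diff slices[OF assms] continuous_on_const) auto
  show "excess U lo hi \<alpha> p \<Psi> t = 2 * integral\<^sup>L (lebesgue_on U) (\<lambda>x. phi0 \<alpha> 1 (p t x - \<Psi> t x - 1)) + mU + 1"
    unfolding excess_def mU_def by (subst ext_integral_LINT[OF U c]) simp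
  show "integrable (lebesgue_on U) (\<lambda>x. phi0 \<alpha> 1 (p t x - \<Psi> t x - 1))"
    by (rule integrable_bounded_continuous[OF U(1) bU c])
qed

lemma excess_ge_1: "t \<ge> 0 \<Longrightarrow> excess U lo hi \<alpha> p \<Psi> t \<ge> 1"
  using al data_pos(3) by (simp add: excess_LINT phi_nonneg Bochner_Integration.integral_nonneg)

lemma excess_continuous: "continuous_on {0..} (excess U lo hi \<alpha> p \<Psi>)"
proof -
  have "continuous_on {0..} (\<lambda>t. integral\<^sup>L (lebesgue_on U) (\<lambda>x. phi0 \<alpha> 1 (p t x - \<Psi> t x - 1)))"
  proof (rule LINT_param_continuous[OF U(1) bU])
    show "continuous_on ({0..} \<times> closure U) (\<lambda>(t, x). phi0 \<alpha> 1 (p t x - \<Psi> t x - 1))"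
      using al unfolding split_beta
      by (intro continuous_phi continuous_on_diff p_cont[unfolded split_beta] Psi_cont(1)[unfolded split_beta] continuous_on_const) auto
  qed
  then have "continuous_on {0..} (\<lambda>t. 2 * integral\<^sup>L (lebesgue_on U) (\<lambda>x. phi0 \<alpha> 1 (p t x - \<Psi> t x - 1)) + mU + 1)"
    by (intro continuous_intros)
  then show ?thesis by (rule continuous_on_eq) (simp add: excess_LINT)
qed

lemma excess_initial:
  "excess U lo hi \<alpha> p \<Psi> 0 \<le> 2 * integral\<^sup>L (lebesgue_on U) (\<lambda>x. \<bar>p 0 x - \<Psi> 0 x\<bar> powr \<alpha>) + mU + 1"
proof -
  have "integral\<^sup>L (lebesgue_on U) (\<lambda>x. phi0 \<alpha> 1 (p 0 x - \<Psi> 0 x - 1)) \<le> integral\<^sup>L (lebesgue_on U) (\<lambda>x. \<bar>p 0 x - \<Psi> 0 x\<bar> powr \<alpha>)"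
  proof (rule integral_mono[OF excess_LINT(2)])
    show "integrable (lebesgue_on U) (\<lambda>x. \<bar>p 0 x - \<Psi> 0 x\<bar> powr \<alpha>)"
      using al by (intro integrable_bounded_continuous[OF U(1) bU] continuous_on_powr_const continuous_on_rabs continuous_on_diff slices) auto
    fix x
    show "phi0 \<alpha> 1 (p 0 x - \<Psi> 0 x - 1) \<le> \<bar>p 0 x - \<Psi> 0 x\<bar> powr \<alpha>"
    proof (cases "p 0 x - \<Psi> 0 x - 1 > 0")
      case True
      define s where "s = p 0 x - \<Psi> 0 x - 1"
      have "phi0 \<alpha> 1 s = s powr \<alpha> * (s / (1 + s))" using True by (intro phi0_eq) (auto simp: s_def)
      also have "\<dots> \<le> s powr \<alpha>" using True by (intro mult_left_le) (auto simp: s_def)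
      also have "\<dots> \<le> \<bar>p 0 x - \<Psi> 0 x\<bar> powr \<alpha>" using True al by (intro powr_mono2) (auto simp: s_def)
      finally show ?thesis by (simp add: s_def)
    qed (simp add: phi_nonpos)
  qed simp
  then show ?thesis by (simp add: excess_LINT)
qed

text \<open>With v = p - \<Psi> one has |v| \<le> 1 + (|v| - 1)_+, and the truncated part is
  controlled by the excess of p where v is positive and by that of - p where v is negative.\<close>

lemma p_integral_bound:
  assumes t: "t \<ge> 0"
  shows "integral\<^sup>L (lebesgue_on U) (\<lambda>x. \<bar>p t x\<bar> powr \<alpha>)
    \<le> 2 powr \<alpha> * (3 * 2 powr \<alpha> * (excess U lo hi \<alpha> p \<Psi> t + excess U lo hi \<alpha> (\<lambda>t x. - p t x) (\<lambda>t x. - \<Psi> t x) t)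
        + integral\<^sup>L (lebesgue_on U) (\<lambda>x. \<bar>\<Psi> t x\<bar> powr \<alpha>))"
proof -
  interpret M: global_setting U lo hi \<alpha> q k1 k2 k3 K "\<lambda>t x. - p t x" "\<lambda>t x. - gp t x" "\<lambda>t x. - pt t x"
    "\<lambda>t x. - \<Psi> t x" "\<lambda>t x. - g\<Psi> t x" "\<lambda>t x. - \<Psi>t t x"
    by (rule global_setting_uminus) unfold_locales
  let ?I = "integral\<^sup>L (lebesgue_on U)"
  define f g h where "f x = phi0 \<alpha> 1 (p t x - \<Psi> t x - 1)" and "g x = phi0 \<alpha> 1 (- p t x - - \<Psi> t x - 1)"
    and "h x = \<bar>\<Psi> t x\<bar> powr \<alpha>" for x
  have fg: "integrable (lebesgue_on U) f" "integrable (lebesgue_on U) g"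
    using excess_LINT(2)[OF t] M.excess_LINT(2)[OF t] by (simp_all add: f_def[abs_def] g_def[abs_def])
  have c1: "integrable (lebesgue_on U) (\<lambda>x. 3 :: real)" by (rule integrable_bounded_continuous[OF U(1) bU]) simp
  have h: "integrable (lebesgue_on U) h" unfolding h_def
    using al by (intro integrable_bounded_continuous[OF U(1) bU] continuous_on_powr_const continuous_on_rabs slices t) auto
  have "?I (\<lambda>x. \<bar>p t x\<bar> powr \<alpha>) \<le> ?I (\<lambda>x. 2 powr \<alpha> * (2 powr \<alpha> * (2 * f x + 2 * g x + 3) + h x))"
  proof (rule integral_mono)
    show "integrable (lebesgue_on U) (\<lambda>x. \<bar>p t x\<bar> powr \<alpha>)"
      using al by (intro integrable_bounded_continuous[OF U(1) bU] continuous_on_powr_const continuous_on_rabs slices t) auto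
    show "integrable (lebesgue_on U) (\<lambda>x. 2 powr \<alpha> * (2 powr \<alpha> * (2 * f x + 2 * g x + 3) + h x))"
      by (intro Bochner_Integration.integrable_add integrable_mult_right fg h c1)
    fix x
    define v where "v = p t x - \<Psi> t x"
    have "\<bar>v\<bar> powr \<alpha> \<le> (1 + max 0 (\<bar>v\<bar> - 1)) powr \<alpha>" using al by (intro powr_mono2) auto
    also have "\<dots> \<le> 2 powr \<alpha> * (1 powr \<alpha> + max 0 (\<bar>v\<bar> - 1) powr \<alpha>)" using al by (intro powr_add_le) auto
    also have "max 0 (\<bar>v\<bar> - 1) powr \<alpha> \<le> max 0 (v - 1) powr \<alpha> + max 0 (- v - 1) powr \<alpha>"
      by (cases "v \<ge> 0") auto
    also have "\<dots> \<le> (2 * f x + 1) + (2 * g x + 1)"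
      using phi_w_bound[of "v - 1"] phi_w_bound[of "- v - 1"] by (simp add: f_def g_def v_def)
    finally have v: "\<bar>v\<bar> powr \<alpha> \<le> 2 powr \<alpha> * (2 * f x + 2 * g x + 3)" by (simp add: algebra_simps)
    have "\<bar>p t x\<bar> powr \<alpha> \<le> (\<bar>v\<bar> + \<bar>\<Psi> t x\<bar>) powr \<alpha>" using al by (intro powr_mono2) (auto simp: v_def)
    also have "\<dots> \<le> 2 powr \<alpha> * (\<bar>v\<bar> powr \<alpha> + h x)" unfolding h_def using al by (intro powr_add_le) auto
    also have "\<dots> \<le> 2 powr \<alpha> * (2 powr \<alpha> * (2 * f x + 2 * g x + 3) + h x)" using v by (intro mult_left_mono) auto
    finally show "\<bar>p t x\<bar> powr \<alpha> \<le> 2 powr \<alpha> * (2 powr \<alpha> * (2 * f x + 2 * g x + 3) + h x)" .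
  qed
  also have "\<dots> = 2 powr \<alpha> * (2 powr \<alpha> * (2 * ?I f + 2 * ?I g + 3 * mU) + ?I h)"
    using fg h c1 LINT_const_on[OF U(1), of 3] by (simp add: mU_def)
  also have "\<dots> \<le> 2 powr \<alpha> * (3 * 2 powr \<alpha> * (excess U lo hi \<alpha> p \<Psi> t + excess U lo hi \<alpha> (\<lambda>t x. - p t x) (\<lambda>t x. - \<Psi> t x) t) + ?I h)"
  proof (intro mult_left_mono add_right_mono)
    have "?I f \<ge> 0" "?I g \<ge> 0" using al by (auto simp: f_def g_def phi_nonneg intro!: Bochner_Integration.integral_nonneg)
    then have "2 * ?I f + 2 * ?I g + 3 * mU \<le> 3 * ((2 * ?I f + mU + 1) + (2 * ?I g + mU + 1))" using data_pos(3) by simp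
    also have "\<dots> = 3 * (excess U lo hi \<alpha> p \<Psi> t + excess U lo hi \<alpha> (\<lambda>t x. - p t x) (\<lambda>t x. - \<Psi> t x) t)"
      by (simp add: excess_LINT[OF t] M.excess_LINT[OF t] M.mU_def mU_def f_def[abs_def] g_def[abs_def])
    finally have "2 powr \<alpha> * (2 * ?I f + 2 * ?I g + 3 * mU) \<le> 2 powr \<alpha> * (3 * (excess U lo hi \<alpha> p \<Psi> t + excess U lo hi \<alpha> (\<lambda>t x. - p t x) (\<lambda>t x. - \<Psi> t x) t))"
      by (intro mult_left_mono) auto
    then show "2 powr \<alpha> * (2 * ?I f + 2 * ?I g + 3 * mU) \<le> 3 * 2 powr \<alpha> * (excess U lo hi \<alpha> p \<Psi> t + excess U lo hi \<alpha> (\<lambda>t x. - p t x) (\<lambda>t x. - \<Psi> t x) t)"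
      by (simp only: mult.assoc mult.left_commute)
  qed auto
  finally show ?thesis by (simp add: h_def[abs_def])
qed

end

lemma continuous_on_swap_args:
  assumes "continuous_on (A \<times> B) (\<lambda>z. f (fst z) (snd z))"
  shows "continuous_on (B \<times> A) (\<lambda>(t, x). f x t)"
  using continuous_on_compose2[OF assms, of "B \<times> A" "\<lambda>z. (snd z, fst z)"]
  by (force simp: split_beta intro!: continuous_intros)

text \<open>Swaps the order of the arguments. At positive times the derivative of \<Psi> within [0,
  \<infinity>) is two-sided.\<close>

lemma classical_solution_global_setting:
  assumes U: "open U" "U \<subseteq> cbox lo hi" and al: "\<alpha> \<ge> 2"
    and q: "1 < q" "q < 2" and k: "k1 > 0" "k2 > 0" "k3 > 0"
    and K: "\<And>X. X \<ge> 0 \<Longrightarrow> K X * X\<^sup>2 \<ge> k1 * X powr q - k2"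
      "\<And>X. X \<ge> 0 \<Longrightarrow> K X * X \<le> k3 * X powr (q - 1)" "\<And>X. X \<ge> 0 \<Longrightarrow> K X \<ge> 0"
    and s: "classical_solution U K p \<Psi> g\<Psi> \<Psi>t"
  obtains gp pt where "global_setting U lo hi \<alpha> q k1 k2 k3 K (\<lambda>t x. p x t) gp pt (\<lambda>t x. \<Psi> x t) (\<lambda>t x. g\<Psi> x t) (\<lambda>t x. \<Psi>t x t)"
proof -
  obtain gradp pt DF where p: "continuous_on (closure U \<times> {0..}) (\<lambda>z. p (fst z) (snd z))"
     "\<And>x t. x\<in>U \<Longrightarrow> t>0 \<Longrightarrow> ((\<lambda>y. p y t) has_derivative (\<lambda>h. gradp x t \<bullet> h)) (at x)"
     "continuous_on (closure U \<times> {0<..}) (\<lambda>z. gradp (fst z) (snd z))"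
     "\<And>x t. x\<in>U \<Longrightarrow> t>0 \<Longrightarrow> ((\<lambda>s. p x s) has_real_derivative pt x t) (at t)"
     "continuous_on (closure U \<times> {0<..}) (\<lambda>z. pt (fst z) (snd z))"
     "\<And>x t. x\<in>U \<Longrightarrow> t>0 \<Longrightarrow> ((\<lambda>y. K (norm (gradp y t)) *\<^sub>R gradp y t) has_derivative DF x t) (at x)"
     "\<And>x t. x\<in>U \<Longrightarrow> t>0 \<Longrightarrow> pt x t = (\<Sum>i\<in>UNIV. DF x t (axis i 1) $ i)"
     "\<And>x t. x\<in>frontier U \<Longrightarrow> t>0 \<Longrightarrow> p x t = \<Psi> x t"
    and Psi: "continuous_on (closure U \<times> {0..}) (\<lambda>z. \<Psi> (fst z) (snd z))"
     "\<And>x t. x\<in>U \<Longrightarrow> t\<ge>0 \<Longrightarrow> ((\<lambda>y. \<Psi> y t) has_derivative (\<lambda>h. g\<Psi> x t \<bullet> h)) (at x)"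
     "continuous_on (closure U \<times> {0..}) (\<lambda>z. g\<Psi> (fst z) (snd z))"
     "\<And>x t. x\<in>U \<Longrightarrow> t\<ge>0 \<Longrightarrow> ((\<lambda>s. \<Psi> x s) has_real_derivative \<Psi>t x t) (at t within {0..})"
     "continuous_on (closure U \<times> {0..}) (\<lambda>z. \<Psi>t (fst z) (snd z))"
    using s unfolding classical_solution_def
    apply (elim exE conjE)
    subgoal premises prems for gradp pt DF
      by (rule that[of gradp pt DF]) (rule prems[rule_format]; assumption)+
    done
  have sub: "{0<..} \<times> U \<subseteq> {0::real..} \<times> closure U" "{0::real<..} \<times> U \<subseteq> {0<..} \<times> closure U" using closure_subset[of U] by auto
  show thesis
  proof (rule that, unfold_locales)
    show "flow U K (\<lambda>t x. p x t) (\<lambda>t x. gradp x t) (\<lambda>t x. pt x t)"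
      unfolding flow_def
    proof (intro conjI allI impI ballI)
      show "continuous_on ({0<..} \<times> U) (\<lambda>(t, x). p x t)"
        by (rule continuous_on_subset[OF continuous_on_swap_args[OF p(1)] sub(1)])
      show "continuous_on ({0<..} \<times> U) (\<lambda>(t, x). gradp x t)"
        by (rule continuous_on_subset[OF continuous_on_swap_args[OF p(3)] sub(2)])
      show "continuous_on ({0<..} \<times> U) (\<lambda>(t, x). pt x t)"
        by (rule continuous_on_subset[OF continuous_on_swap_args[OF p(5)] sub(2)])
      fix t :: real assume t: "t > 0"
      show "\<exists>DF. \<forall>x\<in>U. ((\<lambda>x. K (norm (gradp x t)) *\<^sub>R gradp x t) has_derivative DF x) (at x) \<and> pt x t = (\<Sum>i\<in>UNIV. DF x (axis i 1) $ i)"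
        using p(6,7) t by (intro exI[of _ "\<lambda>x. DF x t"]) blast
    qed (use p(2,4) in blast)+
    show "continuous_on ({0..} \<times> closure U) (\<lambda>(t, x). p x t)" by (rule continuous_on_swap_args[OF p(1)])
    show "continuous_on ({0..} \<times> closure U) (\<lambda>(t, x). \<Psi> x t)" by (rule continuous_on_swap_args[OF Psi(1)])
    show "continuous_on ({0..} \<times> closure U) (\<lambda>(t, x). g\<Psi> x t)" by (rule continuous_on_swap_args[OF Psi(3)])
    show "continuous_on ({0..} \<times> closure U) (\<lambda>(t, x). \<Psi>t x t)" by (rule continuous_on_swap_args[OF Psi(5)])
    fix t x assume t: "t > (0::real)"
    show "x \<in> U \<Longrightarrow> ((\<lambda>x. \<Psi> x t) has_derivative (\<lambda>h. g\<Psi> x t \<bullet> h)) (at x)" using Psi(2)[of x t] t by simp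
    show "x \<in> U \<Longrightarrow> ((\<lambda>s. \<Psi> x s) has_real_derivative \<Psi>t x t) (at t)"
      using Psi(4)[of x t] t at_within_interior[of t "{0..}"] by (simp add: interior_real_atLeast)
    show "x \<in> frontier U \<Longrightarrow> p x t = \<Psi> x t" using p(8) t by blast
  qed (use assms in auto)
qed

text \<open>Z is the sum of the excesses of p and - p. The last clause accepts any integrable
  majorant \<zeta> of Z on the final \<sigma> units of time, so that each part of the theorem can
  insert its own: a constant in (i) and (ii), a function of A in (iii). The freedom t0 \<le> t -
  \<sigma> allows the norm of \<Psi> to be taken over the longer interval of the statement.\<close>

lemma sup_bound:
  fixes U U' :: "(real^'n) set" and c e :: "nat \<Rightarrow> real" and N :: nat and \<alpha> :: real
  assumes U: "open U" "bounded U" and U': "open U'" "closure U' \<subseteq> U"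
    and g: "admissible_g c e N" and al: "\<alpha> \<ge> 2" "\<alpha> > alpha_star CARD('n) (expo_a e N)"
  defines "a \<equiv> expo_a e N" and "\<gamma> \<equiv> (2 - expo_a e N) / CARD('n)" and "\<kappa>0 \<equiv> kappa0 CARD('n) (expo_a e N) \<alpha>"
  obtains Cs c1 C1 where "Cs \<ge> 1" "c1 > 0" "C1 > 0"
    "\<And>p Psi gradPsi Psit. classical_solution U (Kfun c e N) p Psi gradPsi Psit \<Longrightarrow>
      \<exists>Z. continuous_on {0..} Z \<and> (\<forall>s\<ge>0. Z s \<ge> 0) \<and>
        Z 0 \<le> C1 * (1 + Lnorm (lebesgue_on U) \<alpha> (\<lambda>x. p x 0 - Psi x 0) powr \<alpha>) \<and>
        (\<forall>s>0. \<exists>z'. (Z has_real_derivative z') (at s) \<and>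
          z' \<le> - c1 * Z s powr ((\<alpha> - a) / \<alpha>) + C1 * (1 + Afun U a \<alpha> gradPsi Psit s)) \<and>
        (\<forall>\<sigma> t0 t \<zeta> W. 0 < \<sigma> \<and> \<sigma> \<le> 1 \<and> \<sigma> < t \<and> 0 \<le> t0 \<and> t0 \<le> t - \<sigma> \<and> \<zeta> integrable_on {t-\<sigma>..t} \<and>
          (\<forall>s\<in>{t-\<sigma>..t}. Z s \<le> \<zeta> s) \<and> integral {t-\<sigma>..t} \<zeta> \<le> W \<longrightarrow>
          Linf_norm U' (\<lambda>x. p x t) \<le> ereal (Cs * \<sigma> powr (- ((1 + \<gamma>) / (\<kappa>0 - \<alpha>))) *
            (1 + W + Lnorm (lebesgue_on (U \<times> {t0<..<t})) \<alpha> (\<lambda>z. Psi (fst z) (snd z)) powr \<alpha>) powr (\<gamma> / (\<kappa>0 - \<alpha>))))"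
proof -
  define q where "q = 2 - a"
  define n where "n = real CARD('n)"
  have n: "n > 0" by (simp add: n_def)
  have a: "0 < a" "a < 1" using expo_a_range[OF g] by (auto simp: a_def)
  have q: "1 < q" "q < 2" using a by (auto simp: q_def)
  have k0: "\<kappa>0 = \<alpha> - 2 + q + \<alpha> * q / CARD('n)"
    by (simp add: \<kappa>0_def kappa0_def q_def a_def algebra_simps)
  have "\<alpha> * (2 - a) > a * n" using al(2) a by (simp add: alpha_star_def a_def[symmetric] n_def divide_less_eq)
  then have "\<alpha> * q / n > a" using n by (simp add: q_def less_divide_eq)
  then have k0': "\<kappa>0 > \<alpha>" by (simp add: k0 q_def n_def)
  have gq: "\<gamma> = q / CARD('n)" by (simp add: \<gamma>_def q_def a_def)
  define e1 where "e1 = \<gamma> / (\<kappa>0 - \<alpha>)"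
  have e1: "e1 > 0" unfolding e1_def gq using q k0' by simp
  obtain k1 k2 k3 where k: "k1 > 0" "k2 > 0" "k3 > 0"
    and K': "\<And>\<xi>. \<xi> \<ge> 0 \<Longrightarrow> Kfun c e N \<xi> * \<xi>\<^sup>2 \<ge> k1 * \<xi> powr (2 - expo_a e N) - k2"
    "\<And>\<xi>. \<xi> \<ge> 0 \<Longrightarrow> Kfun c e N \<xi> * \<xi> \<le> k3 * \<xi> powr (1 - expo_a e N)"
    "\<And>\<xi>. \<xi> \<ge> 0 \<Longrightarrow> Kfun c e N \<xi> \<ge> 0"
    by (rule Kfun_bounds[OF g]) blast
  have qe: "q = 2 - expo_a e N" "q - 1 = 1 - expo_a e N" by (simp_all add: q_def a_def)
  have K: "\<And>\<xi>. \<xi> \<ge> 0 \<Longrightarrow> Kfun c e N \<xi> * \<xi>\<^sup>2 \<ge> k1 * \<xi> powr q - k2"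
    "\<And>\<xi>. \<xi> \<ge> 0 \<Longrightarrow> Kfun c e N \<xi> * \<xi> \<le> k3 * \<xi> powr (q - 1)"
    "\<And>\<xi>. \<xi> \<ge> 0 \<Longrightarrow> Kfun c e N \<xi> \<ge> 0"
    using K'(1) K'(2) K'(3) unfolding qe(1)[symmetric] qe(2)[symmetric] by simp_all
  \<comment> \<open>Including 0 and One forces the enclosing box to have positive volume even if U
    is empty.\<close>
  have "bounded (U \<union> {0, One})" using U by simp
  then obtain b where b: "U \<union> {0, One} \<subseteq> cbox (- b) b" using bounded_subset_cbox_symmetric by blast
  define lo hi where "lo = - b" and "hi = b"
  have Uc: "U \<subseteq> cbox lo hi" using b by (simp add: lo_def hi_def)
  have "One \<in> cbox lo hi" "0 \<in> cbox lo hi" using b by (auto simp: lo_def hi_def)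
  then have "lo \<bullet> i < hi \<bullet> i" if "i \<in> Basis" for i
    using that by (force simp: mem_box)
  then have cb: "measure lborel (cbox lo hi) > 0" by (simp add: content_pos_lt_eq)
  obtain Cs where Cs: "Cs \<ge> 1"
    "\<And>p gp pt \<sigma> t0 Yb x1. flow U (Kfun c e N) p gp pt \<Longrightarrow> 0 < \<sigma> \<Longrightarrow> \<sigma> \<le> 1 \<Longrightarrow> \<sigma> < t0 \<Longrightarrow>
      (\<And>t. t \<in> {t0-\<sigma>..t0} \<Longrightarrow> integrable (lebesgue_on U) (\<lambda>x. \<bar>p t x\<bar> powr \<alpha>)) \<Longrightarrow>
      continuous_on {t0-\<sigma>..t0} (\<lambda>t. integral\<^sup>L (lebesgue_on U) (\<lambda>x. \<bar>p t x\<bar> powr \<alpha>)) \<Longrightarrow>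
      integral {t0-\<sigma>..t0} (\<lambda>t. integral\<^sup>L (lebesgue_on U) (\<lambda>x. \<bar>p t x\<bar> powr \<alpha>)) \<le> Yb \<Longrightarrow> x1 \<in> U' \<Longrightarrow>
      p t0 x1 \<le> Cs * \<sigma> powr (- ((1 + \<gamma>) / (\<kappa>0 - \<alpha>))) * (1 + Yb) powr (\<gamma> / (\<kappa>0 - \<alpha>))"
    unfolding gq
    apply (rule local_sup_bound[OF U(1) Uc U' al(1) q k K k0 k0']; assumption?)
    subgoal premises prems for Cs by (rule prems(1)[of Cs]) (fact prems)+
    done
  obtain c1 C1 where c1: "c1 > 0" "C1 > 0"
    and en: "\<And>p gp pt \<Psi> g\<Psi> \<Psi>t t. global_setting U lo hi \<alpha> q k1 k2 k3 (Kfun c e N) p gp pt \<Psi> g\<Psi> \<Psi>t \<Longrightarrow> t > 0 \<Longrightarrow>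
      \<exists>z'. (excess U lo hi \<alpha> p \<Psi> has_real_derivative z') (at t) \<and>
        z' \<le> - c1 * excess U lo hi \<alpha> p \<Psi> t powr ((\<alpha> - 2 + q) / \<alpha>) + C1 * (1 + Afun U (2 - q) \<alpha> (\<lambda>x t. g\<Psi> t x) (\<lambda>x t. \<Psi>t t x) t)"
    by (rule global_energy[OF cb al(1) q k k0 k0', where K="Kfun c e N"]) blast
  define \<theta> where "\<theta> = (\<alpha> - a) / \<alpha>"
  have th: "\<theta> > 0" "(\<alpha> - 2 + q) / \<alpha> = \<theta>" using a al by (auto simp: \<theta>_def q_def)
  define mU where "mU = measure lebesgue U"
  have mU: "mU \<ge> 0" by (simp add: mU_def)
  \<comment> \<open>Absorbs the factors of \<open>p_integral_bound\<close>, so that 1 + Yb is at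
    most Cy times the sum in the final bound.\<close>
  define Cy where "Cy = 1 + 3 * (2 powr \<alpha> * 2 powr \<alpha>)"
  have Cy: "Cy \<ge> 1" "Cy \<ge> 2 powr \<alpha>"
  proof -
    have "(2::real) powr \<alpha> \<ge> 1" using al by (intro ge_one_powr_ge_zero) auto
    then have "2 powr \<alpha> * 1 \<le> (2::real) powr \<alpha> * 2 powr \<alpha>" by (intro mult_left_mono) auto
    moreover have "(2::real) powr \<alpha> > 0" by simp
    ultimately show "Cy \<ge> 1" "Cy \<ge> 2 powr \<alpha>" unfolding Cy_def by linarith+
  qed
  show thesis
  proof (rule that[of "Cs * Cy powr e1" "c1 * 2 powr (- \<theta>)" "2 * C1 + 4 + 2 * (mU + 1)"])
    have "1 * 1 \<le> Cs * Cy powr e1" using Cs(1) Cy e1 by (intro mult_mono ge_one_powr_ge_zero) auto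
    then show "1 \<le> Cs * Cy powr e1" by simp
    show "c1 * 2 powr (- \<theta>) > 0" "2 * C1 + 4 + 2 * (mU + 1) > 0" using c1 mU by auto
    fix p Psi gradPsi Psit
    assume sol: "classical_solution U (Kfun c e N) p Psi gradPsi Psit"
    obtain gp pt where gs: "global_setting U lo hi \<alpha> q k1 k2 k3 (Kfun c e N) (\<lambda>t x. p x t) gp pt (\<lambda>t x. Psi x t) (\<lambda>t x. gradPsi x t) (\<lambda>t x. Psit x t)"
      by (rule classical_solution_global_setting[OF U(1) Uc al(1) q k K sol])
    interpret P: global_setting U lo hi \<alpha> q k1 k2 k3 "Kfun c e N" "\<lambda>t x. p x t" gp pt "\<lambda>t x. Psi x t" "\<lambda>t x. gradPsi x t" "\<lambda>t x. Psit x t"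
      by (rule gs)
    interpret M: global_setting U lo hi \<alpha> q k1 k2 k3 "Kfun c e N" "\<lambda>t x. - p x t" "\<lambda>t x. - gp t x" "\<lambda>t x. - pt t x"
      "\<lambda>t x. - Psi x t" "\<lambda>t x. - gradPsi x t" "\<lambda>t x. - Psit x t"
      by (rule global_setting_uminus[OF gs])
    define Zp Zm where "Zp = excess U lo hi \<alpha> (\<lambda>t x. p x t) (\<lambda>t x. Psi x t)" and "Zm = excess U lo hi \<alpha> (\<lambda>t x. - p x t) (\<lambda>t x. - Psi x t)"
    define Z where "Z t = Zp t + Zm t" for t
    let ?L = "Lnorm (lebesgue_on U) \<alpha> (\<lambda>x. p x 0 - Psi x 0)"
    let ?P = "\<lambda>t0 t. Lnorm (lebesgue_on (U \<times> {t0<..<t})) \<alpha> (\<lambda>z. Psi (fst z) (snd z))"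
    have Zpos: "Zp s \<ge> 1" "Zm s \<ge> 1" if "s \<ge> 0" for s
      using P.excess_ge_1[OF that] M.excess_ge_1[OF that] by (simp_all add: Zp_def Zm_def)
    have "continuous_on {0..} Z" unfolding Z_def Zp_def Zm_def
      by (intro continuous_on_add P.excess_continuous M.excess_continuous)
    moreover have "\<forall>s\<ge>0. Z s \<ge> 0" using Zpos unfolding Z_def by (metis add_nonneg_nonneg order_trans zero_le_one)
    moreover have "Z 0 \<le> (2 * C1 + 4 + 2 * (mU + 1)) * (1 + ?L powr \<alpha>)"
    proof -
      have L: "?L powr \<alpha> = integral\<^sup>L (lebesgue_on U) (\<lambda>x. \<bar>p x 0 - Psi x 0\<bar> powr \<alpha>)" using al by (intro Lnorm_powr(1)) simp
      have "\<bar>- p x 0 - - Psi x 0\<bar> = \<bar>p x 0 - Psi x 0\<bar>" for x by simp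
      then have "Z 0 \<le> 4 * ?L powr \<alpha> + 2 * (mU + 1)"
        using P.excess_initial M.excess_initial unfolding Z_def Zp_def Zm_def L P.mU_def M.mU_def mU_def by simp
      moreover have "0 \<le> (2 * C1 + 2 * (mU + 1)) * ?L powr \<alpha>" using c1 mU by simp
      ultimately show ?thesis using c1 by (simp add: algebra_simps)
    qed
    moreover have "\<exists>z'. (Z has_real_derivative z') (at s) \<and>
          z' \<le> - (c1 * 2 powr (- \<theta>)) * Z s powr ((\<alpha> - a) / \<alpha>) + (2 * C1 + 4 + 2 * (mU + 1)) * (1 + Afun U a \<alpha> gradPsi Psit s)" if s: "s > 0" for s
    proof -
      let ?A = "Afun U a \<alpha> gradPsi Psit s"
      have A: "?A \<ge> 0" by (simp add: Afun_def)
      have qa: "2 - q = a" by (simp add: q_def)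
      have Aeq: "Afun U a \<alpha> (\<lambda>x t. - gradPsi x t) (\<lambda>x t. - Psit x t) s = ?A" by (simp add: Afun_def)
      obtain z1 where z1: "(Zp has_real_derivative z1) (at s)" "z1 \<le> - c1 * Zp s powr \<theta> + C1 * (1 + ?A)"
        using en[OF gs s] unfolding th qa Zp_def[symmetric] by blast
      obtain z2 where z2: "(Zm has_real_derivative z2) (at s)" "z2 \<le> - c1 * Zm s powr \<theta> + C1 * (1 + ?A)"
        using en[OF global_setting_uminus[OF gs] s] unfolding th qa Zm_def[symmetric] Aeq by blast
      \<comment> \<open>Recombines the decay of the two excesses into decay of their sum; the cost 2
        powr \<theta> goes into the rate.\<close>
      have "Z s powr \<theta> \<le> 2 powr \<theta> * (Zp s powr \<theta> + Zm s powr \<theta>)"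
        unfolding Z_def using Zpos[of s] s th by (intro powr_add_le) auto
      then have "c1 * 2 powr (- \<theta>) * Z s powr \<theta> \<le> c1 * 2 powr (- \<theta>) * (2 powr \<theta> * (Zp s powr \<theta> + Zm s powr \<theta>))"
        using c1 by (intro mult_left_mono) auto
      also have "\<dots> = c1 * (Zp s powr \<theta> + Zm s powr \<theta>)" by (simp add: powr_minus)
      finally have "z1 + z2 \<le> - (c1 * 2 powr (- \<theta>)) * Z s powr \<theta> + 2 * C1 * (1 + ?A)"
        using z1(2) z2(2) by (simp add: algebra_simps)
      also have "2 * C1 * (1 + ?A) \<le> (2 * C1 + 4 + 2 * (mU + 1)) * (1 + ?A)" using A mU by (intro mult_right_mono) auto
      finally show ?thesis using DERIV_add[OF z1(1) z2(1)] unfolding Z_def[abs_def] \<theta>_def by (intro exI[of _ "z1 + z2"]) auto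
    qed
    moreover have "Linf_norm U' (\<lambda>x. p x t) \<le> ereal (Cs * Cy powr e1 * \<sigma> powr (- ((1 + \<gamma>) / (\<kappa>0 - \<alpha>))) *
            (1 + W + ?P t0 t powr \<alpha>) powr (\<gamma> / (\<kappa>0 - \<alpha>)))"
      if h: "0 < \<sigma>" "\<sigma> \<le> 1" "\<sigma> < t" "0 \<le> t0" "t0 \<le> t - \<sigma>" "\<zeta> integrable_on {t-\<sigma>..t}"
          "\<And>s. s\<in>{t-\<sigma>..t} \<Longrightarrow> Z s \<le> \<zeta> s" "integral {t-\<sigma>..t} \<zeta> \<le> W" for \<sigma> t0 t \<zeta> W
    proof (rule Linf_norm_le[OF U'(1)])
      have t: "t \<ge> 0" using h by simp
      show "continuous_on U' (\<lambda>x. p x t)"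
        by (rule continuous_on_subset[OF P.slices(1)[OF t]]) (use U' closure_subset in blast)
      define I where "I f s = integral\<^sup>L (lebesgue_on U) (\<lambda>x. \<bar>f x s\<bar> powr \<alpha>)" for f :: "real^'n \<Rightarrow> real \<Rightarrow> real" and s
      have cI: "continuous_on ({0..} \<times> closure U) (\<lambda>(t, x). \<bar>p x t\<bar> powr \<alpha>)" "continuous_on ({0..} \<times> closure U) (\<lambda>(t, x). \<bar>Psi x t\<bar> powr \<alpha>)"
        using al P.p_cont P.Psi_cont(1) unfolding split_beta by (auto intro!: continuous_on_powr_const continuous_on_rabs)
      have cIp: "continuous_on {0..} (I p)" "continuous_on {0..} (I Psi)" unfolding I_def
        by (rule LINT_param_continuous[OF U]; fact cI)+
      have I0: "I f s \<ge> 0" for f s unfolding I_def by (auto intro: Bochner_Integration.integral_nonneg)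
      have ii: "I p integrable_on {t-\<sigma>..t}" "I Psi integrable_on {t-\<sigma>..t}" "I Psi integrable_on {t0..t}"
        using h by (auto intro!: integrable_continuous_real continuous_on_subset[OF cIp(1)] continuous_on_subset[OF cIp(2)])
      have PP: "integral {t-\<sigma>..t} (I Psi) \<le> ?P t0 t powr \<alpha>"
      proof -
        have "integral {t-\<sigma>..t} (I Psi) \<le> integral {t0..t} (I Psi)"
          using h I0 by (intro integral_subset_le ii) auto
        also have "\<dots> = integral\<^sup>L (lebesgue_on (U \<times> {t0<..<t})) (\<lambda>z. \<bar>Psi (fst z) (snd z)\<bar> powr \<alpha>)"
          unfolding I_def using h
          by (intro LINT_slices[OF U, symmetric] continuous_on_subset[OF cI(2)]) auto
        also have "\<dots> = ?P t0 t powr \<alpha>" using al by (intro Lnorm_powr(1)[symmetric]) simp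
        finally show ?thesis .
      qed
      have W0: "0 \<le> W"
      proof -
        have "0 \<le> \<zeta> s" if s: "s \<in> {t-\<sigma>..t}" for s
        proof -
          have "s \<ge> 0" using s h(3) by simp
          then show ?thesis using h(7)[OF s] Zpos[of s] unfolding Z_def by linarith
        qed
        then have "0 \<le> integral {t-\<sigma>..t} \<zeta>" by (intro integral_nonneg h(6)) auto
        then show ?thesis using h(8) by linarith
      qed
      define Yb where "Yb = 2 powr \<alpha> * (3 * 2 powr \<alpha> * W + ?P t0 t powr \<alpha>)"
      have Y: "integral {t-\<sigma>..t} (I p) \<le> Yb"
      proof -
        have "integral {t-\<sigma>..t} (I p) \<le> 2 powr \<alpha> * (3 * 2 powr \<alpha> * integral {t-\<sigma>..t} \<zeta> + integral {t-\<sigma>..t} (I Psi))"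
        proof (rule has_integral_le)
          show "(I p has_integral integral {t-\<sigma>..t} (I p)) {t-\<sigma>..t}" using ii(1) by (rule integrable_integral)
          show "((\<lambda>s. 2 powr \<alpha> * (3 * 2 powr \<alpha> * \<zeta> s + I Psi s)) has_integral 2 powr \<alpha> * (3 * 2 powr \<alpha> * integral {t-\<sigma>..t} \<zeta> + integral {t-\<sigma>..t} (I Psi))) {t-\<sigma>..t}"
            by (intro has_integral_mult_right has_integral_add integrable_integral h(6) ii(2))
          fix s assume s: "s \<in> {t-\<sigma>..t}"
          have "I p s \<le> 2 powr \<alpha> * (3 * 2 powr \<alpha> * Z s + I Psi s)"
            using P.p_integral_bound[of s] s h unfolding I_def Z_def Zp_def Zm_def by simp
          also have "\<dots> \<le> 2 powr \<alpha> * (3 * 2 powr \<alpha> * \<zeta> s + I Psi s)"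
            using h(7)[OF s] by (intro mult_left_mono add_right_mono) auto
          finally show "I p s \<le> 2 powr \<alpha> * (3 * 2 powr \<alpha> * \<zeta> s + I Psi s)" .
        qed
        also have "\<dots> \<le> Yb" unfolding Yb_def using h(8) PP by (intro mult_left_mono add_mono) auto
        finally show ?thesis .
      qed
      have Yb: "0 \<le> Yb" unfolding Yb_def using W0 by (intro mult_nonneg_nonneg add_nonneg_nonneg) auto
      have "1 + Yb \<le> Cy * (1 + W + ?P t0 t powr \<alpha>)"
      proof -
        have "Yb = 3 * (2 powr \<alpha> * 2 powr \<alpha>) * W + 2 powr \<alpha> * ?P t0 t powr \<alpha>" by (simp add: Yb_def algebra_simps)
        also have "\<dots> \<le> Cy * W + Cy * ?P t0 t powr \<alpha>" using W0 Cy by (intro add_mono mult_right_mono) (auto simp: Cy_def)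
        finally show ?thesis using Cy(1) by (simp add: algebra_simps)
      qed
      then have "(1 + Yb) powr e1 \<le> (Cy * (1 + W + ?P t0 t powr \<alpha>)) powr e1" using Yb e1 by (intro powr_mono2) auto
      also have "\<dots> = Cy powr e1 * (1 + W + ?P t0 t powr \<alpha>) powr e1" by (simp only: powr_mult)
      finally have fin: "Cs * \<sigma> powr (- ((1 + \<gamma>) / (\<kappa>0 - \<alpha>))) * (1 + Yb) powr e1
        \<le> Cs * \<sigma> powr (- ((1 + \<gamma>) / (\<kappa>0 - \<alpha>))) * (Cy powr e1 * (1 + W + ?P t0 t powr \<alpha>) powr e1)"
        using Cs(1) by (intro mult_left_mono) auto
      have int: "integrable (lebesgue_on U) (\<lambda>x. \<bar>p x s\<bar> powr \<alpha>)" if "s \<in> {t-\<sigma>..t}" for s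
        using al that h by (intro integrable_bounded_continuous[OF U] continuous_on_powr_const continuous_on_rabs P.slices) auto
      have cont: "continuous_on {t-\<sigma>..t} (\<lambda>s. integral\<^sup>L (lebesgue_on U) (\<lambda>x. \<bar>p x s\<bar> powr \<alpha>))"
        using cIp(1) h unfolding I_def by (auto intro: continuous_on_subset)
      fix x assume x: "x \<in> U'"
      have "p x t \<le> Cs * \<sigma> powr (- ((1 + \<gamma>) / (\<kappa>0 - \<alpha>))) * (1 + Yb) powr e1"
        unfolding e1_def by (rule Cs(2)[OF P.fl h(1-3) int cont Y[unfolded I_def] x])
      moreover have "- p x t \<le> Cs * \<sigma> powr (- ((1 + \<gamma>) / (\<kappa>0 - \<alpha>))) * (1 + Yb) powr e1"
        unfolding e1_def by (rule Cs(2)[OF M.fl h(1-3) _ _ _ x]) (use int cont Y[unfolded I_def] in simp_all)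
      ultimately have "\<bar>p x t\<bar> \<le> Cs * \<sigma> powr (- ((1 + \<gamma>) / (\<kappa>0 - \<alpha>))) * (1 + Yb) powr e1" by linarith
      also note fin
      finally show "\<bar>p x t\<bar> \<le> Cs * Cy powr e1 * \<sigma> powr (- ((1 + \<gamma>) / (\<kappa>0 - \<alpha>))) * (1 + W + ?P t0 t powr \<alpha>) powr (\<gamma> / (\<kappa>0 - \<alpha>))"
        by (simp only: e1_def mult_ac)
    qed
    ultimately show "\<exists>Z. continuous_on {0..} Z \<and> (\<forall>s\<ge>0. Z s \<ge> 0) \<and>
        Z 0 \<le> (2 * C1 + 4 + 2 * (mU + 1)) * (1 + ?L powr \<alpha>) \<and>
        (\<forall>s>0. \<exists>z'. (Z has_real_derivative z') (at s) \<and>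
          z' \<le> - (c1 * 2 powr (- \<theta>)) * Z s powr ((\<alpha> - a) / \<alpha>) + (2 * C1 + 4 + 2 * (mU + 1)) * (1 + Afun U a \<alpha> gradPsi Psit s)) \<and>
        (\<forall>\<sigma> t0 t \<zeta> W. 0 < \<sigma> \<and> \<sigma> \<le> 1 \<and> \<sigma> < t \<and> 0 \<le> t0 \<and> t0 \<le> t - \<sigma> \<and> \<zeta> integrable_on {t-\<sigma>..t} \<and>
          (\<forall>s\<in>{t-\<sigma>..t}. Z s \<le> \<zeta> s) \<and> integral {t-\<sigma>..t} \<zeta> \<le> W \<longrightarrow>
          Linf_norm U' (\<lambda>x. p x t) \<le> ereal (Cs * Cy powr e1 * \<sigma> powr (- ((1 + \<gamma>) / (\<kappa>0 - \<alpha>))) *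
            (1 + W + ?P t0 t powr \<alpha>) powr (\<gamma> / (\<kappa>0 - \<alpha>))))"
      by (intro exI[of _ Z]) blast
  qed
qed

text \<open>From \<gamma> \<open>alpha_star\<close> = a one gets \<kappa>0 - \<alpha> = \<gamma>
  (\<alpha> - \<open>alpha_star\<close>). Hence \<alpha> \<gamma>/(\<kappa>0 - \<alpha>) = 1/(1 -
  \<open>alpha_star\<close>/\<alpha>), and \<kappa>2 has the additional factor 1 - a/\<alpha> \<le>
  1 in its denominator. The bound by \<kappa>1 is (1 + \<gamma>)(\<alpha> - a) = \<kappa>0 - a
  \<gamma> \<le> \<kappa>0.\<close>

lemma exponent_bounds:
  fixes a \<alpha> :: real
  assumes a: "0 < a" "a < 1" and al: "\<alpha> \<ge> 2" "\<alpha> > alpha_star n a" and n: "n > 0"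
  defines "\<gamma> \<equiv> (2 - a) / n"
  shows "kappa0 n a \<alpha> > \<alpha>" "\<alpha> * (\<gamma> / (kappa0 n a \<alpha> - \<alpha>)) \<le> kappa2 n a \<alpha>"
    "(1 + \<gamma>) / (kappa0 n a \<alpha> - \<alpha>) \<le> kappa1 n a \<alpha> / (\<alpha> - a)" "\<gamma> > 0"
proof -
  let ?s = "alpha_star n a" and ?k = "kappa0 n a \<alpha>"
  show g: "\<gamma> > 0" using a n by (simp add: \<gamma>_def)
  have gs: "\<gamma> * ?s = a" using a n by (simp add: \<gamma>_def alpha_star_def)
  have k: "?k = \<alpha> + \<alpha> * \<gamma> - a" by (simp add: kappa0_def \<gamma>_def algebra_simps)
  have kd: "?k - \<alpha> = \<gamma> * (\<alpha> - ?s)" using k gs by (simp add: algebra_simps)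
  have "\<gamma> * (\<alpha> - ?s) > 0" using g al by simp
  then show kp: "?k > \<alpha>" using kd by linarith
  define y where "y = 1 - ?s / \<alpha>"
  have y: "y > 0" using al by (simp add: y_def)
  have x: "0 < 1 - a / \<alpha>" "1 - a / \<alpha> \<le> 1" using a al by auto
  have "\<alpha> * (\<gamma> / (?k - \<alpha>)) = 1 / y" unfolding kd y_def using g al by (simp add: field_simps)
  also have "\<dots> \<le> 1 / ((1 - a / \<alpha>) * y)"
    using x y by (intro divide_left_mono mult_pos_pos mult_left_le_one_le) auto
  finally show "\<alpha> * (\<gamma> / (?k - \<alpha>)) \<le> kappa2 n a \<alpha>" by (simp add: kappa2_def y_def)
  have "a * \<gamma> \<ge> 0" using a g by simp
  then have "(1 + \<gamma>) * (\<alpha> - a) \<le> ?k" unfolding k by (simp add: algebra_simps)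
  then have "(1 + \<gamma>) \<le> ?k / (\<alpha> - a)" using al a by (simp add: le_divide_eq)
  then have "(1 + \<gamma>) / (?k - \<alpha>) \<le> ?k / (\<alpha> - a) / (?k - \<alpha>)" using kp by (intro divide_right_mono) auto
  also have "\<dots> = kappa1 n a \<alpha> / (\<alpha> - a)"
  proof -
    have "kappa1 n a \<alpha> = ?k / (?k - \<alpha>)" unfolding kappa1_def using kp al by (simp add: field_simps)
    then show ?thesis by simp
  qed
  finally show "(1 + \<gamma>) / (?k - \<alpha>) \<le> kappa1 n a \<alpha> / (\<alpha> - a)" .
qed

text \<open>Serves to express each contribution through one power of the bracket B of the theorem:
  if x powr (1/e) is a summand of B \<ge> 1, then x \<le> B powr e, and the additive r is absorbed
  because B powr e \<ge> 1.\<close>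

lemma powr_affine_bound:
  fixes x B :: real
  assumes B: "B \<ge> 1" "x powr (1 / e) \<le> B" and x: "x \<ge> 0" and e: "e > 0" and rk: "r \<ge> 0" "k \<ge> 0" and m: "m \<ge> 0"
  shows "(k * (r + x)) powr m \<le> (k * (r + 1)) powr m * B powr (e * m)"
proof -
  have "x = (x powr (1 / e)) powr e" using x e by (simp add: powr_powr)
  also have "\<dots> \<le> B powr e" using B e by (intro powr_mono2) auto
  finally have xB: "x \<le> B powr e" .
  have B1: "B powr e \<ge> 1" using B e by (intro ge_one_powr_ge_zero) auto
  have "r + x \<le> r * B powr e + B powr e" using xB B1 rk mult_left_mono[of 1 "B powr e" r] by simp
  then have "k * (r + x) \<le> k * (r + 1) * B powr e" using rk mult_left_mono[of "r + x" "r * B powr e + B powr e" k] by (simp add: algebra_simps)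
  then have "(k * (r + x)) powr m \<le> (k * (r + 1) * B powr e) powr m" using rk x m by (intro powr_mono2) auto
  also have "\<dots> = (k * (r + 1)) powr m * B powr (e * m)" by (simp only: powr_mult powr_powr)
  finally show ?thesis .
qed

text \<open>Nonnegativity excludes the value minus infinity, so the limit superior is a real number
  and \<open>real_of_ereal\<close> does not take its default value. The slack 1 will disappear into
  the 1 of the bracket.\<close>

lemma Limsup_real_bound:
  fixes f :: "real \<Rightarrow> real"
  assumes fin: "Limsup at_top (\<lambda>t. ereal (f t)) < \<infinity>" and f: "\<And>t. f t \<ge> 0"
  shows "real_of_ereal (Limsup at_top (\<lambda>t. ereal (f t))) \<ge> 0"
    "eventually (\<lambda>t. f t \<le> real_of_ereal (Limsup at_top (\<lambda>t. ereal (f t))) + 1) at_top"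
proof -
  let ?L = "Limsup at_top (\<lambda>t. ereal (f t))"
  have "0 \<le> ?L" using f by (intro le_Limsup) auto
  then obtain L where L: "?L = ereal L" "L \<ge> 0" using fin by (cases ?L) auto
  then show "real_of_ereal ?L \<ge> 0" by simp
  have "?L < ereal (L + 1)" using L by simp
  from Limsup_lessD[OF this] have "eventually (\<lambda>t. ereal (f t) < ereal (L + 1)) at_top" .
  then show "eventually (\<lambda>t. f t \<le> real_of_ereal ?L + 1) at_top"
    by (rule eventually_mono) (simp add: L)
qed

lemma powr_le_bracket:
  assumes "0 \<le> x" "x \<le> (B::real)" "q > 0"
  shows "x powr q \<le> B powr q"
  using assms by (intro powr_mono2) auto

theorem theorem4p2:
  fixes U U' :: "(real^'n) set" and c e :: "nat \<Rightarrow> real" and N :: nat and \<alpha> :: real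
  assumes "CARD('n) \<ge> 2"
    and "open U" and "bounded U" and "connected U" and "C2_boundary U"
    and "open U'" and "closure U' \<subseteq> U"
    and "admissible_g c e N"
    and "\<alpha> \<ge> 2" and "\<alpha> > alpha_star CARD('n) (expo_a e N)"
  shows "\<exists>C>0. \<forall>(p::real^'n \<Rightarrow> real \<Rightarrow> real) (Psi::real^'n \<Rightarrow> real \<Rightarrow> real)
            (gradPsi::real^'n \<Rightarrow> real \<Rightarrow> real^'n) (Psit::real^'n \<Rightarrow> real \<Rightarrow> real).
     classical_solution U (Kfun c e N) p Psi gradPsi Psit \<longrightarrow>
     (let a = expo_a e N; n = CARD('n);
          A = Afun U a \<alpha> gradPsi Psit;
          pbar0 = (\<lambda>x. p x 0 - Psi x 0);
          PsiN = (\<lambda>t0 t. Lnorm (lebesgue_on (U \<times> {t0<..<t})) \<alpha> (\<lambda>z. Psi (fst z) (snd z)))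
      in
      \<comment> \<open>(i)\<close>
      (\<forall>F::real \<Rightarrow> real. continuous_on {0..} F \<and> mono_on {0..} F \<and> (\<forall>t\<ge>0. A t \<le> F t) \<longrightarrow>
         (\<forall>t. 0 < t \<and> t < 1 \<longrightarrow>
            Linf_norm U' (\<lambda>x. p x t) \<le>
              ereal (C * t powr (- (kappa1 n a \<alpha> / (\<alpha> - a))) *
                (1 + Lnorm (lebesgue_on U) \<alpha> pbar0 + F t powr (1 / (\<alpha> - a)) + PsiN 0 t)
                  powr kappa2 n a \<alpha>)) \<and>
         (\<forall>t\<ge>1.
            Linf_norm U' (\<lambda>x. p x t) \<le>
              ereal (C * (1 + Lnorm (lebesgue_on U) \<alpha> pbar0 + F t powr (1 / (\<alpha> - a))
                            + PsiN (t - 1) t) powr kappa2 n a \<alpha>))) \<and>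
      \<comment> \<open>(ii)\<close>
      (Limsup at_top (\<lambda>t. ereal (A t)) < \<infinity> \<longrightarrow>
       Limsup at_top (\<lambda>t. ereal (PsiN (t - 1) t)) < \<infinity> \<longrightarrow>
         Limsup at_top (\<lambda>t. Linf_norm U' (\<lambda>x. p x t)) \<le>
           ereal (C * (1 + real_of_ereal (Limsup at_top (\<lambda>t. ereal (A t))) powr (1 / (\<alpha> - a))
                       + real_of_ereal (Limsup at_top (\<lambda>t. ereal (PsiN (t - 1) t))))
                    powr kappa2 n a \<alpha>)) \<and>
      \<comment> \<open>(iii)\<close>
      (\<forall>dA::real \<Rightarrow> real.
         (\<forall>t>0. (A has_real_derivative dA t) (at t)) \<and> continuous_on {0<..} dA \<and>
         Limsup at_top (\<lambda>t. ereal (max 0 (- dA t))) < \<infinity> \<longrightarrow>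
         (\<exists>T>0. \<forall>t\<ge>T.
            Linf_norm U' (\<lambda>x. p x t) \<le>
              ereal (C * (1 + real_of_ereal (Limsup at_top (\<lambda>t. ereal (max 0 (- dA t))))
                                powr (1 / (\<alpha> - 2 * a))
                          + Lnorm (lebesgue_on {t - 1<..<t}) (\<alpha> / (\<alpha> - a)) A powr (1 / (\<alpha> - a))
                          + PsiN (t - 1) t) powr kappa2 n a \<alpha>))))"
proof -
  define a where "a = expo_a e N"
  have a: "0 < a" "a < 1" using expo_a_range[OF assms(8)] by (auto simp: a_def)
  have al: "\<alpha> \<ge> 2" "\<alpha> > alpha_star CARD('n) a" using assms(9,10) by (simp_all add: a_def)
  define \<gamma> where "\<gamma> = (2 - a) / CARD('n)"
  define \<kappa>0 \<kappa>1 \<kappa>2 where "\<kappa>0 = kappa0 CARD('n) a \<alpha>" and "\<kappa>1 = kappa1 CARD('n) a \<alpha>" and "\<kappa>2 = kappa2 CARD('n) a \<alpha>"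
  define e0 e1 where "e0 = (1 + \<gamma>) / (\<kappa>0 - \<alpha>)" and "e1 = \<gamma> / (\<kappa>0 - \<alpha>)"
  have ex: "\<kappa>0 > \<alpha>" "\<alpha> * e1 \<le> \<kappa>2" "e0 \<le> \<kappa>1 / (\<alpha> - a)" "\<gamma> > 0"
    using exponent_bounds[OF a al] by (simp_all add: \<gamma>_def \<kappa>0_def \<kappa>1_def \<kappa>2_def e0_def e1_def)
  have e01: "e0 > 0" "e1 > 0" using ex by (auto simp: e0_def e1_def)
  define \<theta> where "\<theta> = (\<alpha> - a) / \<alpha>"
  define m where "m = \<alpha> / (\<alpha> - a)"
  have aa: "\<alpha> - a > 0" "\<alpha> - 2 * a > 0" using a al by auto
  have th: "\<theta> > 0" "1 / 2 < \<theta>" "\<theta> \<le> 1" "1 / \<theta> = m" "m > 0" "(\<alpha> - a) * m = \<alpha>"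
    using a al aa by (auto simp: \<theta>_def m_def field_simps)
  obtain Cs c1 C1 where Cs: "Cs \<ge> 1" and c1: "c1 > 0" "C1 > 0"
    and key: "\<And>p Psi gradPsi Psit. classical_solution U (Kfun c e N) p Psi gradPsi Psit \<Longrightarrow>
      \<exists>Z. continuous_on {0..} Z \<and> (\<forall>s\<ge>0. Z s \<ge> 0) \<and>
        Z 0 \<le> C1 * (1 + Lnorm (lebesgue_on U) \<alpha> (\<lambda>x. p x 0 - Psi x 0) powr \<alpha>) \<and>
        (\<forall>s>0. \<exists>z'. (Z has_real_derivative z') (at s) \<and>
          z' \<le> - c1 * Z s powr \<theta> + C1 * (1 + Afun U a \<alpha> gradPsi Psit s)) \<and>
        (\<forall>\<sigma> t0 t \<zeta> W. 0 < \<sigma> \<and> \<sigma> \<le> 1 \<and> \<sigma> < t \<and> 0 \<le> t0 \<and> t0 \<le> t - \<sigma> \<and> \<zeta> integrable_on {t-\<sigma>..t} \<and>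
          (\<forall>s\<in>{t-\<sigma>..t}. Z s \<le> \<zeta> s) \<and> integral {t-\<sigma>..t} \<zeta> \<le> W \<longrightarrow>
          Linf_norm U' (\<lambda>x. p x t) \<le> ereal (Cs * \<sigma> powr (- e0) *
            (1 + W + Lnorm (lebesgue_on (U \<times> {t0<..<t})) \<alpha> (\<lambda>z. Psi (fst z) (snd z)) powr \<alpha>) powr e1))"
    unfolding e0_def e1_def \<theta>_def \<gamma>_def \<kappa>0_def
    by (rule sup_bound[OF assms(2,3,6,7,8,9,10), folded a_def]) blast
  define Mb where "Mb = 4 * C1 / (\<theta> * c1\<^sup>2)"
  \<comment> \<open>One constant for each part of the theorem: it bounds 1 + W + |\<Psi>|^\<alpha>
    by a multiple of B powr \<alpha>, where B is the bracket of that part and W the integrated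
    majorant of Z.\<close>
  define D1 where "D1 = 2 + 2 * C1 + (C1 / c1 * (1 + 1)) powr m"
  define D2 where "D2 = 2 + (2 * C1 / c1 * (2 + 1)) powr m"
  define h where "h = 2 powr m * (2 * C1 / c1) powr m * 2 powr m"
  define D3 where "D3 = 2 + 2 * h + 2 powr m * (Mb * (1 + 1)) powr (\<alpha> / (\<alpha> - 2 * a))"
  define D where "D = D1 + D2 + D3"
  have Mb: "Mb > 0" using c1 th by (simp add: Mb_def)
  have h: "h \<ge> 0" by (simp add: h_def)
  have D': "D1 \<ge> 0" "D2 \<ge> 0" "D3 \<ge> 0" using c1 h by (auto simp: D1_def D2_def D3_def)
  have D: "D > 0" using c1 h by (auto simp: D_def D1_def D2_def D3_def intro!: add_pos_nonneg add_nonneg_nonneg)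
  \<comment> \<open>The factor 2 powr e0 is the price for \<sigma> = t/2 or \<sigma> = 1/2 in part
    (i), since \<open>sup_bound\<close> requires \<sigma> < t strictly.\<close>
  define C where "C = Cs * 2 powr e0 * D powr e1"
  have C: "C > 0" using Cs D by (simp add: C_def)
  have main: "(let A = Afun U a \<alpha> gradPsi Psit; pbar0 = (\<lambda>x. p x 0 - Psi x 0);
          PsiN = (\<lambda>t0 t. Lnorm (lebesgue_on (U \<times> {t0<..<t})) \<alpha> (\<lambda>z. Psi (fst z) (snd z)))
      in
      (\<forall>F::real \<Rightarrow> real. continuous_on {0..} F \<and> mono_on {0..} F \<and> (\<forall>t\<ge>0. A t \<le> F t) \<longrightarrow>
         (\<forall>t. 0 < t \<and> t < 1 \<longrightarrow>
            Linf_norm U' (\<lambda>x. p x t) \<le>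
              ereal (C * t powr (- (\<kappa>1 / (\<alpha> - a))) *
                (1 + Lnorm (lebesgue_on U) \<alpha> pbar0 + F t powr (1 / (\<alpha> - a)) + PsiN 0 t) powr \<kappa>2)) \<and>
         (\<forall>t\<ge>1.
            Linf_norm U' (\<lambda>x. p x t) \<le>
              ereal (C * (1 + Lnorm (lebesgue_on U) \<alpha> pbar0 + F t powr (1 / (\<alpha> - a)) + PsiN (t - 1) t) powr \<kappa>2))) \<and>
      (Limsup at_top (\<lambda>t. ereal (A t)) < \<infinity> \<longrightarrow>
       Limsup at_top (\<lambda>t. ereal (PsiN (t - 1) t)) < \<infinity> \<longrightarrow>
         Limsup at_top (\<lambda>t. Linf_norm U' (\<lambda>x. p x t)) \<le>
           ereal (C * (1 + real_of_ereal (Limsup at_top (\<lambda>t. ereal (A t))) powr (1 / (\<alpha> - a))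
                       + real_of_ereal (Limsup at_top (\<lambda>t. ereal (PsiN (t - 1) t)))) powr \<kappa>2)) \<and>
      (\<forall>dA::real \<Rightarrow> real.
         (\<forall>t>0. (A has_real_derivative dA t) (at t)) \<and> continuous_on {0<..} dA \<and>
         Limsup at_top (\<lambda>t. ereal (max 0 (- dA t))) < \<infinity> \<longrightarrow>
         (\<exists>T>0. \<forall>t\<ge>T.
            Linf_norm U' (\<lambda>x. p x t) \<le>
              ereal (C * (1 + real_of_ereal (Limsup at_top (\<lambda>t. ereal (max 0 (- dA t)))) powr (1 / (\<alpha> - 2 * a))
                          + Lnorm (lebesgue_on {t - 1<..<t}) m A powr (1 / (\<alpha> - a))
                          + PsiN (t - 1) t) powr \<kappa>2))))"
    if sol: "classical_solution U (Kfun c e N) p Psi gradPsi Psit"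
    for p Psi :: "real^'n \<Rightarrow> real \<Rightarrow> real" and gradPsi Psit
  proof -
    define A where "A = Afun U a \<alpha> gradPsi Psit"
    define P where "P = (\<lambda>t0 t. Lnorm (lebesgue_on (U \<times> {t0<..<t})) \<alpha> (\<lambda>z. Psi (fst z) (snd z)))"
    define L where "L = Lnorm (lebesgue_on U) \<alpha> (\<lambda>x. p x 0 - Psi x 0)"
    have A0: "A t \<ge> 0" for t by (simp add: A_def Afun_def)
    have P0: "P t0 t \<ge> 0" for t0 t by (simp add: P_def Lnorm_def)
    have L0: "L \<ge> 0" by (simp add: L_def Lnorm_def)
    obtain Z where Zc: "continuous_on {0..} Z" and Zn: "\<And>s. s \<ge> 0 \<Longrightarrow> Z s \<ge> 0" and Z0: "Z 0 \<le> C1 * (1 + L powr \<alpha>)"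
      and ode: "\<And>s. s > 0 \<Longrightarrow> \<exists>z'. (Z has_real_derivative z') (at s) \<and> z' \<le> - c1 * Z s powr \<theta> + C1 * (1 + A s)"
      and sb: "\<And>\<sigma> t0 t \<zeta> W. 0 < \<sigma> \<Longrightarrow> \<sigma> \<le> 1 \<Longrightarrow> \<sigma> < t \<Longrightarrow> 0 \<le> t0 \<Longrightarrow> t0 \<le> t - \<sigma> \<Longrightarrow> \<zeta> integrable_on {t-\<sigma>..t} \<Longrightarrow>
          (\<And>s. s\<in>{t-\<sigma>..t} \<Longrightarrow> Z s \<le> \<zeta> s) \<Longrightarrow> integral {t-\<sigma>..t} \<zeta> \<le> W \<Longrightarrow>
          Linf_norm U' (\<lambda>x. p x t) \<le> ereal (Cs * \<sigma> powr (- e0) * (1 + W + P t0 t powr \<alpha>) powr e1)"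
    proof -
      obtain Z where Z: "continuous_on {0..} Z" "\<forall>s\<ge>0. Z s \<ge> 0" "Z 0 \<le> C1 * (1 + L powr \<alpha>)"
        "\<forall>s>0. \<exists>z'. (Z has_real_derivative z') (at s) \<and> z' \<le> - c1 * Z s powr \<theta> + C1 * (1 + A s)"
        "\<forall>\<sigma> t0 t \<zeta> W. 0 < \<sigma> \<and> \<sigma> \<le> 1 \<and> \<sigma> < t \<and> 0 \<le> t0 \<and> t0 \<le> t - \<sigma> \<and> \<zeta> integrable_on {t-\<sigma>..t} \<and>
          (\<forall>s\<in>{t-\<sigma>..t}. Z s \<le> \<zeta> s) \<and> integral {t-\<sigma>..t} \<zeta> \<le> W \<longrightarrow>
          Linf_norm U' (\<lambda>x. p x t) \<le> ereal (Cs * \<sigma> powr (- e0) * (1 + W + P t0 t powr \<alpha>) powr e1)"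
        using key[OF sol] unfolding A_def P_def L_def by (elim exE conjE)
      show thesis
      proof (rule that[of Z])
        fix \<sigma> t0 t \<zeta> W
        assume "0 < \<sigma>" "\<sigma> \<le> 1" "\<sigma> < t" "0 \<le> t0" "t0 \<le> t - \<sigma>" "\<zeta> integrable_on {t-\<sigma>..t}"
          "\<And>s. s\<in>{t-\<sigma>..t} \<Longrightarrow> Z s \<le> \<zeta> s" "integral {t-\<sigma>..t} \<zeta> \<le> W"
        then show "Linf_norm U' (\<lambda>x. p x t) \<le> ereal (Cs * \<sigma> powr (- e0) * (1 + W + P t0 t powr \<alpha>) powr e1)"
          by (intro Z(5)[rule_format] conjI ballI)
      qed (use Z(1-4) in blast)+
    qed
    \<comment> \<open>The common last step: a bound by B powr \<alpha> inside becomes B powr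
      (\<alpha> e1) outside, and B \<ge> 1 permits enlarging the exponent to \<kappa>2.\<close>
    have gb: "Linf_norm U' (\<lambda>x. p x t) \<le> ereal (Cs * r * (D powr e1 * B powr \<kappa>2))"
      if r: "\<sigma> powr (- e0) \<le> r" and *: "0 < \<sigma>" "\<sigma> \<le> 1" "\<sigma> < t" "0 \<le> t0" "t0 \<le> t - \<sigma>" "\<zeta> integrable_on {t-\<sigma>..t}"
         "\<And>s. s\<in>{t-\<sigma>..t} \<Longrightarrow> Z s \<le> \<zeta> s" "integral {t-\<sigma>..t} \<zeta> \<le> W"
        and W: "W \<ge> 0" and B: "B \<ge> 1" "1 + W + P t0 t powr \<alpha> \<le> D * B powr \<alpha>"
      for \<sigma> t0 t \<zeta> W B r
    proof -
      have "(1 + W + P t0 t powr \<alpha>) powr e1 \<le> (D * B powr \<alpha>) powr e1"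
        using B W e01 by (intro powr_mono2) auto
      also have "\<dots> = D powr e1 * B powr (\<alpha> * e1)" by (simp only: powr_mult powr_powr)
      also have "\<dots> \<le> D powr e1 * B powr \<kappa>2" using B ex by (intro mult_left_mono powr_mono) auto
      finally have "Cs * \<sigma> powr (- e0) * (1 + W + P t0 t powr \<alpha>) powr e1 \<le> Cs * r * (D powr e1 * B powr \<kappa>2)"
        using r Cs by (intro mult_mono mult_nonneg_nonneg order_trans[OF powr_ge_zero r]) auto
      with sb[OF *] show ?thesis by (meson ereal_less_eq(3) order_trans)
    qed
    have half: "(1 / 2) powr (- e0) \<le> 2 powr e0" "1 powr (- e0) \<le> 2 powr e0"
      using e01 by (auto simp: powr_divide powr_minus_divide intro!: ge_one_powr_ge_zero)
    have Beq: "Cs * 2 powr e0 * (D powr e1 * y) = C * y" for y by (simp add: C_def)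
    \<comment> \<open>Both time ranges at once, r standing for the power of \<sigma>. Monotonicity
      of F lets its value at t bound the forcing on all of (0,t].\<close>
    have part1: "Linf_norm U' (\<lambda>x. p x t) \<le> ereal (Cs * r * (D powr e1 * (1 + L + F t powr (1 / (\<alpha> - a)) + P t0 t) powr \<kappa>2))"
      if F: "mono_on {0..} F" "\<And>t. t \<ge> 0 \<Longrightarrow> A t \<le> F t" and r: "\<sigma> powr (- e0) \<le> r"
        and *: "0 < \<sigma>" "\<sigma> \<le> 1" "\<sigma> < t" "0 \<le> t0" "t0 \<le> t - \<sigma>" for F r \<sigma> t0 t
    proof -
      define B where "B = 1 + L + F t powr (1 / (\<alpha> - a)) + P t0 t"
      have t: "t > 0" using * by simp
      have F0: "F t \<ge> 0" using F(2)[of t] A0[of t] t by simp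
      have B: "B \<ge> 1" "L \<le> B" "F t powr (1 / (\<alpha> - a)) \<le> B" "P t0 t \<le> B"
        using L0 P0[of t0 t] by (auto simp: B_def)
      define k where "k = (C1 * (1 + F t) / c1) powr (1 / \<theta>)"
      have AF: "A s \<le> F t" if "0 < s" "s \<le> t" for s
      proof -
        have "A s \<le> F s" using F(2) that by simp
        also have "F s \<le> F t" using that by (intro mono_onD[OF F(1)]) auto
        finally show ?thesis .
      qed
      have Zk: "Z s \<le> Z 0 + k" if "s \<in> {t-\<sigma>..t}" for s
        unfolding k_def by (rule ode_bounded[OF Zc Zn[OF order_refl] c1 th(1) ode AF F0]) (use that * in auto)
      have k0: "Z 0 + k \<ge> 0" using Zn[of 0] by (simp add: k_def)
      have "k = (C1 / c1 * (1 + F t)) powr m" unfolding k_def th(4) by simp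
      also have "\<dots> \<le> (C1 / c1 * (1 + 1)) powr m * B powr ((\<alpha> - a) * m)"
        using c1 th by (intro powr_affine_bound B aa F0) auto
      finally have k: "k \<le> (C1 / c1 * (1 + 1)) powr m * B powr \<alpha>" unfolding th(6) .
      define y where "y = B powr \<alpha>"
      have y: "1 \<le> y" "L powr \<alpha> \<le> y" "P t0 t powr \<alpha> \<le> y"
        using B al L0 P0[of t0 t] unfolding y_def by (auto intro: ge_one_powr_ge_zero powr_le_bracket)
      have "C1 * (1 + L powr \<alpha>) \<le> C1 * (y + y)" using y c1 by (intro mult_left_mono add_mono) auto
      then have "1 + (Z 0 + k) + P t0 t powr \<alpha> \<le> D1 * y"
        using y k Z0 by (simp add: D1_def y_def[symmetric] algebra_simps)
      also have "\<dots> \<le> D * y" using D' y by (intro mult_right_mono) (auto simp: D_def)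
      finally have fin: "1 + (Z 0 + k) + P t0 t powr \<alpha> \<le> D * B powr \<alpha>" by (simp add: y_def)
      have int: "integral {t-\<sigma>..t} (\<lambda>_. Z 0 + k) \<le> Z 0 + k"
        using * k0 mult_right_mono[of \<sigma> 1 "Z 0 + k"] by simp
      show ?thesis unfolding B_def[symmetric]
        by (rule gb[OF r * integrable_const_ivl Zk int k0 B(1) fin])
    qed
    \<comment> \<open>Integrates the majorant of Z used in part (iii); the exponent m = 1/\<theta> =
      \<alpha>/(\<alpha> - a) is that of the time norm of A.\<close>
    have ivl: "(\<lambda>s. h * (1 + \<bar>A s\<bar> powr m) + w) integrable_on {t-1..t} \<and>
        integral {t-1..t} (\<lambda>s. h * (1 + \<bar>A s\<bar> powr m) + w) = h * (1 + Lnorm (lebesgue_on {t-1<..<t}) m A powr m) + w"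
      if t: "t > 1" and dA: "\<And>t. t > 0 \<Longrightarrow> (A has_real_derivative dA t) (at t)" for t w dA
    proof -
      have "continuous_on {t-1..t} A" using dA t by (intro DERIV_continuous_on[of _ A dA] has_field_derivative_at_within[OF dA]) auto
      then have c: "continuous_on {t-1..t} (\<lambda>s. \<bar>A s\<bar> powr m)" using th by (intro continuous_on_powr_const continuous_on_rabs) auto
      have e: "Lnorm (lebesgue_on {t-1<..<t}) m A powr m = integral {t-1..t} (\<lambda>s. \<bar>A s\<bar> powr m)"
        using th(5) by (simp add: Lnorm_powr LINT_interval[OF c])
      have "((\<lambda>s. h * (1 + \<bar>A s\<bar> powr m) + w) has_integral (h * (1 + integral {t-1..t} (\<lambda>s. \<bar>A s\<bar> powr m)) + w)) {t-1..t}"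
        using has_integral_const_real[of "1::real" "t-1" t] has_integral_const_real[of w "t-1" t]
        by (intro has_integral_add has_integral_mult_right integrable_integral integrable_continuous_real c) auto
      then show ?thesis unfolding e by (simp add: has_integral_iff)
    qed
    \<comment> \<open>Here t is large, so \<sigma> = 1 is admissible. The slack 1 in both eventual
      bounds only changes constants.\<close>
    have part2: "Limsup at_top (\<lambda>t. Linf_norm U' (\<lambda>x. p x t)) \<le> ereal (C * (1 + L1 powr (1 / (\<alpha> - a)) + P1) powr \<kappa>2)"
      if L1: "L1 \<ge> 0" "eventually (\<lambda>t. A t \<le> L1 + 1) at_top" and P1: "P1 \<ge> 0" "eventually (\<lambda>t. P (t - 1) t \<le> P1 + 1) at_top" for L1 P1
    proof -
      define B where "B = 1 + L1 powr (1 / (\<alpha> - a)) + P1"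
      have B: "B \<ge> 1" "L1 powr (1 / (\<alpha> - a)) \<le> B" "P1 + 1 \<le> B" using P1 by (auto simp: B_def)
      obtain T0 where T0: "\<And>s. s \<ge> T0 \<Longrightarrow> A s \<le> L1 + 1" using L1(2) by (auto simp: eventually_at_top_linorder)
      define k where "k = (2 * C1 * (1 + (L1 + 1)) / c1) powr (1 / \<theta>)"
      have "\<exists>T\<ge>max T0 1. \<forall>t\<ge>T. Z t \<le> k"
        unfolding k_def by (rule ode_eventually_bounded[OF c1 th(1) ode]) (use T0 L1 in auto)
      then obtain T where T: "T \<ge> 1" "\<And>t. t \<ge> T \<Longrightarrow> Z t \<le> k" by auto
      have "k = (2 * C1 / c1 * (2 + L1)) powr m" unfolding k_def th(4) by (simp add: algebra_simps)
      also have "\<dots> \<le> (2 * C1 / c1 * (2 + 1)) powr m * B powr ((\<alpha> - a) * m)"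
        using c1 th by (intro powr_affine_bound B aa L1(1)) auto
      finally have k: "k \<le> (2 * C1 / c1 * (2 + 1)) powr m * B powr \<alpha>" unfolding th(6) .
      define y where "y = B powr \<alpha>"
      have y1: "1 \<le> y" using B al unfolding y_def by (auto intro: ge_one_powr_ge_zero)
      have "eventually (\<lambda>t. Linf_norm U' (\<lambda>x. p x t) \<le> ereal (C * B powr \<kappa>2)) at_top"
        using P1(2) eventually_ge_at_top[of "T + 1"]
      proof eventually_elim
        case (elim t)
        have y: "P (t-1) t powr \<alpha> \<le> y" using elim B P0[of "t-1" t] al unfolding y_def by (intro powr_le_bracket) auto
        have "1 + k + P (t-1) t powr \<alpha> \<le> D2 * y"
          using y1 y k by (simp add: D2_def y_def[symmetric] algebra_simps)
        also have "\<dots> \<le> D * y" using D' y1 by (intro mult_right_mono) (auto simp: D_def)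
        finally have fin: "1 + k + P (t-1) t powr \<alpha> \<le> D * B powr \<alpha>" by (simp add: y_def)
        have "Linf_norm U' (\<lambda>x. p x t) \<le> ereal (Cs * 2 powr e0 * (D powr e1 * B powr \<kappa>2))"
          by (rule gb[OF half(2) _ _ _ _ _ integrable_const_ivl _ _ _ B(1) fin]) (use T elim in \<open>auto simp: k_def\<close>)
        then show ?case unfolding Beq .
      qed
      then show ?thesis unfolding B_def by (rule Limsup_bounded)
    qed
    have part3: "\<exists>T>0. \<forall>t\<ge>T. Linf_norm U' (\<lambda>x. p x t) \<le> ereal (C * (1 + \<beta> powr (1 / (\<alpha> - 2 * a))
        + Lnorm (lebesgue_on {t - 1<..<t}) m A powr (1 / (\<alpha> - a)) + P (t - 1) t) powr \<kappa>2)"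
      if dA: "\<And>t. t > 0 \<Longrightarrow> (A has_real_derivative dA t) (at t)" and be: "\<beta> \<ge> 0" "eventually (\<lambda>t. max 0 (- dA t) \<le> \<beta> + 1) at_top" for dA \<beta>
    proof -
      \<comment> \<open>The bound \<beta> + 1 holds eventually and is strictly positive even for
        \<beta> = 0, as the moving barrier requires.\<close>
      obtain T0 where T0: "\<And>s. s \<ge> T0 \<Longrightarrow> - dA s \<le> \<beta> + 1" using be(2) by (auto simp: eventually_at_top_linorder)
      define b where "b = (4 * C1 * (\<beta> + 1) / (\<theta> * c1\<^sup>2)) powr (1 / (2 - 1 / \<theta>))"
      have "\<exists>T\<ge>max T0 1. \<forall>t\<ge>T. Z t \<le> (2 * C1 * (1 + A t) / c1 + b) powr (1 / \<theta>)"
        unfolding b_def by (rule ode_tracks_forcing[OF c1 th(2,3) ode A0 dA]) (use T0 be in auto)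
      then obtain T where T: "T \<ge> 1" "\<And>t. t \<ge> T \<Longrightarrow> Z t \<le> (2 * C1 * (1 + A t) / c1 + b) powr m" unfolding th(4) by auto
      \<comment> \<open>The exponents combine to m/(2 - m) = \<alpha>/(\<alpha> - 2 a); since the
        bracket carries the power \<alpha>, this is the origin of \<beta> powr (1/(\<alpha> - 2
        a)).\<close>
      have bm: "b powr m = (Mb * (1 + \<beta>)) powr (\<alpha> / (\<alpha> - 2 * a))"
      proof -
        have m2: "2 - m = (\<alpha> - 2 * a) / (\<alpha> - a)" using aa by (simp add: m_def field_simps)
        have "1 / (2 - m) * m = \<alpha> / (\<alpha> - 2 * a)" unfolding m2 using aa by (simp add: m_def)
        moreover have "4 * C1 * (\<beta> + 1) / (\<theta> * c1\<^sup>2) = Mb * (1 + \<beta>)" by (simp add: Mb_def add.commute)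
        ultimately show ?thesis unfolding b_def th(4) powr_powr by simp
      qed
      define w where "w = 2 powr m * b powr m"
      have w0: "w \<ge> 0" "b \<ge> 0" by (simp_all add: w_def b_def)
      \<comment> \<open>In contrast to the other parts the majorant varies with time, and
        integrating it over the last time unit produces the norm of A.\<close>
      have ZA: "Z t \<le> h * (1 + \<bar>A t\<bar> powr m) + w" if "t \<ge> T" for t
      proof -
        have "Z t \<le> (2 * C1 / c1 * (1 + A t) + b) powr m" using T(2)[OF that] by simp
        also have "\<dots> \<le> 2 powr m * ((2 * C1 / c1 * (1 + A t)) powr m + b powr m)"
          using c1 th A0[of t] w0 by (intro powr_add_le) auto
        also have "(2 * C1 / c1 * (1 + A t)) powr m = (2 * C1 / c1) powr m * (1 + A t) powr m" by (rule powr_mult)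
        also have "2 powr m * ((2 * C1 / c1) powr m * (1 + A t) powr m + b powr m)
           \<le> 2 powr m * ((2 * C1 / c1) powr m * (2 powr m * (1 powr m + A t powr m)) + b powr m)"
          using A0[of t] th by (intro mult_left_mono add_right_mono powr_add_le) auto
        also have "\<dots> = h * (1 + \<bar>A t\<bar> powr m) + w" using A0[of t] by (simp add: h_def w_def algebra_simps)
        finally show ?thesis .
      qed
      show ?thesis
      \<comment> \<open>Beyond T + 2 the whole interval [t - 1, t] lies where the barrier already
        dominates Z.\<close>
      proof (intro exI[of _ "T + 2"] conjI allI impI)
        show "T + 2 > 0" using T by simp
        fix t assume t: "T + 2 \<le> t"
        define N where "N = Lnorm (lebesgue_on {t - 1<..<t}) m A"
        have N0: "N \<ge> 0" by (simp add: N_def Lnorm_def)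
        define B where "B = 1 + \<beta> powr (1 / (\<alpha> - 2 * a)) + N powr (1 / (\<alpha> - a)) + P (t - 1) t"
        have B: "B \<ge> 1" "\<beta> powr (1 / (\<alpha> - 2 * a)) \<le> B" "N powr (1 / (\<alpha> - a)) \<le> B" "P (t - 1) t \<le> B"
          using P0[of "t-1" t] by (auto simp: B_def)
        define y where "y = B powr \<alpha>"
        have y: "1 \<le> y" "P (t-1) t powr \<alpha> \<le> y"
          using B al P0[of "t-1" t] unfolding y_def by (auto intro: ge_one_powr_ge_zero powr_le_bracket)
        have Ny: "N powr m \<le> y"
          using powr_affine_bound[OF B(1,3) N0 aa(1), of 0 1 m] th by (simp add: y_def)
        have "(Mb * (1 + \<beta>)) powr (\<alpha> / (\<alpha> - 2 * a)) \<le> (Mb * (1 + 1)) powr (\<alpha> / (\<alpha> - 2 * a)) * B powr ((\<alpha> - 2 * a) * (\<alpha> / (\<alpha> - 2 * a)))"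
          using Mb al aa by (intro powr_affine_bound B be(1)) auto
        then have "b powr m \<le> (Mb * (1 + 1)) powr (\<alpha> / (\<alpha> - 2 * a)) * y" unfolding bm y_def using aa by simp
        then have wy: "w \<le> 2 powr m * ((Mb * (1 + 1)) powr (\<alpha> / (\<alpha> - 2 * a)) * y)" unfolding w_def by (intro mult_left_mono) auto
        have "h * (1 + N powr m) \<le> h * (y + y)" using h y Ny by (intro mult_left_mono add_mono) auto
        then have "1 + (h * (1 + N powr m) + w) + P (t-1) t powr \<alpha> \<le> D3 * y"
          using y wy by (simp add: D3_def algebra_simps)
        also have "\<dots> \<le> D * y" using D' y by (intro mult_right_mono) (auto simp: D_def)
        finally have fin: "1 + (h * (1 + N powr m) + w) + P (t-1) t powr \<alpha> \<le> D * B powr \<alpha>" by (simp add: y_def)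
        have iv: "(\<lambda>s. h * (1 + \<bar>A s\<bar> powr m) + w) integrable_on {t-1..t}"
          "integral {t-1..t} (\<lambda>s. h * (1 + \<bar>A s\<bar> powr m) + w) \<le> h * (1 + N powr m) + w"
          using ivl[of t dA w] dA t T unfolding N_def by auto
        have W0: "h * (1 + N powr m) + w \<ge> 0" using h w0 by simp
        have "Linf_norm U' (\<lambda>x. p x t) \<le> ereal (Cs * 2 powr e0 * (D powr e1 * B powr \<kappa>2))"
          by (rule gb[OF half(2) _ _ _ _ _ iv(1) ZA iv(2) W0 B(1) fin]) (use T t in auto)
        then show "Linf_norm U' (\<lambda>x. p x t) \<le> ereal (C * (1 + \<beta> powr (1 / (\<alpha> - 2 * a))
            + Lnorm (lebesgue_on {t - 1<..<t}) m A powr (1 / (\<alpha> - a)) + P (t - 1) t) powr \<kappa>2)"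
          unfolding Beq B_def N_def .
      qed
    qed
    show ?thesis
      unfolding Let_def A_def[symmetric] L_def[symmetric] P_def[symmetric, THEN fun_cong, THEN fun_cong]
    proof (intro conjI allI impI)
      fix F :: "real \<Rightarrow> real" and t :: real assume F: "continuous_on {0..} F \<and> mono_on {0..} F \<and> (\<forall>t\<ge>0. A t \<le> F t)" and t: "0 < t \<and> t < 1"
      \<comment> \<open>\<sigma> = t/2; as t < 1, the negative power of t only grows when e0 is
        replaced by the larger \<kappa>1/(\<alpha> - a).\<close>
      have "(t / 2) powr (- e0) = 2 powr e0 * t powr (- e0)" by (simp add: powr_divide powr_minus_divide)
      also have "\<dots> \<le> 2 powr e0 * t powr (- (\<kappa>1 / (\<alpha> - a)))"
        using ex(3) t by (intro mult_left_mono powr_mono') auto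
      finally have r: "(t / 2) powr (- e0) \<le> 2 powr e0 * t powr (- (\<kappa>1 / (\<alpha> - a)))" .
      have "Linf_norm U' (\<lambda>x. p x t) \<le> ereal (Cs * (2 powr e0 * t powr (- (\<kappa>1 / (\<alpha> - a)))) *
          (D powr e1 * (1 + L + F t powr (1 / (\<alpha> - a)) + P 0 t) powr \<kappa>2))"
        using F t by (intro part1[OF _ _ r]) auto
      then show "Linf_norm U' (\<lambda>x. p x t) \<le> ereal (C * t powr (- (\<kappa>1 / (\<alpha> - a))) * (1 + L + F t powr (1 / (\<alpha> - a)) + P 0 t) powr \<kappa>2)"
        by (simp add: C_def mult_ac)
    next
      fix F :: "real \<Rightarrow> real" and t :: real assume F: "continuous_on {0..} F \<and> mono_on {0..} F \<and> (\<forall>t\<ge>0. A t \<le> F t)" and t: "1 \<le> t"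
      have "Linf_norm U' (\<lambda>x. p x t) \<le> ereal (Cs * 2 powr e0 *
          (D powr e1 * (1 + L + F t powr (1 / (\<alpha> - a)) + P (t - 1) t) powr \<kappa>2))"
        using F t by (intro part1[OF _ _ half(1)]) auto
      then show "Linf_norm U' (\<lambda>x. p x t) \<le> ereal (C * (1 + L + F t powr (1 / (\<alpha> - a)) + P (t - 1) t) powr \<kappa>2)"
        unfolding Beq .
    next
      assume "Limsup at_top (\<lambda>t. ereal (A t)) < \<infinity>" "Limsup at_top (\<lambda>t. ereal (P (t - 1) t)) < \<infinity>"
      then show "Limsup at_top (\<lambda>t. Linf_norm U' (\<lambda>x. p x t)) \<le> ereal (C * (1 + real_of_ereal (Limsup at_top (\<lambda>t. ereal (A t))) powr (1 / (\<alpha> - a))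
           + real_of_ereal (Limsup at_top (\<lambda>t. ereal (P (t - 1) t)))) powr \<kappa>2)"
        by (intro part2 Limsup_real_bound A0 P0)
    next
      fix dA :: "real \<Rightarrow> real" assume d: "(\<forall>t>0. (A has_real_derivative dA t) (at t)) \<and> continuous_on {0<..} dA \<and> Limsup at_top (\<lambda>t. ereal (max 0 (- dA t))) < \<infinity>"
      then show "\<exists>T>0. \<forall>t\<ge>T. Linf_norm U' (\<lambda>x. p x t) \<le> ereal (C * (1 + real_of_ereal (Limsup at_top (\<lambda>t. ereal (max 0 (- dA t)))) powr (1 / (\<alpha> - 2 * a))
           + Lnorm (lebesgue_on {t - 1<..<t}) m A powr (1 / (\<alpha> - a)) + P (t - 1) t) powr \<kappa>2)"
        by (intro part3[of dA] Limsup_real_bound) auto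
    qed
  qed
  show ?thesis
    by (rule exI[of _ C], rule conjI[OF C], intro allI impI, unfold Let_def,
        rule main[unfolded Let_def \<kappa>1_def \<kappa>2_def m_def a_def])
qed

end
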